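(* A generalized quadrangle $\Gamma=(\mathcal{P},\mathcal{L},\mathtt{I})$ is a mixed quadrangle if and only if there exist a nonempty set $\mathcal{O}\subseteq\mathcal{P}$ of points and a set $\mathcal{S}\subseteq\mathcal{L}$ of lines such that: (i) all points of $\mathcal{O}$ and all lines of $\mathcal{S}$ are regular; (ii) every line span containing a line of $\mathcal{S}$ contains at least two lines of $\mathcal{S}$; (iii) every element of $\mathcal{S}$ is incident with some element of $\mathcal{O}$; (iv) for each point $x\in\mathcal{O}$, the dual net $\Gamma^*_x$ satisfies (LD) with respect to a vertical line given by some element of $\mathcal{S}$ incident with $x$. In particular, if all points and lines of $\Gamma$ are regular and (iv) holds with $\mathcal{O}=\mathcal{P}$ and $\mathcal{S}=\mathcal{L}$, then $\Gamma$ is a mixed quadrangle.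
   Context: A generalized quadrangle is a triple $(\mathcal{P},\mathcal{L},\mathtt{I})$ of disjoint point/line sets with symmetric incidence such that no two distinct points lie on two distinct common lines, every element is incident with at least three elements, and for every point $x$ and line $M$ not through $x$ there are a unique point $y$ and line $N$ with $x\,\mathtt{I}\,N\,\mathtt{I}\,y\,\mathtt{I}\,M$. $x^\perp$: points collinear with $x$ including $x$, $X^\perp$ the intersection over $X$; dually for lines with concurrency. For opposite points $x,y$ the span is $\{x,y\}^{\perp\perp}$; for opposite lines $M,N$ the line span is $\{M,N\}^{\perp\perp}$. A point $x$ is regular if each span $\{x,y\}^{\perp\perp}$ ($y$ opposite $x$) equals $\{u,v\}^\perp$ for some opposite $u,v$; regular lines dually. For a regular point $x$, $\Gamma^*_x$ has points $x^\perp\setminus\{x\}$ and blocks $\{x,y\}^\perp$ ($y$ opposite $x$); distinct points in no common block are parallel; classes of "equal or parallel" are vertical lines; for a line $M$ through $x$, the points of $M$ other than $x$ form the vertical line given by $M$. A new point $\infty$ lies on all vertical lines. A triangle: three distinct blocks pairwise meeting in three distinct points; two triangles are in perspective from $\infty$ if three distinct vertical lines each contain one vertex of each (inducing a correspondence of sides). (LD) with respect to a vertical line $V$: for each pair of triangles in perspective from $\infty$ with two pairs of corresponding sides meeting in points of $V$, the third pair also meets in a point of $V$. Mixed quadrangle $\mathsf{W}(\mathbb{K},\mathbb{K}';L,L')$: $\mathbb{K}$ a field of characteristic 2, $\mathbb{K}'$ a field with $\mathbb{K}^2\subseteq\mathbb{K}'\subseteq\mathbb{K}$, $L\supseteq\mathbb{K}'$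 a $\mathbb{K}'$-subspace of $\mathbb{K}$, $L'\supseteq\mathbb{K}^2$ a $\mathbb{K}^2$-subspace of $\mathbb{K}'$; points $(\infty),(a),(k,b),(a,l,a')$, lines $[\infty],[k],[a,l],[k,b,k']$ with $a,a',b\in L$, $k,k',l\in L'$; incidences $(a,l,a')\,\mathtt{I}\,[a,l]\,\mathtt{I}\,(a)\,\mathtt{I}\,[\infty]\,\mathtt{I}\,(\infty)\,\mathtt{I}\,[k]\,\mathtt{I}\,(k,b)\,\mathtt{I}\,[k,b,k']$ and $(a,l,a')\,\mathtt{I}\,[k,b,k']$ iff $a'=ak+b$, $k'=a^2k+l$. "$\Gamma$ is a mixed quadrangle" means isomorphic to one of these.
   Formalization: In (LD), triangles in perspective from ∞ are required to have distinct corresponding vertices (otherwise a shared vertex on V breaks (LD) in the mixed quadrangle over the field of 4 elements); generalized quadrangles are assumed nonempty. *)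

theory Defs
  imports "HOL-Algebra.Embedded_Algebras" "HOL-Algebra.Weak_Morphisms"
begin

section \<open>Point-line geometries and generalized quadrangles\<close>

text \<open>
  A geometry is given by its point set, its line set and an incidence relation, which is relevant
  only on these two sets. Points and lines have different types, so the two sets are disjoint and
  symmetry of incidence is implicit. Every notion for lines is the notion for points in the dual
  geometry, obtained by swapping the two sets and taking \<^term>\<open>conversep I\<close>.
\<close>

text \<open>
  The empty geometry satisfies all the other axioms; it is excluded as usual.
\<close>
definition generalized_quadrangle :: "'p set \<Rightarrow> 'l set \<Rightarrow> ('p \<Rightarrow> 'l \<Rightarrow> bool) \<Rightarrow> bool" where
  "generalized_quadrangle \<P> \<L> I \<longleftrightarrow>
     \<P> \<noteq> {} \<and>
     (\<forall>x\<in>\<P>. \<forall>y\<in>\<P>. \<forall>M\<in>\<L>. \<forall>N\<in>\<L>.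
        I x M \<and> I y M \<and> I x N \<and> I y N \<longrightarrow> x = y \<or> M = N) \<and>
     (\<forall>x\<in>\<P>. \<exists>T \<subseteq> {M \<in> \<L>. I x M}. card T = 3) \<and>
     (\<forall>M\<in>\<L>. \<exists>T \<subseteq> {x \<in> \<P>. I x M}. card T = 3) \<and>
     (\<forall>x\<in>\<P>. \<forall>M\<in>\<L>. \<not> I x M \<longrightarrow>
        (\<exists>!(y, N). y \<in> \<P> \<and> N \<in> \<L> \<and> I x N \<and> I y N \<and> I y M))"

definition isomorphic_geometries ::
  "'p set \<Rightarrow> 'l set \<Rightarrow> ('p \<Rightarrow> 'l \<Rightarrow> bool) \<Rightarrow> 'q set \<Rightarrow> 'm set \<Rightarrow> ('q \<Rightarrow> 'm \<Rightarrow> bool) \<Rightarrow> bool" where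
  "isomorphic_geometries \<P> \<L> I \<P>' \<L>' I' \<longleftrightarrow>
     (\<exists>f g. bij_betw f \<P> \<P>' \<and> bij_betw g \<L> \<L>' \<and>
            (\<forall>x\<in>\<P>. \<forall>M\<in>\<L>. I x M \<longleftrightarrow> I' (f x) (g M)))"

definition perp :: "'p set \<Rightarrow> 'l set \<Rightarrow> ('p \<Rightarrow> 'l \<Rightarrow> bool) \<Rightarrow> 'p set \<Rightarrow> 'p set" where
  "perp \<P> \<L> I A = {y \<in> \<P>. \<forall>x\<in>A. y = x \<or> (\<exists>M\<in>\<L>. I x M \<and> I y M)}"

definition opposite :: "'p set \<Rightarrow> 'l set \<Rightarrow> ('p \<Rightarrow> 'l \<Rightarrow> bool) \<Rightarrow> 'p \<Rightarrow> 'p \<Rightarrow> bool" where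
  "opposite \<P> \<L> I x y \<longleftrightarrow> x \<in> \<P> \<and> y \<in> \<P> \<and> y \<notin> perp \<P> \<L> I {x}"

definition point_span :: "'p set \<Rightarrow> 'l set \<Rightarrow> ('p \<Rightarrow> 'l \<Rightarrow> bool) \<Rightarrow> 'p \<Rightarrow> 'p \<Rightarrow> 'p set" where
  "point_span \<P> \<L> I x y = perp \<P> \<L> I (perp \<P> \<L> I {x, y})"

definition regular_point :: "'p set \<Rightarrow> 'l set \<Rightarrow> ('p \<Rightarrow> 'l \<Rightarrow> bool) \<Rightarrow> 'p \<Rightarrow> bool" where
  "regular_point \<P> \<L> I x \<longleftrightarrow> x \<in> \<P> \<and>
     (\<forall>y. opposite \<P> \<L> I x y \<longrightarrow>
        (\<exists>u v. opposite \<P> \<L> I u v \<and> point_span \<P> \<L> I x y = perp \<P> \<L> I {u, v}))"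

definition regular_line :: "'p set \<Rightarrow> 'l set \<Rightarrow> ('p \<Rightarrow> 'l \<Rightarrow> bool) \<Rightarrow> 'l \<Rightarrow> bool" where
  "regular_line \<P> \<L> I M \<longleftrightarrow> regular_point \<L> \<P> (conversep I) M"

definition line_spans :: "'p set \<Rightarrow> 'l set \<Rightarrow> ('p \<Rightarrow> 'l \<Rightarrow> bool) \<Rightarrow> 'l set set" where
  "line_spans \<P> \<L> I =
     {point_span \<L> \<P> (conversep I) M N | M N. opposite \<L> \<P> (conversep I) M N}"


section \<open>The dual net at a regular point and the condition (LD)\<close>

definition net_points :: "'p set \<Rightarrow> 'l set \<Rightarrow> ('p \<Rightarrow> 'l \<Rightarrow> bool) \<Rightarrow> 'p \<Rightarrow> 'p set" where
  "net_points \<P> \<L> I x = perp \<P> \<L> I {x} - {x}"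

definition net_blocks :: "'p set \<Rightarrow> 'l set \<Rightarrow> ('p \<Rightarrow> 'l \<Rightarrow> bool) \<Rightarrow> 'p \<Rightarrow> 'p set set" where
  "net_blocks \<P> \<L> I x = {perp \<P> \<L> I {x, y} | y. opposite \<P> \<L> I x y}"

definition vertical_line_of :: "'p set \<Rightarrow> ('p \<Rightarrow> 'l \<Rightarrow> bool) \<Rightarrow> 'p \<Rightarrow> 'l \<Rightarrow> 'p set" where
  "vertical_line_of \<P> I x M = {p \<in> \<P>. I p M} - {x}"

text \<open>In the following, \<open>Q\<close> is the point set and \<open>\<B>\<close> the set of blocks of a dual net.\<close>

definition net_parallel :: "'p set set \<Rightarrow> 'p \<Rightarrow> 'p \<Rightarrow> bool" where
  "net_parallel \<B> p q \<longleftrightarrow> p \<noteq> q \<and> \<not> (\<exists>B\<in>\<B>. p \<in> B \<and> q \<in> B)"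

definition vertical_lines :: "'p set \<Rightarrow> 'p set set \<Rightarrow> 'p set set" where
  "vertical_lines Q \<B> = {{q \<in> Q. q = p \<or> net_parallel \<B> p q} | p. p \<in> Q}"

text \<open>Triangles are labelled so that the side \<open>A\<^sub>i\<close> lies opposite the vertex \<open>a\<^sub>i\<close>.\<close>
definition triangle ::
  "'p set set \<Rightarrow> 'p \<Rightarrow> 'p \<Rightarrow> 'p \<Rightarrow> 'p set \<Rightarrow> 'p set \<Rightarrow> 'p set \<Rightarrow> bool" where
  "triangle \<B> a\<^sub>1 a\<^sub>2 a\<^sub>3 A\<^sub>1 A\<^sub>2 A\<^sub>3 \<longleftrightarrow>
     A\<^sub>1 \<in> \<B> \<and> A\<^sub>2 \<in> \<B> \<and> A\<^sub>3 \<in> \<B> \<and> distinct [A\<^sub>1, A\<^sub>2, A\<^sub>3] \<and>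
     A\<^sub>2 \<inter> A\<^sub>3 = {a\<^sub>1} \<and> A\<^sub>1 \<inter> A\<^sub>3 = {a\<^sub>2} \<and> A\<^sub>1 \<inter> A\<^sub>2 = {a\<^sub>3} \<and> distinct [a\<^sub>1, a\<^sub>2, a\<^sub>3]"

text \<open>
  The vertical lines are the lines through the extra point \<open>\<infinity>\<close>. As usual for triangles in
  perspective from a point, corresponding vertices are distinct; corresponding sides are then
  distinct as well. This cannot be dropped: if two triangles share a vertex on the vertical line
  \<open>V\<close>, then two pairs of sides meet there automatically, whereas the third sides are arbitrary
  blocks missing that vertex, so that (LD) below would fail in all but the smallest cases.
\<close>
definition in_perspective ::
  "'p set \<Rightarrow> 'p set set \<Rightarrow> 'p \<Rightarrow> 'p \<Rightarrow> 'p \<Rightarrow> 'p \<Rightarrow> 'p \<Rightarrow> 'p \<Rightarrow> bool" where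
  "in_perspective Q \<B> a\<^sub>1 a\<^sub>2 a\<^sub>3 b\<^sub>1 b\<^sub>2 b\<^sub>3 \<longleftrightarrow>
     a\<^sub>1 \<noteq> b\<^sub>1 \<and> a\<^sub>2 \<noteq> b\<^sub>2 \<and> a\<^sub>3 \<noteq> b\<^sub>3 \<and>
     (\<exists>W\<^sub>1 W\<^sub>2 W\<^sub>3. W\<^sub>1 \<in> vertical_lines Q \<B> \<and> W\<^sub>2 \<in> vertical_lines Q \<B> \<and>
        W\<^sub>3 \<in> vertical_lines Q \<B> \<and> distinct [W\<^sub>1, W\<^sub>2, W\<^sub>3] \<and>
        {a\<^sub>1, b\<^sub>1} \<subseteq> W\<^sub>1 \<and> {a\<^sub>2, b\<^sub>2} \<subseteq> W\<^sub>2 \<and> {a\<^sub>3, b\<^sub>3} \<subseteq> W\<^sub>3)"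

definition meet_on :: "'p set \<Rightarrow> 'p set \<Rightarrow> 'p set \<Rightarrow> bool" where
  "meet_on V A B \<longleftrightarrow> (\<exists>v\<in>V. A \<inter> B = {v})"

text \<open>
  All labellings of the two triangles are quantified over, so singling out the first two pairs of
  corresponding sides is no restriction.
\<close>
definition LD :: "'p set \<Rightarrow> 'p set set \<Rightarrow> 'p set \<Rightarrow> bool" where
  "LD Q \<B> V \<longleftrightarrow>
     (\<forall>a\<^sub>1 a\<^sub>2 a\<^sub>3 A\<^sub>1 A\<^sub>2 A\<^sub>3 b\<^sub>1 b\<^sub>2 b\<^sub>3 B\<^sub>1 B\<^sub>2 B\<^sub>3.
        triangle \<B> a\<^sub>1 a\<^sub>2 a\<^sub>3 A\<^sub>1 A\<^sub>2 A\<^sub>3 \<and> triangle \<B> b\<^sub>1 b\<^sub>2 b\<^sub>3 B\<^sub>1 B\<^sub>2 B\<^sub>3 \<and>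
        in_perspective Q \<B> a\<^sub>1 a\<^sub>2 a\<^sub>3 b\<^sub>1 b\<^sub>2 b\<^sub>3 \<and>
        meet_on V A\<^sub>1 B\<^sub>1 \<and> meet_on V A\<^sub>2 B\<^sub>2 \<longrightarrow> meet_on V A\<^sub>3 B\<^sub>3)"

definition LD_at :: "'p set \<Rightarrow> 'l set \<Rightarrow> ('p \<Rightarrow> 'l \<Rightarrow> bool) \<Rightarrow> 'p \<Rightarrow> 'l \<Rightarrow> bool" where
  "LD_at \<P> \<L> I x M \<longleftrightarrow>
     LD (net_points \<P> \<L> I x) (net_blocks \<P> \<L> I x) (vertical_line_of \<P> I x M)"


section \<open>Mixed quadrangles\<close>

definition squares :: "('a, 'm) ring_scheme \<Rightarrow> 'a set" where
  "squares K = {a \<otimes>\<^bsub>K\<^esub> a | a. a \<in> carrier K}"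

text \<open>Here \<open>subalgebra F V K\<close> says that \<open>V\<close> is an additive subgroup of \<open>K\<close> closed under multiplication
  by scalars from \<open>F\<close>; it does not require \<open>V\<close> to be closed under multiplication.\<close>
definition mixed_data :: "('a, 'm) ring_scheme \<Rightarrow> 'a set \<Rightarrow> 'a set \<Rightarrow> 'a set \<Rightarrow> bool" where
  "mixed_data K K' L L' \<longleftrightarrow>
     field K \<and> \<one>\<^bsub>K\<^esub> \<oplus>\<^bsub>K\<^esub> \<one>\<^bsub>K\<^esub> = \<zero>\<^bsub>K\<^esub> \<and>
     subfield K' K \<and> squares K \<subseteq> K' \<and>
     subalgebra K' L K \<and> K' \<subseteq> L \<and>
     subalgebra (squares K) L' K \<and> squares K \<subseteq> L' \<and> L' \<subseteq> K'"

text \<open>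
  The constructors stand for \<open>(\<infinity>)\<close>, \<open>(a)\<close>, \<open>(k, b)\<close>, \<open>(a, l, a')\<close> and for
  \<open>[\<infinity>]\<close>, \<open>[k]\<close>, \<open>[a, l]\<close>, \<open>[k, b, k']\<close>.
\<close>
datatype 'a mq_point = Pt_inf | Pt1 'a | Pt2 'a 'a | Pt3 'a 'a 'a

datatype 'a mq_line = Ln_inf | Ln1 'a | Ln2 'a 'a | Ln3 'a 'a 'a

definition mq_points :: "'a set \<Rightarrow> 'a set \<Rightarrow> 'a mq_point set" where
  "mq_points L L' = {Pt_inf} \<union> {Pt1 a | a. a \<in> L} \<union> {Pt2 k b | k b. k \<in> L' \<and> b \<in> L} \<union>
     {Pt3 a l a' | a l a'. a \<in> L \<and> l \<in> L' \<and> a' \<in> L}"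

definition mq_lines :: "'a set \<Rightarrow> 'a set \<Rightarrow> 'a mq_line set" where
  "mq_lines L L' = {Ln_inf} \<union> {Ln1 k | k. k \<in> L'} \<union> {Ln2 a l | a l. a \<in> L \<and> l \<in> L'} \<union>
     {Ln3 k b k' | k b k'. k \<in> L' \<and> b \<in> L \<and> k' \<in> L'}"

fun mq_inc :: "('a, 'm) ring_scheme \<Rightarrow> 'a mq_point \<Rightarrow> 'a mq_line \<Rightarrow> bool" where
  "mq_inc K (Pt3 a l a') (Ln2 c m) \<longleftrightarrow> c = a \<and> m = l"
| "mq_inc K (Pt1 a) (Ln2 c m) \<longleftrightarrow> c = a"
| "mq_inc K (Pt1 a) Ln_inf \<longleftrightarrow> True"
| "mq_inc K Pt_inf Ln_inf \<longleftrightarrow> True"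
| "mq_inc K Pt_inf (Ln1 k) \<longleftrightarrow> True"
| "mq_inc K (Pt2 k b) (Ln1 h) \<longleftrightarrow> h = k"
| "mq_inc K (Pt2 k b) (Ln3 h c h') \<longleftrightarrow> h = k \<and> c = b"
| "mq_inc K (Pt3 a l a') (Ln3 k b k') \<longleftrightarrow>
     a' = a \<otimes>\<^bsub>K\<^esub> k \<oplus>\<^bsub>K\<^esub> b \<and> k' = (a \<otimes>\<^bsub>K\<^esub> a) \<otimes>\<^bsub>K\<^esub> k \<oplus>\<^bsub>K\<^esub> l"
| "mq_inc K _ _ \<longleftrightarrow> False"

text \<open>
  One cannot quantify over the type of the elements of the field, but a field \<open>K\<close> with elements
  in \<^typ>\<open>'p\<close>, the type of the points, is fully general: squaring is injective on \<open>K\<close> and maps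
  it into \<open>L\<close>, which in turn embeds into the point set. See \<open>mixed_quadrangleI\<close> below.
\<close>
definition mixed_quadrangle :: "'p set \<Rightarrow> 'l set \<Rightarrow> ('p \<Rightarrow> 'l \<Rightarrow> bool) \<Rightarrow> bool" where
  "mixed_quadrangle \<P> \<L> I \<longleftrightarrow>
     (\<exists>(K :: 'p ring) K' L L'. mixed_data K K' L L' \<and>
        isomorphic_geometries (mq_points L L') (mq_lines L L') (mq_inc K) \<P> \<L> I)"

lemma mixed_quadrangleI:
  fixes K :: "('a, 'm) ring_scheme" and \<P> :: "'p set"
  assumes D: "mixed_data K K' L L'"
    and iso: "isomorphic_geometries (mq_points L L') (mq_lines L L') (mq_inc K) \<P> \<L> I"
  shows "mixed_quadrangle \<P> \<L> I"
proof -
  have fld: "field K" and char2: "\<one>\<^bsub>K\<^esub> \<oplus>\<^bsub>K\<^esub> \<one>\<^bsub>K\<^esub> = \<zero>\<^bsub>K\<^esub>"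
    and sub: "subfield K' K" "subalgebra K' L K" "subalgebra (squares K) L' K"
    and incl: "squares K \<subseteq> K'" "K' \<subseteq> L" "squares K \<subseteq> L'" "L' \<subseteq> K'"
    using D by (auto simp: mixed_data_def)
  interpret field K by (rule fld)
  have LK: "L \<subseteq> carrier K"
    using sub(2) by (simp add: subalgebra_def subgroup_def)
  hence carr: "K' \<subseteq> carrier K" "L' \<subseteq> carrier K" using incl by auto
  obtain f g where f: "bij_betw f (mq_points L L') \<P>" and g: "bij_betw g (mq_lines L L') \<L>"
    and fg: "\<And>x M. x \<in> mq_points L L' \<Longrightarrow> M \<in> mq_lines L L' \<Longrightarrow> mq_inc K x M \<longleftrightarrow> I (f x) (g M)"
    using iso by (auto simp: isomorphic_geometries_def)

  have dbl: "a \<oplus>\<^bsub>K\<^esub> a = \<zero>\<^bsub>K\<^esub>" if "a \<in> carrier K" for a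
    using l_distr[of "\<one>\<^bsub>K\<^esub>" "\<one>\<^bsub>K\<^esub>" a] that char2 by simp
  have sq_inj: "a = b" if ab: "a \<in> carrier K" "b \<in> carrier K" and eq: "a \<otimes>\<^bsub>K\<^esub> a = b \<otimes>\<^bsub>K\<^esub> b" for a b
  proof -
    have "(a \<oplus>\<^bsub>K\<^esub> b) \<otimes>\<^bsub>K\<^esub> (a \<oplus>\<^bsub>K\<^esub> b) = (a \<otimes>\<^bsub>K\<^esub> a \<oplus>\<^bsub>K\<^esub> b \<otimes>\<^bsub>K\<^esub> b) \<oplus>\<^bsub>K\<^esub> (a \<otimes>\<^bsub>K\<^esub> b \<oplus>\<^bsub>K\<^esub> a \<otimes>\<^bsub>K\<^esub> b)"
      using ab by (simp add: l_distr r_distr m_comm a_ac)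
    also have "\<dots> = \<zero>\<^bsub>K\<^esub>" using ab eq dbl by simp
    finally have "a \<oplus>\<^bsub>K\<^esub> b = \<zero>\<^bsub>K\<^esub>" using ab integral by blast
    moreover have "b \<oplus>\<^bsub>K\<^esub> b = \<zero>\<^bsub>K\<^esub>" using ab dbl by simp
    ultimately show ?thesis using ab add.right_cancel by metis
  qed
  define h where "h a = f (Pt1 (a \<otimes>\<^bsub>K\<^esub> a))" for a
  have sqL: "a \<otimes>\<^bsub>K\<^esub> a \<in> L" if "a \<in> carrier K" for a
    using that incl by (auto simp: squares_def)
  have h_inj: "inj_on h (carrier K)"
  proof (rule inj_onI)
    fix a b assume ab: "a \<in> carrier K" "b \<in> carrier K" and "h a = h b"
    moreover have "Pt1 (a \<otimes>\<^bsub>K\<^esub> a) \<in> mq_points L L'" "Pt1 (b \<otimes>\<^bsub>K\<^esub> b) \<in> mq_points L L'"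
      using sqL ab by (auto simp: mq_points_def)
    ultimately have "Pt1 (a \<otimes>\<^bsub>K\<^esub> a) = Pt1 (b \<otimes>\<^bsub>K\<^esub> b)"
      using bij_betw_imp_inj_on[OF f] unfolding h_def by (meson inj_onD)
    hence "a \<otimes>\<^bsub>K\<^esub> a = b \<otimes>\<^bsub>K\<^esub> b" by simp
    thus "a = b" by (rule sq_inj[OF ab])
  qed

  define K1 where "K1 = image_ring h K"
  have iso1: "h \<in> ring_iso K K1" unfolding K1_def by (rule inj_imp_image_ring_iso[OF h_inj])
  have fld1: "field K1" unfolding K1_def by (rule inj_imp_image_ring_is_field[OF h_inj])
  interpret K1: field K1 by (rule fld1)
  interpret hom: ring_hom_ring K K1 h
    using iso1 by (intro ring_hom_ringI2 ring_axioms K1.ring_axioms) (simp add: ring_iso_def)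
  have carr1: "carrier K1 = h ` carrier K" by (simp add: K1_def image_ring_carrier)
  have sq1: "squares K1 = h ` squares K"
  proof (intro equalityI subsetI)
    fix z assume "z \<in> squares K1"
    then obtain a where "a \<in> carrier K" "z = h a \<otimes>\<^bsub>K1\<^esub> h a"
      by (auto simp: squares_def carr1)
    thus "z \<in> h ` squares K" by (auto simp: squares_def hom.hom_mult[symmetric] simp del: hom.hom_mult)
  next
    fix z assume "z \<in> h ` squares K"
    then obtain a where "a \<in> carrier K" "z = h a \<otimes>\<^bsub>K1\<^esub> h a"
      by (auto simp: squares_def)
    thus "z \<in> squares K1" by (auto simp: squares_def carr1)
  qed
  have sqc: "squares K \<subseteq> carrier K" by (auto simp: squares_def)
  have D1: "mixed_data K1 (h ` K') (h ` L) (h ` L')"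
    unfolding mixed_data_def sq1
  proof (intro conjI)
    show "\<one>\<^bsub>K1\<^esub> \<oplus>\<^bsub>K1\<^esub> \<one>\<^bsub>K1\<^esub> = \<zero>\<^bsub>K1\<^esub>"
      using arg_cong[OF char2, of h] by simp
  qed (use incl fld1 hom.img_is_subfield[OF sub(1)] hom.img_is_subalgebra[OF carr(1) sub(2)]
       hom.img_is_subalgebra[OF sqc sub(3)] in auto)

  define k where "k = inv_into (carrier K) h"
  have kh: "k (h a) = a" if "a \<in> carrier K" for a
    using h_inj that by (simp add: k_def)
  have khL: "k (h a) = a" if "a \<in> L \<or> a \<in> L'" for a
    using that kh LK carr by auto
  have P: "bij_betw (map_mq_point k) (mq_points (h ` L) (h ` L')) (mq_points L L')"
    by (rule bij_betw_byWitness[where f' = "map_mq_point h"])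
      (auto simp: mq_points_def khL)
  have Ln: "bij_betw (map_mq_line k) (mq_lines (h ` L) (h ` L')) (mq_lines L L')"
    by (rule bij_betw_byWitness[where f' = "map_mq_line h"])
      (auto simp: mq_lines_def khL)
  have ad: "h c = h a \<otimes>\<^bsub>K1\<^esub> h b \<oplus>\<^bsub>K1\<^esub> h d \<longleftrightarrow> c = a \<otimes>\<^bsub>K\<^esub> b \<oplus>\<^bsub>K\<^esub> d"
    if "a \<in> carrier K" "b \<in> carrier K" "c \<in> carrier K" "d \<in> carrier K" for a b c d
    using that inj_on_eq_iff[OF h_inj, of c "a \<otimes>\<^bsub>K\<^esub> b \<oplus>\<^bsub>K\<^esub> d"] by simp
  have ad3: "h c = h a \<otimes>\<^bsub>K1\<^esub> h a \<otimes>\<^bsub>K1\<^esub> h b \<oplus>\<^bsub>K1\<^esub> h d \<longleftrightarrow> c = a \<otimes>\<^bsub>K\<^esub> a \<otimes>\<^bsub>K\<^esub> b \<oplus>\<^bsub>K\<^esub> d"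
    if "a \<in> carrier K" "b \<in> carrier K" "c \<in> carrier K" "d \<in> carrier K" for a b c d
    using that inj_on_eq_iff[OF h_inj, of c "a \<otimes>\<^bsub>K\<^esub> a \<otimes>\<^bsub>K\<^esub> b \<oplus>\<^bsub>K\<^esub> d"] by simp
  have ak: "k (h a \<otimes>\<^bsub>K1\<^esub> h b \<oplus>\<^bsub>K1\<^esub> h d) = a \<otimes>\<^bsub>K\<^esub> b \<oplus>\<^bsub>K\<^esub> d"
    "k (h a \<otimes>\<^bsub>K1\<^esub> h a \<otimes>\<^bsub>K1\<^esub> h b \<oplus>\<^bsub>K1\<^esub> h d) = a \<otimes>\<^bsub>K\<^esub> a \<otimes>\<^bsub>K\<^esub> b \<oplus>\<^bsub>K\<^esub> d"
    if "a \<in> carrier K" "b \<in> carrier K" "d \<in> carrier K" for a b d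
    using that kh[of "a \<otimes>\<^bsub>K\<^esub> b \<oplus>\<^bsub>K\<^esub> d"] kh[of "a \<otimes>\<^bsub>K\<^esub> a \<otimes>\<^bsub>K\<^esub> b \<oplus>\<^bsub>K\<^esub> d"] by simp_all
  have mem: "a \<in> carrier K" if "a \<in> L \<or> a \<in> L'" for a using that LK carr by auto
  have inc: "mq_inc K1 x M \<longleftrightarrow> mq_inc K (map_mq_point k x) (map_mq_line k M)"
    if "x \<in> mq_points (h ` L) (h ` L')" "M \<in> mq_lines (h ` L) (h ` L')" for x M
    using that unfolding mq_points_def mq_lines_def
    by (auto simp: khL ad ad3 ak mem inj_on_eq_iff[OF h_inj])
  have "isomorphic_geometries (mq_points (h ` L) (h ` L')) (mq_lines (h ` L) (h ` L')) (mq_inc K1) \<P> \<L> I"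
    unfolding isomorphic_geometries_def
  proof (intro exI conjI ballI)
    show "bij_betw (f \<circ> map_mq_point k) (mq_points (h ` L) (h ` L')) \<P>"
      by (rule bij_betw_trans[OF P f])
    show "bij_betw (g \<circ> map_mq_line k) (mq_lines (h ` L) (h ` L')) \<L>"
      by (rule bij_betw_trans[OF Ln g])
    show "mq_inc K1 x M \<longleftrightarrow> I ((f \<circ> map_mq_point k) x) ((g \<circ> map_mq_line k) M)"
      if "x \<in> mq_points (h ` L) (h ` L')" "M \<in> mq_lines (h ` L) (h ` L')" for x M
      using that inc fg bij_betw_apply[OF P] bij_betw_apply[OF Ln] by simp
  qed
  with D1 show ?thesis unfolding mixed_quadrangle_def by blast
qed

end

theory Submission
  imports Defs
begin

text \<open>
  Let \<open>M\<close> be a regular line through a regular point \<open>x\<close> whose dual net satisfies (LD) with respect to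
  \<open>M\<close>. Calling two blocks parallel if they meet the vertical line of \<open>M\<close> in the same point, (LD) says
  that parallelograms can be composed, so the net has enough translations along the other vertical
  lines. They extend to the quadrangle, and thus \<open>M\<close> is an axis of symmetry. By (ii), the
  symmetries about lines of \<open>\<S>\<close> move regular points and lines around: if two conjugates of such axes
  are opposite, then all lines and all points on them are regular; otherwise all these axes pass
  through one point \<open>z\<close>, and all lines through \<open>z\<close> and all points collinear with \<open>z\<close> are regular.

  In both cases there is a flag \<open>(x, M)\<close> such that \<open>M\<close> is an axis, all points of \<open>M\<close> and all lines
  through \<open>x\<close> are regular, and so are one further point collinear with \<open>x\<close> and one further line
  meeting \<open>M\<close>. Introduce coordinates with respect to this flag. Regularity turns the two coordinate
  operations into biadditive maps on groups of exponent 2, which for the mixed quadrangle are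
  \<open>a k\<close> and \<open>a\<^sup>2 k\<close>;
  the field consists of additive operators that are compatible with both.

  Conversely, the points and lines of a mixed quadrangle are represented by vectors in \<open>K\<^sup>4\<close> so that
  collinear points and concurrent lines are those whose vectors are perpendicular with respect to
  an alternating form. Regularity and (LD) then follow from linear dependence of vectors in \<open>K\<^sup>4\<close>.
\<close>

text \<open>Characteristic 2 is nowhere assumed; it comes from having regular points and regular
  lines at once. Doubling an element of the coordinate group can be carried out by adding points of
  \<open>M\<close> or by adding lines through \<open>x\<close>, and the two outcomes would produce a
  triangle unless the double vanishes. The same absence of triangles controls additivity. A priori
  every line through \<open>x\<close> induces its own addition on the points of \<open>M\<close>,
  and every point of \<open>M\<close> its own addition on the lines through \<open>x\<close>. That
  these additions all agree is the main obstacle: it is equivalent to the commutation of certain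
  permutations, and geometry alone yields this only up to a deviation that has to be eliminated by
  group theory. A second obstacle is that the sets \<open>L\<close> and \<open>L'\<close> of a mixed
  quadrangle are in general not closed under multiplication, so coordinates cannot simply be
  multiplied. What is available are the squares of coordinates acting on \<open>L'\<close>; hence
  the field is found among the additive maps of \<open>L'\<close> into itself and contains
  \<open>L\<close> and \<open>L'\<close> as sets of operators.\<close>

section \<open>Collinearity, projections and regularity\<close>

definition col :: "'l set \<Rightarrow> ('p \<Rightarrow> 'l \<Rightarrow> bool) \<Rightarrow> 'p \<Rightarrow> 'p \<Rightarrow> bool" where
  "col L I p q \<longleftrightarrow> (\<exists>M\<in>L. I p M \<and> I q M)"

text \<open>First-order form of regularity: a point collinear with two distinct points of the trace
  of \<open>x\<close> and \<open>y\<close> is collinear with the entire trace. The original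
  definition speaks of one suitable opposite pair only; that any pair serves is the content of
  \<open>regular_imp_reg\<close>.\<close>

definition reg :: "'p set \<Rightarrow> 'l set \<Rightarrow> ('p \<Rightarrow> 'l \<Rightarrow> bool) \<Rightarrow> 'p \<Rightarrow> bool" where
  "reg P L I x \<longleftrightarrow> x \<in> P \<and>
     (\<forall>y\<in>P. \<forall>u\<in>P. \<forall>v\<in>P. \<forall>z\<in>P. \<forall>w\<in>P. \<not> col L I x y \<longrightarrow> u \<noteq> v \<longrightarrow>
        col L I x u \<longrightarrow> col L I y u \<longrightarrow> col L I x v \<longrightarrow> col L I y v \<longrightarrow> col L I z u \<longrightarrow> col L I z v \<longrightarrow>
        col L I x w \<longrightarrow> col L I y w \<longrightarrow> col L I z w)"

lemma gq_dual:
  assumes "generalized_quadrangle P L I"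
  shows "generalized_quadrangle L P (conversep I)"
proof -
  note G = assms[unfolded generalized_quadrangle_def]
  have three: "\<And>M. M \<in> L \<Longrightarrow> \<exists>T \<subseteq> {x \<in> P. I x M}. card T = 3"
    and three': "\<And>x. x \<in> P \<Longrightarrow> \<exists>T \<subseteq> {M \<in> L. I x M}. card T = 3"
    using G by blast+
  have "L \<noteq> {}"
  proof -
    obtain x where x: "x \<in> P" using G by blast
    obtain T where "T \<subseteq> {M \<in> L. I x M}" "card T = 3" using three'[OF x] by blast
    then show ?thesis by (auto intro: ccontr)
  qed
  moreover have "\<exists>!(N, y). N \<in> L \<and> y \<in> P \<and> conversep I M y \<and> conversep I N y \<and> conversep I N x"
    if "M \<in> L" "x \<in> P" "\<not> conversep I M x" for x M
  proof -
    have "\<exists>!(y, N). y \<in> P \<and> N \<in> L \<and> I x N \<and> I y N \<and> I y M" using G that by auto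
    then obtain yN where 1: "case yN of (y, N) \<Rightarrow> y \<in> P \<and> N \<in> L \<and> I x N \<and> I y N \<and> I y M"
      and 2: "\<And>zN. (case zN of (y, N) \<Rightarrow> y \<in> P \<and> N \<in> L \<and> I x N \<and> I y N \<and> I y M) \<Longrightarrow> zN = yN"
      by (auto elim!: ex1E)
    obtain y N where yN: "yN = (y, N)" by force
    have "(\<lambda>(N, y). N \<in> L \<and> y \<in> P \<and> conversep I M y \<and> conversep I N y \<and> conversep I N x) (N, y)"
      using 1 yN by auto
    moreover have "zN = (N, y)" if "(\<lambda>(N, y). N \<in> L \<and> y \<in> P \<and> conversep I M y \<and> conversep I N y \<and> conversep I N x) zN" for zN
      using 2[of "(snd zN, fst zN)"] that yN by (cases zN) auto
    ultimately show ?thesis by (rule ex1I)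
  qed
  ultimately show ?thesis
    unfolding generalized_quadrangle_def using three three' G by (auto 0 3)
qed

locale gq =
  fixes P :: "'p set" and L :: "'l set" and I :: "'p \<Rightarrow> 'l \<Rightarrow> bool"
  assumes gq: "generalized_quadrangle P L I"
begin

abbreviation cl :: "'p \<Rightarrow> 'p \<Rightarrow> bool" where "cl \<equiv> col L I"
abbreviation mt :: "'l \<Rightarrow> 'l \<Rightarrow> bool" where "mt \<equiv> col P (conversep I)"
abbreviation rp :: "'p \<Rightarrow> bool" where "rp \<equiv> reg P L I"
abbreviation rl :: "'l \<Rightarrow> bool" where "rl \<equiv> reg L P (conversep I)"

lemma dual: "gq L P (conversep I)"
  using gq_dual[OF gq] by unfold_locales

lemma line_unique: "\<lbrakk>x \<in> P; y \<in> P; M \<in> L; N \<in> L; I x M; I y M; I x N; I y N; x \<noteq> y\<rbrakk> \<Longrightarrow> M = N"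
  using gq[unfolded generalized_quadrangle_def, THEN conjunct2, THEN conjunct1] by metis

lemma proj_ex:
  assumes "x \<in> P" "M \<in> L" "\<not> I x M"
  shows "\<exists>y N. y \<in> P \<and> N \<in> L \<and> I x N \<and> I y N \<and> I y M"
proof -
  have "\<exists>!(y, N). y \<in> P \<and> N \<in> L \<and> I x N \<and> I y N \<and> I y M"
    using gq[unfolded generalized_quadrangle_def] assms by (elim conjE) auto
  then show ?thesis by (auto elim!: ex1E)
qed

lemma proj_unique:
  assumes "x \<in> P" "M \<in> L" "\<not> I x M"
    "y \<in> P" "N \<in> L" "I x N" "I y N" "I y M" "y' \<in> P" "N' \<in> L" "I x N'" "I y' N'" "I y' M"
  shows "y = y'" "N = N'"
proof -
  have "\<exists>!(y, N). y \<in> P \<and> N \<in> L \<and> I x N \<and> I y N \<and> I y M"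
    using gq[unfolded generalized_quadrangle_def] assms(1-3) by (elim conjE) auto
  then obtain yN where 2: "\<And>zN. (case zN of (y, N) \<Rightarrow> y \<in> P \<and> N \<in> L \<and> I x N \<and> I y N \<and> I y M) \<Longrightarrow> zN = yN"
    by (auto elim!: ex1E)
  have "(y, N) = (y', N')" using 2[of "(y, N)"] 2[of "(y', N')"] assms by auto
  then show "y = y'" "N = N'" by auto
qed

lemma three_lines:
  assumes "x \<in> P"
  shows "\<exists>M1 M2 M3. M1 \<in> L \<and> M2 \<in> L \<and> M3 \<in> L \<and> I x M1 \<and> I x M2 \<and> I x M3 \<and> M1 \<noteq> M2 \<and> M1 \<noteq> M3 \<and> M2 \<noteq> M3"
proof -
  obtain T where T: "T \<subseteq> {M \<in> L. I x M}" "card T = 3"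
    using gq[unfolded generalized_quadrangle_def, THEN conjunct2, THEN conjunct2, THEN conjunct1] assms by blast
  from T(2) obtain M1 M2 M3 where "T = {M1, M2, M3}" "M1 \<noteq> M2" "M1 \<noteq> M3" "M2 \<noteq> M3"
    unfolding card_3_iff by blast
  then show ?thesis using T(1) by (intro exI[of _ M1] exI[of _ M2] exI[of _ M3]) auto
qed

lemma line_other: "x \<in> P \<Longrightarrow> \<exists>M\<in>L. I x M \<and> M \<noteq> A \<and> M \<noteq> B"
  using three_lines[of x] by metis

lemma line_through: "x \<in> P \<Longrightarrow> \<exists>M\<in>L. I x M"
  using line_other by blast

lemma cl_refl: "x \<in> P \<Longrightarrow> cl x x"
  using line_through by (auto simp: col_def)

lemma cl_sym: "cl x y \<longleftrightarrow> cl y x"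
  by (auto simp: col_def)

lemma clI: "\<lbrakk>M \<in> L; I x M; I y M\<rbrakk> \<Longrightarrow> cl x y"
  by (auto simp: col_def)

lemma clE: "cl x y \<Longrightarrow> (\<And>M. \<lbrakk>M \<in> L; I x M; I y M\<rbrakk> \<Longrightarrow> thesis) \<Longrightarrow> thesis"
  by (auto simp: col_def)

lemma mtI: "\<lbrakk>p \<in> P; I p M; I p N\<rbrakk> \<Longrightarrow> mt M N"
  by (auto simp: col_def)

lemma mtE: "mt M N \<Longrightarrow> (\<And>p. \<lbrakk>p \<in> P; I p M; I p N\<rbrakk> \<Longrightarrow> thesis) \<Longrightarrow> thesis"
  by (auto simp: col_def)

lemma mt_sym: "mt M N \<longleftrightarrow> mt N M"
  by (auto simp: col_def)

text \<open>\<open>pj x M\<close> is the point of \<open>M\<close> collinear with \<open>x\<close>, and \<open>pl x M\<close> the line through \<open>x\<close> meeting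
  \<open>M\<close>; only the former is meaningful if \<open>x\<close> lies on \<open>M\<close>.\<close>

definition pj :: "'p \<Rightarrow> 'l \<Rightarrow> 'p" where
  "pj x M = (if I x M then x else (SOME y. y \<in> P \<and> I y M \<and> cl x y))"

definition pl :: "'p \<Rightarrow> 'l \<Rightarrow> 'l" where
  "pl x M = (SOME N. N \<in> L \<and> I x N \<and> mt N M)"

lemma pj:
  assumes "x \<in> P" "M \<in> L"
  shows "pj x M \<in> P" "I (pj x M) M" "cl x (pj x M)"
proof -
  have "pj x M \<in> P \<and> I (pj x M) M \<and> cl x (pj x M)"
  proof (cases "I x M")
    case True then show ?thesis using assms by (auto simp: pj_def cl_refl)
  next
    case False
    then have "\<exists>y. y \<in> P \<and> I y M \<and> cl x y" using proj_ex[OF assms] by (auto simp: col_def)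
    then show ?thesis using False by (auto simp: pj_def intro: someI2)
  qed
  then show "pj x M \<in> P" "I (pj x M) M" "cl x (pj x M)" by auto
qed

lemma pl:
  assumes "x \<in> P" "M \<in> L" "\<not> I x M"
  shows "pl x M \<in> L" "I x (pl x M)" "mt (pl x M) M"
proof -
  have "\<exists>N. N \<in> L \<and> I x N \<and> mt N M" using proj_ex[OF assms] by (auto simp: col_def)
  then have "pl x M \<in> L \<and> I x (pl x M) \<and> mt (pl x M) M" unfolding pl_def by (rule someI_ex)
  then show "pl x M \<in> L" "I x (pl x M)" "mt (pl x M) M" by auto
qed

lemma pj_unique:
  assumes "x \<in> P" "M \<in> L" "\<not> I x M" "y \<in> P" "I y M" "cl x y" "y' \<in> P" "I y' M" "cl x y'"
  shows "y = y'"
  using proj_unique(1)[OF assms(1-3)] assms(4-) by (auto simp: col_def)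

lemma pj_eq: "\<lbrakk>x \<in> P; M \<in> L; \<not> I x M; y \<in> P; I y M; cl x y\<rbrakk> \<Longrightarrow> pj x M = y"
  using pj_unique pj by metis

lemma pj_on: "I x M \<Longrightarrow> pj x M = x"
  by (simp add: pj_def)

lemma pl_unique:
  assumes "x \<in> P" "M \<in> L" "\<not> I x M" "N \<in> L" "I x N" "mt N M" "N' \<in> L" "I x N'" "mt N' M"
  shows "N = N'"
proof -
  obtain y y' where "y \<in> P" "I y N" "I y M" "y' \<in> P" "I y' N'" "I y' M"
    using assms(6,9) by (auto simp: col_def)
  then show ?thesis using proj_unique(2)[OF assms(1-3), of y N y' N'] assms by auto
qed

lemma pl_eq: "\<lbrakk>x \<in> P; M \<in> L; \<not> I x M; N \<in> L; I x N; mt N M\<rbrakk> \<Longrightarrow> pl x M = N"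
  using pl_unique pl by metis

text \<open>Otherwise \<open>x\<close> and \<open>y\<close> would be two projections of
  \<open>z\<close> on \<open>M\<close>.\<close>

lemma no_tri:
  assumes "x \<in> P" "y \<in> P" "z \<in> P" "M \<in> L" "I x M" "I y M" "x \<noteq> y" "cl z x" "cl z y"
  shows "I z M"
  using pj_unique[of z M x y] assms by blast

lemma no_tri':
  assumes "p \<in> P" "q \<in> P" "r \<in> P" "A \<in> L" "B \<in> L" "C \<in> L" "A \<noteq> B" "A \<noteq> C" "B \<noteq> C"
    "I p A" "I p B" "I q B" "I q C" "I r C" "I r A"
  shows "p = q" "q = r"
proof -
  show "p = q"
  proof (rule ccontr)
    assume ne: "p \<noteq> q"
    show False
    proof (cases "r = q")
      case True
      then show False using line_unique[of p q A B] assms ne by auto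
    next
      case False
      have "I p C" using no_tri[of q r p C] assms False by (auto simp: col_def)
      then show False using line_unique[of p q B C] assms ne by auto
    qed
  qed
  then have "I q A" using assms by simp
  show "q = r"
  proof (rule ccontr)
    assume "q \<noteq> r"
    then show False using line_unique[of q r A C] assms \<open>I q A\<close> by auto
  qed
qed

text \<open>A line joining \<open>u\<close> and \<open>v\<close> would contain both \<open>x\<close>
  and \<open>y\<close>, triangles being excluded.\<close>

lemma trace_opp:
  assumes "x \<in> P" "y \<in> P" "u \<in> P" "v \<in> P" "\<not> cl x y" "u \<noteq> v" "cl x u" "cl y u" "cl x v" "cl y v"
  shows "\<not> cl u v"
proof
  assume "cl u v"
  then obtain M where M: "M \<in> L" "I u M" "I v M" by (rule clE)
  have "I x M" using no_tri[of u v x M] assms M by auto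
  moreover have "I y M" using no_tri[of u v y M] assms M by auto
  ultimately show False using assms(5) M(1) by (auto simp: col_def)
qed

section \<open>Perps, spans and the two forms of regularity\<close>

lemma perp_iff: "A \<subseteq> P \<Longrightarrow> y \<in> perp P L I A \<longleftrightarrow> y \<in> P \<and> (\<forall>x\<in>A. cl y x)"
  unfolding perp_def using cl_refl by (auto simp: col_def)

lemma opposite_iff: "opposite P L I x y \<longleftrightarrow> x \<in> P \<and> y \<in> P \<and> \<not> cl x y"
  unfolding opposite_def using perp_iff[of "{x}" y] by (auto simp: cl_sym)

lemma perp_sub: "perp P L I A \<subseteq> P"
  by (auto simp: perp_def)

lemma two_traces:
  assumes "x \<in> P" "y \<in> P" "\<not> cl x y"
  shows "\<exists>u\<in>P. \<exists>v\<in>P. u \<noteq> v \<and> cl x u \<and> cl y u \<and> cl x v \<and> cl y v"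
proof -
  obtain A B C where A: "A \<in> L" "B \<in> L" "I x A" "I x B" "A \<noteq> B" using three_lines[OF assms(1)] by blast
  have ny: "\<not> I y A" "\<not> I y B" using A assms(3) by (auto simp: col_def)
  let ?u = "pj y A" and ?v = "pj y B"
  have u: "?u \<in> P" "I ?u A" "cl y ?u" and v: "?v \<in> P" "I ?v B" "cl y ?v" using pj assms A by auto
  have "?u \<noteq> ?v"
  proof
    assume eq: "?u = ?v"
    have "?u \<noteq> x" using u assms(3) by (auto simp: cl_sym)
    then show False using line_unique[of x ?u A B] A u v eq assms by auto
  qed
  then show ?thesis using u v A by (auto simp: col_def)
qed

text \<open>The pair \<open>u0\<close>, \<open>v0\<close> witnessing regularity lies in the trace,
  because \<open>x\<close> and \<open>y\<close> belong to their own span. For another pair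
  \<open>u\<close>, \<open>v\<close> and a point \<open>z\<close> collinear with both, the line
  \<open>R\<close> joining \<open>u\<close> and \<open>z\<close> is shown to carry a point
  \<open>r\<close> of the span. Being collinear with \<open>v\<close>, the point \<open>r\<close> is
  the projection of \<open>v\<close> on \<open>R\<close>, and this is \<open>z\<close>.\<close>

lemma regular_imp_reg:
  assumes R: "regular_point P L I x"
  shows "rp x"
  unfolding reg_def
proof (intro conjI ballI impI)
  show xP: "x \<in> P" using R by (simp add: regular_point_def)
  fix y u v z w
  assume P: "y \<in> P" "u \<in> P" "v \<in> P" "z \<in> P" "w \<in> P" and xy: "\<not> cl x y" and uv: "u \<noteq> v"
    and c: "cl x u" "cl y u" "cl x v" "cl y v" "cl z u" "cl z v" "cl x w" "cl y w"
  obtain u0 v0 where o: "opposite P L I u0 v0" and sp: "point_span P L I x y = perp P L I {u0, v0}"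
    using R P xP xy by (auto simp: regular_point_def opposite_iff)
  have uv0: "u0 \<in> P" "v0 \<in> P" "\<not> cl u0 v0" using o by (auto simp: opposite_iff)
  define H where "H = perp P L I {x, y}"
  have HP: "H \<subseteq> P" by (auto simp: H_def perp_def)
  have Hiff: "\<And>t. t \<in> H \<longleftrightarrow> t \<in> P \<and> cl x t \<and> cl y t"
    unfolding H_def using perp_iff[of "{x, y}"] xP P by (auto simp: cl_sym)
  have span: "\<And>t. t \<in> P \<and> cl t u0 \<and> cl t v0 \<longleftrightarrow> t \<in> P \<and> (\<forall>h\<in>H. cl t h)"
    using sp perp_iff[OF HP] perp_iff[of "{u0, v0}"] uv0 unfolding point_span_def H_def[symmetric] by auto
  have u0H: "u0 \<in> H"
    using span[of x] span[of y] Hiff xP P uv0 by (auto simp: cl_sym)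
  have v0H: "v0 \<in> H"
    using span[of x] span[of y] Hiff xP P uv0 by (auto simp: cl_sym)
  have nuv: "\<not> cl u v" by (rule trace_opp[of x y]) (use P xP xy uv c in auto)
  obtain R where R: "R \<in> L" "I z R" "I u R" using c by (auto simp: col_def)
  have vR: "\<not> I v R" using R nuv by (auto simp: col_def)
  have "\<exists>r\<in>P. I r R \<and> cl r u0 \<and> cl r v0"
  proof (cases "u = u0")
    case True
    then have "I u0 R" "\<not> I v0 R" using R uv0 by (auto simp: col_def)
    then show ?thesis using pj[of v0 R] uv0 R by (auto simp: col_def)
  next
    case False
    have nuu: "\<not> cl u u0"
      by (rule trace_opp[of x y]) (use P xP xy False c u0H Hiff in auto)
    then have u0R: "\<not> I u0 R" using R by (auto simp: col_def)
    let ?r = "pj u0 R"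
    have r: "?r \<in> P" "I ?r R" "cl u0 ?r" using pj uv0 R by auto
    obtain Q where Q: "Q \<in> L" "I u0 Q" "I ?r Q" using r by (auto simp: col_def)
    \<comment> \<open>\<open>?g\<close> is collinear with \<open>u0\<close> and \<open>v0\<close>,
      hence lies in the span and is collinear with \<open>u\<close>. So \<open>?g\<close> and
      \<open>?r\<close> are both the projection of \<open>u\<close> on \<open>Q\<close>, and
      \<open>?r\<close> is collinear with \<open>v0\<close> as well.\<close>
    let ?g = "pj v0 Q"
    have g: "?g \<in> P" "I ?g Q" "cl v0 ?g" using pj uv0 Q by auto
    have "cl ?g u0" using g Q by (auto simp: col_def)
    then have gs: "\<forall>h\<in>H. cl ?g h" using span[of ?g] g by (auto simp: cl_sym)
    then have gu: "cl ?g u" using Hiff P c by auto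
    have "\<not> I u Q" using nuu Q by (auto simp: col_def)
    then have "?g = ?r"
      using pj_unique[of u Q ?g ?r] P Q g r gu R by (auto simp: col_def)
    then show ?thesis using r g by (auto simp: cl_sym)
  qed
  then obtain r where r: "r \<in> P" "I r R" "cl r u0" "cl r v0" by blast
  then have rs: "\<forall>h\<in>H. cl r h" using span[of r] by auto
  then have "cl v r" using Hiff P c by (auto simp: cl_sym)
  then have "z = r" using pj_unique[of v R z r] P R r vR c by (auto simp: cl_sym)
  then show "cl z w" using rs Hiff P c by auto
qed

lemma reg_imp_regular:
  assumes R: "rp x"
  shows "regular_point P L I x"
  unfolding regular_point_def opposite_iff
proof (intro conjI allI impI)
  show xP: "x \<in> P" using R by (simp add: reg_def)
  fix y assume "x \<in> P \<and> y \<in> P \<and> \<not> cl x y"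
  then have y: "y \<in> P" "\<not> cl x y" by auto
  obtain u v where uv: "u \<in> P" "v \<in> P" "u \<noteq> v" "cl x u" "cl y u" "cl x v" "cl y v"
    using two_traces[OF xP y] by blast
  have "\<not> cl u v" by (rule trace_opp[of x y]) (use xP y uv in auto)
  have HP: "perp P L I {x, y} \<subseteq> P" by (auto simp: perp_def)
  have "point_span P L I x y = perp P L I {u, v}"
  proof (intro equalityI subsetI)
    fix t assume "t \<in> point_span P L I x y"
    then have "t \<in> P" "\<forall>h\<in>perp P L I {x, y}. cl t h" unfolding point_span_def perp_iff[OF HP] by auto
    then show "t \<in> perp P L I {u, v}" using perp_iff[of "{u, v}"] perp_iff[of "{x, y}"] uv xP y by (auto simp: cl_sym)
  next
    fix t assume "t \<in> perp P L I {u, v}"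
    then have t: "t \<in> P" "cl t u" "cl t v" using perp_iff[of "{u, v}"] uv by auto
    have "cl t h" if "h \<in> perp P L I {x, y}" for h
    proof -
      have "h \<in> P" "cl x h" "cl y h" using that perp_iff[of "{x, y}"] xP y by (auto simp: cl_sym)
      then show ?thesis using R t uv xP y unfolding reg_def by blast
    qed
    then show "t \<in> point_span P L I x y" unfolding point_span_def perp_iff[OF HP] using t by auto
  qed
  then show "\<exists>u v. (u \<in> P \<and> v \<in> P \<and> \<not> cl u v) \<and> point_span P L I x y = perp P L I {u, v}"
    using uv \<open>\<not> cl u v\<close> by blast
qed

lemma regular_point_iff: "regular_point P L I x \<longleftrightarrow> rp x"
  using regular_imp_reg reg_imp_regular by blast

lemma regD:
  assumes "rp x" "\<not> cl x y" "u \<noteq> v" "cl x u" "cl y u" "cl x v" "cl y v" "cl z u" "cl z v" "cl x w" "cl y w"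
    "y \<in> P" "u \<in> P" "v \<in> P" "z \<in> P" "w \<in> P"
  shows "cl z w"
  using assms unfolding reg_def by blast

text \<open>Regularity is applied at \<open>w\<close>, for the opposite pair \<open>w\<close>,
  \<open>v\<close> whose trace contains \<open>z\<close> and \<open>y\<close>: whatever is collinear
  with \<open>z\<close> and \<open>y\<close> is collinear with everything collinear with
  \<open>w\<close> and \<open>v\<close>. In this way regularity reaches points to which no
  collineation moves a regular point.\<close>

lemma reg_by_traces:
  assumes z: "z \<in> P" and H: "\<And>y. \<lbrakk>y \<in> P; \<not> cl z y\<rbrakk> \<Longrightarrow> \<exists>w\<in>P. rp w \<and> cl z w \<and> cl y w"
  shows "rp z"
proof (rule regular_imp_reg)
  show "regular_point P L I z"
    unfolding regular_point_def opposite_iff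
  proof (intro conjI allI impI z)
    fix y assume "z \<in> P \<and> y \<in> P \<and> \<not> cl z y"
    then have y: "y \<in> P" "\<not> cl z y" by auto
    obtain w where w: "w \<in> P" "rp w" "cl z w" "cl y w" using H y by blast
    obtain v where v: "v \<in> P" "v \<noteq> w" "cl z v" "cl y v"
      using two_traces[OF z y] by metis
    have wv: "\<not> cl w v" by (rule trace_opp[of z y]) (use z y w v in auto)
    have HP: "perp P L I {z, y} \<subseteq> P" by (auto simp: perp_def)
    have "z \<noteq> y" using y z cl_refl by auto
    have "point_span P L I z y = perp P L I {w, v}"
    proof (intro equalityI subsetI)
      fix t assume "t \<in> point_span P L I z y"
      then have "t \<in> P" "\<forall>h\<in>perp P L I {z, y}. cl t h" unfolding point_span_def perp_iff[OF HP] by auto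
      then show "t \<in> perp P L I {w, v}" using perp_iff[of "{w, v}"] perp_iff[of "{z, y}"] w v z y by (auto simp: cl_sym)
    next
      fix t assume "t \<in> perp P L I {w, v}"
      then have t: "t \<in> P" "cl t w" "cl t v" using perp_iff[of "{w, v}"] w v by auto
      have "cl t h" if "h \<in> perp P L I {z, y}" for h
      proof -
        have h: "h \<in> P" "cl z h" "cl y h" using that perp_iff[of "{z, y}"] z y by (auto simp: cl_sym)
        have "cl h t" using regD[OF w(2) wv \<open>z \<noteq> y\<close>, of h t] w v z y t h by (auto simp: cl_sym)
        then show ?thesis by (simp add: cl_sym)
      qed
      then show "t \<in> point_span P L I z y" unfolding point_span_def perp_iff[OF HP] using t by auto
    qed
    then show "\<exists>u v. (u \<in> P \<and> v \<in> P \<and> \<not> cl u v) \<and> point_span P L I z y = perp P L I {u, v}"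
      using w v wv by blast
  qed
qed

lemma reg_line_by_traces:
  assumes z: "U \<in> L" and H: "\<And>V. \<lbrakk>V \<in> L; \<not> mt U V\<rbrakk> \<Longrightarrow> \<exists>W\<in>L. rl W \<and> mt U W \<and> mt V W"
  shows "rl U"
  using gq.reg_by_traces[OF dual, of U] assms by blast

lemma three_points:
  "M \<in> L \<Longrightarrow> \<exists>x\<in>P. I x M \<and> x \<noteq> a \<and> x \<noteq> b"
  using gq.line_other[OF dual, of M a b] by auto

lemma mt_refl: "M \<in> L \<Longrightarrow> mt M M"
  using gq.cl_refl[OF dual] by blast

lemma two_trans:
  assumes "M \<in> L" "N \<in> L" "\<not> mt M N"
  shows "\<exists>U\<in>L. \<exists>V\<in>L. U \<noteq> V \<and> mt M U \<and> mt N U \<and> mt M V \<and> mt N V"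
  using gq.two_traces[OF dual assms] .

lemma regular_line_iff: "regular_line P L I M \<longleftrightarrow> rl M"
  unfolding regular_line_def using gq.regular_point_iff[OF dual] by blast

lemma rlD:
  assumes "rl M" "\<not> mt M N" "U \<noteq> V" "mt M U" "mt N U" "mt M V" "mt N V" "mt Z U" "mt Z V" "mt M W" "mt N W"
    "N \<in> L" "U \<in> L" "V \<in> L" "Z \<in> L" "W \<in> L"
  shows "mt Z W"
  using gq.regD[OF dual assms] .

lemma trace_opp_line:
  assumes "M \<in> L" "N \<in> L" "U \<in> L" "V \<in> L" "\<not> mt M N" "U \<noteq> V" "mt M U" "mt N U" "mt M V" "mt N V"
  shows "\<not> mt U V"
  using gq.trace_opp[OF dual assms] .

lemma rpP: "rp x \<Longrightarrow> x \<in> P" by (simp add: reg_def)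
lemma rlL: "rl M \<Longrightarrow> M \<in> L" by (simp add: reg_def)

end

section \<open>Translations of the dual net\<close>

context gq
begin

definition colln :: "('p \<Rightarrow> 'p) \<Rightarrow> ('l \<Rightarrow> 'l) \<Rightarrow> bool" where
  "colln f g \<longleftrightarrow> bij_betw f P P \<and> bij_betw g L L \<and> (\<forall>x\<in>P. \<forall>M\<in>L. I x M \<longleftrightarrow> I (f x) (g M))"

definition axis :: "'l \<Rightarrow> bool" where
  "axis M \<longleftrightarrow> M \<in> L \<and> (\<forall>U\<in>L. \<forall>p\<in>P. \<forall>p'\<in>P. U \<noteq> M \<longrightarrow> mt U M \<longrightarrow> I p U \<longrightarrow> I p' U \<longrightarrow> \<not> I p M \<longrightarrow> \<not> I p' M \<longrightarrow>
     (\<exists>f g. colln f g \<and> (\<forall>N\<in>L. mt N M \<longrightarrow> g N = N) \<and> f p = p'))"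

lemma colln_P: "colln f g \<Longrightarrow> x \<in> P \<Longrightarrow> f x \<in> P"
  unfolding colln_def by (meson bij_betwE)

lemma colln_L: "colln f g \<Longrightarrow> M \<in> L \<Longrightarrow> g M \<in> L"
  unfolding colln_def by (meson bij_betwE)

lemma colln_I: "colln f g \<Longrightarrow> x \<in> P \<Longrightarrow> M \<in> L \<Longrightarrow> I (f x) (g M) \<longleftrightarrow> I x M"
  unfolding colln_def by blast

lemma colln_surjP: "colln f g \<Longrightarrow> y \<in> P \<Longrightarrow> \<exists>x\<in>P. y = f x"
  unfolding colln_def bij_betw_def by blast

lemma colln_surjL: "colln f g \<Longrightarrow> N \<in> L \<Longrightarrow> \<exists>M\<in>L. N = g M"
  unfolding colln_def bij_betw_def by blast

lemma colln_inj: "colln f g \<Longrightarrow> x \<in> P \<Longrightarrow> y \<in> P \<Longrightarrow> f x = f y \<longleftrightarrow> x = y"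
  unfolding colln_def bij_betw_def inj_on_def by blast

lemma colln_dual: "colln f g \<Longrightarrow> gq.colln L P (conversep I) g f"
  unfolding colln_def gq.colln_def[OF dual] by auto

lemma colln_cl:
  assumes "colln f g" "p \<in> P" "q \<in> P"
  shows "cl (f p) (f q) \<longleftrightarrow> cl p q"
proof
  assume "cl (f p) (f q)"
  then obtain N where N: "N \<in> L" "I (f p) N" "I (f q) N" by (rule clE)
  then obtain M where "M \<in> L" "N = g M" using colln_surjL[OF assms(1)] by blast
  then show "cl p q" using N assms colln_I by (auto simp: col_def)
next
  assume "cl p q"
  then show "cl (f p) (f q)" using assms colln_I colln_L by (fastforce simp: col_def)
qed

lemma colln_mt: "colln f g \<Longrightarrow> M \<in> L \<Longrightarrow> N \<in> L \<Longrightarrow> mt (g M) (g N) \<longleftrightarrow> mt M N"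
  using gq.colln_cl[OF dual colln_dual] by blast

lemma colln_comp:
  assumes "colln f g" "colln f' g'"
  shows "colln (f' \<circ> f) (g' \<circ> g)"
  unfolding colln_def
proof (intro conjI ballI)
  show "bij_betw (f' \<circ> f) P P" "bij_betw (g' \<circ> g) L L"
    using assms unfolding colln_def by (blast intro: bij_betw_trans)+
  show "I x M \<longleftrightarrow> I ((f' \<circ> f) x) ((g' \<circ> g) M)" if "x \<in> P" "M \<in> L" for x M
    using that colln_I[OF assms(1)] colln_I[OF assms(2)] colln_P[OF assms(1)] colln_L[OF assms(1)] by simp
qed

lemma colln_inv:
  assumes "colln f g"
  shows "\<exists>f' g'. colln f' g' \<and> (\<forall>x\<in>P. f' (f x) = x \<and> f (f' x) = x) \<and> (\<forall>M\<in>L. g' (g M) = M \<and> g (g' M) = M)"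
proof -
  have b: "bij_betw f P P" "bij_betw g L L" using assms by (auto simp: colln_def)
  let ?f = "inv_into P f" and ?g = "inv_into L g"
  have 1: "\<forall>x\<in>P. ?f (f x) = x \<and> f (?f x) = x" "\<forall>M\<in>L. ?g (g M) = M \<and> g (?g M) = M"
    using b by (auto simp: bij_betw_inv_into_left bij_betw_inv_into_right)
  have b': "bij_betw ?f P P" "bij_betw ?g L L" using b by (auto intro: bij_betw_inv_into)
  have "I x M \<longleftrightarrow> I (?f x) (?g M)" if "x \<in> P" "M \<in> L" for x M
  proof -
    have "?f x \<in> P" "?g M \<in> L" using b' that by (auto dest: bij_betwE)
    then have "I (f (?f x)) (g (?g M)) \<longleftrightarrow> I (?f x) (?g M)" using colln_I[OF assms] by blast
    then show ?thesis using 1 that by auto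
  qed
  then have "colln ?f ?g" unfolding colln_def using b' by blast
  then show ?thesis using 1 by blast
qed

lemma colln_reg:
  assumes c: "colln f g" and r: "rp x"
  shows "rp (f x)"
  unfolding reg_def
proof (intro conjI ballI impI)
  have x: "x \<in> P" using r by (rule rpP)
  show "f x \<in> P" using colln_P[OF c x] .
  fix y' u' v' z' w'
  assume P: "y' \<in> P" "u' \<in> P" "v' \<in> P" "z' \<in> P" "w' \<in> P"
    and a: "\<not> cl (f x) y'" "u' \<noteq> v'" "cl (f x) u'" "cl y' u'" "cl (f x) v'" "cl y' v'" "cl z' u'" "cl z' v'" "cl (f x) w'" "cl y' w'"
  note S = colln_surjP[OF c]
  obtain y where y: "y \<in> P" "y' = f y" using S[OF P(1)] by blast
  obtain u where u: "u \<in> P" "u' = f u" using S[OF P(2)] by blast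
  obtain v where v: "v \<in> P" "v' = f v" using S[OF P(3)] by blast
  obtain z where z: "z \<in> P" "z' = f z" using S[OF P(4)] by blast
  obtain w where w: "w \<in> P" "w' = f w" using S[OF P(5)] by blast
  note e = y u v z w
  then have "cl z w" using regD[OF r, of y u v z w] a x by (auto simp: colln_cl[OF c])
  then show "cl z' w'" using e by (auto simp: colln_cl[OF c])
qed

lemma colln_rl: "colln f g \<Longrightarrow> rl M \<Longrightarrow> rl (g M)"
  using gq.colln_reg[OF dual colln_dual] by blast

lemma colln_pj:
  assumes c: "colln f g" "p \<in> P" "N \<in> L"
  shows "pj (f p) (g N) = f (pj p N)"
proof (cases "I p N")
  case True then show ?thesis using assms by (simp add: pj_on colln_I)
next
  case False
  show ?thesis
    by (rule pj_eq) (use assms False pj[of p N] in \<open>auto simp: colln_P colln_L colln_I colln_cl\<close>)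
qed

text \<open>The symmetries about \<open>M\<close> are conjugated by the given collineation.\<close>

lemma colln_axis:
  assumes c: "colln f g" and a: "axis M"
  shows "axis (g M)"
  unfolding axis_def
proof (intro conjI ballI impI)
  have M: "M \<in> L" using a by (simp add: axis_def)
  then show "g M \<in> L" using colln_L[OF c] by blast
  fix U' q q' assume U': "U' \<in> L" "q \<in> P" "q' \<in> P" "U' \<noteq> g M" "mt U' (g M)" "I q U'" "I q' U'" "\<not> I q (g M)" "\<not> I q' (g M)"
  obtain U where 1: "U \<in> L" "U' = g U" using colln_surjL[OF c U'(1)] by blast
  obtain p where 2: "p \<in> P" "q = f p" using colln_surjP[OF c U'(2)] by blast
  obtain p' where 3: "p' \<in> P" "q' = f p'" using colln_surjP[OF c U'(3)] by blast
  note e = 1 2 3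
  have "U \<noteq> M" "mt U M" "I p U" "I p' U" "\<not> I p M" "\<not> I p' M"
    using U' e M c by (auto simp: colln_I colln_mt)
  then obtain h k where h: "colln h k" "\<forall>N\<in>L. mt N M \<longrightarrow> k N = N" "h p = p'"
    using a e unfolding axis_def by blast
  obtain f' g' where i: "colln f' g'" "\<forall>x\<in>P. f' (f x) = x \<and> f (f' x) = x" "\<forall>M\<in>L. g' (g M) = M \<and> g (g' M) = M"
    using colln_inv[OF c] by blast
  have "colln (f \<circ> (h \<circ> f')) (g \<circ> (k \<circ> g'))" using colln_comp c h i by blast
  moreover have "\<forall>N\<in>L. mt N (g M) \<longrightarrow> (g \<circ> (k \<circ> g')) N = N"
  proof (intro ballI impI)
    fix N assume N: "N \<in> L" "mt N (g M)"
    then obtain N0 where N0: "N0 \<in> L" "N = g N0" using colln_surjL[OF c] by blast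
    then have "mt N0 M" using N M c by (simp add: colln_mt)
    then show "(g \<circ> (k \<circ> g')) N = N" using N0 i h by auto
  qed
  moreover have "(f \<circ> (h \<circ> f')) q = q'" using e i h by auto
  ultimately show "\<exists>f g'. colln f g' \<and> (\<forall>N\<in>L. mt N (g M) \<longrightarrow> g' N = N) \<and> f q = q'" by blast
qed

end

section \<open>The dual net at a regular point on a regular line\<close>

locale LD_flag = gq P L I for P :: "'p set" and L :: "'l set" and I +
  fixes x :: 'p and M :: 'l
  assumes rx: "rp x" and rM: "rl M" and xM: "I x M" and LD: "LD_at P L I x M"
begin

lemma xP: "x \<in> P" using rx by (rule rpP)
lemma MinL: "M \<in> L" using rM by (rule rlL)

text \<open>In terms of the dual net at \<open>x\<close>, \<open>Bk y\<close> is the block of \<open>y\<close> and \<open>xl q\<close> the vertical line of \<open>q\<close>; \<open>sl q r v\<close>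
  says that the block joining \<open>q\<close> and \<open>r\<close> meets \<open>M\<close> in \<open>v\<close>, and \<open>par q q' r r'\<close> that \<open>q, r, r', q'\<close> is a
  parallelogram.\<close>

definition N0 :: "'p \<Rightarrow> bool" where "N0 q \<longleftrightarrow> q \<in> P \<and> cl x q \<and> \<not> I q M"
definition VV :: "'p \<Rightarrow> bool" where "VV v \<longleftrightarrow> v \<in> P \<and> I v M \<and> v \<noteq> x"
definition Bk :: "'p \<Rightarrow> 'p set" where "Bk y = perp P L I {x, y}"
definition xl :: "'p \<Rightarrow> 'l" where "xl q = (SOME W. W \<in> L \<and> I x W \<and> I q W)"
definition opx :: "'p \<Rightarrow> bool" where "opx y \<longleftrightarrow> y \<in> P \<and> \<not> cl x y"
definition sl :: "'p \<Rightarrow> 'p \<Rightarrow> 'p \<Rightarrow> bool" where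
  "sl q r v \<longleftrightarrow> (\<exists>y. opx y \<and> q \<in> Bk y \<and> r \<in> Bk y \<and> v \<in> Bk y)"
definition par :: "'p \<Rightarrow> 'p \<Rightarrow> 'p \<Rightarrow> 'p \<Rightarrow> bool" where
  "par q q' r r' \<longleftrightarrow> (\<exists>v. VV v \<and> sl q r v \<and> sl q' r' v)"

lemma Bk_iff: "opx y \<Longrightarrow> t \<in> Bk y \<longleftrightarrow> t \<in> P \<and> cl x t \<and> cl y t"
  unfolding Bk_def opx_def using perp_iff[of "{x, y}"] xP by (auto simp: cl_sym)

lemma N0_ne: "N0 q \<Longrightarrow> q \<noteq> x" using xM by (auto simp: N0_def)

lemma xl:
  assumes "q \<in> P" "cl x q"
  shows "xl q \<in> L" "I x (xl q)" "I q (xl q)"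
proof -
  have "\<exists>W. W \<in> L \<and> I x W \<and> I q W" using assms by (auto simp: col_def)
  then have "xl q \<in> L \<and> I x (xl q) \<and> I q (xl q)" unfolding xl_def by (rule someI_ex)
  then show "xl q \<in> L" "I x (xl q)" "I q (xl q)" by auto
qed

lemma xl_eq: "\<lbrakk>q \<in> P; q \<noteq> x; W \<in> L; I x W; I q W\<rbrakk> \<Longrightarrow> xl q = W"
  using xl[of q] line_unique[of x q "xl q" W] xP by (auto simp: col_def)

lemma cl_xl:
  assumes "p \<in> P" "p \<noteq> x" "cl x p" "q \<in> P" "q \<noteq> x" "cl x q"
  shows "cl p q \<longleftrightarrow> xl p = xl q"
proof
  assume c: "cl p q"
  have "I q (xl p)" using no_tri[of x p q "xl p"] xl[of p] assms xP c by (auto simp: cl_sym)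
  then show "xl p = xl q" using xl_eq[of q "xl p"] xl[of p] assms by simp
next
  assume "xl p = xl q"
  then show "cl p q" using xl[of p] xl[of q] assms by (auto simp: col_def)
qed

lemma Bk_opp: "\<lbrakk>opx y; q \<in> Bk y; r \<in> Bk y; q \<noteq> r\<rbrakk> \<Longrightarrow> \<not> cl q r"
  using trace_opp[of x y q r] xP by (auto simp: Bk_iff opx_def)

lemma Bk_ne: "opx y \<Longrightarrow> q \<in> Bk y \<Longrightarrow> q \<noteq> x"
  by (auto simp: Bk_iff) (auto simp: opx_def cl_sym)

text \<open>Regularity of \<open>x\<close> enters the net here: a block is determined by any two of
  its points.\<close>

lemma Bk_sub:
  assumes "opx y" "opx y'" "q \<noteq> r" "q \<in> Bk y" "r \<in> Bk y" "q \<in> Bk y'" "r \<in> Bk y'"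
  shows "Bk y \<subseteq> Bk y'"
proof
  fix t assume "t \<in> Bk y"
  then show "t \<in> Bk y'"
    using assms regD[OF rx, of y q r y' t] by (auto simp: Bk_iff) (auto simp: opx_def)
qed

lemma Bk_eq:
  assumes "opx y" "opx y'" "q \<noteq> r" "q \<in> Bk y" "r \<in> Bk y" "q \<in> Bk y'" "r \<in> Bk y'"
  shows "Bk y = Bk y'"
  using Bk_sub[of y y' q r] Bk_sub[of y' y q r] assms by blast

lemma Bk_inter:
  assumes "opx y" "opx y'" "Bk y \<noteq> Bk y'" "a \<in> Bk y" "a \<in> Bk y'"
  shows "Bk y \<inter> Bk y' = {a}"
proof -
  have "t = a" if "t \<in> Bk y" "t \<in> Bk y'" for t
    using Bk_eq[of y y' t a] assms that by metis
  then show ?thesis using assms by blast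
qed

lemma Bk_ex:
  assumes "q \<in> P" "r \<in> P" "cl x q" "cl x r" "\<not> cl q r"
  shows "\<exists>y. opx y \<and> q \<in> Bk y \<and> r \<in> Bk y"
proof -
  obtain y where y: "y \<in> P" "y \<noteq> x" "cl q y" "cl r y" using two_traces[of q r] assms by metis
  then have "\<not> cl x y" using trace_opp[of q r x y] assms xP by (auto simp: cl_sym)
  then have "opx y" using y by (simp add: opx_def)
  then show ?thesis using y assms by (auto simp: Bk_iff cl_sym)
qed

lemma pj_Bk: "\<lbrakk>opx y; W \<in> L; I x W\<rbrakk> \<Longrightarrow> pj y W \<in> Bk y \<and> I (pj y W) W \<and> pj y W \<noteq> x"
  using pj[of y W] xP Bk_ne[of y "pj y W"] by (auto simp: Bk_iff opx_def col_def)

lemma N0_VV: "N0 q \<Longrightarrow> VV v \<Longrightarrow> \<not> cl q v"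
  using no_tri[of x v q M] xP MinL xM by (auto simp: N0_def VV_def cl_sym)

lemma slope_ex:
  assumes "N0 q" "N0 r" "\<not> cl q r"
  shows "\<exists>v. VV v \<and> sl q r v"
proof -
  obtain y where y: "opx y" "q \<in> Bk y" "r \<in> Bk y" using Bk_ex[of q r] assms by (auto simp: N0_def)
  have "VV (pj y M)" using pj_Bk[OF y(1) MinL xM] y(1) by (simp add: VV_def Bk_iff)
  moreover have "sl q r (pj y M)" unfolding sl_def using y pj_Bk[OF y(1) MinL xM] by blast
  ultimately show ?thesis by blast
qed

lemma Bk_VV: "\<lbrakk>opx y; VV v; VV v'; v \<in> Bk y; v' \<in> Bk y\<rbrakk> \<Longrightarrow> v = v'"
  using Bk_opp[of y v v'] MinL by (auto simp: VV_def col_def)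

lemma Bk_line: "\<lbrakk>opx y; q \<in> Bk y; r \<in> Bk y; cl q r\<rbrakk> \<Longrightarrow> q = r"
  using Bk_opp by blast

lemma slope_unique: "\<lbrakk>q \<noteq> r; VV v; VV v'; sl q r v; sl q r v'\<rbrakk> \<Longrightarrow> v = v'"
  unfolding sl_def using Bk_eq Bk_VV by metis

lemma third_ex:
  assumes "N0 q" "VV v" "W \<in> L" "I x W" "W \<noteq> M"
  shows "\<exists>r. N0 r \<and> I r W \<and> sl q r v"
proof -
  obtain y where y: "opx y" "q \<in> Bk y" "v \<in> Bk y"
    using Bk_ex[of q v] assms N0_VV[of q v] MinL xM by (auto simp: N0_def VV_def col_def)
  have p: "pj y W \<in> Bk y" "I (pj y W) W" "pj y W \<noteq> x" using pj_Bk assms y by auto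
  have "\<not> I (pj y W) M" using line_unique[of x "pj y W" W M] assms p y xP MinL xM by (auto simp: Bk_iff)
  then have "N0 (pj y W)" using p y(1) by (simp add: N0_def Bk_iff)
  moreover have "sl q (pj y W) v" unfolding sl_def using y p by blast
  ultimately show ?thesis using p by blast
qed

text \<open>The points \<open>q\<close> and \<open>v\<close> are distinct and determine a block,
  which contains both \<open>r\<close> and \<open>r'\<close>.\<close>

lemma third_trans:
  assumes "N0 q" "VV v" "sl q r v" "sl q r' v"
  shows "sl r r' v"
proof -
  have "q \<noteq> v" using N0_VV[OF assms(1,2)] assms cl_refl by (auto simp: N0_def)
  then show ?thesis using assms(3,4) unfolding sl_def using Bk_eq by metis
qed

lemma third_unique:
  assumes "N0 q" "VV v" "sl q r v" "sl q r' v" "cl r r'"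
  shows "r = r'"
  using third_trans[OF assms(1-4)] assms(5) Bk_line unfolding sl_def by blast

section \<open>Parallelograms and their composition\<close>

lemma sl_sym: "sl q r v \<Longrightarrow> sl r q v" unfolding sl_def by blast
lemma par_sym: "par q q' r r' \<Longrightarrow> par r r' q q'" unfolding par_def using sl_sym by blast
lemma par_swap: "par q q' r r' \<Longrightarrow> par q' q r' r" unfolding par_def by blast

text \<open>Noncollinear points of the net lie in a common block and distinct collinear ones do not,
  so parallel means collinear in the quadrangle.\<close>

lemma vline:
  assumes "W \<in> L" "I x W"
  shows "{q \<in> P. I q W} - {x} \<in> vertical_lines (net_points P L I x) (net_blocks P L I x)"
proof -
  obtain p where p: "p \<in> P" "I p W" "p \<noteq> x" using three_points[OF assms(1)] by blast
  have np: "q \<in> net_points P L I x \<longleftrightarrow> q \<in> P \<and> cl x q \<and> q \<noteq> x" for q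
    unfolding net_points_def using perp_iff[of "{x}"] xP by (auto simp: cl_sym)
  have nb: "net_blocks P L I x = {Bk y | y. opx y}"
    unfolding net_blocks_def Bk_def opposite_iff opx_def using xP by auto
  have clp: "cl x p" using p assms by (auto simp: col_def)
  have "q = p \<or> net_parallel (net_blocks P L I x) p q \<longleftrightarrow> cl p q" if q: "q \<in> P" "cl x q" "q \<noteq> x" for q
  proof (cases "q = p")
    case True then show ?thesis using p cl_refl by auto
  next
    case False
    then show ?thesis unfolding net_parallel_def nb using Bk_ex[of p q] Bk_line[of _ p q] p q clp by blast
  qed
  then have "{q \<in> P. I q W} - {x} = {q \<in> net_points P L I x. q = p \<or> net_parallel (net_blocks P L I x) p q}"
    using np cl_xl[of p] p clp xl_eq[of _ W] assms xl by (auto simp: col_def) metis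
  moreover have "p \<in> net_points P L I x" using np p clp by auto
  ultimately show ?thesis unfolding vertical_lines_def by blast
qed

text \<open>(LD) in the language of parallelograms: two of them sharing the side \<open>p3\<close>,
  \<open>q3\<close> compose. If one of the two triples lies in a single block, the two directions
  agree and the other triple lies in a single block as well. Otherwise the triples are triangles in
  perspective from infinity, and the hypotheses say that two pairs of sides meet on the vertical
  line of \<open>M\<close>.\<close>

lemma LD_par:
  assumes N: "N0 p1" "N0 p2" "N0 p3" "N0 q1" "N0 q2" "N0 q3"
    and c: "cl p1 q1" "cl p2 q2" "cl p3 q3" and ne: "p1 \<noteq> q1" "p2 \<noteq> q2" "p3 \<noteq> q3"
    and d: "\<not> cl p1 p2" "\<not> cl p1 p3" "\<not> cl p2 p3"
    and s: "par p1 q1 p3 q3" "par p2 q2 p3 q3"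
  shows "par p1 q1 p2 q2"
proof -
  have X: "q \<in> P" "q \<noteq> x" "cl x q" if "N0 q" for q using that N0_ne by (auto simp: N0_def)
  have xe: "xl p1 = xl q1" "xl p2 = xl q2" "xl p3 = xl q3" using c X N cl_xl by metis+
  have d': "\<not> cl q1 q2" "\<not> cl q1 q3" "\<not> cl q2 q3" using d xe X N cl_xl by metis+
  have dd: "p1 \<noteq> p2" "p1 \<noteq> p3" "p2 \<noteq> p3" "q1 \<noteq> q2" "q1 \<noteq> q3" "q2 \<noteq> q3"
    using d d' N X cl_refl by metis+
  obtain v2 ya yb where v2: "VV v2" "opx ya" "p1 \<in> Bk ya" "p3 \<in> Bk ya" "v2 \<in> Bk ya"
    "opx yb" "q1 \<in> Bk yb" "q3 \<in> Bk yb" "v2 \<in> Bk yb" using s(1) unfolding par_def sl_def by blast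
  obtain v1 yc yd where v1: "VV v1" "opx yc" "p2 \<in> Bk yc" "p3 \<in> Bk yc" "v1 \<in> Bk yc"
    "opx yd" "q2 \<in> Bk yd" "q3 \<in> Bk yd" "v1 \<in> Bk yd" using s(2) unfolding par_def sl_def by blast
  obtain ye where ye: "opx ye" "p1 \<in> Bk ye" "p2 \<in> Bk ye" using Bk_ex[of p1 p2] X N d by auto
  obtain yf where yf: "opx yf" "q1 \<in> Bk yf" "q2 \<in> Bk yf" using Bk_ex[of q1 q2] X N d' by auto
  have nv: "v \<noteq> q" if "N0 q" "VV v" for v q using that by (auto simp: N0_def VV_def)
  consider "p1 \<in> Bk yc" | "q1 \<in> Bk yd" | "p1 \<notin> Bk yc" "q1 \<notin> Bk yd" by blast
  then show ?thesis
  proof cases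
    case 1
    then have e: "Bk yc = Bk ya" using Bk_eq[of yc ya p1 p3] v1 v2 dd by auto
    then have "v1 = v2" using Bk_VV[of ya v1 v2] v1 v2 by auto
    then have "Bk yb = Bk yd" using Bk_eq[of yb yd q3 v1] v1 v2 nv[of q3 v1] N by auto
    then show ?thesis unfolding par_def sl_def using 1 v1 v2 e by blast
  next
    case 2
    then have e: "Bk yd = Bk yb" using Bk_eq[of yd yb q1 q3] v1 v2 dd by auto
    then have "v1 = v2" using Bk_VV[of yb v1 v2] v1 v2 by auto
    then have "Bk ya = Bk yc" using Bk_eq[of ya yc p3 v1] v1 v2 nv[of p3 v1] N by auto
    then show ?thesis unfolding par_def sl_def using 2 v1 v2 e by blast
  next
    case 3
    have nb: "Bk y \<in> net_blocks P L I x" if "opx y" for y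
      using that unfolding net_blocks_def Bk_def opposite_iff opx_def using xP by auto
    have tri: "triangle (net_blocks P L I x) a1 a2 a3 (Bk y1) (Bk y2) (Bk y3)"
      if "opx y1" "opx y2" "opx y3" "a1 \<in> Bk y2" "a1 \<in> Bk y3" "a2 \<in> Bk y1" "a2 \<in> Bk y3" "a3 \<in> Bk y1" "a3 \<in> Bk y2"
        "a1 \<notin> Bk y1" "a1 \<noteq> a2" "a1 \<noteq> a3" "a2 \<noteq> a3" for a1 a2 a3 y1 y2 y3
    proof -
      have n: "Bk y1 \<noteq> Bk y2" "Bk y1 \<noteq> Bk y3" using that by auto
      have n23: "Bk y2 \<noteq> Bk y3"
      proof
        assume "Bk y2 = Bk y3"
        then have "a2 \<in> Bk y2" using that(7) by simp
        then have "Bk y1 = Bk y2" by (rule Bk_eq[of y1 y2 a2 a3, OF that(1,2,13,6) that(8) _ that(9)])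
        then show False using n by blast
      qed
      have "Bk y2 \<inter> Bk y3 = {a1}" using Bk_inter[of y2 y3 a1] n23 that(2-5) by metis
      moreover have "Bk y1 \<inter> Bk y3 = {a2}" using Bk_inter[of y1 y3 a2] n(2) that(1,3,6,7) by metis
      moreover have "Bk y1 \<inter> Bk y2 = {a3}" using Bk_inter[of y1 y2 a3] n(1) that(1,2,8,9) by metis
      ultimately show ?thesis unfolding triangle_def using that nb n n23 by simp
    qed
    have t1: "triangle (net_blocks P L I x) p1 p2 p3 (Bk yc) (Bk ya) (Bk ye)"
      by (rule tri) (use v1 v2 ye 3 dd in auto)
    have t2: "triangle (net_blocks P L I x) q1 q2 q3 (Bk yd) (Bk yb) (Bk yf)"
      by (rule tri) (use v1 v2 yf 3 dd in auto)
    let ?W = "\<lambda>p. {q \<in> P. I q (xl p)} - {x}"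
    have dW: "distinct [?W p1, ?W p2, ?W p3]"
    proof -
      have "?W p = ?W q \<Longrightarrow> cl p q" if "N0 p" "N0 q" for p q
      proof -
        assume "?W p = ?W q"
        then have "p \<in> ?W q" using xl[of p] X[OF that(1)] by blast
        then show "cl p q" using xl[of q] X[OF that(2)] by (auto simp: col_def)
      qed
      then show ?thesis using N d by auto
    qed
    have persp: "in_perspective (net_points P L I x) (net_blocks P L I x) p1 p2 p3 q1 q2 q3"
    proof -
      have "?W p \<in> vertical_lines (net_points P L I x) (net_blocks P L I x)" if "N0 p" for p
        using vline xl X that by blast
      moreover have "{p1, q1} \<subseteq> ?W p1" "{p2, q2} \<subseteq> ?W p2" "{p3, q3} \<subseteq> ?W p3"
        using xl[of p1] xl[of p2] xl[of p3] xl[of q1] xl[of q2] xl[of q3] X N xe by auto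
      ultimately show ?thesis unfolding in_perspective_def using N ne dW by blast
    qed
    have V: "vertical_line_of P I x M = {v. VV v}" unfolding vertical_line_of_def VV_def by auto
    have meet: "meet_on {v. VV v} (Bk y) (Bk y')"
      if "opx y" "opx y'" "VV v" "v \<in> Bk y" "v \<in> Bk y'" "p \<in> Bk y" "q \<in> Bk y'" "cl p q" "p \<noteq> q" for y y' v p q
    proof -
      have "Bk y \<noteq> Bk y'"
      proof
        assume "Bk y = Bk y'"
        then have "q \<in> Bk y" using that(7) by simp
        then show False using Bk_line[OF that(1,6)] that(8,9) by blast
      qed
      then have "Bk y \<inter> Bk y' = {v}" by (rule Bk_inter[OF that(1,2) _ that(4,5)])
      then show ?thesis unfolding meet_on_def using that(3) by blast
    qed
    have m1: "meet_on {v. VV v} (Bk yc) (Bk yd)"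
      by (rule meet[OF v1(2,6,1,5,9,3,7) c(2) ne(2)])
    have m2: "meet_on {v. VV v} (Bk ya) (Bk yb)"
      by (rule meet[OF v2(2,6,1,5,9,3,7) c(1) ne(1)])
    have "meet_on {v. VV v} (Bk ye) (Bk yf)"
      using LD[unfolded LD_at_def LD_def V] t1 t2 persp m1 m2 by blast
    then obtain v where "VV v" "v \<in> Bk ye" "v \<in> Bk yf" unfolding meet_on_def by blast
    then show ?thesis unfolding par_def sl_def using ye yf by blast
  qed
qed

lemma par_unique:
  assumes "N0 q" "N0 q'" "N0 r" "\<not> cl q r" "par q q' r r'" "par q q' r r''" "cl r' r''"
  shows "r' = r''"
proof -
  obtain v v' where v: "VV v" "sl q r v" "sl q' r' v" "VV v'" "sl q r v'" "sl q' r'' v'"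
    using assms(5,6) unfolding par_def by blast
  have "q \<noteq> r" using assms cl_refl by (auto simp: N0_def)
  then have "v = v'" using slope_unique v by blast
  then show ?thesis using third_unique[of q' v r' r''] v assms by blast
qed

lemma par_ex:
  assumes "N0 q" "N0 q'" "q \<noteq> q'" "cl q q'" "N0 r" "\<not> cl q r"
  shows "\<exists>r'. N0 r' \<and> cl r r' \<and> r \<noteq> r' \<and> par q q' r r'"
proof -
  obtain v where v: "VV v" "sl q r v" using slope_ex assms by blast
  have W: "xl r \<in> L" "I x (xl r)" "I r (xl r)" using xl[of r] assms by (auto simp: N0_def)
  moreover have "xl r \<noteq> M" using W assms by (auto simp: N0_def)
  ultimately obtain r' where r': "N0 r'" "I r' (xl r)" "sl q' r' v"
    using third_ex[of q' v "xl r"] assms v by blast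
  have "r \<noteq> r'" using third_unique[of r v q q'] v r' assms sl_sym by blast
  then show ?thesis using r' v W unfolding par_def by (auto simp: col_def)
qed

text \<open>Bijectivity is not demanded; it will follow from \<open>TR_inverse\<close> applied to
  two translations with opposite effect on one point. The points of \<open>M\<close> are left out
  because the extension to the quadrangle fixes them.\<close>

definition TR :: "('p \<Rightarrow> 'p) \<Rightarrow> bool" where
  "TR \<sigma> \<longleftrightarrow> (\<forall>q. N0 q \<longrightarrow> N0 (\<sigma> q) \<and> cl q (\<sigma> q)) \<and>
     (\<forall>q r. N0 q \<longrightarrow> N0 r \<longrightarrow> \<not> cl q r \<longrightarrow> par q (\<sigma> q) r (\<sigma> r))"

lemma cl_N0: "\<lbrakk>N0 p; N0 q; N0 r; cl p q; cl q r\<rbrakk> \<Longrightarrow> cl p r"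
  using cl_xl N0_ne unfolding N0_def by metis

text \<open>If there are only three lines through \<open>x\<close>, then (LD) is void; but then, \<open>M\<close> being regular, there are only
  three points on each line, and parallelograms compose for trivial reasons.\<close>
definition at_most_three_lines :: "'p \<Rightarrow> bool" where
  "at_most_three_lines z \<longleftrightarrow> (\<forall>A B C D. {A, B, C, D} \<subseteq> L \<longrightarrow> I z A \<longrightarrow> I z B \<longrightarrow> I z C \<longrightarrow> I z D \<longrightarrow> \<not> distinct [A, B, C, D])"

text \<open>For opposite points \<open>y\<close> and \<open>z\<close>, sending a line through
  \<open>y\<close> to the line through \<open>z\<close> that meets it is injective.\<close>

lemma few_opp:
  assumes "at_most_three_lines z" "z \<in> P" "y \<in> P" "\<not> cl z y"
  shows "at_most_three_lines y"
  unfolding at_most_three_lines_def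
proof (intro allI impI notI)
  fix A B C D assume a: "{A, B, C, D} \<subseteq> L" "I y A" "I y B" "I y C" "I y D" and d: "distinct [A, B, C, D]"
  have nz: "\<not> I z N" if "N \<in> L" "I y N" for N using that assms(4) by (auto simp: col_def)
  have inj: "N = N'" if N: "N \<in> L" "N' \<in> L" "I y N" "I y N'" "pl z N = pl z N'" for N N'
  proof (rule ccontr)
    assume ne: "N \<noteq> N'"
    have W: "pl z N \<in> L" "I z (pl z N)" "mt (pl z N) N" "mt (pl z N) N'"
      using pl[of z N] pl[of z N'] assms nz N by auto
    obtain n where n: "n \<in> P" "I n (pl z N)" "I n N" using W by (auto simp: col_def)
    obtain n' where n': "n' \<in> P" "I n' (pl z N)" "I n' N'" using W by (auto simp: col_def)
    have "pl z N \<noteq> N" "pl z N \<noteq> N'" using W nz N by auto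
    then have "y = n" using no_tri'(1)[of y n n' N' N "pl z N"] N W ne n n' assms by auto
    then show False using W n assms by (auto simp: col_def)
  qed
  have "{pl z A, pl z B, pl z C, pl z D} \<subseteq> L" "I z (pl z A)" "I z (pl z B)" "I z (pl z C)" "I z (pl z D)"
    using pl[OF assms(2)] nz a by auto
  moreover have "distinct [pl z A, pl z B, pl z C, pl z D]" using inj a d by auto
  ultimately show False using assms(1) unfolding at_most_three_lines_def by blast
qed

text \<open>Two distinct collinear points have a common opposite point, through which the bound is
  passed on twice.\<close>

lemma few_line:
  assumes "at_most_three_lines z" "z \<in> P" "q \<in> P" "cl z q" "z \<noteq> q"
  shows "at_most_three_lines q"
proof -
  obtain A where A: "A \<in> L" "I z A" "I q A" using assms by (auto simp: col_def)
  obtain W where W: "W \<in> L" "I q W" "W \<noteq> A" using line_other[OF assms(3)] by blast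
  obtain n where n: "n \<in> P" "I n W" "n \<noteq> q" using three_points[OF W(1)] by blast
  obtain W' where W': "W' \<in> L" "I n W'" "W' \<noteq> W" using line_other[OF n(1)] by blast
  obtain y where y: "y \<in> P" "I y W'" "y \<noteq> n" "y \<noteq> pj z W'" using three_points[OF W'(1)] by blast
  have qW': "\<not> I q W'" using line_unique[of q n W W'] n W W' assms by auto
  have nq: "\<not> cl q y" using pj_unique[of q W' n y] qW' n W W' y assms by (auto simp: col_def)
  have "\<not> I z W'"
  proof
    assume "I z W'"
    then have "cl z n" "cl q n" using n W W' by (auto simp: col_def)
    then have "I n A" using no_tri[of z q n A] A n assms by (auto simp: cl_sym)
    then show False using line_unique[of n q A W] n W A assms by auto
  qed
  then have "\<not> cl z y" using pj_eq[of z W' y] y assms W' by auto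
  then have "at_most_three_lines y" using few_opp assms y by blast
  then show ?thesis using few_opp[of y q] nq y assms by (auto simp: cl_sym)
qed

text \<open>For a line \<open>N\<close> opposite \<open>M\<close> and a point \<open>q\<close> on a
  further line \<open>U2\<close> through \<open>x\<close>, each point \<open>a\<close> of
  \<open>M\<close> other than \<open>x\<close> yields a line through \<open>q\<close>, namely the
  one meeting the transversal of \<open>M\<close> and \<open>N\<close> through \<open>a\<close>. If
  two of these lines coincided, regularity of \<open>M\<close> would make the common line meet the
  transversal \<open>U\<close> too, giving a triangle. Three such points \<open>a\<close> would
  therefore give, together with \<open>U2\<close>, four lines through \<open>q\<close>.\<close>

lemma few_M:
  assumes "at_most_three_lines x" and a: "VV a1" "VV a2" "VV a3"
  shows "\<not> distinct [a1, a2, a3]"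
proof
  assume d: "distinct [a1, a2, a3]"
  obtain U where U: "U \<in> L" "I x U" "U \<noteq> M" using line_other[OF xP] by blast
  obtain U2 where U2: "U2 \<in> L" "I x U2" "U2 \<noteq> M" "U2 \<noteq> U" using line_other[OF xP] by metis
  have N0I: "N0 p" if "p \<in> P" "p \<noteq> x" "I p W" "W \<in> L" "I x W" "W \<noteq> M" for p W
    using line_unique[of p x W M] that xP xM MinL by (auto simp: N0_def col_def)
  obtain p where p: "p \<in> P" "I p U" "p \<noteq> x" using three_points[OF U(1)] by blast
  obtain q where q: "q \<in> P" "I q U2" "q \<noteq> x" using three_points[OF U2(1)] by blast
  have Np: "N0 p" "N0 q" using N0I p q U U2 by auto
  obtain N where N: "N \<in> L" "I p N" "N \<noteq> U" using line_other[OF p(1)] by blast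
  have xN: "\<not> I x N" using line_unique[of x p U N] U N p xP by auto
  have opp: "\<not> mt M N"
  proof
    assume "mt M N"
    then obtain t where t: "t \<in> P" "I t M" "I t N" by (rule mtE)
    then have "VV t" using xN by (auto simp: VV_def)
    then show False using N0_VV[of p t] Np t N by (auto simp: col_def)
  qed
  have ell: "pl a N \<in> L \<and> I a (pl a N) \<and> mt (pl a N) N \<and> mt M (pl a N) \<and> \<not> I q (pl a N) \<and> pl a N \<noteq> M" if "VV a" for a
  proof -
    have "\<not> I a N" using that opp by (auto simp: VV_def col_def)
    then have l: "pl a N \<in> L" "I a (pl a N)" "mt (pl a N) N" using pl[of a N] that N by (auto simp: VV_def)
    then have "\<not> I q (pl a N)" using N0_VV[of q a] Np that by (auto simp: col_def)
    then show ?thesis using l that opp by (auto simp: VV_def col_def)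
  qed
  have ellne: "pl a N \<noteq> pl b N" if "VV a" "VV b" "a \<noteq> b" for a b
    using ell[OF that(1)] ell[OF that(2)] line_unique[of a b M "pl a N"] that MinL by (auto simp: VV_def)
  have n: "pl q (pl a N) \<in> L \<and> I q (pl q (pl a N)) \<and> mt (pl q (pl a N)) (pl a N) \<and> pl q (pl a N) \<noteq> U2" if "VV a" for a
  proof -
    have l: "pl q (pl a N) \<in> L" "I q (pl q (pl a N))" "mt (pl q (pl a N)) (pl a N)"
      using pl[of q "pl a N"] ell[OF that] q by auto
    have "pl q (pl a N) \<noteq> U2"
    proof
      assume e: "pl q (pl a N) = U2"
      then obtain t where t: "t \<in> P" "I t U2" "I t (pl a N)" using l by (auto simp: col_def)
      have "\<not> I x (pl a N)" using line_unique[of x a M "pl a N"] ell[OF that] that xP xM MinL by (auto simp: VV_def)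
      then have "t \<noteq> x" using t by auto
      then have "N0 t" using N0I t U2 by auto
      then show False using N0_VV[of t a] that t ell[OF that] by (auto simp: col_def)
    qed
    then show ?thesis using l by auto
  qed
  have ne: "pl q (pl a N) \<noteq> pl q (pl b N)" if ab: "VV a" "VV b" "a \<noteq> b" for a b
  proof
    assume e: "pl q (pl a N) = pl q (pl b N)"
    let ?n = "pl q (pl a N)"
    have "mt ?n U"
      by (rule rlD[OF rM opp ellne[OF ab]])
        (use ell[OF ab(1)] ell[OF ab(2)] n[OF ab(1)] n[OF ab(2)] e U N p xP xM in \<open>auto simp: mt_sym intro: mtI\<close>)
    then obtain t where t: "t \<in> P" "I t ?n" "I t U" by (rule mtE)
    have xn: "\<not> I x ?n" using line_unique[of x q ?n U2] n[OF ab(1)] U2 q xP by auto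
    have tq: "t \<noteq> q" using line_unique[of t x U U2] t U U2 q xP by auto
    show False using no_tri[of t q x ?n] t q xP n[OF ab(1)] tq xn U U2 by (auto simp: col_def)
  qed
  have "at_most_three_lines q" using few_line[OF assms(1) xP q(1)] q U2 by (auto simp: col_def)
  moreover have "distinct [U2, pl q (pl a1 N), pl q (pl a2 N), pl q (pl a3 N)]"
    using ne[OF a(1,2)] ne[OF a(1,3)] ne[OF a(2,3)] n[OF a(1)] n[OF a(2)] n[OF a(3)] d by auto
  moreover have "{U2, pl q (pl a1 N), pl q (pl a2 N), pl q (pl a3 N)} \<subseteq> L"
    using n[OF a(1)] n[OF a(2)] n[OF a(3)] U2 by auto
  ultimately show False using n[OF a(1)] n[OF a(2)] n[OF a(3)] q unfolding at_most_three_lines_def by blast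
qed

lemma few_swap:
  assumes "at_most_three_lines x" "N0 q" "N0 q'" "q \<noteq> q'" "cl q q'" "N0 r" "N0 r'" "r \<noteq> r'" "cl r r'" "\<not> cl q r"
  shows "par q q' r r'"
proof -
  obtain r'' where r'': "N0 r''" "cl r r''" "r \<noteq> r''" "par q q' r r''" using par_ex assms by blast
  have c: "\<not> cl q r'" "\<not> cl q r''" using cl_N0[of q r' r] cl_N0[of q r'' r] assms r'' by (auto simp: cl_sym)
  obtain v1 v2 v3 where v: "VV v1" "sl q r v1" "VV v2" "sl q r' v2" "VV v3" "sl q r'' v3"
    using slope_ex assms r'' c by metis
  have rr: "cl r' r''" using cl_N0[of r' r r''] assms r'' by (auto simp: cl_sym)
  have "v1 \<noteq> v2" "v1 \<noteq> v3" "v2 \<noteq> v3 \<or> r' = r''"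
    using third_unique[of q v1 r r'] third_unique[of q v1 r r''] third_unique[of q v2 r' r''] v assms r'' rr by auto
  then have "r' = r''" using few_M[OF assms(1) v(1,3,5)] by auto
  then show ?thesis using r'' by simp
qed

text \<open>Off the vertical line of \<open>p\<close> the images are prescribed by parallelograms
  over \<open>p\<close>, \<open>p'\<close>. On that vertical line they are prescribed by
  parallelograms over an auxiliary point \<open>r0\<close> and its image. Composition of
  parallelograms shows that the two prescriptions fit together.\<close>

lemma translation_ex:
  assumes "N0 p" "N0 p'" "p \<noteq> p'" "cl p p'"
  shows "\<exists>\<sigma>. TR \<sigma> \<and> \<sigma> p = p'"
proof -
  have ex1: "\<exists>q'. N0 q' \<and> cl q q' \<and> q \<noteq> q' \<and> par p p' q q'" if "N0 q" "\<not> cl p q" for q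
    using par_ex assms that by blast
  define s where "s q = (SOME q'. N0 q' \<and> cl q q' \<and> q \<noteq> q' \<and> par p p' q q')" for q
  have s: "N0 (s q) \<and> cl q (s q) \<and> q \<noteq> s q \<and> par p p' q (s q)" if "N0 q" "\<not> cl p q" for q
    unfolding s_def using someI_ex[OF ex1[OF that]] .
  have pP: "p \<in> P" "cl x p" using assms by (auto simp: N0_def)
  obtain W where W: "W \<in> L" "I x W" "W \<noteq> M" "W \<noteq> xl p" using line_other[OF xP] by metis
  obtain r0 where r0: "r0 \<in> P" "I r0 W" "r0 \<noteq> x" using three_points[OF W(1)] by blast
  have Nr0: "N0 r0" using line_unique[of r0 x W M] r0 W xP xM MinL by (auto simp: N0_def col_def)
  have pr0: "\<not> cl p r0" using cl_xl[of p r0] xl_eq[of r0 W] r0 W pP Nr0 N0_ne[OF assms(1)] by (auto simp: N0_def)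
  have ex2: "\<exists>q'. N0 q' \<and> cl q q' \<and> q \<noteq> q' \<and> par r0 (s r0) q q'" if "N0 q" "cl p q" for q
  proof -
    have "\<not> cl r0 q" using cl_N0[of p q r0] that pr0 assms Nr0 by (auto simp: cl_sym)
    then show ?thesis using par_ex[of r0 "s r0" q] s[OF Nr0 pr0] Nr0 that by blast
  qed
  define t where "t q = (SOME q'. N0 q' \<and> cl q q' \<and> q \<noteq> q' \<and> par r0 (s r0) q q')" for q
  have t: "N0 (t q) \<and> cl q (t q) \<and> q \<noteq> t q \<and> par r0 (s r0) q (t q)" if "N0 q" "cl p q" for q
    unfolding t_def using someI_ex[OF ex2[OF that]] .
  define \<sigma> where "\<sigma> q = (if cl p q then t q else s q)" for q
  have \<sigma>: "N0 (\<sigma> q) \<and> cl q (\<sigma> q) \<and> q \<noteq> \<sigma> q" if "N0 q" for q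
    unfolding \<sigma>_def using s t that by auto
  have a: "par q (\<sigma> q) r (\<sigma> r)" if "N0 q" "N0 r" "\<not> cl q r" "\<not> cl p q" "\<not> cl p r" for q r
    using LD_par[of q r p "\<sigma> q" "\<sigma> r" p'] \<sigma>[OF that(1)] \<sigma>[OF that(2)] s[of q] s[of r] that assms
    by (auto simp: \<sigma>_def cl_sym intro: par_sym)
  have b: "par q (\<sigma> q) r0 (\<sigma> r0)" if "N0 q" "cl p q" for q
    using t[OF that] pr0 that by (auto simp: \<sigma>_def intro: par_sym)
  have nqr: "\<not> cl q r" if "N0 q" "N0 r" "cl p q" "\<not> cl p r" for q r
    using cl_N0[of p q r] that assms by auto
  have c: "par q (\<sigma> q) r (\<sigma> r)" if q: "N0 q" "cl p q" and r: "N0 r" "\<not> cl p r" "\<not> cl r r0" for q r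
    by (rule LD_par[of q r r0 "\<sigma> q" "\<sigma> r" "\<sigma> r0"])
      (use \<sigma>[OF q(1)] \<sigma>[OF r(1)] \<sigma>[OF Nr0] b[OF q] a[of r r0] nqr[of q r] nqr[of q r0] q r Nr0 pr0 in auto)
  \<comment> \<open>If \<open>r\<close> lies on the vertical line of \<open>r0\<close>, then neither
    \<open>p\<close> nor \<open>r0\<close> can be the third pair in \<open>LD_par\<close>. A point
    \<open>e\<close> on a fourth line through \<open>x\<close> can; if there is no such line,
    \<open>few_swap\<close> applies.\<close>
  have d: "par q (\<sigma> q) r (\<sigma> r)" if q: "N0 q" "cl p q" and r: "N0 r" "\<not> cl p r" for q r
  proof (cases "cl r r0 \<and> \<not> at_most_three_lines x")
    case True
    then obtain A B C D where ABCD: "{A, B, C, D} \<subseteq> L" "I x A" "I x B" "I x C" "I x D" "distinct [A, B, C, D]"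
      unfolding at_most_three_lines_def by blast
    have "\<exists>E\<in>{A, B, C, D}. E \<noteq> M \<and> E \<noteq> xl p \<and> E \<noteq> W" using ABCD(6) by auto
    then obtain E where E: "E \<in> L" "I x E" "E \<noteq> M" "E \<noteq> xl p" "E \<noteq> W" using ABCD by blast
    obtain e where e: "e \<in> P" "I e E" "e \<noteq> x" using three_points[OF E(1)] by blast
    have Ne: "N0 e" using line_unique[of e x E M] e E xP xM MinL by (auto simp: N0_def col_def)
    have pe: "\<not> cl p e" using cl_xl[of p e] xl_eq[of e E] e E pP Ne N0_ne[OF assms(1)] by (auto simp: N0_def)
    have er0: "\<not> cl e r0" using cl_xl[of e r0] xl_eq[of e E] xl_eq[of r0 W] e E r0 W Nr0 Ne by (auto simp: N0_def)
    then have er: "\<not> cl r e" using cl_N0[of e r r0] True Ne r Nr0 by (auto simp: cl_sym)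
    show ?thesis
      by (rule LD_par[of q r e "\<sigma> q" "\<sigma> r" "\<sigma> e"])
        (use \<sigma>[OF q(1)] \<sigma>[OF r(1)] \<sigma>[OF Ne] c[OF q Ne pe er0] a[of r e] nqr[of q r] nqr[of q e] q r Ne pe er in auto)
  next
    case False
    then show ?thesis
      using c[OF q r] few_swap[of q "\<sigma> q" r "\<sigma> r"] \<sigma>[OF q(1)] \<sigma>[OF r(1)] nqr[of q r] q r by auto
  qed
  have "TR \<sigma>"
    unfolding TR_def
  proof (intro conjI allI impI)
    show "N0 (\<sigma> q)" "cl q (\<sigma> q)" if "N0 q" for q using \<sigma> that by auto
    fix q r assume n: "N0 q" "N0 r" "\<not> cl q r"
    have "\<not> (cl p q \<and> cl p r)" using cl_N0[of q p r] n assms by (auto simp: cl_sym)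
    then show "par q (\<sigma> q) r (\<sigma> r)" using a[OF n] d[of q r] d[of r q] n by (auto intro: par_sym)
  qed
  moreover have "\<sigma> p = p'"
  proof -
    have cp: "cl p p" using pP cl_refl by blast
    have "par r0 (s r0) p (\<sigma> p)" using t[OF assms(1) cp] cp by (auto simp: \<sigma>_def)
    moreover have "par r0 (s r0) p p'" using s[OF Nr0 pr0] by (auto intro: par_sym)
    moreover have "cl (\<sigma> p) p'" using cl_N0[of "\<sigma> p" p p'] \<sigma>[OF assms(1)] assms by (auto simp: cl_sym)
    ultimately show ?thesis
      using par_unique[of r0 "s r0" p "\<sigma> p" p'] Nr0 s[OF Nr0 pr0] assms pr0 by (auto simp: cl_sym)
  qed
  ultimately show ?thesis by blast
qed

text \<open>A point fixed by the composition propagates along parallelograms to all other vertical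
  lines, and from one of these back to its own.\<close>

lemma TR_inverse:
  assumes \<sigma>: "TR \<sigma>" and \<tau>: "TR \<tau>" and p: "N0 p" "\<tau> (\<sigma> p) = p" and q: "N0 q"
  shows "\<tau> (\<sigma> q) = q"
proof -
  have P: "N0 (\<sigma> r) \<and> cl r (\<sigma> r) \<and> N0 (\<tau> r) \<and> cl r (\<tau> r)" if "N0 r" for r
    using that \<sigma> \<tau> unfolding TR_def by blast
  have step: "\<tau> (\<sigma> r) = r" if a: "N0 a" "\<tau> (\<sigma> a) = a" and r: "N0 r" "\<not> cl a r" for a r
  proof -
    have n: "\<not> cl (\<sigma> a) (\<sigma> r)"
    proof
      assume "cl (\<sigma> a) (\<sigma> r)"
      then have "cl a (\<sigma> r)" using cl_N0[of a "\<sigma> a" "\<sigma> r"] P a r by blast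
      then show False using cl_N0[of a "\<sigma> r" r] P a r by (auto simp: cl_sym)
    qed
    have "par (\<sigma> a) a (\<sigma> r) (\<tau> (\<sigma> r))" using \<tau> n P a r unfolding TR_def by metis
    moreover have "par (\<sigma> a) a (\<sigma> r) r" using \<sigma> r a unfolding TR_def by (auto intro: par_swap)
    moreover have "cl (\<tau> (\<sigma> r)) r" using cl_N0[of "\<tau> (\<sigma> r)" "\<sigma> r" r] P r by (auto simp: cl_sym)
    ultimately show ?thesis using par_unique[of "\<sigma> a" a "\<sigma> r" "\<tau> (\<sigma> r)" r] P a r n by blast
  qed
  show ?thesis
  proof (cases "cl p q")
    case True
    obtain W where W: "W \<in> L" "I x W" "W \<noteq> M" "W \<noteq> xl p" using line_other[OF xP] by metis
    obtain r0 where r0: "r0 \<in> P" "I r0 W" "r0 \<noteq> x" using three_points[OF W(1)] by blast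
    have Nr0: "N0 r0" using line_unique[of r0 x W M] r0 W xP xM MinL by (auto simp: N0_def col_def)
    have pr0: "\<not> cl p r0" using cl_xl[of p r0] xl_eq[of r0 W] r0 W p Nr0 N0_ne[OF p(1)] by (auto simp: N0_def)
    then have "\<not> cl r0 q" using cl_N0[of p q r0] True p q Nr0 by (auto simp: cl_sym)
    then show ?thesis using step[of r0 q] step[of p r0] p q Nr0 pr0 by blast
  next
    case False
    then show ?thesis using step p q by blast
  qed
qed

end

section \<open>Axes of symmetry\<close>

context gq
begin

lemma collnI:
  assumes "\<And>z. z \<in> P \<Longrightarrow> f z \<in> P \<and> f' z \<in> P \<and> f' (f z) = z \<and> f (f' z) = z"
    "\<And>N. N \<in> L \<Longrightarrow> g N \<in> L \<and> g' N \<in> L \<and> g' (g N) = N \<and> g (g' N) = N"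
    "\<And>z N. z \<in> P \<Longrightarrow> N \<in> L \<Longrightarrow> I z N \<Longrightarrow> I (f z) (g N)"
    "\<And>z N. z \<in> P \<Longrightarrow> N \<in> L \<Longrightarrow> I z N \<Longrightarrow> I (f' z) (g' N)"
  shows "colln f g"
  unfolding colln_def
proof (intro conjI ballI)
  show "bij_betw f P P" by (rule bij_betw_byWitness[of _ f']) (use assms(1) in auto)
  show "bij_betw g L L" by (rule bij_betw_byWitness[of _ g']) (use assms(2) in auto)
  show "I z N \<longleftrightarrow> I (f z) (g N)" if "z \<in> P" "N \<in> L" for z N
    using assms(3)[OF that] assms(4)[of "f z" "g N"] assms(1,2) that by auto
qed

lemma colln_id: "colln id id"
  unfolding colln_def by auto

end

section \<open>Extending a translation of the net to the quadrangle\<close>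

locale LD_flag_translation = LD_flag P L I x M for P :: "'p set" and L :: "'l set" and I x M +
  fixes U :: 'l and o1 :: 'p
  assumes U: "U \<in> L" "I x U" "U \<noteq> M" and o1: "VV o1"
begin

text \<open>\<open>ff \<sigma>\<close> and \<open>gg \<sigma>\<close> are the only possible extensions of a translation \<open>\<sigma>\<close> of the net to the points and lines of
  the quadrangle.\<close>
definition ff :: "('p \<Rightarrow> 'p) \<Rightarrow> 'p \<Rightarrow> 'p" where
  "ff \<sigma> z = (if N0 z then \<sigma> z else if I z M then z else pj (\<sigma> (pj z U)) (pl z M))"
definition gg :: "('p \<Rightarrow> 'p) \<Rightarrow> 'l \<Rightarrow> 'l" where
  "gg \<sigma> N = (if mt N M then N else pl (\<sigma> (pj x N)) (pl o1 N))"

lemma cases3: "z \<in> P \<Longrightarrow> N0 z \<or> I z M \<or> opx z"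
  by (auto simp: N0_def opx_def)

lemma opx_M: "opx z \<Longrightarrow> \<not> I z M" using xM MinL by (auto simp: opx_def col_def)
lemma opx_N0: "opx z \<Longrightarrow> \<not> N0 z" by (auto simp: opx_def N0_def)
lemma opxP: "opx z \<Longrightarrow> z \<in> P" by (auto simp: opx_def)
lemma N0P: "N0 z \<Longrightarrow> z \<in> P" by (auto simp: N0_def)
lemma N0M: "N0 z \<Longrightarrow> \<not> I z M" by (auto simp: N0_def)

lemma N0I: "\<lbrakk>p \<in> P; p \<noteq> x; I p W; W \<in> L; I x W; W \<noteq> M\<rbrakk> \<Longrightarrow> N0 p"
  using line_unique[of p x W M] xP xM MinL by (auto simp: N0_def col_def)

lemma pjU: "opx z \<Longrightarrow> N0 (pj z U)"
  using pj_Bk[of z U] N0I[of "pj z U" U] U pj[of z U] by (auto simp: opx_def)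

lemma el:
  assumes "opx z"
  shows "\<exists>a. pl z M \<in> L \<and> I z (pl z M) \<and> VV a \<and> I a (pl z M) \<and> pl z M \<noteq> M \<and> \<not> I x (pl z M) \<and>
    (\<forall>q. N0 q \<longrightarrow> \<not> I q (pl z M))"
proof -
  have l: "pl z M \<in> L" "I z (pl z M)" "mt (pl z M) M" using pl[of z M] assms opx_M opxP MinL by auto
  then obtain a where a: "a \<in> P" "I a (pl z M)" "I a M" by (auto simp: col_def)
  have nx: "\<not> I x (pl z M)" using l assms by (auto simp: opx_def col_def)
  then have v: "VV a" using a by (auto simp: VV_def)
  then have "\<forall>q. N0 q \<longrightarrow> \<not> I q (pl z M)" using N0_VV[OF _ v] l a by (auto simp: col_def)
  moreover have "pl z M \<noteq> M" using l opx_M[OF assms] by auto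
  ultimately show ?thesis using l v a nx by blast
qed

lemma TR1: "TR \<sigma> \<Longrightarrow> N0 q \<Longrightarrow> N0 (\<sigma> q)" and TR2: "TR \<sigma> \<Longrightarrow> N0 q \<Longrightarrow> cl q (\<sigma> q)"
  and TR3: "TR \<sigma> \<Longrightarrow> N0 q \<Longrightarrow> N0 r \<Longrightarrow> \<not> cl q r \<Longrightarrow> par q (\<sigma> q) r (\<sigma> r)"
  by (auto simp: TR_def)

text \<open>The last claim shows that the auxiliary line \<open>U\<close> has no influence on the
  image. The block of \<open>z\<close> contains the projection on \<open>U\<close>, the point
  \<open>q\<close>, and the point \<open>a\<close> in which the line from \<open>z\<close> to
  \<open>M\<close> meets \<open>M\<close>. The parallelogram property puts the two translated points
  and \<open>a\<close> into one block, and regularity of \<open>x\<close> makes it the block of the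
  image of \<open>z\<close>.\<close>

lemma ff_opx:
  assumes s: "TR \<sigma>" and z: "opx z"
  shows "opx (ff \<sigma> z)" "pl (ff \<sigma> z) M = pl z M" "pj (ff \<sigma> z) U = \<sigma> (pj z U)" "I (ff \<sigma> z) (pl z M)"
    "\<lbrakk>N0 q; cl q z\<rbrakk> \<Longrightarrow> cl (\<sigma> q) (ff \<sigma> z)"
proof -
  obtain a where l: "pl z M \<in> L" "I z (pl z M)" "VV a" "I a (pl z M)" "pl z M \<noteq> M" "\<not> I x (pl z M)"
    "\<forall>q. N0 q \<longrightarrow> \<not> I q (pl z M)" using el[OF z] by blast
  let ?l = "pl z M" and ?b = "pj z U"
  let ?w = "ff \<sigma> z"
  have w: "?w = pj (\<sigma> ?b) ?l" using z by (simp add: ff_def opx_N0 opx_M)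
  have b: "N0 ?b" "I ?b U" using pjU z pj[of z U] opxP U by auto
  have sb: "N0 (\<sigma> ?b)" using TR1[OF s b(1)] .
  have W: "?w \<in> P" "I ?w ?l" "cl (\<sigma> ?b) ?w" using pj[of "\<sigma> ?b" ?l] w N0P[OF sb] l by auto
  then show "I ?w ?l" by simp
  have wa: "?w \<noteq> a" using N0_VV[OF sb l(3)] W by auto
  have wM: "\<not> I ?w M" using line_unique[of a ?w M ?l] wa W l MinL by (auto simp: VV_def)
  have "\<not> cl x ?w"
  proof
    assume "cl x ?w"
    then have "I x ?l" using no_tri[of a ?w x ?l] wa W l xP MinL xM by (auto simp: VV_def col_def)
    then show False using l by simp
  qed
  then show ow: "opx ?w" using W by (simp add: opx_def)
  show "pl ?w M = ?l" by (rule pl_eq) (use W l wM MinL in \<open>auto simp: VV_def col_def\<close>)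
  have "xl ?b = U" using xl_eq[of ?b U] b U N0P N0_ne by auto
  moreover have "xl (\<sigma> ?b) = xl ?b"
    using TR2[OF s b(1)] cl_xl[of ?b "\<sigma> ?b"] b sb N0_ne by (auto simp: N0_def)
  ultimately have sbU: "I (\<sigma> ?b) U" using xl[of "\<sigma> ?b"] sb by (auto simp: N0_def)
  show "pj ?w U = \<sigma> ?b"
    by (rule pj_eq) (use W U ow sbU N0P[OF sb] in \<open>auto simp: cl_sym opx_def intro: clI\<close>)
  assume q: "N0 q" "cl q z"
  show "cl (\<sigma> q) ?w"
  proof (cases "cl ?b q")
    case True
    have "?b \<in> Bk z" "q \<in> Bk z" using z b q pj[of z U] U opxP by (auto simp: Bk_iff N0_def cl_sym)
    then have "?b = q" using Bk_line[OF z] True by blast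
    then show ?thesis using W by simp
  next
    case False
    then obtain v where v: "VV v" "sl ?b q v" "sl (\<sigma> ?b) (\<sigma> q) v" using TR3[OF s b(1) q(1)] unfolding par_def by blast
    have ax: "cl x a" using l(3) xM MinL by (auto simp: VV_def col_def)
    have "?b \<in> Bk z" "q \<in> Bk z" "a \<in> Bk z"
      using z b q pj[of z U] U opxP l ax by (auto simp: Bk_iff N0_def cl_sym VV_def intro: clI)
    then have "sl ?b q a" unfolding sl_def using z by blast
    then have "v = a" using slope_unique[of ?b q v a] v l False cl_refl N0P[OF b(1)] by blast
    then obtain y where y: "opx y" "\<sigma> ?b \<in> Bk y" "\<sigma> q \<in> Bk y" "a \<in> Bk y" using v unfolding sl_def by blast
    have "\<sigma> ?b \<in> Bk ?w" "a \<in> Bk ?w" using ow W sb ax l by (auto simp: Bk_iff N0_def cl_sym VV_def intro: clI)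
    moreover have "\<sigma> ?b \<noteq> a" using N0M[OF sb] l by (auto simp: VV_def)
    ultimately have "Bk y \<subseteq> Bk ?w" using Bk_sub[of y ?w "\<sigma> ?b" a] y ow by blast
    then show ?thesis using y ow by (auto simp: Bk_iff cl_sym)
  qed
qed

lemma oppM:
  assumes N: "N \<in> L" "\<not> mt N M"
  shows "N0 (pj x N)" "I (pj x N) N" "pl o1 N \<in> L" "I o1 (pl o1 N)" "mt (pl o1 N) N" "mt (pl o1 N) M"
    "pl o1 N \<noteq> M" "\<And>q. N0 q \<Longrightarrow> \<not> I q (pl o1 N)" "\<not> I x N"
proof -
  have p: "pj x N \<in> P" "I (pj x N) N" "cl x (pj x N)" using pj N xP by auto
  show nx: "\<not> I x N" using N xM xP by (auto simp: col_def)
  show "N0 (pj x N)" using p N by (auto simp: N0_def col_def)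
  show "I (pj x N) N" by fact
  have no: "\<not> I o1 N" using N o1 by (auto simp: VV_def col_def)
  then show l: "pl o1 N \<in> L" "I o1 (pl o1 N)" "mt (pl o1 N) N" using pl[of o1 N] o1 N by (auto simp: VV_def)
  then show "mt (pl o1 N) M" using o1 by (auto simp: VV_def col_def)
  show "pl o1 N \<noteq> M" using l N by (auto simp: col_def)
  show "\<And>q. N0 q \<Longrightarrow> \<not> I q (pl o1 N)" using N0_VV[OF _ o1] l by (auto simp: col_def)
qed

text \<open>The last claim is regularity of \<open>M\<close>: the image of \<open>N\<close> meets
  two transversals of \<open>M\<close> and \<open>N\<close>, one through \<open>x\<close> and one
  through \<open>o1\<close>, hence all of them. This removes the dependence on
  \<open>o1\<close>.\<close>

lemma gg_opp:
  assumes s: "TR \<sigma>" and N: "N \<in> L" "\<not> mt N M"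
  shows "gg \<sigma> N \<in> L" "\<not> mt (gg \<sigma> N) M" "pj x (gg \<sigma> N) = \<sigma> (pj x N)" "pl o1 (gg \<sigma> N) = pl o1 N"
    "I (\<sigma> (pj x N)) (gg \<sigma> N)" "\<lbrakk>W \<in> L; mt W M; mt W N\<rbrakk> \<Longrightarrow> mt W (gg \<sigma> N)"
proof -
  note o = oppM[OF N]
  let ?q = "pj x N" and ?l = "pl o1 N"
  let ?G = "gg \<sigma> N"
  have G: "?G = pl (\<sigma> ?q) ?l" using N by (simp add: gg_def)
  have sq: "N0 (\<sigma> ?q)" using TR1[OF s o(1)] .
  have g: "?G \<in> L" "I (\<sigma> ?q) ?G" "mt ?G ?l" using pl[of "\<sigma> ?q" ?l] G o sq N0P by auto
  then show "?G \<in> L" "I (\<sigma> ?q) ?G" by auto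
  let ?W = "xl ?q"
  have W: "?W \<in> L" "I x ?W" "I ?q ?W" using xl[of ?q] o(1) by (auto simp: N0_def)
  have "xl (\<sigma> ?q) = ?W"
    using TR2[OF s o(1)] cl_xl[of ?q "\<sigma> ?q"] o(1) sq N0_ne by (auto simp: N0_def)
  then have sW: "I (\<sigma> ?q) ?W" using xl[of "\<sigma> ?q"] sq by (auto simp: N0_def)
  have Wl: "?W \<noteq> ?l" using o(8)[OF o(1)] W(3) by metis
  have nMN: "\<not> mt M N" using N mt_sym by blast
  show all: "mt W ?G" if "W \<in> L" "mt W M" "mt W N" for W
  proof -
    have 1: "mt M ?W" "mt N ?W" using W xM xP o(1,2) by (auto simp: N0_def intro: mtI)
    have 2: "mt ?G ?W" using g sW N0P[OF sq] by (auto intro: mtI)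
    have "mt ?G W"
      by (rule rlD[OF rM nMN Wl]) (use 1 2 o g W N that in \<open>auto simp: mt_sym\<close>)
    then show ?thesis by (simp add: mt_sym)
  qed
  show GM: "\<not> mt ?G M"
  proof
    assume "mt ?G M"
    then obtain t where t: "t \<in> P" "I t ?G" "I t M" by (rule mtE)
    show False
    proof (cases "t = x")
      case True
      then have "?G = ?W" using line_unique[of x "\<sigma> ?q" ?G ?W] t g W sW xP N0P[OF sq] N0_ne[OF sq] by auto
      then obtain r where r: "r \<in> P" "I r ?W" "I r ?l" using g by (auto simp: col_def)
      have "r \<noteq> x" using r o line_unique[of x o1 M ?l] o1 xM xP MinL by (auto simp: VV_def)
      moreover have "?W \<noteq> M" using W o(1) by (auto simp: N0_def)
      ultimately have "N0 r" using N0I r W by blast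
      then show False using o r by blast
    next
      case False
      then show False using N0_VV[OF sq, of t] t g by (auto simp: VV_def col_def)
    qed
  qed
  show "pj x ?G = \<sigma> ?q"
    by (rule pj_eq) (use g sq xP GM xM in \<open>auto simp: N0_def intro: mtI\<close>)
  show "pl o1 ?G = ?l"
    by (rule pl_eq) (use g o o1 GM in \<open>auto simp: VV_def mt_sym intro: mtI\<close>)
qed

lemma ff_P: "TR \<sigma> \<Longrightarrow> z \<in> P \<Longrightarrow> ff \<sigma> z \<in> P"
  using cases3[of z] ff_opx(1)[of \<sigma> z] TR1[of \<sigma> z] N0P opxP by (auto simp: ff_def)

lemma gg_L: "TR \<sigma> \<Longrightarrow> N \<in> L \<Longrightarrow> gg \<sigma> N \<in> L"
  using gg_opp(1) by (cases "mt N M") (auto simp: gg_def)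

lemma ff_inv:
  assumes "TR \<sigma>" "TR \<tau>" "\<And>q. N0 q \<Longrightarrow> \<tau> (\<sigma> q) = q" "z \<in> P"
  shows "ff \<tau> (ff \<sigma> z) = z"
proof -
  consider "N0 z" | "I z M" | "opx z" using cases3 assms by blast
  then show ?thesis
  proof cases
    case 1 then show ?thesis using assms TR1 by (simp add: ff_def)
  next
    case 2 then show ?thesis using N0M by (auto simp: ff_def)
  next
    case 3
    note w = ff_opx[OF assms(1) 3]
    have "ff \<tau> (ff \<sigma> z) = pj (\<tau> (pj (ff \<sigma> z) U)) (pl (ff \<sigma> z) M)"
      using w(1) opx_N0 opx_M by (simp add: ff_def[of \<tau>])
    also have "\<dots> = pj (pj z U) (pl z M)" using w assms(3) pjU 3 by simp
    also have "\<dots> = z"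
    proof -
      have l: "pl z M \<in> L" "I z (pl z M)" "\<forall>q. N0 q \<longrightarrow> \<not> I q (pl z M)" using el[OF 3] by blast+
      show ?thesis
        by (rule pj_eq) (use l pj[of z U] pjU[OF 3] opxP[OF 3] U in \<open>auto simp: cl_sym\<close>)
    qed
    finally show ?thesis .
  qed
qed

lemma gg_inv:
  assumes "TR \<sigma>" "TR \<tau>" "\<And>q. N0 q \<Longrightarrow> \<tau> (\<sigma> q) = q" "N \<in> L"
  shows "gg \<tau> (gg \<sigma> N) = N"
proof (cases "mt N M")
  case True then show ?thesis by (simp add: gg_def)
next
  case False
  note w = gg_opp[OF assms(1,4) False] and o = oppM[OF assms(4) False]
  have "gg \<tau> (gg \<sigma> N) = pl (pj x N) (pl o1 N)" using w o assms(3) by (simp add: gg_def[of \<tau>])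
  also have "\<dots> = N"
    by (rule pl_eq) (use o assms in \<open>auto simp: mt_sym N0_def\<close>)
  finally show ?thesis .
qed

text \<open>The substantial case is a point \<open>z\<close> opposite \<open>x\<close> on a line
  \<open>N\<close> not meeting \<open>M\<close>. The line from \<open>z\<close> to \<open>M\<close>
  is fixed and meets the image of \<open>N\<close> by \<open>gg_opp\<close>. Both this meeting point
  and the image of \<open>z\<close> are the projection of the translate of \<open>pj x N\<close> on
  that fixed line.\<close>

lemma fg_inc:
  assumes s: "TR \<sigma>" and i: "z \<in> P" "N \<in> L" "I z N"
  shows "I (ff \<sigma> z) (gg \<sigma> N)"
proof -
  consider "N0 z" | "I z M" | "opx z" using cases3 i by blast
  then show ?thesis
  proof cases
    case 1
    show ?thesis
    proof (cases "mt N M")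
      case True
      then obtain t where t: "t \<in> P" "I t N" "I t M" by (rule mtE)
      have "t = x" using N0_VV[OF 1, of t] t i by (auto simp: VV_def col_def)
      then have "xl z = N" using xl_eq[of z N] t i N0_ne[OF 1] by auto
      moreover have "xl (\<sigma> z) = xl z"
        using TR2[OF s 1] TR1[OF s 1] cl_xl[of z "\<sigma> z"] 1 N0_ne by (auto simp: N0_def)
      ultimately show ?thesis using xl[of "\<sigma> z"] TR1[OF s 1] True 1 by (auto simp: N0_def ff_def gg_def)
    next
      case False
      have "pj x N = z" using pj_eq[of x N z] 1 i oppM(9)[OF i(2) False] xP by (auto simp: N0_def)
      then show ?thesis using gg_opp(5)[OF s i(2) False] 1 by (simp add: ff_def)
    qed
  next
    case 2
    then have "mt N M" using i by (auto intro: mtI)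
    then show ?thesis using 2 i N0M by (auto simp: ff_def gg_def)
  next
    case 3
    note w = ff_opx[OF s 3]
    obtain a where l: "pl z M \<in> L" "I z (pl z M)" "VV a" "I a (pl z M)" "pl z M \<noteq> M" "\<not> I x (pl z M)"
      "\<forall>q. N0 q \<longrightarrow> \<not> I q (pl z M)" using el[OF 3] by blast
    show ?thesis
    proof (cases "mt N M")
      case True
      have "pl z M = N" using pl_eq[of z M N] True i opx_M[OF 3] MinL by auto
      then show ?thesis using w True by (simp add: gg_def)
    next
      case False
      note G = gg_opp[OF s i(2) False] and o = oppM[OF i(2) False]
      have "mt (pl z M) M" using l by (auto simp: VV_def col_def)
      moreover have "mt (pl z M) N" using l i by (auto intro: mtI)
      ultimately have "mt (pl z M) (gg \<sigma> N)" using G(6) l by blast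
      then obtain t where t: "t \<in> P" "I t (pl z M)" "I t (gg \<sigma> N)" by (rule mtE)
      have sq: "N0 (\<sigma> (pj x N))" using TR1[OF s o(1)] .
      have "cl (pj x N) z" using o(2) i by (auto intro: clI)
      then have c: "cl (\<sigma> (pj x N)) (ff \<sigma> z)" using w(5)[OF o(1)] by blast
      have "cl (\<sigma> (pj x N)) t" using G(1,5) t by (auto intro: clI)
      then have "t = ff \<sigma> z"
        using pj_unique[of "\<sigma> (pj x N)" "pl z M" t "ff \<sigma> z"] l sq t w c opxP N0P by blast
      then show ?thesis using t by simp
    qed
  qed
qed

lemma net_symmetry:
  assumes "N0 p" "N0 p'" "I p U" "I p' U"
  shows "\<exists>f g. colln f g \<and> (\<forall>N\<in>L. mt N M \<longrightarrow> g N = N) \<and> f p = p'"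
proof (cases "p = p'")
  case True
  then show ?thesis using colln_id by (intro exI[of _ id]) auto
next
  case False
  have c: "cl p p'" using assms U by (auto intro: clI)
  obtain \<sigma> where s: "TR \<sigma>" "\<sigma> p = p'" using translation_ex[OF assms(1,2) False c] by blast
  obtain \<tau> where t: "TR \<tau>" "\<tau> p' = p" using translation_ex[of p' p] assms False c cl_sym by metis
  have ts: "\<tau> (\<sigma> q) = q" if "N0 q" for q using TR_inverse[OF s(1) t(1) assms(1) _ that] s t by simp
  have st: "\<sigma> (\<tau> q) = q" if "N0 q" for q using TR_inverse[OF t(1) s(1) assms(2) _ that] s t by simp
  have "colln (ff \<sigma>) (gg \<sigma>)"
    by (rule collnI[of _ "ff \<tau>" _ "gg \<tau>"])
      (use ff_P gg_L ff_inv gg_inv fg_inc s t st ts in blast)+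
  moreover have "ff \<sigma> p = p'" using s assms by (simp add: ff_def)
  moreover have "\<forall>N\<in>L. mt N M \<longrightarrow> gg \<sigma> N = N" by (simp add: gg_def)
  ultimately show ?thesis by blast
qed

end

context LD_flag
begin

text \<open>For a line \<open>U\<close> meeting \<open>M\<close> outside \<open>x\<close>, the
  points of \<open>U\<close> off \<open>M\<close> are projected to a line \<open>W\<close> through
  \<open>x\<close>. A symmetry that moves the projections as required fixes \<open>U\<close>, and
  therefore moves the points of \<open>U\<close> accordingly.\<close>

theorem axis: "axis M"
  unfolding axis_def
proof (intro conjI ballI impI MinL)
  fix U p p' assume a: "U \<in> L" "p \<in> P" "p' \<in> P" "U \<noteq> M" "mt U M" "I p U" "I p' U" "\<not> I p M" "\<not> I p' M"
  obtain o1 where "o1 \<in> P" "I o1 M" "o1 \<noteq> x" using three_points[OF MinL] by blast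
  then have o1: "VV o1" by (simp add: VV_def)
  obtain u where u: "u \<in> P" "I u U" "I u M" using a by (auto simp: col_def)
  show "\<exists>f g. colln f g \<and> (\<forall>N\<in>L. mt N M \<longrightarrow> g N = N) \<and> f p = p'"
  proof (cases "u = x")
    case True
    interpret LD_flag_translation P L I x M U o1 by unfold_locales (use True u a o1 in auto)
    show ?thesis by (rule net_symmetry) (use a u True in \<open>auto simp: N0_def intro: clI\<close>)
  next
    case False
    then have vu: "VV u" using u by (simp add: VV_def)
    obtain W where W: "W \<in> L" "I x W" "W \<noteq> M" using line_other[OF xP] by blast
    interpret LD_flag_translation P L I x M W o1 by unfold_locales (use W o1 in auto)
    have xU: "\<not> I x U" using line_unique[of x u U M] u a xM xP MinL False by auto
    have N: "N0 (pj r W) \<and> I (pj r W) W \<and> cl r (pj r W) \<and> pj r W \<in> P \<and> \<not> I (pj r W) U"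
      if r: "r \<in> P" "I r U" "\<not> I r M" for r
    proof -
      have 1: "pj r W \<in> P" "I (pj r W) W" "cl r (pj r W)" using pj[of r W] W r by auto
      have "pj r W \<noteq> x"
      proof
        assume "pj r W = x"
        then have "I r M" using no_tri[of x u r M] False 1 r u a xM xP MinL by (auto simp: col_def)
        then show False using r by simp
      qed
      then have 2: "N0 (pj r W)" using N0I 1 W by blast
      then have "\<not> I (pj r W) U" using N0_VV[OF _ vu] u a by (auto simp: col_def)
      then show ?thesis using 1 2 by blast
    qed
    obtain f g where fg: "colln f g" "\<forall>N\<in>L. mt N M \<longrightarrow> g N = N" "f (pj p W) = pj p' W"
      using net_symmetry[of "pj p W" "pj p' W"] N[of p] N[of p'] a by blast
    have "cl (f p) (pj p' W)" using colln_cl[OF fg(1), of p "pj p W"] fg(3) N[of p] a by auto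
    moreover have "I (f p) U" using colln_I[OF fg(1), of p U] fg(2) a by auto
    ultimately have "f p = p'"
      using pj_unique[of "pj p' W" U "f p" p'] N[of p'] a colln_P[OF fg(1)] by (auto simp: cl_sym)
    then show ?thesis using fg by blast
  qed
qed

end

section \<open>The algebra of coordinates\<close>

text \<open>
  In coordinates, the points not collinear with \<open>x\<close> are triples \<open>(a, r, b)\<close> and the lines not meeting \<open>M\<close>
  are triples \<open>[k, g, s]\<close>, incident iff \<open>b = m a k \<boxplus> g\<close> and \<open>s = T a k r\<close>, for instance
  \<open>m a k = a k\<close> and \<open>T a k r = a\<^sup>2 k + r\<close> in a mixed quadrangle.
\<close>
locale coordinate_algebra =
  fixes A :: "'a set" and K :: "'k set" and B :: "'b set" and R :: "'r set"
    and a0 :: 'a and k0 :: 'k and b0 :: 'b and r0 :: 'r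
    and bp :: "'b \<Rightarrow> 'b \<Rightarrow> 'b" (infixl "\<boxplus>" 65)
    and m :: "'a \<Rightarrow> 'k \<Rightarrow> 'b" and T :: "'a \<Rightarrow> 'k \<Rightarrow> 'r \<Rightarrow> 'r"
  assumes z[simp, intro]: "a0 \<in> A" "k0 \<in> K" "b0 \<in> B" "r0 \<in> R"
    and bp_cl[simp, intro]: "\<lbrakk>x \<in> B; y \<in> B\<rbrakk> \<Longrightarrow> x \<boxplus> y \<in> B"
    and bp_assoc: "\<lbrakk>x \<in> B; y \<in> B; w \<in> B\<rbrakk> \<Longrightarrow> x \<boxplus> y \<boxplus> w = x \<boxplus> (y \<boxplus> w)"
    and bp_0l[simp]: "x \<in> B \<Longrightarrow> b0 \<boxplus> x = x"
    and bp_0r[simp]: "x \<in> B \<Longrightarrow> x \<boxplus> b0 = x"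
    and bp_inv: "x \<in> B \<Longrightarrow> \<exists>y\<in>B. y \<boxplus> x = b0 \<and> x \<boxplus> y = b0"
    and m_cl[simp, intro]: "\<lbrakk>a \<in> A; k \<in> K\<rbrakk> \<Longrightarrow> m a k \<in> B"
    and T_cl[simp, intro]: "\<lbrakk>a \<in> A; k \<in> K; r \<in> R\<rbrakk> \<Longrightarrow> T a k r \<in> R"
    and m0[simp]: "k \<in> K \<Longrightarrow> m a0 k = b0" "a \<in> A \<Longrightarrow> m a k0 = b0"
    and T0[simp]: "\<lbrakk>k \<in> K; r \<in> R\<rbrakk> \<Longrightarrow> T a0 k r = r" "\<lbrakk>a \<in> A; r \<in> R\<rbrakk> \<Longrightarrow> T a k0 r = r"
    and T_inj: "\<lbrakk>a \<in> A; k \<in> K; r \<in> R; r' \<in> R; T a k r = T a k r'\<rbrakk> \<Longrightarrow> r = r'"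
    and T_surj: "\<lbrakk>a \<in> A; k \<in> K; r \<in> R\<rbrakk> \<Longrightarrow> \<exists>r'\<in>R. T a k r' = r"
    and Xa_ex: "\<lbrakk>k \<in> K; c \<in> K; k \<noteq> c; d \<in> B\<rbrakk> \<Longrightarrow> \<exists>a\<in>A. m a k = m a c \<boxplus> d"
    and Xa_un: "\<lbrakk>k \<in> K; c \<in> K; k \<noteq> c; d \<in> B; a \<in> A; m a k = m a c \<boxplus> d; a' \<in> A; m a' k = m a' c \<boxplus> d\<rbrakk> \<Longrightarrow> a = a'"
    and Xb_ex: "\<lbrakk>a \<in> A; a' \<in> A; a \<noteq> a'; r \<in> R; r' \<in> R\<rbrakk> \<Longrightarrow> \<exists>k\<in>K. T a k r = T a' k r'"
    and Xb_un: "\<lbrakk>a \<in> A; a' \<in> A; a \<noteq> a'; r \<in> R; r' \<in> R; k \<in> K; T a k r = T a' k r'; h \<in> K; T a h r = T a' h r'\<rbrakk> \<Longrightarrow> k = h"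
    and no_triangles: "\<lbrakk>k1 \<in> K; k2 \<in> K; k3 \<in> K; k1 \<noteq> k2; k2 \<noteq> k3; k1 \<noteq> k3; a1 \<in> A; a2 \<in> A; a3 \<in> A;
        r1 \<in> R; r2 \<in> R; r3 \<in> R; g1 \<in> B; g2 \<in> B; g3 \<in> B;
        m a1 k1 \<boxplus> g1 = m a1 k2 \<boxplus> g2; T a1 k1 r1 = s1; T a1 k2 r1 = s2;
        m a2 k2 \<boxplus> g2 = m a2 k3 \<boxplus> g3; T a2 k2 r2 = s2; T a2 k3 r2 = s3;
        m a3 k3 \<boxplus> g3 = m a3 k1 \<boxplus> g1; T a3 k3 r3 = s3; T a3 k1 r3 = s1\<rbrakk> \<Longrightarrow> a1 = a2 \<and> a2 = a3"
    and line_regularity: "\<lbrakk>k \<in> K; c \<in> K; k \<noteq> c; a \<in> A; a' \<in> A; a'' \<in> A; d \<in> B; d' \<in> B; m a k = m a c \<boxplus> d; m a' k = m a' c \<boxplus> d';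
        m a'' k = m a'' c \<boxplus> (d \<boxplus> d'); r1 \<in> R; r2 \<in> R; r3 \<in> R;
        T a k r2 = T a' c r1; T a'' k r3 = T a' k r1\<rbrakk> \<Longrightarrow> T a'' c r3 = T a c r2"
    and point_regularity: "\<lbrakk>a \<in> A; a' \<in> A; a \<noteq> a'; k \<in> K; k'' \<in> K; r \<in> R; g \<in> B; g'' \<in> B; r1 \<in> R; r3 \<in> R;
        m a k \<boxplus> g = b0; m a k'' \<boxplus> g'' = b0; T a' k r1 = T a k r; T a' k'' r3 = T a k'' r\<rbrakk> \<Longrightarrow>
        \<exists>h\<in>K. \<exists>gh\<in>B. m a h \<boxplus> gh = b0 \<and> m a' k'' \<boxplus> g'' = (m a' h \<boxplus> gh) \<boxplus> (m a' k \<boxplus> g) \<and> T a' h r3 = T a h r1"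
    and K_ex: "\<exists>k\<in>K. k \<noteq> k0"
    and B_ex: "\<exists>b\<in>B. b \<noteq> b0"
begin

section \<open>Cancellation and exponent 2\<close>

lemma lcan: "\<lbrakk>x \<in> B; y \<in> B; w \<in> B; x \<boxplus> y = x \<boxplus> w\<rbrakk> \<Longrightarrow> y = w"
  using bp_inv[of x] bp_assoc bp_0l by metis

lemma rcan: "\<lbrakk>x \<in> B; y \<in> B; w \<in> B; y \<boxplus> x = w \<boxplus> x\<rbrakk> \<Longrightarrow> y = w"
  using bp_inv[of x] bp_assoc bp_0r by metis

text \<open>The double of \<open>x = m a k\<close> is produced in two ways: by line regularity as
  \<open>m a2 k\<close>, and by point regularity as \<open>m a h2\<close>. Both come with the same
  value of \<open>T\<close> at \<open>r0\<close>, so that the lines with first coordinates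
  \<open>k0\<close>, \<open>k\<close>, \<open>h2\<close> bound a triangle, unless the double is zero
  or these coordinates are not distinct.\<close>

lemma exp2:
  assumes x: "x \<in> B"
  shows "x \<boxplus> x = b0"
proof -
  obtain k where k: "k \<in> K" "k \<noteq> k0" using K_ex by blast
  obtain a where a: "a \<in> A" "m a k = x" using Xa_ex[of k k0 x] k x by auto
  obtain a2 where a2: "a2 \<in> A" "m a2 k = x \<boxplus> x" using Xa_ex[of k k0 "x \<boxplus> x"] k x by auto
  obtain g where g: "g \<in> B" "g \<boxplus> x = b0" "x \<boxplus> g = b0" using bp_inv[OF x] by blast
  show ?thesis
  proof (cases "a = a0")
    case True
    then have "x = b0" using a k by simp
    then show ?thesis by simp
  next
    case False
    have sq: "T a2 k r = T a k (T a k r)" if r: "r \<in> R" for r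
    proof -
      obtain r3 where r3: "r3 \<in> R" "T a2 k r3 = T a k (T a k r)" using T_surj[of a2 k] a2 a k r by blast
      have "T a2 k0 r3 = T a k0 r"
        by (rule line_regularity[of k k0 a a a2 x x "T a k r" r r3]) (use a a2 k x r r3 in auto)
      then show ?thesis using r3 a a2 r by simp
    qed
    \<comment> \<open>Point regularity with \<open>a'\<close> the origin \<open>a0\<close>: it adds
      lines at the point \<open>a\<close>, giving \<open>m a k'' = m a k' + m a h\<close> and
      \<open>T a k'' r = T a h (T a k' r)\<close>. The values of \<open>m\<close> are recorded
      through their inverses, because commutativity is not yet known.\<close>
    have H1: "\<exists>h\<in>K. \<exists>gh\<in>B. m a h \<boxplus> gh = b0 \<and> g'' = gh \<boxplus> g' \<and> T a k'' r = T a h (T a k' r)"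
      if "k' \<in> K" "k'' \<in> K" "g' \<in> B" "g'' \<in> B" "m a k' \<boxplus> g' = b0" "m a k'' \<boxplus> g'' = b0" "r \<in> R" for k' k'' g' g'' r
    proof -
      have "\<exists>h\<in>K. \<exists>gh\<in>B. m a h \<boxplus> gh = b0 \<and> m a0 k'' \<boxplus> g'' = (m a0 h \<boxplus> gh) \<boxplus> (m a0 k' \<boxplus> g') \<and> T a0 h (T a k'' r) = T a h (T a k' r)"
        by (rule point_regularity[of a a0 k' k'' r g' g'' "T a k' r" "T a k'' r"]) (use that a False in auto)
      then obtain h gh where h: "h \<in> K" "gh \<in> B" "m a h \<boxplus> gh = b0"
        "m a0 k'' \<boxplus> g'' = (m a0 h \<boxplus> gh) \<boxplus> (m a0 k' \<boxplus> g')" "T a0 h (T a k'' r) = T a h (T a k' r)" by blast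
      have "g'' = gh \<boxplus> g'" "T a k'' r = T a h (T a k' r)" using h(1,2,4,5) that a by auto
      then show ?thesis using h(1-3) by blast
    qed
    have minj: "k' = k''" if "k' \<in> K" "k'' \<in> K" "m a k' = m a k''" for k' k''
      by (rule ccontr) (use Xa_un[of k' k'' b0 a a0] that a False in auto)
    \<comment> \<open>At the point \<open>a\<close>, the line \<open>h\<close> behaves like minus
      \<open>k\<close>. Subtracting it from \<open>k\<close> gives \<open>h2\<close>, which behaves
      like twice \<open>k\<close>.\<close>
    obtain h gh where h: "h \<in> K" "gh \<in> B" "m a h \<boxplus> gh = b0" "b0 = gh \<boxplus> g" "r0 = T a h (T a k r0)"
      using H1[of k k0 g b0 r0] k g a by auto
    have "gh \<boxplus> g = x \<boxplus> g" by (rule trans[OF h(4)[symmetric] g(3)[symmetric]])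
    then have gx: "gh = x" by (rule rcan[OF g(1) h(2) x])
    obtain h2 gh2 where h2: "h2 \<in> K" "gh2 \<in> B" "m a h2 \<boxplus> gh2 = b0" "g = gh2 \<boxplus> x" "T a k (T a k r0) = T a h2 (T a h (T a k r0))"
      using H1[of h k x g "T a k r0"] h(1,3) gx k g a x by auto
    have mh2: "m a h2 = x \<boxplus> x"
    proof -
      have "gh2 \<boxplus> (x \<boxplus> x) = b0" using h2 g x bp_assoc[of gh2 x x] by auto
      moreover obtain i where "i \<in> B" "i \<boxplus> gh2 = b0" using bp_inv[OF h2(2)] by blast
      ultimately show ?thesis
        using bp_assoc[of i gh2 "x \<boxplus> x"] rcan[of gh2 "m a h2" i] h2 x a bp_0r[of i] by auto
    qed
    have Th2: "T a h2 r0 = T a2 k r0" using h2 h sq by simp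
    obtain g2 where g2: "g2 \<in> B" "(x \<boxplus> x) \<boxplus> g2 = b0" using bp_inv[of "x \<boxplus> x"] x by blast
    show ?thesis
    proof (cases "h2 = k0 \<or> h2 = k")
      case True
      then show ?thesis
      proof
        assume "h2 = k0" then show ?thesis using mh2 a by simp
      next
        assume "h2 = k"
        then have "x \<boxplus> x = x" using mh2 a by simp
        then show ?thesis using lcan[of x x b0] x by auto
      qed
    next
      case False
      \<comment> \<open>The vertices \<open>a2\<close>, \<open>a0\<close>, \<open>a\<close> of the
        would-be triangle must coincide, so the double of \<open>x\<close> is \<open>m a0 k\<close>,
        which is zero.\<close>
      have "a2 = a0 \<and> a0 = a"
        by (rule no_triangles[of k0 k h2 a2 a0 a r0 "T a2 k r0" r0 b0 g2 g2 r0 "T a2 k r0" "T a2 k r0"])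
          (use False k h2 a a2 g2 x mh2 Th2 in auto)
      then have "m a2 k = m a0 k" by blast
      then have "m a2 k = b0" by (rule trans[OF _ m0(1)[OF k(1)]])
      then show ?thesis using a2(2) by metis
    qed
  qed
qed

lemma bp_comm: "\<lbrakk>x \<in> B; y \<in> B\<rbrakk> \<Longrightarrow> x \<boxplus> y = y \<boxplus> x"
proof -
  assume x: "x \<in> B" and y: "y \<in> B"
  have "(x \<boxplus> y) \<boxplus> (x \<boxplus> y) = b0" using exp2 x y by blast
  then have "x \<boxplus> (y \<boxplus> (x \<boxplus> y)) = x \<boxplus> x" using bp_assoc[of x y "x \<boxplus> y"] x y exp2[of x] by simp
  then have "y \<boxplus> (x \<boxplus> y) = x" using lcan[of x "y \<boxplus> (x \<boxplus> y)" x] x y by simp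
  then have "y \<boxplus> (y \<boxplus> (x \<boxplus> y)) = y \<boxplus> x" by simp
  then show ?thesis using bp_assoc[of y y "x \<boxplus> y"] exp2[of y] x y by simp
qed

lemma bp_lcomm: "\<lbrakk>x \<in> B; y \<in> B; w \<in> B\<rbrakk> \<Longrightarrow> x \<boxplus> (y \<boxplus> w) = y \<boxplus> (x \<boxplus> w)"
  using bp_assoc bp_comm by metis

lemma bp_self[simp]: "\<lbrakk>x \<in> B; y \<in> B\<rbrakk> \<Longrightarrow> x \<boxplus> (x \<boxplus> y) = y"
  using bp_assoc[of x x y] exp2 by simp

lemmas bpac = bp_assoc bp_comm bp_lcomm exp2

lemma bp_eq0: "\<lbrakk>x \<in> B; y \<in> B\<rbrakk> \<Longrightarrow> x \<boxplus> y = b0 \<longleftrightarrow> x = y"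
  using exp2 lcan by metis

lemma bp_eq: "\<lbrakk>x \<in> B; y \<in> B; w \<in> B\<rbrakk> \<Longrightarrow> x = y \<boxplus> w \<longleftrightarrow> x \<boxplus> y = w"
proof -
  assume a: "x \<in> B" "y \<in> B" "w \<in> B"
  have "x \<boxplus> y = y \<boxplus> x" using a by (simp only: bp_comm)
  moreover have "y \<boxplus> (y \<boxplus> w) = w" "y \<boxplus> (y \<boxplus> x) = x" using a by simp_all
  ultimately show ?thesis by metis
qed

section \<open>The additions on the points of \<open>M\<close> and on the lines through
  \<open>x\<close>\<close>

lemma m_inj_a: "\<lbrakk>k \<in> K; k \<noteq> k0; a \<in> A; a' \<in> A; m a k = m a' k\<rbrakk> \<Longrightarrow> a = a'"
  by (rule Xa_un[of k k0 "m a k" a a']) auto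

lemma m_inj_k: "\<lbrakk>a \<in> A; a \<noteq> a0; k \<in> K; h \<in> K; m a k = m a h\<rbrakk> \<Longrightarrow> k = h"
  by (rule ccontr) (use Xa_un[of k h b0 a a0] in auto)

text \<open>Addition on \<open>A\<close> carried over from \<open>B\<close> along
  \<open>m _ k\<close>. Independence of \<open>k\<close> is reached only in \<open>pA_indep\<close>;
  \<open>pK\<close> and \<open>pK_indep\<close> are the counterparts for \<open>K\<close>.\<close>

definition pA :: "'k \<Rightarrow> 'a \<Rightarrow> 'a \<Rightarrow> 'a" where
  "pA k a a' = (SOME a''. a'' \<in> A \<and> m a'' k = m a k \<boxplus> m a' k)"

lemma pA:
  assumes "k \<in> K" "k \<noteq> k0" "a \<in> A" "a' \<in> A"
  shows "pA k a a' \<in> A" "m (pA k a a') k = m a k \<boxplus> m a' k"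
proof -
  have "\<exists>a''. a'' \<in> A \<and> m a'' k = m a k \<boxplus> m a' k" using Xa_ex[of k k0 "m a k \<boxplus> m a' k"] assms by auto
  then have "pA k a a' \<in> A \<and> m (pA k a a') k = m a k \<boxplus> m a' k" unfolding pA_def by (rule someI_ex)
  then show "pA k a a' \<in> A" "m (pA k a a') k = m a k \<boxplus> m a' k" by auto
qed

lemma pA_eq: "\<lbrakk>k \<in> K; k \<noteq> k0; a \<in> A; a' \<in> A; a'' \<in> A; m a'' k = m a k \<boxplus> m a' k\<rbrakk> \<Longrightarrow> pA k a a' = a''"
  using pA m_inj_a by metis

lemma T_pA':
  assumes "k \<in> K" "k \<noteq> k0" "a \<in> A" "a' \<in> A" "a'' \<in> A" "m a'' k = m a k \<boxplus> m a' k" "r \<in> R"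
  shows "T a'' k r = T a' k (T a k r)"
proof -
  obtain r3 where r3: "r3 \<in> R" "T a'' k r3 = T a' k (T a k r)" using T_surj[of a'' k] assms by blast
  have "T a'' k0 r3 = T a k0 r"
    by (rule line_regularity[of k k0 a a' a'' "m a k" "m a' k" "T a k r" r r3]) (use assms r3 in auto)
  then show ?thesis using r3 assms by simp
qed

lemma T_pA: "\<lbrakk>k \<in> K; k \<noteq> k0; a \<in> A; a' \<in> A; r \<in> R\<rbrakk> \<Longrightarrow> T (pA k a a') k r = T a' k (T a k r)"
  using T_pA'[of k a a' "pA k a a'" r] pA[of k a a'] by simp

lemma T_inv[simp]: "\<lbrakk>k \<in> K; a \<in> A; r \<in> R\<rbrakk> \<Longrightarrow> T a k (T a k r) = r"
  using T_pA'[of k a a a0 r] exp2[of "m a k"] by (cases "k = k0") auto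

lemma T_comm_k: "\<lbrakk>k \<in> K; a \<in> A; a' \<in> A; r \<in> R\<rbrakk> \<Longrightarrow> T a k (T a' k r) = T a' k (T a k r)"
  using T_pA'[of k a a' "pA k a a'" r] T_pA'[of k a' a "pA k a a'" r] pA[of k a a'] bp_comm[of "m a k" "m a' k"]
  by (cases "k = k0") auto

text \<open>Point regularity after the inverses have been replaced by the elements themselves, which
  exponent 2 permits. For fixed distinct \<open>a\<close>, \<open>a'\<close> the sums
  \<open>m a k + m a' k\<close> are closed under addition.\<close>

lemma lam0:
  assumes "a \<in> A" "a' \<in> A" "a \<noteq> a'" "k \<in> K" "k'' \<in> K" "r \<in> R"
  shows "\<exists>h\<in>K. m a k'' \<boxplus> m a' k'' = (m a h \<boxplus> m a' h) \<boxplus> (m a k \<boxplus> m a' k) \<and>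
    T a' h (T a' k'' (T a k'' r)) = T a h (T a' k (T a k r))"
proof -
  have "\<exists>h\<in>K. \<exists>gh\<in>B. m a h \<boxplus> gh = b0 \<and> m a' k'' \<boxplus> m a k'' = (m a' h \<boxplus> gh) \<boxplus> (m a' k \<boxplus> m a k) \<and>
      T a' h (T a' k'' (T a k'' r)) = T a h (T a' k (T a k r))"
    by (rule point_regularity) (use assms exp2 in auto)
  then obtain h gh where h: "h \<in> K" "gh \<in> B" "m a h \<boxplus> gh = b0"
    "m a' k'' \<boxplus> m a k'' = (m a' h \<boxplus> gh) \<boxplus> (m a' k \<boxplus> m a k)" "T a' h (T a' k'' (T a k'' r)) = T a h (T a' k (T a k r))" by blast
  have "gh = m a h" using bp_eq0[of "m a h" gh] h(1-3) assms(1) m_cl by blast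
  then show ?thesis using h assms by (intro bexI[of _ h]) (auto simp: bp_comm)
qed

lemma E_inj:
  assumes "a \<in> A" "a' \<in> A" "a \<noteq> a'" "k \<in> K" "h \<in> K" "m a k \<boxplus> m a' k = m a h \<boxplus> m a' h"
  shows "k = h"
proof (rule ccontr)
  assume ne: "k \<noteq> h"
  let ?d = "m a k \<boxplus> m a h"
  have 1: "m a k = m a h \<boxplus> ?d" using assms by (simp add: bpac)
  have "?d = (m a k \<boxplus> m a' k) \<boxplus> (m a h \<boxplus> m a' k)" using assms(1-5) by (simp add: bpac)
  also have "\<dots> = (m a h \<boxplus> m a' h) \<boxplus> (m a h \<boxplus> m a' k)" by (simp only: assms(6))
  also have "\<dots> = m a' h \<boxplus> m a' k" using assms(1-5) by (simp add: bpac)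
  finally have d: "?d = m a' h \<boxplus> m a' k" .
  have "m a' k = m a' h \<boxplus> ?d" unfolding d using assms(1-5) by (simp add: bpac)
  then show False using Xa_un[of k h ?d a a'] 1 ne assms(1-5) by blast
qed

text \<open>The line supplied by \<open>lam0\<close> is \<open>h\<close>, since \<open>k\<close> is
  determined by \<open>m a k + m a' k\<close>. Thus for fixed \<open>a\<close>, \<open>a'\<close>
  the permutation obtained from \<open>T a k\<close> and \<open>T a' k\<close> depends additively on
  that sum.\<close>

lemma lam2:
  assumes "a \<in> A" "a' \<in> A" "a \<noteq> a'" "k \<in> K" "h \<in> K" "e \<in> K" "r \<in> R"
    and E: "m a e \<boxplus> m a' e = (m a h \<boxplus> m a' h) \<boxplus> (m a k \<boxplus> m a' k)"
  shows "T a' e (T a e r) = T a' h (T a h (T a' k (T a k r)))"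
proof -
  obtain h' where h': "h' \<in> K" "m a e \<boxplus> m a' e = (m a h' \<boxplus> m a' h') \<boxplus> (m a k \<boxplus> m a' k)"
    "T a' h' (T a' e (T a e r)) = T a h' (T a' k (T a k r))" using lam0[of a a' k e r] assms by blast
  have "m a h' \<boxplus> m a' h' = m a h \<boxplus> m a' h"
    by (rule rcan[of "m a k \<boxplus> m a' k"]) (use h'(1) assms(1-7) in auto, use h'(2) E in simp)
  then have "h' = h" by (rule E_inj[OF assms(1-3) h'(1) assms(5)])
  then have "T a' h (T a' h (T a' e (T a e r))) = T a' h (T a h (T a' k (T a k r)))" using h' by simp
  then show ?thesis using assms by simp
qed

lemma E_sum_ex:
  assumes "a \<in> A" "a' \<in> A" "a \<noteq> a'" "k \<in> K" "h \<in> K"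
  shows "\<exists>e\<in>K. m a e \<boxplus> m a' e = (m a h \<boxplus> m a' h) \<boxplus> (m a k \<boxplus> m a' k)"
proof -
  obtain e where e: "e \<in> K" "m a h \<boxplus> m a' h = (m a e \<boxplus> m a' e) \<boxplus> (m a k \<boxplus> m a' k)"
    using lam0[of a a' k h r0] assms by blast
  then have "m a e \<boxplus> m a' e = (m a h \<boxplus> m a' h) \<boxplus> (m a k \<boxplus> m a' k)"
    unfolding e(2) using e(1) assms by (simp add: bpac)
  then show ?thesis using e by blast
qed

definition pK :: "'a \<Rightarrow> 'k \<Rightarrow> 'k \<Rightarrow> 'k" where
  "pK a k h = (SOME e. e \<in> K \<and> m a e = m a k \<boxplus> m a h)"

lemma pK:
  assumes "a \<in> A" "a \<noteq> a0" "k \<in> K" "h \<in> K"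
  shows "pK a k h \<in> K" "m a (pK a k h) = m a k \<boxplus> m a h"
proof -
  have "\<exists>e. e \<in> K \<and> m a e = m a k \<boxplus> m a h" using E_sum_ex[of a a0 h k] assms by auto
  then have "pK a k h \<in> K \<and> m a (pK a k h) = m a k \<boxplus> m a h" unfolding pK_def by (rule someI_ex)
  then show "pK a k h \<in> K" "m a (pK a k h) = m a k \<boxplus> m a h" by auto
qed

lemma T_pK: "\<lbrakk>a \<in> A; a \<noteq> a0; k \<in> K; h \<in> K; r \<in> R\<rbrakk> \<Longrightarrow> T a (pK a k h) r = T a k (T a h r)"
  using lam2[of a a0 h k "pK a k h" r] pK[of a k h] by simp

lemma T_comm_a: "\<lbrakk>a \<in> A; k \<in> K; h \<in> K; r \<in> R\<rbrakk> \<Longrightarrow> T a k (T a h r) = T a h (T a k r)"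
proof (cases "a = a0")
  case False
  assume a: "a \<in> A" "k \<in> K" "h \<in> K" "r \<in> R"
  have "pK a k h = pK a h k" using m_inj_k[of a "pK a k h" "pK a h k"] pK[of a k h] pK[of a h k] a False by (simp add: bp_comm)
  then show ?thesis using T_pK[of a k h r] T_pK[of a h k r] a False by simp
qed simp

text \<open>The counterpart of \<open>lam2\<close> obtained from line regularity: for fixed
  \<open>k\<close>, \<open>c\<close> the composite of \<open>T a k\<close> and \<open>T a c\<close>
  depends additively on \<open>m a k + m a c\<close>.\<close>

lemma rho2:
  assumes "k \<in> K" "c \<in> K" "k \<noteq> c" "a \<in> A" "a' \<in> A" "a'' \<in> A" "r \<in> R"
    and D: "m a'' k \<boxplus> m a'' c = (m a k \<boxplus> m a c) \<boxplus> (m a' k \<boxplus> m a' c)"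
  shows "T a'' c (T a'' k r) = T a c (T a k (T a' c (T a' k r)))"
proof (rule line_regularity[of k c a a' a'' "m a k \<boxplus> m a c" "m a' k \<boxplus> m a' c"])
  show "m a'' k = m a'' c \<boxplus> ((m a k \<boxplus> m a c) \<boxplus> (m a' k \<boxplus> m a' c))"
    unfolding D[symmetric] using assms(1-7) by (simp add: bpac)
qed (use assms in \<open>auto simp: bpac\<close>)

lemma D_sum_ex:
  assumes "k \<in> K" "c \<in> K" "k \<noteq> c" "d \<in> B"
  shows "\<exists>a\<in>A. m a k \<boxplus> m a c = d"
proof -
  obtain a where "a \<in> A" "m a k = m a c \<boxplus> d" using Xa_ex[OF assms] by blast
  then show ?thesis using assms by (intro bexI[of _ a]) (auto simp: bpac)
qed

text \<open>The hypotheses describe a triangle with sides of first coordinates \<open>k0\<close>,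
  \<open>c\<close>, \<open>k\<close> and vertices of first coordinates \<open>p\<close>,
  \<open>t\<close>, \<open>q\<close>; it must degenerate.\<close>

lemma tri1:
  assumes "k \<in> K" "c \<in> K" "k \<noteq> c" "k \<noteq> k0" "c \<noteq> k0" "p \<in> A" "q \<in> A" "t \<in> A" "s \<in> R"
    and mm: "m p c \<boxplus> m q k = m t k \<boxplus> m t c" and TT: "T p c (T q k s) = T t c (T t k s)"
  shows "p = q"
proof -
  have *: "m t c \<boxplus> m p c = m t k \<boxplus> m q k"
  proof -
    have "m t c \<boxplus> m p c = (m t c \<boxplus> m q k) \<boxplus> (m p c \<boxplus> m q k)" using assms(1-9) by (simp add: bpac)
    also have "\<dots> = m t k \<boxplus> m q k" unfolding mm using assms(1-9) by (simp add: bpac)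
    finally show ?thesis .
  qed
  have "p = t \<and> t = q"
    by (rule no_triangles[of k0 c k p t q "T q k s" "T t k s" "T q k s" b0 "m p c" "m q k" "T q k s" "T p c (T q k s)" s])
      (use assms(1-9) TT * in \<open>auto simp: exp2\<close>)
  then show ?thesis by simp
qed

text \<open>For \<open>x\<close> and \<open>y\<close> different, the lines with first coordinates
  \<open>e\<close>, \<open>x\<close>, \<open>y\<close> would form a triangle with vertices over
  \<open>a\<close>, \<open>a0\<close>, \<open>a'\<close>, which are not all equal.\<close>

lemma tri2:
  assumes "a \<in> A" "a' \<in> A" "a \<noteq> a'" "a \<noteq> a0" "a' \<noteq> a0" "x \<in> K" "y \<in> K" "e \<in> K" "s \<in> R"
    and mm: "m a x \<boxplus> m a' y = m a e \<boxplus> m a' e" and TT: "T a' y (T a x s) = T a' e (T a e s)"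
  shows "x = y"
proof (rule ccontr)
  assume xy: "x \<noteq> y"
  have "x \<noteq> e"
  proof
    assume "x = e"
    then have "m a' y = m a' e" using lcan[of "m a e" "m a' y" "m a' e"] mm assms by auto
    then show False using m_inj_k[of a' y e] \<open>x = e\<close> xy assms by auto
  qed
  moreover have "y \<noteq> e"
  proof
    assume "y = e"
    then have "m a x = m a e" using rcan[of "m a' e" "m a x" "m a e"] mm assms by auto
    then show False using m_inj_k[of a x e] \<open>y = e\<close> xy assms by auto
  qed
  moreover have *: "m a' y \<boxplus> m a x = m a' e \<boxplus> m a e" using mm assms by (simp add: bp_comm)
  moreover define r3 where "r3 = T a' y (T a x s)"
  moreover have "T a' y r3 = T a x s" "T a' e r3 = T a e s" "r3 \<in> R"
    unfolding r3_def using assms(1-9) by simp (use assms(1-9) in \<open>simp_all add: TT\<close>)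
  ultimately have "a = a0 \<and> a0 = a'"
    using no_triangles[of e x y a a0 a' s "T a x s" r3 "m a e" "m a x" "m a x" "T a e s" "T a x s" "T a x s"] xy assms(1-9)
    by (auto simp: exp2)
  then show False using assms by simp
qed

section \<open>Commutation and independence of the additions\<close>

definition comm :: "'a \<Rightarrow> 'k \<Rightarrow> 'a \<Rightarrow> 'k \<Rightarrow> bool" where
  "comm a k a' c \<longleftrightarrow> (\<forall>r\<in>R. T a k (T a' c r) = T a' c (T a k r))"

text \<open>Let \<open>t\<close> have the same sum over \<open>k\<close> and \<open>c\<close> as
  \<open>a\<close> and \<open>a'\<close> together. Then \<open>rho2\<close> expresses the composite
  for \<open>t\<close> by \<open>a\<close> and \<open>a'\<close>. If the inner factors commute, it
  can be regrouped into the permutations of the two sums \<open>pA c a a'\<close> and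
  \<open>pA k a a'\<close>, and \<open>tri1\<close> forces these to be equal. Conversely, equal sums
  allow \<open>rho2\<close> to be applied to the sum itself, and comparison with \<open>T_pA\<close>
  gives commutation.\<close>

lemma comm_pA:
  assumes "k \<in> K" "c \<in> K" "k \<noteq> c" "k \<noteq> k0" "c \<noteq> k0" "a \<in> A" "a' \<in> A"
  shows "comm a k a' c \<longleftrightarrow> pA k a a' = pA c a a'"
proof
  note p = pA[OF assms(1,4,6,7)] and q = pA[OF assms(2,5,6,7)]
  assume c: "comm a k a' c"
  obtain t where t: "t \<in> A" "m t k \<boxplus> m t c = (m a k \<boxplus> m a c) \<boxplus> (m a' k \<boxplus> m a' c)"
    using D_sum_ex[OF assms(1-3), of "(m a k \<boxplus> m a c) \<boxplus> (m a' k \<boxplus> m a' c)"] assms by auto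
  have "pA c a a' = pA k a a'"
  proof (rule tri1[OF assms(1-5) q(1) p(1) t(1), of r0])
    show "m (pA c a a') c \<boxplus> m (pA k a a') k = m t k \<boxplus> m t c"
      unfolding t p q using assms by (simp add: bpac)
    have "T t c (T t k r0) = T a c (T a k (T a' c (T a' k r0)))" by (rule rho2) (use assms t in auto)
    also have "\<dots> = T a c (T a' c (T a k (T a' k r0)))" using c assms unfolding comm_def by simp
    also have "\<dots> = T a' c (T a c (T a' k (T a k r0)))" using assms by (simp add: T_comm_k)
    finally show "T (pA c a a') c (T (pA k a a') k r0) = T t c (T t k r0)" using assms by (simp add: T_pA)
  qed simp
  then show "pA k a a' = pA c a a'" by simp
next
  note p = pA[OF assms(1,4,6,7)] and q = pA[OF assms(2,5,6,7)]
  assume e: "pA k a a' = pA c a a'"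
  show "comm a k a' c"
    unfolding comm_def
  proof
    fix r assume r: "r \<in> R"
    let ?s = "T a' k r" and ?p = "pA k a a'"
    have "T ?p c (T ?p k ?s) = T a c (T a k (T a' c (T a' k ?s)))"
      by (rule rho2) (use assms p r in \<open>auto simp: e q[folded e] bpac\<close>, use assms e p q in \<open>auto simp: bpac\<close>)
    moreover have "T ?p k ?s = T a k r" using assms r by (simp add: T_pA T_comm_k)
    moreover have "T ?p c (T a k r) = T a c (T a' c (T a k r))" using assms r e by (simp add: T_pA T_comm_k)
    ultimately have "T a c (T a' c (T a k r)) = T a c (T a k (T a' c r))" using assms r by simp
    then show "T a k (T a' c r) = T a' c (T a k r)" using T_inj[of a c] assms r by (metis T_cl)
  qed
qed

text \<open>The argument for \<open>comm_pA\<close> with points and lines interchanged,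
  \<open>lam2\<close> and \<open>tri2\<close> taking the place of \<open>rho2\<close> and
  \<open>tri1\<close>.\<close>

lemma comm_pK:
  assumes "a \<in> A" "a' \<in> A" "a \<noteq> a'" "a \<noteq> a0" "a' \<noteq> a0" "k \<in> K" "c \<in> K"
  shows "comm a' k a c \<longleftrightarrow> pK a k c = pK a' k c"
proof
  note x = pK[OF assms(1,4,6,7)] and y = pK[OF assms(2,5,6,7)]
  assume c: "comm a' k a c"
  obtain e where e: "e \<in> K" "m a e \<boxplus> m a' e = (m a c \<boxplus> m a' c) \<boxplus> (m a k \<boxplus> m a' k)"
    using E_sum_ex[OF assms(1-3,6,7)] by blast
  show "pK a k c = pK a' k c"
  proof (rule tri2[OF assms(1-5) x(1) y(1) e(1), of r0])
    show "m a (pK a k c) \<boxplus> m a' (pK a' k c) = m a e \<boxplus> m a' e"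
      unfolding e x y using assms by (simp add: bpac)
    have "T a' e (T a e r0) = T a' c (T a c (T a' k (T a k r0)))" by (rule lam2) (use assms e in auto)
    also have "\<dots> = T a' c (T a' k (T a c (T a k r0)))" using c assms unfolding comm_def by simp
    finally show "T a' (pK a' k c) (T a (pK a k c) r0) = T a' e (T a e r0)" using assms by (simp add: T_pK T_comm_a)
  qed simp
next
  note x = pK[OF assms(1,4,6,7)] and y = pK[OF assms(2,5,6,7)]
  assume e: "pK a k c = pK a' k c"
  show "comm a' k a c"
    unfolding comm_def
  proof
    fix r assume r: "r \<in> R"
    let ?p = "pK a k c" and ?s = "T a k r"
    have "m a ?p \<boxplus> m a' ?p = (m a c \<boxplus> m a' c) \<boxplus> (m a k \<boxplus> m a' k)"
      using x y(2)[folded e] assms by (simp add: bpac)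
    then have "T a' ?p (T a ?p ?s) = T a' c (T a c (T a' k (T a k ?s)))"
      by (intro lam2) (use assms x r in auto)
    moreover have "T a ?p ?s = T a c r" using assms r by (simp add: T_pK T_comm_a)
    moreover have "T a' ?p (T a c r) = T a' c (T a' k (T a c r))" using assms r e by (simp add: T_pK T_comm_a)
    ultimately have "T a' c (T a' k (T a c r)) = T a' c (T a c (T a' k r))" using assms r by simp
    then show "T a' k (T a c r) = T a c (T a' k r)" using T_inj[of a' c] assms r by (metis T_cl)
  qed
qed

text \<open>Commutation of the permutations \<open>T a k\<close> and \<open>T a' c\<close> means both that adding \<open>a\<close> and \<open>a'\<close> at \<open>k\<close> and at
  \<open>c\<close> gives the same result, so that the \<open>a'\<close> with this property form a subgroup, and that adding \<open>k\<close> and \<open>c\<close>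
  at \<open>a\<close> and at \<open>a'\<close> gives the same result, so that it is an equivalence relation. Subgroups which partition
  a group leave no room for a nontrivial deviation between the two additions.\<close>

lemma all_comm:
  assumes "k \<in> K" "c \<in> K" "a \<in> A" "e \<in> A"
  shows "comm a k e c"
proof (cases "k = k0 \<or> c = k0 \<or> k = c \<or> a = a0 \<or> e = a0")
  case True
  then show ?thesis using assms by (auto simp: comm_def T_comm_k)
next
  case False
  then have n: "k \<noteq> c" "k \<noteq> k0" "c \<noteq> k0" "a \<noteq> a0" "e \<noteq> a0" by auto
  have self: "comm x k x c" if "x \<in> A" for x using that assms by (auto simp: comm_def T_comm_a)
  have sym: "comm x k y c \<longleftrightarrow> comm y k x c" if "x \<in> A" "y \<in> A" for x y
  proof -
    have "pA k x y = pA k y x" "pA c x y = pA c y x" using that unfolding pA_def by (simp_all add: bp_comm assms)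
    then show ?thesis using comm_pA[OF assms(1,2) n(1-3)] that by simp
  qed
  have sub: "comm (pA k x y) k t c" if "comm x k t c" "comm y k t c" "x \<in> A" "y \<in> A" "t \<in> A" for x y t
    using that assms n pA[of k x y] unfolding comm_def by (simp add: T_pA)
  have pKiff: "comm x k y c \<longleftrightarrow> pK x k c = pK y k c" if "x \<in> A" "y \<in> A" "x \<noteq> a0" "y \<noteq> a0" for x y
    using that comm_pK[of y x k c] self[of x] assms by (cases "x = y") auto
  \<comment> \<open>With \<open>s\<close> the sum of \<open>x\<close> and \<open>y\<close> at
    \<open>c\<close>, the permutation of the element in question at \<open>k\<close> is the product
    of those of \<open>s\<close> and \<open>x\<close> at \<open>k\<close>, and the permutation of
    \<open>y\<close> at \<open>c\<close> is the product of those of \<open>s\<close> and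
    \<open>x\<close> at \<open>c\<close>. By \<open>lam2\<close> the order in which \<open>k\<close>
    and \<open>c\<close> are used for the pair \<open>s\<close>, \<open>x\<close> does not
    matter.\<close>
  have W: "comm (pA k (pA c x y) x) k y c" if xy: "x \<in> A" "y \<in> A" for x y
  proof (cases "pA c x y = x")
    case True
    then have "m x c = m x c \<boxplus> m y c" using pA[of c x y] xy assms n by simp
    then have "m y c = b0" using lcan[of "m x c" "m y c" b0] xy assms by simp
    then have "y = a0" using m_inj_a[of c y a0] xy assms n by simp
    then show ?thesis using assms pA(1)[of k "pA c x a0" x] pA(1)[of c x a0] xy n by (auto simp: comm_def)
  next
    case False
    let ?s = "pA c x y" and ?x = "pA k (pA c x y) x"
    have s: "?s \<in> A" "m ?s c = m x c \<boxplus> m y c" using pA xy assms n by auto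
    have x: "?x \<in> A" "m ?x k = m ?s k \<boxplus> m x k" using pA xy assms n s by auto
    have y: "T y c r = T x c (T ?s c r)" if "r \<in> R" for r
      by (rule T_pA') (use that s xy assms n in \<open>auto simp: bpac\<close>)
    obtain t where t: "t \<in> K" "m ?s t \<boxplus> m x t = (m ?s k \<boxplus> m x k) \<boxplus> (m ?s c \<boxplus> m x c)"
      using E_sum_ex[of ?s x c k] False s xy assms by blast
    have "T ?x k (T y c r) = T y c (T ?x k r)" if r: "r \<in> R" for r
    proof -
      have e1: "T x t (T ?s t r) = T x k (T ?s k (T x c (T ?s c r)))"
        by (rule lam2) (use False s xy assms t r in auto)
      have e2: "T x t (T ?s t r) = T x c (T ?s c (T x k (T ?s k r)))"
        by (rule lam2) (use False s xy assms t r in \<open>auto simp: bp_comm\<close>)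
      have "T ?x k q = T x k (T ?s k q)" if "q \<in> R" for q
        by (rule T_pA) (use that s xy assms n in auto)
      note l = this
      have 1: "T ?x k (T y c r) = T x k (T ?s k (T y c r))" by (rule l) (use r xy assms in auto)
      have 2: "T y c (T ?x k r) = T x c (T ?s c (T ?x k r))" by (rule y) (use r x assms in auto)
      have "T ?x k (T y c r) = T x k (T ?s k (T x c (T ?s c r)))" unfolding 1 unfolding y[OF r] ..
      also have "\<dots> = T x c (T ?s c (T x k (T ?s k r)))" by (rule trans[OF e1[symmetric] e2])
      also have "\<dots> = T y c (T ?x k r)" unfolding 2 unfolding l[OF r] ..
      finally show ?thesis .
    qed
    then show ?thesis by (simp add: comm_def)
  qed
  let ?s = "pA c a e"
  let ?x = "pA k ?s a" and ?y = "pA k (pA c e a) e"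
  have s: "?s \<in> A" using pA assms n by blast
  have es: "pA c e a = ?s" unfolding pA_def by (simp add: bp_comm assms)
  have x: "?x \<in> A" "m ?x k = m ?s k \<boxplus> m a k" using pA s assms n by auto
  have y: "?y \<in> A" "m ?y k = m ?s k \<boxplus> m e k" using pA s assms n es by auto
  \<comment> \<open>\<open>?d\<close> is the deviation between the sums of \<open>a\<close> and
    \<open>e\<close> at \<open>k\<close> and at \<open>c\<close>: it is zero iff they agree. By
    \<open>W\<close>, taken in both orders, it commutes with \<open>a\<close> as well as with
    \<open>e\<close>. If it is nonzero, the equivalence relation makes \<open>a\<close> commute with
    \<open>e\<close>.\<close>
  let ?d = "pA k ?x e"
  have d: "?d \<in> A" "m ?d k = m ?x k \<boxplus> m e k" using pA x assms n by auto
  have "pA k ?y a = ?d" by (rule pA_eq) (use d x y s assms n in \<open>auto simp: bpac\<close>)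
  then have d1: "comm ?d k a c" using sub[OF W[of e a] self[of a]] assms y by auto
  have d2: "comm ?d k e c" using sub[OF W[of a e] self[of e]] assms x by auto
  show ?thesis
  proof (cases "?d = a0")
    case False
    then show ?thesis using pKiff[of ?d a] pKiff[of ?d e] pKiff[of a e] d1 d2 d n assms by auto
  next
    case True
    then have "m ?d k = b0" using assms(1) by simp
    then have "m ?x k \<boxplus> m e k = b0" by (rule trans[OF d(2)[symmetric]])
    then have "m ?x k = m e k" using bp_eq0[of "m ?x k" "m e k"] x(1) assms m_cl by blast
    then have "m ?s k \<boxplus> m a k = m e k" using x by simp
    then have "m ?s k = m a k \<boxplus> m e k" using s assms bp_eq[of "m ?s k" "m a k" "m e k"] by blast
    then have "pA k a e = ?s" by (intro pA_eq) (use s assms n in auto)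
    then show ?thesis using comm_pA[OF assms(1,2) n(1-3) assms(3,4)] by simp
  qed
qed

lemma T_comm: "\<lbrakk>k \<in> K; c \<in> K; a \<in> A; e \<in> A; r \<in> R\<rbrakk> \<Longrightarrow> T a k (T e c r) = T e c (T a k r)"
  using all_comm unfolding comm_def by blast

lemma pA_indep:
  assumes "k \<in> K" "c \<in> K" "k \<noteq> k0" "c \<noteq> k0" "a \<in> A" "a' \<in> A"
  shows "pA k a a' = pA c a a'"
  using comm_pA[of k c a a'] all_comm assms by (cases "k = c") auto

lemma pK_indep:
  assumes "a \<in> A" "a' \<in> A" "a \<noteq> a0" "a' \<noteq> a0" "k \<in> K" "c \<in> K"
  shows "pK a k c = pK a' k c"
  using comm_pK[of a a' k c] all_comm assms by (cases "a = a'") auto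

end

section \<open>The field\<close>

locale biadditive_algebra =
  fixes B :: "'b set" and R :: "'r set" and b0 e :: 'b and r0 u :: 'r
    and bp :: "'b \<Rightarrow> 'b \<Rightarrow> 'b" (infixl "\<boxplus>" 65) and rp :: "'r \<Rightarrow> 'r \<Rightarrow> 'r" (infixl "\<uplus>" 65)
    and M :: "'b \<Rightarrow> 'r \<Rightarrow> 'b" and Q :: "'b \<Rightarrow> 'r \<Rightarrow> 'r"
  assumes el[simp, intro]: "b0 \<in> B" "e \<in> B" "r0 \<in> R" "u \<in> R"
    and ne: "e \<noteq> b0" "u \<noteq> r0"
    and bp_cl[simp, intro]: "\<lbrakk>x \<in> B; y \<in> B\<rbrakk> \<Longrightarrow> x \<boxplus> y \<in> B"
    and bp_assoc: "\<lbrakk>x \<in> B; y \<in> B; z \<in> B\<rbrakk> \<Longrightarrow> x \<boxplus> y \<boxplus> z = x \<boxplus> (y \<boxplus> z)"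
    and bp_comm: "\<lbrakk>x \<in> B; y \<in> B\<rbrakk> \<Longrightarrow> x \<boxplus> y = y \<boxplus> x"
    and bp_0[simp]: "x \<in> B \<Longrightarrow> b0 \<boxplus> x = x"
    and bp_2[simp]: "x \<in> B \<Longrightarrow> x \<boxplus> x = b0"
    and rp_cl[simp, intro]: "\<lbrakk>r \<in> R; s \<in> R\<rbrakk> \<Longrightarrow> r \<uplus> s \<in> R"
    and rp_assoc: "\<lbrakk>r \<in> R; s \<in> R; t \<in> R\<rbrakk> \<Longrightarrow> r \<uplus> s \<uplus> t = r \<uplus> (s \<uplus> t)"
    and rp_comm: "\<lbrakk>r \<in> R; s \<in> R\<rbrakk> \<Longrightarrow> r \<uplus> s = s \<uplus> r"
    and rp_0[simp]: "r \<in> R \<Longrightarrow> r0 \<uplus> r = r"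
    and rp_2[simp]: "r \<in> R \<Longrightarrow> r \<uplus> r = r0"
    and M_cl[simp, intro]: "\<lbrakk>x \<in> B; r \<in> R\<rbrakk> \<Longrightarrow> M x r \<in> B"
    and Q_cl[simp, intro]: "\<lbrakk>x \<in> B; r \<in> R\<rbrakk> \<Longrightarrow> Q x r \<in> R"
    and M_l: "\<lbrakk>x \<in> B; y \<in> B; r \<in> R\<rbrakk> \<Longrightarrow> M (x \<boxplus> y) r = M x r \<boxplus> M y r"
    and M_r: "\<lbrakk>x \<in> B; r \<in> R; s \<in> R\<rbrakk> \<Longrightarrow> M x (r \<uplus> s) = M x r \<boxplus> M x s"
    and Q_l: "\<lbrakk>x \<in> B; y \<in> B; r \<in> R\<rbrakk> \<Longrightarrow> Q (x \<boxplus> y) r = Q x r \<uplus> Q y r"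
    and Q_r: "\<lbrakk>x \<in> B; r \<in> R; s \<in> R\<rbrakk> \<Longrightarrow> Q x (r \<uplus> s) = Q x r \<uplus> Q x s"
    and M_1[simp]: "x \<in> B \<Longrightarrow> M x u = x"
    and Q_1[simp]: "r \<in> R \<Longrightarrow> Q e r = r"
    and M_0: "\<lbrakk>x \<in> B; r \<in> R; M x r = b0\<rbrakk> \<Longrightarrow> x = b0 \<or> r = r0"
    and Q_0: "\<lbrakk>x \<in> B; r \<in> R; Q x r = r0\<rbrakk> \<Longrightarrow> x = b0 \<or> r = r0"
    and M_surj: "\<lbrakk>r \<in> R; r \<noteq> r0; x \<in> B\<rbrakk> \<Longrightarrow> \<exists>y\<in>B. M y r = x"
    and Q_surj: "\<lbrakk>x \<in> B; x \<noteq> b0; r \<in> R\<rbrakk> \<Longrightarrow> \<exists>s\<in>R. Q x s = r"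
    and MQ_inj: "\<lbrakk>x \<in> B; x' \<in> B; r \<in> R; r' \<in> R; x \<noteq> b0; r \<noteq> r0; M x r = M x' r'; Q x r = Q x' r'\<rbrakk> \<Longrightarrow> x = x' \<and> r = r'"
    and base_point_regularity: "\<lbrakk>x \<in> B; x' \<in> B; x \<noteq> x'; r \<in> R; r' \<in> R; M x r = M x' r'; M x r \<noteq> b0\<rbrakk> \<Longrightarrow>
        \<exists>s\<in>R. M (x \<boxplus> x') s = M x r \<and> Q (x \<boxplus> x') s = Q x r \<uplus> Q x' r'"
    and base_line_regularity: "\<lbrakk>x \<in> B; x' \<in> B; r \<in> R; r' \<in> R; r \<noteq> r'; Q x r = Q x' r'; Q x r \<noteq> r0\<rbrakk> \<Longrightarrow>
        \<exists>y\<in>B. Q y (r \<uplus> r') = Q x r \<and> M y (r \<uplus> r') = M x r \<boxplus> M x' r'"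
begin

text \<open>The axioms are symmetric under exchanging the two groups together with \<open>M\<close>
  and \<open>Q\<close>; hence each identity derived below yields a second one.\<close>

lemma dual: "biadditive_algebra R B r0 u b0 e (\<uplus>) (\<boxplus>) (\<lambda>r x. Q x r) (\<lambda>r x. M x r)"
proof unfold_locales
  show "x = x' \<and> r = r'" if "x \<in> R" "x' \<in> R" "r \<in> B" "r' \<in> B" "x \<noteq> r0" "r \<noteq> b0" "Q r x = Q r' x'" "M r x = M r' x'"
    for x x' r r' using MQ_inj[of r r' x x'] that by auto
  show "\<exists>s\<in>B. Q s (x \<uplus> x') = Q r x \<and> M s (x \<uplus> x') = M r x \<boxplus> M r' x'"
    if "x \<in> R" "x' \<in> R" "x \<noteq> x'" "r \<in> B" "r' \<in> B" "Q r x = Q r' x'" "Q r x \<noteq> r0" for x x' r r'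
    by (rule base_line_regularity) (use that in auto)
  show "\<exists>y\<in>R. M (r \<boxplus> r') y = M r x \<and> Q (r \<boxplus> r') y = Q r x \<uplus> Q r' x'"
    if "x \<in> R" "x' \<in> R" "r \<in> B" "r' \<in> B" "r \<noteq> r'" "M r x = M r' x'" "M r x \<noteq> b0" for x x' r r'
    by (rule base_point_regularity) (use that in auto)
qed (auto simp: ne M_l M_r Q_l Q_r M_surj Q_surj intro: bp_assoc rp_assoc bp_comm rp_comm dest: M_0 Q_0)

lemma bp_0r[simp]: "x \<in> B \<Longrightarrow> x \<boxplus> b0 = x" using bp_comm[of x b0] by simp
lemma rp_0r[simp]: "r \<in> R \<Longrightarrow> r \<uplus> r0 = r" using rp_comm[of r r0] by simp
lemma bp_self[simp]: "\<lbrakk>x \<in> B; y \<in> B\<rbrakk> \<Longrightarrow> x \<boxplus> (x \<boxplus> y) = y" using bp_assoc[of x x y] by simp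
lemma rp_self[simp]: "\<lbrakk>r \<in> R; s \<in> R\<rbrakk> \<Longrightarrow> r \<uplus> (r \<uplus> s) = s" using rp_assoc[of r r s] by simp
lemma bp_lcomm: "\<lbrakk>x \<in> B; y \<in> B; z \<in> B\<rbrakk> \<Longrightarrow> x \<boxplus> (y \<boxplus> z) = y \<boxplus> (x \<boxplus> z)"
  using bp_assoc[of x y z] bp_assoc[of y x z] bp_comm[of x y] by simp
lemma rp_lcomm: "\<lbrakk>x \<in> R; y \<in> R; z \<in> R\<rbrakk> \<Longrightarrow> x \<uplus> (y \<uplus> z) = y \<uplus> (x \<uplus> z)"
  using rp_assoc[of x y z] rp_assoc[of y x z] rp_comm[of x y] by simp

lemmas bpac = bp_assoc bp_comm bp_lcomm
lemmas rpac = rp_assoc rp_comm rp_lcomm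

lemma bp_eq0: "\<lbrakk>x \<in> B; y \<in> B; x \<boxplus> y = b0\<rbrakk> \<Longrightarrow> x = y" using bp_self[of x y] by simp
lemma rp_eq0: "\<lbrakk>x \<in> R; y \<in> R; x \<uplus> y = r0\<rbrakk> \<Longrightarrow> x = y" using rp_self[of x y] by simp

lemma M_r0[simp]: "x \<in> B \<Longrightarrow> M x r0 = b0" using M_r[of x r0 r0] by simp
lemma M_b0[simp]: "r \<in> R \<Longrightarrow> M b0 r = b0" using M_l[of b0 b0 r] by simp
lemma Q_r0[simp]: "x \<in> B \<Longrightarrow> Q x r0 = r0" using Q_r[of x r0 r0] by simp
lemma Q_b0[simp]: "r \<in> R \<Longrightarrow> Q b0 r = r0" using Q_l[of b0 b0 r] by simp

lemma M_inj_r: "\<lbrakk>x \<in> B; x \<noteq> b0; r \<in> R; s \<in> R; M x r = M x s\<rbrakk> \<Longrightarrow> r = s"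
  using M_0[of x "r \<uplus> s"] M_r[of x r s] rp_eq0[of r s] by auto

lemma Q_inj_b: "\<lbrakk>r \<in> R; r \<noteq> r0; x \<in> B; y \<in> B; Q x r = Q y r\<rbrakk> \<Longrightarrow> x = y"
  using Q_0[of "x \<boxplus> y" r] Q_l[of x y r] bp_eq0[of x y] by auto

text \<open>Points \<open>(0, 0, 0)\<close> and \<open>(x, l, y)\<close> are collinear.\<close>
definition Cq :: "'b \<Rightarrow> 'b \<Rightarrow> 'r \<Rightarrow> bool" where
  "Cq x y l \<longleftrightarrow> x \<in> B \<and> y \<in> B \<and> l \<in> R \<and> ((\<exists>h\<in>R. M x h = y \<and> Q x h = l) \<or> x = b0 \<and> l = r0)"

text \<open>For a fixed value \<open>y\<close>, the pairs \<open>(x, l)\<close> related by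
  \<open>Cq\<close> are closed under adding \<open>(n, Q n k)\<close> with \<open>M n k = y\<close>.
  In general position this is \<open>base_point_regularity\<close>; the degenerate positions follow
  from injectivity and the absence of zero divisors.\<close>

lemma Cq_shear1:
  assumes C: "Cq x y l" and n: "n \<in> B" "k \<in> R" "M n k = y"
  shows "Cq (x \<boxplus> n) y (l \<uplus> Q n k)"
proof -
  have xy: "x \<in> B" "y \<in> B" "l \<in> R" using C by (auto simp: Cq_def)
  show ?thesis
  proof (cases "x = b0 \<and> l = r0")
    case True
    then show ?thesis using n xy by (auto simp: Cq_def)
  next
    case False
    then obtain h where h: "h \<in> R" "M x h = y" "Q x h = l" using C by (auto simp: Cq_def)
    then have x0: "x \<noteq> b0" using False by auto
    show ?thesis
    proof (cases "x = n")
      case True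
      then have "M x h = M x k" using h(2) n(3) by metis
      then have "h = k" by (rule M_inj_r[OF xy(1) x0 h(1) n(2)])
      then show ?thesis using True h n xy by (auto simp: Cq_def)
    next
      case xn: False
      show ?thesis
      proof (cases "y = b0")
        case True
        then have "h = r0" using M_0[of x h] h(1,2) x0 xy(1) by metis
        then have l: "l = r0" using h(3) xy(1) by simp
        have "n = b0 \<or> k = r0" using M_0[of n k] n True by metis
        then have q: "Q n k = r0" using n(1,2) by auto
        have "M (x \<boxplus> n) r0 = b0" "Q (x \<boxplus> n) r0 = r0 \<uplus> r0" using n(1) xy(1) by simp_all
        then show ?thesis unfolding Cq_def True l q using n(1) xy(1) el bp_cl rp_cl by metis
      next
        case False
        then obtain s where "s \<in> R" "M (x \<boxplus> n) s = y" "Q (x \<boxplus> n) s = l \<uplus> Q n k"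
          using base_point_regularity[of x n h k] h n(1,2) n(3) xy(1) xn by metis
        then show ?thesis using n xy by (auto simp: Cq_def)
      qed
    qed
  qed
qed

lemma Cq_shear2:
  assumes C: "Cq x y l" and k: "k \<in> R"
  shows "Cq x (y \<boxplus> M x k) (l \<uplus> Q x k)"
proof -
  have xy: "x \<in> B" "y \<in> B" "l \<in> R" using C by (auto simp: Cq_def)
  consider "x = b0" "l = r0" | h where "h \<in> R" "M x h = y" "Q x h = l" using C by (auto simp: Cq_def)
  then show ?thesis
  proof cases
    case 1 then show ?thesis using xy k by (auto simp: Cq_def)
  next
    case 2 then show ?thesis using xy k by (auto simp: Cq_def M_r Q_r intro!: bexI[of _ "h \<uplus> k"])
  qed
qed

text \<open>Three alternating shears compose to an exchange of two coordinates, as for elementary 2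
  by 2 matrices.\<close>

lemma Cq_swap:
  assumes C: "Cq x y l" and n: "n \<in> B" "k \<in> R" "M n k = y"
  shows "Cq n (M x k) l"
proof -
  have xy: "x \<in> B" "y \<in> B" "l \<in> R" using C by (auto simp: Cq_def)
  have "Cq (x \<boxplus> n) y (l \<uplus> Q n k)" by (rule Cq_shear1[OF C n])
  then have "Cq (x \<boxplus> n) (y \<boxplus> M (x \<boxplus> n) k) (l \<uplus> Q n k \<uplus> Q (x \<boxplus> n) k)" by (rule Cq_shear2) (rule n)
  then have "Cq (x \<boxplus> n) (M x k) (l \<uplus> Q x k)" using xy n by (simp add: M_l Q_l bpac rpac)
  then have "Cq (x \<boxplus> n \<boxplus> x) (M x k) (l \<uplus> Q x k \<uplus> Q x k)" by (rule Cq_shear1) (use xy n in auto)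
  then show ?thesis using xy n by (simp add: bpac rpac)
qed

lemma Cq_hom:
  assumes "Cq (M n k) y l" "n \<in> B" "k \<in> R"
  shows "Cq n (M y k) l"
proof -
  have y: "y \<in> B" using assms by (auto simp: Cq_def)
  have "Cq y (M n k) l" using Cq_swap[OF assms(1) y el(4)] assms y by simp
  then show ?thesis using Cq_swap[of y "M n k" l n k] assms by simp
qed

text \<open>In the model the identities read \<open>a^2 (k^2 h) = (a k)^2 h\<close> and
  \<open>a (k^2 h) = a k h k\<close>. For each nonzero \<open>x\<close>, \<open>Cq_hom\<close>
  provides some \<open>g\<close> with the required values of \<open>M x g\<close> and
  \<open>Q x g\<close>; the point is that one \<open>g\<close> works for all \<open>x\<close>.
  Additivity applied to \<open>a\<close>, \<open>e\<close> and their sum reduces this to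
  \<open>MQ_inj\<close>, with \<open>g = Q (M e k) h\<close> read off at
  \<open>x = e\<close>.\<close>

lemma QM_MM:
  assumes a: "a \<in> B" "k \<in> R" "h \<in> R"
  shows "Q a (Q (M e k) h) = Q (M a k) h" "M a (Q (M e k) h) = M (M (M a k) h) k"
proof -
  have ex: "\<exists>g\<in>R. M x g = M (M (M x k) h) k \<and> Q x g = Q (M x k) h" if x: "x \<in> B" "x \<noteq> b0" for x
  proof -
    have "Cq (M x k) (M (M x k) h) (Q (M x k) h)" using x a by (auto simp: Cq_def)
    then have "Cq x (M (M (M x k) h) k) (Q (M x k) h)" by (rule Cq_hom) (use x a in auto)
    then show ?thesis using x by (auto simp: Cq_def)
  qed
  obtain ge where ge: "ge \<in> R" "M e ge = M (M (M e k) h) k" "Q e ge = Q (M e k) h" using ex[of e] ne by auto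
  have gee: "ge = Q (M e k) h" using ge by simp
  have "M a ge = M (M (M a k) h) k \<and> Q a ge = Q (M a k) h"
  proof (cases "a = b0 \<or> a = e")
    case True then show ?thesis using ge a by auto
  next
    case False
    then obtain g where g: "g \<in> R" "M a g = M (M (M a k) h) k" "Q a g = Q (M a k) h" using ex[of a] a by auto
    have "a \<boxplus> e \<noteq> b0" using bp_eq0 False a by auto
    then obtain g3 where g3: "g3 \<in> R" "M (a \<boxplus> e) g3 = M (M (M (a \<boxplus> e) k) h) k" "Q (a \<boxplus> e) g3 = Q (M (a \<boxplus> e) k) h"
      using ex[of "a \<boxplus> e"] a by auto
    have 1: "M a g3 \<boxplus> M e g3 = M a g \<boxplus> M e ge" using g g3 ge a by (simp add: M_l)
    have 2: "Q a g3 \<uplus> Q e g3 = Q a g \<uplus> Q e ge"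
      unfolding g(3) ge(3) using g3(3) g3(1) a by (simp only: M_l Q_l M_cl el)
    have 3: "M a (g \<uplus> g3) = M e (ge \<uplus> g3)"
    proof -
      have "M a (g \<uplus> g3) = M a g \<boxplus> M e ge \<boxplus> (M e ge \<boxplus> M a g3)" using a g(1) ge(1) g3(1) by (simp add: M_r bpac)
      also have "\<dots> = M a g3 \<boxplus> M e g3 \<boxplus> (M e ge \<boxplus> M a g3)" by (simp only: 1)
      also have "\<dots> = M e (ge \<uplus> g3)" using a g(1) ge(1) g3(1) by (simp add: M_r bpac)
      finally show ?thesis .
    qed
    have 4: "Q a (g \<uplus> g3) = Q e (ge \<uplus> g3)"
    proof -
      have "Q a (g \<uplus> g3) = Q a g \<uplus> Q e ge \<uplus> (Q e ge \<uplus> Q a g3)" using a g(1) ge(1) g3(1) by (simp add: Q_r rpac)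
      also have "\<dots> = Q a g3 \<uplus> Q e g3 \<uplus> (Q e ge \<uplus> Q a g3)" by (simp only: 2)
      also have "\<dots> = Q e (ge \<uplus> g3)" using a g(1) ge(1) g3(1) by (simp add: Q_r rpac)
      finally show ?thesis .
    qed
    have "g \<uplus> g3 = r0"
      using MQ_inj[of a e "g \<uplus> g3" "ge \<uplus> g3"] 3 4 False a g(1) ge(1) g3(1) by auto
    then have "g = g3" and "M e (ge \<uplus> g3) = b0" using rp_eq0[of g g3] g(1) g3(1) a 3 by auto
    then have "g = ge" using M_0[of e "ge \<uplus> g3"] rp_eq0[of ge g3] ge(1) g3(1) ne by auto
    then show ?thesis using g by simp
  qed
  then show "Q a (Q (M e k) h) = Q (M a k) h" "M a (Q (M e k) h) = M (M (M a k) h) k" using gee by auto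
qed

lemma MQ_QQ:
  assumes "r \<in> R" "k \<in> B" "h \<in> B"
  shows "M (M h (Q k u)) r = M h (Q k r)" "Q (M h (Q k u)) r = Q k (Q h (Q k r))"
  using biadditive_algebra.QM_MM[OF dual assms] by auto

lemma QQ_sq: "\<lbrakk>k \<in> B; r \<in> R\<rbrakk> \<Longrightarrow> Q (M e (Q k u)) r = Q k (Q k r)"
  using MQ_QQ(2)[of r k e] by simp

text \<open>Write \<open>r = Q k a\<close>. Then both sides equal \<open>Q (M h (Q k u)) a\<close>:
  one by \<open>MQ_QQ\<close>, the other by \<open>QM_MM\<close> and the formula for
  squares.\<close>

lemma QQ_comm:
  assumes "h \<in> B" "k \<in> B" "r \<in> R"
  shows "Q h (Q k r) = Q k (Q h r)"
proof (cases "k = b0")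
  case False
  then obtain a where a: "a \<in> R" "Q k a = r" using Q_surj assms by blast
  have "Q k (Q h (Q k a)) = Q h (Q (M e (Q k u)) a)" using QM_MM(1)[of h "Q k u" a] MQ_QQ(2)[of a k h] a assms by simp
  also have "\<dots> = Q h (Q k (Q k a))" using QQ_sq a assms by simp
  finally show ?thesis using a by simp
qed (use assms in auto)

lemma Q_eps_Q: "\<lbrakk>a \<in> B; k \<in> R; s \<in> R\<rbrakk> \<Longrightarrow> Q (M e (Q a k)) s = Q a (Q a (Q (M e k) s))"
  using MQ_QQ(1)[of k a e] QM_MM(1)[of "M e (Q a u)" k s] QQ_sq[of a "Q (M e k) s"] by simp

lemma Q_M: "\<lbrakk>a \<in> B; k \<in> R; s \<in> R\<rbrakk> \<Longrightarrow> Q (M a k) s = Q a (Q (M e k) s)"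
  using QM_MM(1) by simp

text \<open>In the mixed quadrangle \<open>M x r = x r\<close> and \<open>Q x r = x\<^sup>2 r\<close>, so that the field is recovered from the operators
  \<open>r \<mapsto> x\<^sup>2 r\<close> on \<open>R\<close>; an operator \<open>f\<close> belongs to it iff \<open>(f r)\<^sup>2 = f\<^sup>2 r\<^sup>2\<close>.\<close>
definition FF :: "('r \<Rightarrow> 'r) set" where
  "FF = {f \<in> extensional R. (\<forall>r\<in>R. f r \<in> R) \<and> (\<forall>r\<in>R. \<forall>s\<in>R. f (r \<uplus> s) = f r \<uplus> f s) \<and>
     (\<forall>b\<in>B. \<forall>r\<in>R. f (Q b r) = Q b (f r)) \<and>
     (\<forall>r\<in>R. \<forall>s\<in>R. Q (M e (f r)) s = f (f (Q (M e r) s)))}"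

section \<open>The ring of operators and its inverses\<close>

definition KK :: "('r \<Rightarrow> 'r) ring" where
  "KK = \<lparr>carrier = FF, monoid.mult = (\<lambda>f g. compose R f g), one = (\<lambda>r\<in>R. r),
     zero = (\<lambda>r\<in>R. r0), add = (\<lambda>f g. \<lambda>r\<in>R. f r \<uplus> g r)\<rparr>"

definition qe :: "'b \<Rightarrow> 'r \<Rightarrow> 'r" where "qe b = (\<lambda>r\<in>R. Q b r)"

lemma KK_simps: "carrier KK = FF" "f \<otimes>\<^bsub>KK\<^esub> g = compose R f g" "\<one>\<^bsub>KK\<^esub> = (\<lambda>r\<in>R. r)" "\<zero>\<^bsub>KK\<^esub> = (\<lambda>r\<in>R. r0)"
  "f \<oplus>\<^bsub>KK\<^esub> g = (\<lambda>r\<in>R. f r \<uplus> g r)"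
  by (simp_all add: KK_def)

lemma FF:
  assumes "f \<in> FF"
  shows "f \<in> extensional R" "r \<in> R \<Longrightarrow> f r \<in> R" "\<lbrakk>r \<in> R; s \<in> R\<rbrakk> \<Longrightarrow> f (r \<uplus> s) = f r \<uplus> f s"
    "\<lbrakk>b \<in> B; r \<in> R\<rbrakk> \<Longrightarrow> f (Q b r) = Q b (f r)" "\<lbrakk>r \<in> R; s \<in> R\<rbrakk> \<Longrightarrow> Q (M e (f r)) s = f (f (Q (M e r) s))"
  using assms by (auto simp: FF_def)

lemma FF_ext: "\<lbrakk>f \<in> extensional R; g \<in> extensional R; \<And>r. r \<in> R \<Longrightarrow> f r = g r\<rbrakk> \<Longrightarrow> f = g"
  by (rule extensionalityI)

lemma qe_FF: "b \<in> B \<Longrightarrow> qe b \<in> FF"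
  by (auto simp: FF_def qe_def Q_r Q_eps_Q intro: QQ_comm)

lemma FF_sq: "\<lbrakk>f \<in> FF; s \<in> R\<rbrakk> \<Longrightarrow> f (f s) = Q (M e (f u)) s"
  using FF(5)[of f u s] by simp

lemma eps_inj: "\<lbrakk>p \<in> R; q \<in> R; \<And>s. s \<in> R \<Longrightarrow> Q (M e p) s = Q (M e q) s\<rbrakk> \<Longrightarrow> p = q"
  using Q_inj_b[of u "M e p" "M e q"] M_inj_r[of e p q] ne by auto

text \<open>An element of \<open>R\<close> is determined by the operator of its square, so it
  suffices to compare the squares of both sides. These are products of the squares of
  \<open>f\<close>, \<open>g\<close> and \<open>r\<close>, and the square of \<open>f\<close> is
  \<open>Q (M e (f u))\<close>, one of the commuting operators.\<close>

lemma FF_comm: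
  assumes f: "f \<in> FF" and g: "g \<in> FF" and r: "r \<in> R"
  shows "f (g r) = g (f r)"
proof (rule eps_inj)
  show "f (g r) \<in> R" "g (f r) \<in> R" using FF(2) f g r by auto
  fix s assume s: "s \<in> R"
  have "Q (M e (f (g r))) s = f (f (Q (M e (g r)) s))" using FF(5)[OF f, of "g r" s] FF(2)[OF g r] s by simp
  also have "\<dots> = Q (M e (f u)) (Q (M e (g u)) (Q (M e r) s))"
    using FF(5)[OF g r s] FF_sq[OF f] FF_sq[OF g] FF(2)[OF g] FF(2)[OF f] r s by simp
  also have "\<dots> = Q (M e (g u)) (Q (M e (f u)) (Q (M e r) s))" using FF(2)[OF f] FF(2)[OF g] r s by (intro QQ_comm) auto
  also have "\<dots> = g (g (Q (M e (f r)) s))"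
    using FF(5)[OF f r s] FF_sq[OF f] FF_sq[OF g] FF(2)[OF g] FF(2)[OF f] r s by simp
  also have "\<dots> = Q (M e (g (f r))) s" using FF(5)[OF g, of "f r" s] FF(2)[OF f r] s by simp
  finally show "Q (M e (f (g r))) s = Q (M e (g (f r))) s" .
qed

lemma FF_mult: "\<lbrakk>f \<in> FF; g \<in> FF\<rbrakk> \<Longrightarrow> compose R f g \<in> FF"
proof -
  assume f: "f \<in> FF" and g: "g \<in> FF"
  have "Q (M e (f (g r))) s = f (g (f (g (Q (M e r) s))))" if "r \<in> R" "s \<in> R" for r s
  proof -
    have "Q (M e (f (g r))) s = f (f (g (g (Q (M e r) s))))"
      using FF(5)[OF f, of "g r" s] FF(5)[OF g that] FF(2)[OF g] that by simp
    then show ?thesis using FF_comm[OF f g, of "g (Q (M e r) s)"] FF(2)[OF g] that by simp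
  qed
  then show ?thesis using FF(2-4)[OF f] FF(2-4)[OF g] by (auto simp: FF_def compose_eq)
qed

lemma FF_add: "\<lbrakk>f \<in> FF; g \<in> FF\<rbrakk> \<Longrightarrow> (\<lambda>r\<in>R. f r \<uplus> g r) \<in> FF"
proof -
  assume f: "f \<in> FF" and g: "g \<in> FF"
  have 1: "f r \<in> R" "g r \<in> R" if "r \<in> R" for r using FF(2) f g that by auto
  have "Q (M e (f r \<uplus> g r)) s = f (f (Q (M e r) s) \<uplus> g (Q (M e r) s)) \<uplus> g (f (Q (M e r) s) \<uplus> g (Q (M e r) s))"
    if "r \<in> R" "s \<in> R" for r s
  proof -
    let ?t = "Q (M e r) s"
    have t: "?t \<in> R" using that by auto
    have "Q (M e (f r \<uplus> g r)) s = f (f ?t) \<uplus> g (g ?t)"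
      using that 1 FF(5)[OF f that] FF(5)[OF g that] by (simp add: M_r Q_l)
    also have "\<dots> = f (f ?t) \<uplus> f (g ?t) \<uplus> (g (f ?t) \<uplus> g (g ?t))"
      using 1 t FF_comm[OF f g t] by (simp add: rpac)
    finally show ?thesis using FF(3)[OF f] FF(3)[OF g] t 1 by simp
  qed
  moreover have "f (r \<uplus> s) \<uplus> g (r \<uplus> s) = f r \<uplus> g r \<uplus> (f s \<uplus> g s)" if "r \<in> R" "s \<in> R" for r s
    using FF(3)[OF f that] FF(3)[OF g that] 1 that by (simp add: rpac)
  ultimately show ?thesis using FF(4)[OF f] FF(4)[OF g] 1 by (auto simp: FF_def Q_r)
qed

lemma FF_0: "(\<lambda>r\<in>R. r0) \<in> FF" and FF_1: "(\<lambda>r\<in>R. r) \<in> FF"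
  by (auto simp: FF_def)

text \<open>The square of \<open>f\<close> is the operator of \<open>c = M e (f u)\<close>. Solving
  \<open>c^2 h = 1\<close> gives \<open>f f c^2 h^2 = c^4 h^2 = 1\<close>, so
  \<open>f c^2 h^2\<close> is inverse to \<open>f\<close>. This form of the inverse uses, besides
  \<open>f\<close>, only operators from \<open>LL'\<close>, so that it also proves a subring
  containing \<open>LL'\<close> closed under inverses.\<close>

lemma FF_inv:
  assumes f: "f \<in> FF" and nz: "f \<noteq> (\<lambda>r\<in>R. r0)"
  shows "\<exists>h\<in>R. Q (M e (f u)) h = u \<and>
    compose R f (compose R f (compose R (qe (M e (f u))) (qe (M e h)))) = (\<lambda>r\<in>R. r)"
proof -
  let ?c = "M e (f u)"
  have c: "?c \<in> B" using FF(2)[OF f] by auto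
  have "?c \<noteq> b0"
  proof
    assume z: "?c = b0"
    have "f r = r0" if r: "r \<in> R" for r
    proof (rule eps_inj)
      fix s assume s: "s \<in> R"
      show "Q (M e (f r)) s = Q (M e r0) s" using FF(5)[OF f r s] FF_sq[OF f] z r s by simp
    qed (use FF(2)[OF f r] in auto)
    then have "f = (\<lambda>r\<in>R. r0)" using FF(1)[OF f] by (intro FF_ext) auto
    then show False using nz by simp
  qed
  then obtain h where h: "h \<in> R" "Q ?c h = u" using Q_surj c by blast
  have "f (f (Q ?c (Q (M e h) s))) = s" if s: "s \<in> R" for s
  proof -
    have "f (f (Q ?c (Q (M e h) s))) = Q ?c (Q ?c (Q (M e h) s))" using FF_sq[OF f] c h s by simp
    also have "\<dots> = s" using Q_eps_Q[OF c h(1) s] h s by simp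
    finally show ?thesis .
  qed
  then have "compose R f (compose R f (compose R (qe ?c) (qe (M e h)))) = (\<lambda>r\<in>R. r)"
    using c h by (auto simp: compose_def qe_def)
  then show ?thesis using h by blast
qed

lemma KK_cring: "cring KK"
proof (rule cringI)
  show "abelian_group KK"
  proof (rule abelian_groupI)
    fix f g h assume f: "f \<in> carrier KK" and g: "g \<in> carrier KK" and h: "h \<in> carrier KK"
    note F = FF(2)[OF f[unfolded KK_simps]] FF(2)[OF g[unfolded KK_simps]] FF(2)[OF h[unfolded KK_simps]]
    show "f \<oplus>\<^bsub>KK\<^esub> g \<in> carrier KK" using f g FF_add by (simp add: KK_simps)
    show "f \<oplus>\<^bsub>KK\<^esub> g \<oplus>\<^bsub>KK\<^esub> h = f \<oplus>\<^bsub>KK\<^esub> (g \<oplus>\<^bsub>KK\<^esub> h)" using F by (auto simp: KK_simps rp_assoc intro: restrict_ext)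
    show "f \<oplus>\<^bsub>KK\<^esub> g = g \<oplus>\<^bsub>KK\<^esub> f" using F by (auto simp: KK_simps rp_comm intro: restrict_ext)
    show "\<zero>\<^bsub>KK\<^esub> \<oplus>\<^bsub>KK\<^esub> f = f"
      using F FF(1)[OF f[unfolded KK_simps]] by (intro FF_ext) (auto simp: KK_simps)
    show "\<exists>y\<in>carrier KK. y \<oplus>\<^bsub>KK\<^esub> f = \<zero>\<^bsub>KK\<^esub>" using f F by (intro bexI[of _ f]) (auto simp: KK_simps intro: restrict_ext)
  qed (simp add: KK_simps FF_0)
  show "comm_monoid KK"
  proof (rule comm_monoidI)
    fix f g h assume f: "f \<in> carrier KK" and g: "g \<in> carrier KK" and h: "h \<in> carrier KK"
    note F = FF(2)[OF f[unfolded KK_simps]] FF(2)[OF g[unfolded KK_simps]] FF(2)[OF h[unfolded KK_simps]]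
    show "f \<otimes>\<^bsub>KK\<^esub> g \<in> carrier KK" using f g FF_mult by (simp add: KK_simps)
    show "f \<otimes>\<^bsub>KK\<^esub> g \<otimes>\<^bsub>KK\<^esub> h = f \<otimes>\<^bsub>KK\<^esub> (g \<otimes>\<^bsub>KK\<^esub> h)" using F by (auto simp: KK_simps compose_def)
    show "f \<otimes>\<^bsub>KK\<^esub> g = g \<otimes>\<^bsub>KK\<^esub> f" using FF_comm f g by (auto simp: KK_simps compose_def)
    show "\<one>\<^bsub>KK\<^esub> \<otimes>\<^bsub>KK\<^esub> f = f"
      using F FF(1)[OF f[unfolded KK_simps]] by (intro FF_ext) (auto simp: KK_simps compose_def)
  qed (simp add: KK_simps FF_1)
  fix f g h assume f: "f \<in> carrier KK" and g: "g \<in> carrier KK" and h: "h \<in> carrier KK"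
  note F = FF(2)[OF f[unfolded KK_simps]] FF(2)[OF g[unfolded KK_simps]] FF(2)[OF h[unfolded KK_simps]]
  show "(f \<oplus>\<^bsub>KK\<^esub> g) \<otimes>\<^bsub>KK\<^esub> h = f \<otimes>\<^bsub>KK\<^esub> h \<oplus>\<^bsub>KK\<^esub> g \<otimes>\<^bsub>KK\<^esub> h" using F by (auto simp: KK_simps compose_def)
qed

lemma KK_field: "field KK"
proof (rule cring.cring_fieldI[OF KK_cring])
  interpret cring KK by (rule KK_cring)
  have 01: "\<one>\<^bsub>KK\<^esub> \<noteq> \<zero>\<^bsub>KK\<^esub>"
  proof
    assume "\<one>\<^bsub>KK\<^esub> = \<zero>\<^bsub>KK\<^esub>"
    then have "(\<lambda>r\<in>R. r) u = (\<lambda>r\<in>R. r0) u" by (simp only: KK_simps)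
    then show False using ne by simp
  qed
  show "Units KK = carrier KK - {\<zero>\<^bsub>KK\<^esub>}"
  proof (intro equalityI subsetI)
    fix f assume "f \<in> Units KK"
    then show "f \<in> carrier KK - {\<zero>\<^bsub>KK\<^esub>}"
      using 01 by (auto simp: Units_def)
  next
    fix f assume f: "f \<in> carrier KK - {\<zero>\<^bsub>KK\<^esub>}"
    then obtain h where h: "h \<in> R"
      "compose R f (compose R f (compose R (qe (M e (f u))) (qe (M e h)))) = (\<lambda>r\<in>R. r)"
      using FF_inv[of f] by (auto simp: KK_simps)
    let ?g = "compose R f (compose R (qe (M e (f u))) (qe (M e h)))"
    have g: "?g \<in> carrier KK" using f h FF_mult qe_FF FF(2)[of f u] by (auto simp: KK_simps)
    have "f \<otimes>\<^bsub>KK\<^esub> ?g = \<one>\<^bsub>KK\<^esub>" using h by (simp add: KK_simps)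
    then show "f \<in> Units KK" using f g m_comm[of f ?g] unfolding Units_def by auto
  qed
qed

section \<open>The subfield and the two subspaces\<close>

definition LL :: "('r \<Rightarrow> 'r) set" where "LL = qe ` B"
definition LL' :: "('r \<Rightarrow> 'r) set" where "LL' = (\<lambda>r. qe (M e r)) ` R"
text \<open>The multipliers of \<open>LL\<close>, the largest choice that makes \<open>LL\<close> a
  vector space. It lies in \<open>LL\<close> because \<open>LL\<close> contains the unit, and it
  contains \<open>LL'\<close> because multiplying by \<open>M e k\<close> realizes
  \<open>M _ k\<close>.\<close>

definition KK' :: "('r \<Rightarrow> 'r) set" where "KK' = {f \<in> FF. \<forall>b\<in>B. compose R f (qe b) \<in> LL}"

lemma qe_add: "\<lbrakk>b \<in> B; c \<in> B\<rbrakk> \<Longrightarrow> qe b \<oplus>\<^bsub>KK\<^esub> qe c = qe (b \<boxplus> c)"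
  by (auto simp: KK_simps qe_def Q_l)

lemma qe_mult_eps: "\<lbrakk>b \<in> B; k \<in> R\<rbrakk> \<Longrightarrow> qe b \<otimes>\<^bsub>KK\<^esub> qe (M e k) = qe (M b k)"
  by (auto simp: KK_simps qe_def compose_def Q_M[of b k])

lemma qe_inj: "\<lbrakk>b \<in> B; c \<in> B; qe b = qe c\<rbrakk> \<Longrightarrow> b = c"
proof -
  assume b: "b \<in> B" and c: "c \<in> B" and "qe b = qe c"
  then have "qe b u = qe c u" by simp
  then have "Q b u = Q c u" by (simp add: qe_def)
  then show "b = c" by (rule Q_inj_b[OF el(4) ne(2) b c])
qed

lemma qe_1: "qe e = \<one>\<^bsub>KK\<^esub>" by (auto simp: qe_def KK_simps)
lemma KK_sq: "f \<in> FF \<Longrightarrow> f \<otimes>\<^bsub>KK\<^esub> f = qe (M e (f u))"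
  using FF_sq by (auto simp: KK_simps qe_def compose_def)

lemma KK_mixed: "mixed_data KK KK' LL LL'"
proof -
  interpret K: field KK by (rule KK_field)
  have char2: "f \<oplus>\<^bsub>KK\<^esub> f = \<zero>\<^bsub>KK\<^esub>" if "f \<in> carrier KK" for f
    using that FF(2)[of f] by (auto simp: KK_simps intro: restrict_ext)
  then have neg: "\<ominus>\<^bsub>KK\<^esub> f = f" if "f \<in> carrier KK" for f
    using that K.minus_equality[of f f] by simp
  have LLc: "LL \<subseteq> carrier KK" using qe_FF by (auto simp: LL_def KK_simps)
  have LL'c: "LL' \<subseteq> carrier KK" using qe_FF by (auto simp: LL'_def KK_simps)
  have K'iff: "f \<in> KK' \<longleftrightarrow> f \<in> carrier KK \<and> (\<forall>g\<in>LL. f \<otimes>\<^bsub>KK\<^esub> g \<in> LL)" for f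
    by (auto simp: KK'_def KK_simps LL_def)
  have L'K': "LL' \<subseteq> KK'"
  proof
    fix f assume "f \<in> LL'"
    then obtain k where k: "k \<in> R" "f = qe (M e k)" by (auto simp: LL'_def)
    have "f \<otimes>\<^bsub>KK\<^esub> g \<in> LL" if g: "g \<in> LL" for g
    proof -
      obtain b where b: "b \<in> B" "g = qe b" using g by (auto simp: LL_def)
      have "f \<otimes>\<^bsub>KK\<^esub> g = qe b \<otimes>\<^bsub>KK\<^esub> qe (M e k)"
        using k b K.m_comm[of f g] g LLc \<open>f \<in> LL'\<close> LL'c by auto
      then show ?thesis using qe_mult_eps b k by (auto simp: LL_def)
    qed
    then show "f \<in> KK'" using K'iff \<open>f \<in> LL'\<close> LL'c by auto
  qed
  have sqL': "squares KK \<subseteq> LL'"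
    using KK_sq FF(2)[of _ u] by (auto simp: squares_def KK_simps(1) LL'_def)
  have K'L: "KK' \<subseteq> LL"
  proof
    fix f assume f: "f \<in> KK'"
    have "\<one>\<^bsub>KK\<^esub> \<in> LL" using qe_1 el(2) by (metis LL_def image_eqI)
    then have "f \<otimes>\<^bsub>KK\<^esub> \<one>\<^bsub>KK\<^esub> \<in> LL" using f K'iff by blast
    then show "f \<in> LL" using f K'iff by auto
  qed
  have Ladd: "f \<oplus>\<^bsub>KK\<^esub> g \<in> LL" if "f \<in> LL" "g \<in> LL" for f g
    using that qe_add by (auto simp: LL_def)
  have L'add: "f \<oplus>\<^bsub>KK\<^esub> g \<in> LL'" if fg: "f \<in> LL'" "g \<in> LL'" for f g
  proof -
    obtain r where r: "r \<in> R" "f = qe (M e r)" using fg(1) unfolding LL'_def by blast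
    obtain s where s: "s \<in> R" "g = qe (M e s)" using fg(2) unfolding LL'_def by blast
    note rs = r s
    then have "f \<oplus>\<^bsub>KK\<^esub> g = qe (M e (r \<uplus> s))" by (simp add: qe_add M_r)
    then show ?thesis using rs by (auto simp: LL'_def)
  qed
  have subgrp: "subgroup V (add_monoid KK)"
    if V: "V \<subseteq> carrier KK" "V \<noteq> {}" "\<And>f g. f \<in> V \<Longrightarrow> g \<in> V \<Longrightarrow> f \<oplus>\<^bsub>KK\<^esub> g \<in> V" for V
  proof (rule group.subgroupI[OF K.a_group])
    show "V \<subseteq> carrier (add_monoid KK)" "V \<noteq> {}" using V by auto
    show "inv\<^bsub>add_monoid KK\<^esub> f \<in> V" if "f \<in> V" for f
      using neg[of f] that V unfolding a_inv_def by auto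
    show "f \<otimes>\<^bsub>add_monoid KK\<^esub> g \<in> V" if "f \<in> V" "g \<in> V" for f g using V(3) that by simp
  qed
  have K'mult: "f \<otimes>\<^bsub>KK\<^esub> g \<in> KK'" if f: "f \<in> KK'" and g: "g \<in> KK'" for f g
  proof -
    have c: "f \<in> carrier KK" "g \<in> carrier KK" using f g K'iff by auto
    have "f \<otimes>\<^bsub>KK\<^esub> g \<otimes>\<^bsub>KK\<^esub> h \<in> LL" if "h \<in> LL" for h
      using f g K'iff that c LLc K.m_assoc[of f g h] by auto
    then show ?thesis using K'iff c by auto
  qed
  have K'sub: "subfield KK' KK"
  proof (rule K.subfieldI')
    show "subring KK' KK"
    proof (rule K.subringI)
      show "KK' \<subseteq> carrier KK" using K'iff by auto
      show "\<one>\<^bsub>KK\<^esub> \<in> KK'" using K'iff LLc by auto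
      show "\<ominus>\<^bsub>KK\<^esub> f \<in> KK'" if "f \<in> KK'" for f using neg[of f] that K'iff by auto
      show "f \<otimes>\<^bsub>KK\<^esub> g \<in> KK'" if "f \<in> KK'" "g \<in> KK'" for f g using K'mult that .
      show "f \<oplus>\<^bsub>KK\<^esub> g \<in> KK'" if f: "f \<in> KK'" and g: "g \<in> KK'" for f g
      proof -
        have c: "f \<in> carrier KK" "g \<in> carrier KK" using f g K'iff by auto
        have "(f \<oplus>\<^bsub>KK\<^esub> g) \<otimes>\<^bsub>KK\<^esub> h \<in> LL" if "h \<in> LL" for h
          using f g K'iff that c LLc K.l_distr[of f g h] Ladd by auto
        then show ?thesis using K'iff c by auto
      qed
    qed
    fix f assume f: "f \<in> KK' - {\<zero>\<^bsub>KK\<^esub>}"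
    then have fF: "f \<in> FF" "f \<in> carrier KK" "f \<noteq> \<zero>\<^bsub>KK\<^esub>" by (auto simp: KK'_def KK_simps)
    then obtain h where h: "h \<in> R"
      "compose R f (compose R f (compose R (qe (M e (f u))) (qe (M e h)))) = (\<lambda>r\<in>R. r)"
      using FF_inv[of f] by (auto simp: KK_simps)
    let ?g = "f \<otimes>\<^bsub>KK\<^esub> (qe (M e (f u)) \<otimes>\<^bsub>KK\<^esub> qe (M e h))"
    have "qe (M e (f u)) \<in> KK'" "qe (M e h) \<in> KK'"
      using L'K' h FF(2)[OF fF(1), of u] by (auto simp: LL'_def)
    then have g: "?g \<in> KK'" using K'mult f by blast
    have "f \<otimes>\<^bsub>KK\<^esub> ?g = \<one>\<^bsub>KK\<^esub>" using h by (simp add: KK_simps)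
    then have "inv\<^bsub>KK\<^esub> f = ?g" using K.comm_inv_char[of f ?g] fF g K'iff by auto
    then show "inv\<^bsub>KK\<^esub> f \<in> KK'" using g by simp
  qed
  have LLsub: "subalgebra KK' LL KK"
  proof (intro subalgebra.intro subalgebra_axioms.intro)
    show "subgroup LL (add_monoid KK)" by (rule subgrp) (use LLc Ladd el(1) in \<open>auto simp: LL_def\<close>)
    show "f \<otimes>\<^bsub>KK\<^esub> v \<in> LL" if "f \<in> KK'" "v \<in> LL" for f v using that K'iff by auto
  qed
  have LL'sub: "subalgebra (squares KK) LL' KK"
  proof (intro subalgebra.intro subalgebra_axioms.intro)
    show "subgroup LL' (add_monoid KK)" by (rule subgrp) (use LL'c L'add el(3) in \<open>auto simp: LL'_def\<close>)
    fix f v assume f: "f \<in> squares KK" and v: "v \<in> LL'"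
    obtain g where g: "g \<in> FF" "f = g \<otimes>\<^bsub>KK\<^esub> g" using f by (auto simp: squares_def KK_simps(1))
    obtain r where r: "r \<in> R" "v = qe (M e r)" using v by (auto simp: LL'_def)
    \<comment> \<open>The quadratic condition in \<open>FF\<close> is exactly what makes
      \<open>LL'\<close> closed under multiplication by squares.\<close>
    have "f \<otimes>\<^bsub>KK\<^esub> v = qe (M e (g r))"
      using g r FF(5)[OF g(1) r(1)] by (auto simp: KK_simps qe_def compose_def)
    then show "f \<otimes>\<^bsub>KK\<^esub> v \<in> LL'" using g r FF(2)[OF g(1)] by (auto simp: LL'_def)
  qed
  show ?thesis
    unfolding mixed_data_def
    using KK_field char2[of "\<one>\<^bsub>KK\<^esub>"] K'sub LLsub LL'sub K'L L'K' sqL' by auto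
qed

end

section \<open>Mixed quadrangles from coordinates\<close>

lemma isomorphic_geometries_trans:
  assumes "isomorphic_geometries P L I P' L' I'" "isomorphic_geometries P' L' I' P'' L'' I''"
  shows "isomorphic_geometries P L I P'' L'' I''"
proof -
  obtain f g where f: "bij_betw f P P'" and g: "bij_betw g L L'" and i: "\<forall>x\<in>P. \<forall>M\<in>L. I x M \<longleftrightarrow> I' (f x) (g M)"
    using assms(1) unfolding isomorphic_geometries_def by blast
  obtain f' g' where f': "bij_betw f' P' P''" and g': "bij_betw g' L' L''" and i': "\<forall>x\<in>P'. \<forall>M\<in>L'. I' x M \<longleftrightarrow> I'' (f' x) (g' M)"
    using assms(2) unfolding isomorphic_geometries_def by blast
  show ?thesis
    unfolding isomorphic_geometries_def
  proof (intro exI conjI ballI)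
    show "bij_betw (f' \<circ> f) P P''" by (rule bij_betw_trans[OF f f'])
    show "bij_betw (g' \<circ> g) L L''" by (rule bij_betw_trans[OF g g'])
    show "I x M \<longleftrightarrow> I'' ((f' \<circ> f) x) ((g' \<circ> g) M)" if "x \<in> P" "M \<in> L" for x M
      using i i' that bij_betw_apply[OF f] bij_betw_apply[OF g] by simp
  qed
qed

datatype ('a, 'k, 'r, 'b) cpoint = CI | C1 'a | C2 'k 'b | C3 'a 'r 'b
datatype ('a, 'k, 'r, 'b) cline = DI | D1 'k | D2 'a 'r | D3 'k 'b 'r

text \<open>The antiflag axioms express the unique projection of the point \<open>(0, r', b)\<close>
  on the line \<open>[0, 0, r]\<close>. The other two axioms come from the regularity of one point
  outside \<open>M\<close> and of one line not through \<open>x\<close>.\<close>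

locale regular_coordinate_algebra = coordinate_algebra A K B R a0 k0 b0 r0 bp m T
  for A :: "'a set" and K :: "'k set" and B :: "'b set" and R :: "'r set" and a0 k0 b0 r0
    and bp (infixl "\<boxplus>" 65) and m T +
  assumes antiflag_ex: "\<lbrakk>b \<in> B; b \<noteq> b0; r \<in> R; r' \<in> R; r \<noteq> r'\<rbrakk> \<Longrightarrow> \<exists>a\<in>A. \<exists>k\<in>K. m a k \<boxplus> b = b0 \<and> T a k r = r'"
    and antiflag_un: "\<lbrakk>b \<in> B; b \<noteq> b0; r \<in> R; r' \<in> R; r \<noteq> r'; a \<in> A; k \<in> K; m a k \<boxplus> b = b0; T a k r = r';
      a' \<in> A; k' \<in> K; m a' k' \<boxplus> b = b0; T a' k' r = r'\<rbrakk> \<Longrightarrow> a = a' \<and> k = k'"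
    and base_point_regularity: "\<lbrakk>a \<in> A; a' \<in> A; a \<noteq> a'; k \<in> K; k' \<in> K; l \<in> R; l' \<in> R; b \<in> B; b \<noteq> b0; m a k \<boxplus> b = b0; m a' k' \<boxplus> b = b0;
      T a k l = r0; T a' k' l' = r0\<rbrakk> \<Longrightarrow> \<exists>h\<in>K. \<exists>g\<in>B. b = m a h \<boxplus> g \<and> b0 = m a' h \<boxplus> g \<and> T a h l = T a' h l'"
    and base_line_regularity: "\<lbrakk>a \<in> A; a' \<in> A; k \<in> K; k' \<in> K; k \<noteq> k'; b \<in> B; b' \<in> B; l \<in> R; l \<noteq> r0; m a k \<boxplus> b = b0; m a' k' \<boxplus> b' = b0;
      T a k l = r0; T a' k' l = r0\<rbrakk> \<Longrightarrow> \<exists>c\<in>A. \<exists>s\<in>R. m c k \<boxplus> b = m c k' \<boxplus> b' \<and> T c k s = l \<and> T c k' s = r0"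
begin

text \<open>\<open>k1\<close> and \<open>a1\<close> are arbitrary nonzero elements. They fix the
  units \<open>m a1 k1\<close> of \<open>B\<close> and \<open>T a1 k1 r0\<close> of
  \<open>R\<close>.\<close>

definition k1 :: 'k where "k1 = (SOME k. k \<in> K \<and> k \<noteq> k0)"
definition a1 :: 'a where "a1 = (SOME a. a \<in> A \<and> a \<noteq> a0)"

lemma k1: "k1 \<in> K" "k1 \<noteq> k0"
proof -
  have "k1 \<in> K \<and> k1 \<noteq> k0" unfolding k1_def by (rule someI_ex) (use K_ex in blast)
  then show "k1 \<in> K" "k1 \<noteq> k0" by auto
qed

lemma a1: "a1 \<in> A" "a1 \<noteq> a0"
proof -
  obtain b where b: "b \<in> B" "b \<noteq> b0" using B_ex by blast
  obtain a where "a \<in> A" "m a k1 = b" using Xa_ex[of k1 k0 b] k1 b by auto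
  then have "\<exists>a. a \<in> A \<and> a \<noteq> a0" using b k1 by (intro exI[of _ a]) auto
  then have "a1 \<in> A \<and> a1 \<noteq> a0" unfolding a1_def by (rule someI_ex)
  then show "a1 \<in> A" "a1 \<noteq> a0" by auto
qed

text \<open>\<open>al\<close> identifies \<open>B\<close> with \<open>A\<close> along
  \<open>m _ k1\<close>, and \<open>ka\<close> identifies \<open>R\<close> with \<open>K\<close>
  along \<open>T a1 _ r0\<close>. After this both operations live on \<open>B\<close> and
  \<open>R\<close> alone.\<close>

definition al :: "'b \<Rightarrow> 'a" where "al b = (SOME a. a \<in> A \<and> m a k1 = b)"
definition ka :: "'r \<Rightarrow> 'k" where "ka r = (SOME k. k \<in> K \<and> T a1 k r0 = r)"

lemma al:
  assumes "b \<in> B"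
  shows "al b \<in> A" "m (al b) k1 = b"
proof -
  have "\<exists>a. a \<in> A \<and> m a k1 = b" using Xa_ex[of k1 k0 b] k1 assms by auto
  then have "al b \<in> A \<and> m (al b) k1 = b" unfolding al_def by (rule someI_ex)
  then show "al b \<in> A" "m (al b) k1 = b" by auto
qed

lemma al_m: "a \<in> A \<Longrightarrow> al (m a k1) = a"
  using al[of "m a k1"] m_inj_a[of k1 "al (m a k1)" a] k1 by auto

lemma k_inj: "\<lbrakk>a \<in> A; a \<noteq> a0; k \<in> K; h \<in> K; T a k r0 = T a h r0\<rbrakk> \<Longrightarrow> k = h"
  by (rule Xb_un[of a a0 r0 "T a k r0" k h]) auto

lemma ka:
  assumes "r \<in> R"
  shows "ka r \<in> K" "T a1 (ka r) r0 = r"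
proof -
  have "\<exists>k\<in>K. T a1 k r0 = T a0 k r" using Xb_ex[of a1 a0 r0 r] a1 assms by blast
  then have "\<exists>k. k \<in> K \<and> T a1 k r0 = r" using assms by auto
  then have "ka r \<in> K \<and> T a1 (ka r) r0 = r" unfolding ka_def by (rule someI_ex)
  then show "ka r \<in> K" "T a1 (ka r) r0 = r" by auto
qed

lemma ka_T: "k \<in> K \<Longrightarrow> ka (T a1 k r0) = k"
  using ka[of "T a1 k r0"] k_inj[of a1 "ka (T a1 k r0)" k] a1 by auto

lemma al_ne: "\<lbrakk>x \<in> B; x \<noteq> b0\<rbrakk> \<Longrightarrow> al x \<noteq> a0"
  using al(2)[of x] m0(1)[of k1] k1 by force

lemma ka_ne: "\<lbrakk>r \<in> R; r \<noteq> r0\<rbrakk> \<Longrightarrow> ka r \<noteq> k0"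
  using ka(2)[of r] T0(2)[of a1 r0] a1 by force

definition rp :: "'r \<Rightarrow> 'r \<Rightarrow> 'r" (infixl "\<uplus>" 65) where "r \<uplus> s = T a1 (ka r) s"
definition MM :: "'b \<Rightarrow> 'r \<Rightarrow> 'b" where "MM b r = m (al b) (ka r)"
definition QQ :: "'b \<Rightarrow> 'r \<Rightarrow> 'r" where "QQ b r = T (al b) (ka r) r0"

lemma rp_cl: "\<lbrakk>r \<in> R; s \<in> R\<rbrakk> \<Longrightarrow> r \<uplus> s \<in> R"
  unfolding rp_def using ka a1 by blast

text \<open>Each \<open>T a k\<close> commutes with the maps \<open>T a1 _\<close>, which act
  transitively on \<open>R\<close> and add up the elements of \<open>R\<close>; it is therefore a
  translation.\<close>

lemma T_tr:
  assumes "a \<in> A" "k \<in> K" "s \<in> R"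
  shows "T a k s = T a k r0 \<uplus> s"
proof -
  let ?q = "T a k r0"
  have q: "?q \<in> R" "ka s \<in> K" "ka ?q \<in> K" using assms ka by auto
  have "T a k (T a1 (ka s) r0) = T a1 (ka s) ?q" using T_comm[of k "ka s" a a1 r0] assms q a1 by simp
  also have "\<dots> = T a1 (ka s) (T a1 (ka ?q) r0)" using ka[of ?q] q by simp
  also have "\<dots> = T a1 (ka ?q) (T a1 (ka s) r0)" using T_comm_a[of a1 "ka s" "ka ?q" r0] q a1 by simp
  finally show ?thesis unfolding rp_def using ka[of s] assms by simp
qed

lemma rp_comm: "\<lbrakk>r \<in> R; s \<in> R\<rbrakk> \<Longrightarrow> r \<uplus> s = s \<uplus> r"
  using T_comm_a[of a1 "ka r" "ka s" r0] ka[of r] ka[of s] a1 unfolding rp_def by simp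

lemma ka_rp:
  assumes "r \<in> R" "s \<in> R"
  shows "ka (r \<uplus> s) = pK a1 (ka r) (ka s)"
proof -
  have "T a1 (pK a1 (ka r) (ka s)) r0 = r \<uplus> s"
    using T_pK[of a1 "ka r" "ka s" r0] ka[of r] ka[of s] a1 assms unfolding rp_def by simp
  then show ?thesis using ka_T[of "pK a1 (ka r) (ka s)"] pK(1)[of a1 "ka r" "ka s"] ka(1) a1 assms by simp
qed

lemma m_ka_rp:
  assumes "a \<in> A" "r \<in> R" "s \<in> R"
  shows "m a (ka (r \<uplus> s)) = m a (ka r) \<boxplus> m a (ka s)"
proof (cases "a = a0")
  case True
  then show ?thesis using ka(1) rp_cl assms by simp
next
  case False
  then have "pK a1 (ka r) (ka s) = pK a (ka r) (ka s)" using pK_indep[of a1 a] a1 ka(1) assms by blast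
  then show ?thesis using ka_rp pK(2)[of a "ka r" "ka s"] False ka(1) assms by simp
qed

lemma T_ka_rp:
  assumes "a \<in> A" "r \<in> R" "s \<in> R" "t \<in> R"
  shows "T a (ka (r \<uplus> s)) t = T a (ka r) (T a (ka s) t)"
proof (cases "a = a0")
  case True
  then show ?thesis using ka(1) rp_cl assms by simp
next
  case False
  then have "pK a1 (ka r) (ka s) = pK a (ka r) (ka s)" using pK_indep[of a1 a] a1 ka(1) assms by blast
  then show ?thesis using ka_rp T_pK[of a "ka r" "ka s" t] False ka(1) assms by simp
qed

lemma al_bp: "\<lbrakk>b \<in> B; c \<in> B\<rbrakk> \<Longrightarrow> al (b \<boxplus> c) = pA k1 (al b) (al c)"
  using pA[of k1 "al b" "al c"] al[of b] al[of c] k1 al_m[of "pA k1 (al b) (al c)"] by simp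

lemma m_al_bp:
  assumes "b \<in> B" "c \<in> B" "k \<in> K"
  shows "m (al (b \<boxplus> c)) k = m (al b) k \<boxplus> m (al c) k"
proof (cases "k = k0")
  case True
  then show ?thesis using al(1) assms by simp
next
  case False
  then have "pA k1 (al b) (al c) = pA k (al b) (al c)" using pA_indep[of k1 k] k1 al(1) assms by blast
  then show ?thesis using al_bp pA(2)[of k "al b" "al c"] False al(1) assms by simp
qed

lemma T_al_bp:
  assumes "b \<in> B" "c \<in> B" "k \<in> K" "t \<in> R"
  shows "T (al (b \<boxplus> c)) k t = T (al c) k (T (al b) k t)"
proof (cases "k = k0")
  case True
  then show ?thesis using al(1) assms by simp
next
  case False
  then have "pA k1 (al b) (al c) = pA k (al b) (al c)" using pA_indep[of k1 k] k1 al(1) assms by blast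
  then show ?thesis using al_bp T_pA[of k "al b" "al c" t] False al(1) assms by simp
qed

lemma rp_0: "r \<in> R \<Longrightarrow> r0 \<uplus> r = r"
  using ka_T[of k0] a1 unfolding rp_def by simp

lemma rp_2: "r \<in> R \<Longrightarrow> r \<uplus> r = r0"
  using T_inv[of "ka r" a1 r0] ka[of r] a1 unfolding rp_def by simp

lemma rp_assoc: "\<lbrakk>r \<in> R; s \<in> R; t \<in> R\<rbrakk> \<Longrightarrow> r \<uplus> s \<uplus> t = r \<uplus> (s \<uplus> t)"
  using T_ka_rp[of a1 r s t] a1 unfolding rp_def by simp

lemma rp_cancel:
  assumes "r \<in> R" "s \<in> R" "t \<in> R" "q \<in> R" "r \<uplus> s = t \<uplus> q"
  shows "r \<uplus> t = s \<uplus> q"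
proof -
  have 1: "x \<uplus> (x \<uplus> y) = y" if "x \<in> R" "y \<in> R" for x y
    using rp_assoc[OF that(1,1,2)] rp_2[OF that(1)] rp_0[OF that(2)] by simp
  have lc: "x \<uplus> (y \<uplus> w) = y \<uplus> (x \<uplus> w)" if "x \<in> R" "y \<in> R" "w \<in> R" for x y w
    using rp_assoc[OF that] rp_assoc[OF that(2,1,3)] rp_comm[OF that(1,2)] by simp
  have "r \<uplus> t = t \<uplus> r" by (rule rp_comm[OF assms(1,3)])
  also have "\<dots> = t \<uplus> (s \<uplus> (s \<uplus> r))" using 1[OF assms(2,1)] by simp
  also have "s \<uplus> r = t \<uplus> q" using assms(5) rp_comm[OF assms(1,2)] by simp
  also have "t \<uplus> (s \<uplus> (t \<uplus> q)) = s \<uplus> (t \<uplus> (t \<uplus> q))" by (rule lc[OF assms(3,2) rp_cl[OF assms(3,4)]])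
  also have "\<dots> = s \<uplus> q" using 1[OF assms(3,4)] by simp
  finally show ?thesis .
qed

text \<open>Biadditivity rests on \<open>pA_indep\<close> and \<open>pK_indep\<close>, which make
  the additions independent of the chosen \<open>k1\<close> and \<open>a1\<close>.
  \<open>MQ_inj\<close> is the uniqueness of a projection, and the base regularity axioms are
  simplified by \<open>T_tr\<close>.\<close>

sublocale ba: biadditive_algebra B R b0 "m a1 k1" r0 "T a1 k1 r0" "(\<boxplus>)" "(\<uplus>)" MM QQ
proof unfold_locales
  show "m a1 k1 \<noteq> b0" using m_inj_a[of k1 a1 a0] k1 a1 by auto
  show "T a1 k1 r0 \<noteq> r0" using k_inj[of a1 k1 k0] k1 a1 by auto
  show "MM x r \<in> B" if "x \<in> B" "r \<in> R" for x r unfolding MM_def by (rule m_cl[OF al(1)[OF that(1)] ka(1)[OF that(2)]])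
  show "QQ x r \<in> R" if "x \<in> B" "r \<in> R" for x r unfolding QQ_def by (rule T_cl[OF al(1)[OF that(1)] ka(1)[OF that(2)] z(4)])
  show "MM (x \<boxplus> y) r = MM x r \<boxplus> MM y r" if "x \<in> B" "y \<in> B" "r \<in> R" for x y r
    unfolding MM_def by (rule m_al_bp[OF that(1,2) ka(1)[OF that(3)]])
  show "MM x (r \<uplus> s) = MM x r \<boxplus> MM x s" if "x \<in> B" "r \<in> R" "s \<in> R" for x r s
    unfolding MM_def by (rule m_ka_rp[OF al(1)[OF that(1)] that(2,3)])
  show "QQ (x \<boxplus> y) r = QQ x r \<uplus> QQ y r" if "x \<in> B" "y \<in> B" "r \<in> R" for x y r
  proof -
    note A = al(1)[OF that(1)] al(1)[OF that(2)] and K = ka(1)[OF that(3)]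
    have q: "T (al x) (ka r) r0 \<in> R" "T (al y) (ka r) r0 \<in> R" using A K by auto
    have "QQ (x \<boxplus> y) r = T (al y) (ka r) (T (al x) (ka r) r0)" unfolding QQ_def by (rule T_al_bp[OF that(1,2) K z(4)])
    also have "\<dots> = T (al y) (ka r) r0 \<uplus> T (al x) (ka r) r0" by (rule T_tr[OF A(2) K q(1)])
    also have "\<dots> = T (al x) (ka r) r0 \<uplus> T (al y) (ka r) r0" by (rule rp_comm[OF q(2,1)])
    finally show ?thesis unfolding QQ_def .
  qed
  show "QQ x (r \<uplus> s) = QQ x r \<uplus> QQ x s" if "x \<in> B" "r \<in> R" "s \<in> R" for x r s
  proof -
    note A = al(1)[OF that(1)] and K = ka(1)[OF that(2)] ka(1)[OF that(3)]
    have q: "T (al x) (ka s) r0 \<in> R" using A K by auto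
    have "QQ x (r \<uplus> s) = T (al x) (ka r) (T (al x) (ka s) r0)" unfolding QQ_def by (rule T_ka_rp[OF A that(2,3) z(4)])
    also have "\<dots> = T (al x) (ka r) r0 \<uplus> T (al x) (ka s) r0" by (rule T_tr[OF A K(1) q])
    finally show ?thesis unfolding QQ_def .
  qed
  show "MM x (T a1 k1 r0) = x" if "x \<in> B" for x unfolding MM_def using ka_T k1 al that by simp
  show "QQ (m a1 k1) r = r" if "r \<in> R" for r unfolding QQ_def using al_m a1 ka that by simp
  show "x = b0 \<or> r = r0" if "x \<in> B" "r \<in> R" "MM x r = b0" for x r
  proof (rule ccontr)
    assume n: "\<not> (x = b0 \<or> r = r0)"
    have "ka r \<noteq> k0" using ka_ne that n by blast
    then have "al x = a0" using m_inj_a[of "ka r" "al x" a0] that al ka by (simp add: MM_def)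
    then show False using al[of x] that n k1 by auto
  qed
  show "x = b0 \<or> r = r0" if "x \<in> B" "r \<in> R" "QQ x r = r0" for x r
  proof (rule ccontr)
    assume n: "\<not> (x = b0 \<or> r = r0)"
    have "al x \<noteq> a0" using al_ne that n by blast
    then have "ka r = k0" using k_inj[of "al x" "ka r" k0] that al ka by (simp add: QQ_def)
    then show False using ka[of r] that n a1 by auto
  qed
  show "\<exists>y\<in>B. MM y r = x" if h: "r \<in> R" "r \<noteq> r0" "x \<in> B" for x r
  proof -
    have "ka r \<noteq> k0" using ka_ne h by blast
    then obtain a where "a \<in> A" "m a (ka r) = x" using Xa_ex[of "ka r" k0 x] ka h by auto
    then show ?thesis unfolding MM_def using al_m k1 by (intro bexI[of _ "m a k1"]) auto
  qed
  show "\<exists>s\<in>R. QQ x s = r" if h: "x \<in> B" "x \<noteq> b0" "r \<in> R" for x r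
  proof -
    have "al x \<noteq> a0" using al_ne h by blast
    then obtain k where "k \<in> K" "T (al x) k r0 = r" using Xb_ex[of "al x" a0 r0 r] al h by auto
    then show ?thesis unfolding QQ_def using ka_T a1 by (intro bexI[of _ "T a1 k r0"]) auto
  qed
  fix x x' r r' assume X: "x \<in> B" "x' \<in> B" and Rr: "r \<in> R" "r' \<in> R"
  note A = al(1)[OF X(1)] al(1)[OF X(2)] and K = ka(1)[OF Rr(1)] ka(1)[OF Rr(2)]
  note X2 = al(2)[OF X(1)] al(2)[OF X(2)] and R2 = ka(2)[OF Rr(1)] ka(2)[OF Rr(2)]
  have xx: "al x = al x' \<Longrightarrow> x = x'" and rr: "ka r = ka r' \<Longrightarrow> r = r'" using X2 R2 by metis+
  have MMc: "MM x r \<in> B" "MM x' r' \<in> B" using A K by (auto simp: MM_def)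
  have QQc: "QQ x r \<in> R" "QQ x' r' \<in> R" using A K by (auto simp: QQ_def)
  have Q0: "T (al x) (ka r) (QQ x r) = r0" "T (al x') (ka r') (QQ x' r') = r0"
    using A K by (auto simp: QQ_def)
  have M0: "m (al x) (ka r) \<boxplus> MM x r = b0" "m (al x') (ka r') \<boxplus> MM x' r' = b0"
    using A K exp2 by (auto simp: MM_def)
  show "x = x' \<and> r = r'" if "x \<noteq> b0" "r \<noteq> r0" "MM x r = MM x' r'" "QQ x r = QQ x' r'"
  proof -
    have "ka r \<noteq> k0" using ka_ne that Rr by blast
    moreover have "al x \<noteq> a0" using al_ne that X by blast
    ultimately have n: "MM x r \<noteq> b0" "r0 \<noteq> QQ x r"
      using m_inj_a[of "ka r" "al x" a0] k_inj[of "al x" "ka r" k0] A K by (auto simp: MM_def QQ_def)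
    have "al x = al x' \<and> ka r = ka r'"
      by (rule antiflag_un[OF MMc(1) n(1) z(4) QQc(1) n(2) A(1) K(1) M0(1) _ A(2) K(2) M0(2)[folded that(3)]])
        (use that(4) in \<open>simp_all add: QQ_def\<close>)
    then show ?thesis using xx rr by blast
  qed
  show "\<exists>s\<in>R. MM (x \<boxplus> x') s = MM x r \<and> QQ (x \<boxplus> x') s = QQ x r \<uplus> QQ x' r'"
    if h: "x \<noteq> x'" "MM x r = MM x' r'" "MM x r \<noteq> b0"
  proof -
    have ne: "al x \<noteq> al x'" using xx h by blast
    obtain k g where k: "k \<in> K" "g \<in> B" "MM x r = m (al x) k \<boxplus> g" "b0 = m (al x') k \<boxplus> g"
      "T (al x) k (QQ x r) = T (al x') k (QQ x' r')"
      using base_point_regularity[OF A ne K QQc MMc(1) h(3) M0(1) M0(2)[folded h(2)] Q0] by blast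
    have kg: "g = m (al x') k" using bp_eq0[of "m (al x') k" g] k(1,2) k(4)[symmetric] A by simp
    let ?s = "T a1 k r0"
    have s: "?s \<in> R" "ka ?s = k" using k ka_T a1 by auto
    have "MM (x \<boxplus> x') ?s = MM x r" unfolding MM_def s(2) using m_al_bp[OF X k(1)] k(3) kg by (simp add: MM_def)
    moreover have "QQ (x \<boxplus> x') ?s = QQ x r \<uplus> QQ x' r'"
    proof -
      have q: "T (al x) k r0 \<in> R" "T (al x') k r0 \<in> R" using A k by auto
      have "T (al x) k r0 \<uplus> QQ x r = T (al x') k r0 \<uplus> QQ x' r'"
        using k(5) T_tr[OF A(1) k(1) QQc(1)] T_tr[OF A(2) k(1) QQc(2)] by metis
      then have 1: "T (al x) k r0 \<uplus> T (al x') k r0 = QQ x r \<uplus> QQ x' r'" by (rule rp_cancel[OF q(1) QQc(1) q(2) QQc(2)])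
      have "QQ (x \<boxplus> x') ?s = T (al x') k (T (al x) k r0)" unfolding QQ_def s(2) by (rule T_al_bp[OF X k(1)]) simp
      also have "\<dots> = T (al x') k r0 \<uplus> T (al x) k r0" by (rule T_tr[OF A(2) k(1) q(1)])
      finally show ?thesis using 1 rp_comm[OF q] by simp
    qed
    ultimately show ?thesis using s by blast
  qed
  show "\<exists>y\<in>B. QQ y (r \<uplus> r') = QQ x r \<and> MM y (r \<uplus> r') = MM x r \<boxplus> MM x' r'"
    if h: "r \<noteq> r'" "QQ x r = QQ x' r'" "QQ x r \<noteq> r0"
  proof -
    have ne: "ka r \<noteq> ka r'" using rr h by blast
    obtain c s where c: "c \<in> A" "s \<in> R" "m c (ka r) \<boxplus> MM x r = m c (ka r') \<boxplus> MM x' r'"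
      "T c (ka r) s = QQ x r" "T c (ka r') s = r0"
      using base_line_regularity[OF A K ne MMc QQc(1) h(3) M0 Q0(1) Q0(2)[folded h(2)]] by blast
    let ?y = "m c k1"
    have y: "?y \<in> B" "al ?y = c" using c al_m k1 by auto
    have "MM ?y (r \<uplus> r') = m c (ka r) \<boxplus> m c (ka r')" unfolding MM_def y(2) by (rule m_ka_rp[OF c(1) Rr])
    also have "\<dots> = MM x r \<boxplus> MM x' r'"
    proof -
      have "m c (ka r) \<boxplus> m c (ka r') = (m c (ka r) \<boxplus> MM x r) \<boxplus> (m c (ka r') \<boxplus> MM x r)"
        using c(1) K MMc by (simp add: bpac)
      also have "\<dots> = (m c (ka r') \<boxplus> MM x' r') \<boxplus> (m c (ka r') \<boxplus> MM x r)" by (simp only: c(3))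
      also have "\<dots> = MM x r \<boxplus> MM x' r'" using c(1) K MMc by (simp add: bpac)
      finally show ?thesis .
    qed
    finally have 1: "MM ?y (r \<uplus> r') = MM x r \<boxplus> MM x' r'" .
    have "s = T c (ka r') r0" using c T_inv[OF K(2) c(1) c(2)] by simp
    moreover have "QQ ?y (r \<uplus> r') = T c (ka r) (T c (ka r') r0)" unfolding QQ_def y(2) by (rule T_ka_rp[OF c(1) Rr]) simp
    ultimately have "QQ ?y (r \<uplus> r') = QQ x r" using c by simp
    then show ?thesis using 1 y by blast
  qed
qed (auto simp: exp2 rp_cl rp_2 rp_0 k1 a1 intro: bp_assoc bp_comm rp_assoc rp_comm)

section \<open>The isomorphism with a mixed quadrangle\<close>

definition cpoints :: "('a, 'k, 'r, 'b) cpoint set" where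
  "cpoints = {CI} \<union> {C1 a | a. a \<in> A} \<union> {C2 k b | k b. k \<in> K \<and> b \<in> B} \<union> {C3 a r b | a r b. a \<in> A \<and> r \<in> R \<and> b \<in> B}"
definition clines :: "('a, 'k, 'r, 'b) cline set" where
  "clines = {DI} \<union> {D1 k | k. k \<in> K} \<union> {D2 a r | a r. a \<in> A \<and> r \<in> R} \<union> {D3 k b r | k b r. k \<in> K \<and> b \<in> B \<and> r \<in> R}"

fun cinc :: "('a, 'k, 'r, 'b) cpoint \<Rightarrow> ('a, 'k, 'r, 'b) cline \<Rightarrow> bool" where
  "cinc (C3 a r b) (D2 a' r') \<longleftrightarrow> a' = a \<and> r' = r"
| "cinc (C1 a) (D2 a' r') \<longleftrightarrow> a' = a"
| "cinc (C1 a) DI \<longleftrightarrow> True"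
| "cinc CI DI \<longleftrightarrow> True"
| "cinc CI (D1 k) \<longleftrightarrow> True"
| "cinc (C2 k b) (D1 k') \<longleftrightarrow> k' = k"
| "cinc (C2 k b) (D3 k' b' r) \<longleftrightarrow> k' = k \<and> b' = b"
| "cinc (C3 a r b) (D3 k g s) \<longleftrightarrow> b = m a k \<boxplus> g \<and> s = T a k r"
| "cinc _ _ \<longleftrightarrow> False"

definition qq :: "'b \<Rightarrow> 'r \<Rightarrow> 'r" where "qq = ba.qe"
definition qr :: "'r \<Rightarrow> 'r \<Rightarrow> 'r" where "qr r = ba.qe (MM (m a1 k1) r)"
definition qi :: "('r \<Rightarrow> 'r) \<Rightarrow> 'b" where "qi = inv_into B qq"
definition qri :: "('r \<Rightarrow> 'r) \<Rightarrow> 'r" where "qri = inv_into R qr"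

lemma qq_inj: "\<lbrakk>x \<in> B; y \<in> B\<rbrakk> \<Longrightarrow> qq x = qq y \<longleftrightarrow> x = y"
  unfolding qq_def using ba.qe_inj by blast

lemma qr_inj: "\<lbrakk>x \<in> R; y \<in> R\<rbrakk> \<Longrightarrow> qr x = qr y \<longleftrightarrow> x = y"
  unfolding qr_def using ba.qe_inj[of "MM (m a1 k1) x" "MM (m a1 k1) y"] ba.M_inj_r[of "m a1 k1" x y] ba.ne by auto

lemma LL_eq: "ba.LL = qq ` B" and LL'_eq: "ba.LL' = qr ` R"
  by (auto simp: ba.LL_def ba.LL'_def qq_def qr_def)

lemma qi[simp]: "x \<in> B \<Longrightarrow> qi (qq x) = x"
  unfolding qi_def by (rule inv_into_f_f) (auto simp: inj_on_def qq_inj)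
lemma qri[simp]: "x \<in> R \<Longrightarrow> qri (qr x) = x"
  unfolding qri_def by (rule inv_into_f_f) (auto simp: inj_on_def qr_inj)

fun cmap :: "('r \<Rightarrow> 'r) mq_point \<Rightarrow> ('a, 'k, 'r, 'b) cpoint" where
  "cmap Pt_inf = CI"
| "cmap (Pt1 f) = C1 (al (qi f))"
| "cmap (Pt2 g f) = C2 (ka (qri g)) (qi f)"
| "cmap (Pt3 f g h) = C3 (al (qi f)) (qri g) (qi h)"

fun dmap :: "('r \<Rightarrow> 'r) mq_line \<Rightarrow> ('a, 'k, 'r, 'b) cline" where
  "dmap Ln_inf = DI"
| "dmap (Ln1 g) = D1 (ka (qri g))"
| "dmap (Ln2 f g) = D2 (al (qi f)) (qri g)"
| "dmap (Ln3 g f h) = D3 (ka (qri g)) (qi f) (qri h)"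

fun cinv :: "('a, 'k, 'r, 'b) cpoint \<Rightarrow> ('r \<Rightarrow> 'r) mq_point" where
  "cinv CI = Pt_inf"
| "cinv (C1 a) = Pt1 (qq (m a k1))"
| "cinv (C2 k b) = Pt2 (qr (T a1 k r0)) (qq b)"
| "cinv (C3 a r b) = Pt3 (qq (m a k1)) (qr r) (qq b)"

fun dinv :: "('a, 'k, 'r, 'b) cline \<Rightarrow> ('r \<Rightarrow> 'r) mq_line" where
  "dinv DI = Ln_inf"
| "dinv (D1 k) = Ln1 (qr (T a1 k r0))"
| "dinv (D2 a r) = Ln2 (qq (m a k1)) (qr r)"
| "dinv (D3 k b r) = Ln3 (qr (T a1 k r0)) (qq b) (qr r)"

lemma mult_qq_qr: "\<lbrakk>x \<in> B; k \<in> R\<rbrakk> \<Longrightarrow> qq x \<otimes>\<^bsub>ba.KK\<^esub> qr k = qq (MM x k)"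
  unfolding qq_def qr_def by (rule ba.qe_mult_eps)

lemma add_qq: "\<lbrakk>x \<in> B; y \<in> B\<rbrakk> \<Longrightarrow> qq x \<oplus>\<^bsub>ba.KK\<^esub> qq y = qq (x \<boxplus> y)"
  unfolding qq_def by (rule ba.qe_add)

lemma add_qr: "\<lbrakk>x \<in> R; y \<in> R\<rbrakk> \<Longrightarrow> qr x \<oplus>\<^bsub>ba.KK\<^esub> qr y = qr (x \<uplus> y)"
  unfolding qr_def by (simp add: ba.qe_add ba.M_r)

lemma sq_qr: "\<lbrakk>x \<in> B; k \<in> R\<rbrakk> \<Longrightarrow> qq x \<otimes>\<^bsub>ba.KK\<^esub> qq x \<otimes>\<^bsub>ba.KK\<^esub> qr k = qr (QQ x k)"
  unfolding qq_def qr_def using ba.Q_eps_Q[of x k]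
  by (auto simp: ba.KK_simps ba.qe_def compose_def)

lemma cmap_inc:
  assumes "X \<in> mq_points ba.LL ba.LL'" "Y \<in> mq_lines ba.LL ba.LL'"
  shows "mq_inc ba.KK X Y \<longleftrightarrow> cinc (cmap X) (dmap Y)"
proof -
  have ali: "al x = al y \<longleftrightarrow> x = y" if "x \<in> B" "y \<in> B" for x y using al that by metis
  have kai: "ka x = ka y \<longleftrightarrow> x = y" if "x \<in> R" "y \<in> R" for x y using ka that by metis
  have 1: "qq y = qq x \<otimes>\<^bsub>ba.KK\<^esub> qr k \<oplus>\<^bsub>ba.KK\<^esub> qq g \<longleftrightarrow> y = m (al x) (ka k) \<boxplus> g"
    if "x \<in> B" "y \<in> B" "k \<in> R" "g \<in> B" for x y k g
    using that by (simp add: mult_qq_qr add_qq qq_inj) (simp add: MM_def)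
  have 2: "qr s = qq x \<otimes>\<^bsub>ba.KK\<^esub> qq x \<otimes>\<^bsub>ba.KK\<^esub> qr k \<oplus>\<^bsub>ba.KK\<^esub> qr l \<longleftrightarrow> s = T (al x) (ka k) l"
    if "x \<in> B" "s \<in> R" "k \<in> R" "l \<in> R" for x s k l
    using that T_tr[of "al x" "ka k" l] al ka by (simp add: sq_qr add_qr qr_inj rp_cl) (simp add: QQ_def)
  show ?thesis
    using assms unfolding mq_points_def mq_lines_def LL_eq LL'_eq
    by (auto simp: qq_inj qr_inj ali kai 1 2)
qed

theorem mixed_if_coordinates:
  fixes P :: "'p set"
  assumes "isomorphic_geometries cpoints clines cinc P L I"
  shows "mixed_quadrangle P L I"
proof (rule mixed_quadrangleI[OF ba.KK_mixed])
  have "isomorphic_geometries (mq_points ba.LL ba.LL') (mq_lines ba.LL ba.LL') (mq_inc ba.KK) cpoints clines cinc"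
    unfolding isomorphic_geometries_def
  proof (intro exI conjI ballI)
    show "bij_betw cmap (mq_points ba.LL ba.LL') cpoints"
      by (rule bij_betw_byWitness[of _ cinv])
        (auto simp: mq_points_def LL_eq LL'_eq cpoints_def al ka al_m ka_T k1 a1)
    show "bij_betw dmap (mq_lines ba.LL ba.LL') clines"
      by (rule bij_betw_byWitness[of _ dinv])
        (auto simp: mq_lines_def LL_eq LL'_eq clines_def al ka al_m ka_T k1 a1)
  qed (rule cmap_inc)
  then show "isomorphic_geometries (mq_points ba.LL ba.LL') (mq_lines ba.LL ba.LL') (mq_inc ba.KK) P L I"
    using assms by (rule isomorphic_geometries_trans)
qed

end

section \<open>Coordinates with respect to a flag\<close>

text \<open>\<open>x\<close>, \<open>M\<close> is the flag at infinity; \<open>o1\<close>,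
  \<open>U\<close>, \<open>p0\<close>, \<open>r0\<close> are the zero elements of the coordinate
  sets \<open>A\<close>, \<open>K\<close>, \<open>B\<close>, \<open>R\<close>. Regularity of
  \<open>p0\<close> and \<open>r0\<close> is the source of the two base regularity axioms.\<close>

locale axis_flag = gq P L I for P :: "'p set" and L :: "'l set" and I +
  fixes x :: 'p and M U :: 'l and o1 p0 :: 'p and r0 :: 'l
  assumes xM: "I x M" and axM: "axis M"
    and regM: "\<And>a. a \<in> P \<Longrightarrow> I a M \<Longrightarrow> rp a" and xP: "x \<in> P"
    and regx: "\<And>W. W \<in> L \<Longrightarrow> I x W \<Longrightarrow> rl W"
    and U: "U \<in> L" "I x U" "U \<noteq> M"
    and p0: "p0 \<in> P" "I p0 U" "p0 \<noteq> x" and rp0: "rp p0"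
    and o1: "o1 \<in> P" "I o1 M" "o1 \<noteq> x"
    and r0: "r0 \<in> L" "I o1 r0" "r0 \<noteq> M" and rr0: "rl r0"
begin

section \<open>Coordinate sets and the labelling of points and lines\<close>

definition A :: "'p set" where "A = {a \<in> P. I a M \<and> a \<noteq> x}"
definition K :: "'l set" where "K = {k \<in> L. I x k \<and> k \<noteq> M}"
definition B :: "'p set" where "B = {b \<in> P. I b U \<and> b \<noteq> x}"
definition R :: "'l set" where "R = {l \<in> L. I o1 l \<and> l \<noteq> M}"

lemma MinL: "M \<in> L" using axM by (simp add: axis_def)
lemma rx: "rp x" using regM xP xM by blast
lemma rM: "rl M" using regx MinL xM by blast

lemma AP: "a \<in> A \<Longrightarrow> a \<in> P" "a \<in> A \<Longrightarrow> I a M" "a \<in> A \<Longrightarrow> a \<noteq> x" by (auto simp: A_def)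
lemma KL: "k \<in> K \<Longrightarrow> k \<in> L" "k \<in> K \<Longrightarrow> I x k" "k \<in> K \<Longrightarrow> k \<noteq> M" by (auto simp: K_def)
lemma BP: "b \<in> B \<Longrightarrow> b \<in> P" "b \<in> B \<Longrightarrow> I b U" "b \<in> B \<Longrightarrow> b \<noteq> x" by (auto simp: B_def)
lemma RL: "l \<in> R \<Longrightarrow> l \<in> L" "l \<in> R \<Longrightarrow> I o1 l" "l \<in> R \<Longrightarrow> l \<noteq> M" by (auto simp: R_def)

lemma base[simp]: "o1 \<in> A" "U \<in> K" "p0 \<in> B" "r0 \<in> R"
  using o1 U p0 r0 by (auto simp: A_def K_def B_def R_def)

lemma nM: "\<lbrakk>q \<in> P; q \<noteq> x; k \<in> K; I q k\<rbrakk> \<Longrightarrow> \<not> I q M"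
  using line_unique[of q x k M] KL[of k] xP xM MinL by auto

lemma clx: "\<lbrakk>k \<in> K; I q k\<rbrakk> \<Longrightarrow> cl x q"
  using KL[of k] by (auto intro: clI)

lemma nA: "\<lbrakk>q \<in> P; q \<noteq> x; k \<in> K; I q k; a \<in> A\<rbrakk> \<Longrightarrow> \<not> cl q a"
  using no_tri[of x a q M] nM[of q k] clx[of k q] AP[of a] xP xM MinL by (auto simp: cl_sym)

lemma nAline: "\<lbrakk>q \<in> P; q \<noteq> x; k \<in> K; I q k; a \<in> A; W \<in> L; I a W\<rbrakk> \<Longrightarrow> \<not> I q W"
  using nA[of q k a] by (auto intro: clI)

lemma nxA: "\<lbrakk>a \<in> A; W \<in> L; I a W; W \<noteq> M\<rbrakk> \<Longrightarrow> \<not> I x W"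
  using line_unique[of x a W M] AP[of a] xP xM MinL by auto

lemma oppI:
  assumes "q \<in> P" "q \<noteq> x" "k \<in> K" "I q k" "N \<in> L" "I q N" "N \<noteq> k"
  shows "\<not> mt N M" "\<not> I x N"
proof -
  show nx: "\<not> I x N" using line_unique[of x q N k] assms KL[of k] xP by auto
  show "\<not> mt N M"
  proof
    assume "mt N M"
    then obtain t where t: "t \<in> P" "I t N" "I t M" by (rule mtE)
    then have "t \<in> A" using nx by (auto simp: A_def)
    then show False using nA[of q k t] assms t by (auto intro: clI)
  qed
qed

definition n0 :: "'p \<Rightarrow> 'l \<Rightarrow> 'l" where "n0 b l = pl b l"
text \<open>A line through \<open>a\<close> is labelled by the line \<open>l\<close> through
  \<open>o1\<close> that meets the same line through \<open>p0\<close>. Regularity of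
  \<open>M\<close> frees the label from the choice of \<open>p0\<close>, see
  \<open>el_meets\<close>.\<close>

definition el :: "'p \<Rightarrow> 'l \<Rightarrow> 'l" where "el a l = pl a (n0 p0 l)"
definition pt3 :: "'p \<Rightarrow> 'l \<Rightarrow> 'p \<Rightarrow> 'p" where "pt3 a l b = pj b (el a l)"
text \<open>A point of \<open>k\<close> is labelled by the point of \<open>U\<close> that has the
  same projection on \<open>r0\<close>. Regularity of \<open>x\<close> allows any other line of
  \<open>R\<close> in place of \<open>r0\<close>.\<close>

definition pt2 :: "'l \<Rightarrow> 'p \<Rightarrow> 'p" where "pt2 k b = pj (pj b r0) k"
definition ln3 :: "'l \<Rightarrow> 'p \<Rightarrow> 'l \<Rightarrow> 'l" where "ln3 k b s = pl (pt2 k b) s"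

lemma n0:
  assumes "b \<in> B" "l \<in> R"
  shows "n0 b l \<in> L" "I b (n0 b l)" "mt (n0 b l) l" "\<not> mt (n0 b l) M" "\<not> I b l" "\<not> I x (n0 b l)"
proof -
  show bl: "\<not> I b l" using nAline[of b U o1 l] BP[OF assms(1)] RL[OF assms(2)] by simp
  show n: "n0 b l \<in> L" "I b (n0 b l)" "mt (n0 b l) l" using pl[of b l] bl BP RL assms unfolding n0_def by auto
  have "n0 b l \<noteq> U"
  proof
    assume "n0 b l = U"
    then obtain t where t: "t \<in> P" "I t U" "I t l" using n by (auto simp: col_def)
    have "t \<noteq> x" using nxA[of o1 l] RL[OF assms(2)] t by auto
    then show False using nAline[of t U o1 l] t RL[OF assms(2)] by simp
  qed
  then show "\<not> mt (n0 b l) M" "\<not> I x (n0 b l)" using oppI[of b U "n0 b l"] n BP[OF assms(1)] by auto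
qed

lemma el:
  assumes "a \<in> A" "l \<in> R"
  shows "el a l \<in> L" "I a (el a l)" "mt (el a l) (n0 p0 l)" "el a l \<noteq> M" "mt (el a l) M"
proof -
  note n = n0[OF base(3) assms(2)]
  have "\<not> I a (n0 p0 l)" using n AP[OF assms(1)] by (auto intro: mtI)
  then show e: "el a l \<in> L" "I a (el a l)" "mt (el a l) (n0 p0 l)" using pl[of a "n0 p0 l"] n AP[OF assms(1)] unfolding el_def by auto
  then show "el a l \<noteq> M" using n by (auto simp: mt_sym)
  show "mt (el a l) M" using e AP[OF assms(1)] by (auto intro: mtI)
qed

lemma el_o: "l \<in> R \<Longrightarrow> el o1 l = l"
  unfolding el_def
  by (rule pl_eq) (use n0[of p0 l] o1 RL[of l] in \<open>auto simp: mt_sym intro: mtI\<close>)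

text \<open>\<open>n0 b l\<close> meets \<open>U\<close> and \<open>l\<close>, which are two
  transversals of \<open>M\<close> and \<open>n0 p0 l\<close>; regularity of \<open>M\<close> makes
  it meet the third transversal \<open>el a l\<close>.\<close>

lemma el_meets:
  assumes "a \<in> A" "l \<in> R" "b \<in> B"
  shows "mt (n0 b l) (el a l)"
proof (rule rlD[OF rM _ _ _ _ _ _ _ _ _ _ ])
  note n = n0[OF base(3) assms(2)] and n' = n0[OF assms(3,2)] and e = el[OF assms(1,2)]
  show "\<not> mt M (n0 p0 l)" using n by (simp add: mt_sym)
  show "U \<noteq> l" using n'(5) BP[OF assms(3)] by auto
  show "mt M U" using xM U xP by (auto intro: mtI)
  show "mt (n0 p0 l) U" using n p0 by (auto intro: mtI)
  show "mt M l" using RL[OF assms(2)] o1 by (auto intro: mtI)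
  show "mt (n0 p0 l) l" using n by simp
  show "mt (n0 b l) U" using n' BP[OF assms(3)] by (auto intro: mtI)
  show "mt (n0 b l) l" using n' by simp
  show "mt M (el a l)" "mt (n0 p0 l) (el a l)" using e by (simp_all add: mt_sym)
qed (use n0 el RL U assms in auto)

lemma pt3:
  assumes "a \<in> A" "l \<in> R" "b \<in> B"
  shows "pt3 a l b \<in> P" "I (pt3 a l b) (el a l)" "cl b (pt3 a l b)" "I (pt3 a l b) (n0 b l)" "\<not> cl x (pt3 a l b)"
    "pj (pt3 a l b) U = b" "pj (pt3 a l b) M = a" "cl a (pt3 a l b)" "\<not> I (pt3 a l b) M"
proof -
  note n = n0[OF assms(3,2)] and e = el[OF assms(1,2)] and b = BP[OF assms(3)] and a = AP[OF assms(1)]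
  have be: "\<not> I b (el a l)" using nAline[of b U a "el a l"] b e assms by auto
  show p: "pt3 a l b \<in> P" "I (pt3 a l b) (el a l)" "cl b (pt3 a l b)" using pj[of b "el a l"] b e unfolding pt3_def by auto
  obtain t where t: "t \<in> P" "I t (n0 b l)" "I t (el a l)" using el_meets[OF assms] by (rule mtE)
  have "pt3 a l b = t" unfolding pt3_def by (rule pj_eq) (use t b e be n in \<open>auto intro: clI\<close>)
  then show q: "I (pt3 a l b) (n0 b l)" using t by simp
  have nM: "\<not> I (pt3 a l b) M" using q n p by (auto intro: mtI)
  then show "\<not> I (pt3 a l b) M" .
  have nx: "\<not> I x (el a l)" using nxA[of a "el a l"] e assms by auto
  show nc: "\<not> cl x (pt3 a l b)"
  proof
    assume "cl x (pt3 a l b)"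
    moreover have "cl x a" using a xM MinL by (auto intro: clI)
    moreover have "pt3 a l b \<noteq> a" using nM a by auto
    ultimately show False using no_tri[of a "pt3 a l b" x "el a l"] nx e p a xP by auto
  qed
  have "\<not> I (pt3 a l b) U" using nc U by (auto intro: clI)
  then show "pj (pt3 a l b) U = b" using pj_eq[of "pt3 a l b" U b] p b U by (auto simp: cl_sym)
  show c: "cl a (pt3 a l b)" using e p by (auto intro: clI)
  show "pj (pt3 a l b) M = a" using pj_eq[of "pt3 a l b" M a] nM c p a MinL by (auto simp: cl_sym)
qed

lemma pj_o: "l \<in> R \<Longrightarrow> pj b l = pt3 o1 l b"
  by (simp add: pt3_def el_o)

lemma pt2:
  assumes "k \<in> K" "b \<in> B"
  shows "pt2 k b \<in> P" "I (pt2 k b) k" "pt2 k b \<noteq> x" "l \<in> R \<Longrightarrow> cl (pt3 o1 l b) (pt2 k b)" "\<not> I (pt2 k b) M" "cl x (pt2 k b)"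
proof -
  have e: "pt2 k b = pj (pt3 o1 r0 b) k" by (simp add: pt2_def pj_o)
  note t = pt3[OF base(1,4) assms(2)]
  show p: "pt2 k b \<in> P" "I (pt2 k b) k" unfolding e using pj[of "pt3 o1 r0 b" k] t KL[OF assms(1)] by auto
  have c: "cl (pt3 o1 r0 b) (pt2 k b)" unfolding e using pj[of "pt3 o1 r0 b" k] t KL[OF assms(1)] by auto
  show ne: "pt2 k b \<noteq> x" using c t by (auto simp: cl_sym)
  show "\<not> I (pt2 k b) M" using nM[of "pt2 k b" k] p ne assms by auto
  show cx: "cl x (pt2 k b)" using clx[OF assms(1) p(2)] .
  assume l: "l \<in> R"
  note s = pt3[OF base(1) l assms(2)]
  have "o1 \<noteq> b" using o1 nM[of b U] BP[OF assms(2)] by auto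
  show "cl (pt3 o1 l b) (pt2 k b)"
    by (rule regD[OF rx t(5) \<open>o1 \<noteq> b\<close>])
      (use s t p c cx o1 BP[OF assms(2)] xM MinL U in \<open>auto simp: cl_sym intro: clI\<close>)
qed

lemma pt2_U: "b \<in> B \<Longrightarrow> pt2 U b = b"
  using pt3[OF base(1,4), of b] by (simp add: pt2_def pj_o)

lemma pt2_surj:
  assumes "k \<in> K" "q \<in> P" "I q k" "q \<noteq> x"
  shows "\<exists>b\<in>B. pt2 k b = q"
proof -
  have qr: "\<not> I q r0" using nAline[of q k o1 r0] assms r0 by simp
  let ?y = "pj q r0"
  have y: "?y \<in> P" "I ?y r0" "cl q ?y" using pj[of q r0] assms r0 by auto
  have yo: "?y \<noteq> o1" using nA[of q k o1] y assms by auto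
  have yx: "\<not> cl x ?y" 
  proof
    assume "cl x ?y"
    then have "I x r0" using no_tri[of o1 ?y x r0] y yo o1 r0 xP xM MinL by (auto intro: clI)
    then show False using nxA[of o1 r0] r0 by simp
  qed
  let ?b = "pj ?y U"
  have b: "?b \<in> P" "I ?b U" "cl ?y ?b" using pj[of ?y U] y U by auto
  then have bB: "?b \<in> B" using yx by (auto simp: B_def cl_sym)
  have "pj ?b r0 = ?y" by (rule pj_eq) (use b y r0 n0(5)[OF bB base(4)] in \<open>auto simp: cl_sym\<close>)
  moreover have "pj ?y k = q" by (rule pj_eq) (use y assms yx KL[OF assms(1)] in \<open>auto simp: cl_sym intro: clI\<close>)
  ultimately have "pt2 k ?b = q" by (simp add: pt2_def)
  then show ?thesis using bB by blast
qed

lemma pt2_inj: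
  assumes "k \<in> K" "b \<in> B" "b' \<in> B" "pt2 k b = pt2 k b'"
  shows "b = b'"
proof -
  have qr: "\<not> I (pt2 k b) r0" using nAline[of "pt2 k b" k o1 r0] pt2[OF assms(1,2)] assms r0 by simp
  note t = pt3[OF base(1,4) assms(2)] and t' = pt3[OF base(1,4) assms(3)]
  have "pt3 o1 r0 b = pt3 o1 r0 b'"
    using pj_unique[of "pt2 k b" r0 "pt3 o1 r0 b" "pt3 o1 r0 b'"] qr t(1,2) t'(1,2) el_o[OF base(4)] r0
      pt2(1,4)[OF assms(1,2)] pt2(4)[OF assms(1,3)] assms(4) by (simp add: cl_sym)
  then show ?thesis using t(6) t'(6) by metis
qed

lemma pt2_k: "\<lbrakk>k \<in> K; k' \<in> K; b \<in> B; b' \<in> B; pt2 k b = pt2 k' b'\<rbrakk> \<Longrightarrow> k = k' \<and> b = b'"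
  using pt2[of k b] pt2[of k' b'] line_unique[of x "pt2 k b" k k'] KL[of k] KL[of k'] xP pt2_inj[of k b b'] by auto

lemma ln3:
  assumes "k \<in> K" "b \<in> B" "s \<in> R"
  shows "ln3 k b s \<in> L" "I (pt2 k b) (ln3 k b s)" "mt (ln3 k b s) s" "I (pt3 o1 s b) (ln3 k b s)"
    "\<not> mt (ln3 k b s) M" "\<not> I x (ln3 k b s)" "pj x (ln3 k b s) = pt2 k b" "ln3 k b s \<noteq> k" "\<not> I (pt2 k b) s"
proof -
  note q = pt2[OF assms(1,2)] and t = pt3[OF base(1) assms(3,2)]
  show ns: "\<not> I (pt2 k b) s" using nAline[of "pt2 k b" k o1 s] q RL[OF assms(3)] assms by simp
  show n: "ln3 k b s \<in> L" "I (pt2 k b) (ln3 k b s)" "mt (ln3 k b s) s"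
    using pl[of "pt2 k b" s] ns q RL[OF assms(3)] unfolding ln3_def by auto
  have c: "cl (pt3 o1 s b) (pt2 k b)" using q(4)[OF assms(3)] .
  have ts: "I (pt3 o1 s b) s" using t(2) el_o[OF assms(3)] by simp
  obtain N where N: "N \<in> L" "I (pt3 o1 s b) N" "I (pt2 k b) N" using c by (rule clE)
  have "ln3 k b s = N" unfolding ln3_def
    by (rule pl_eq) (use ns q N ts t RL[OF assms(3)] in \<open>auto intro: mtI\<close>)
  then show i: "I (pt3 o1 s b) (ln3 k b s)" using N by simp
  show nk: "ln3 k b s \<noteq> k" using clx[OF assms(1)] i t(5) by metis
  then show o: "\<not> mt (ln3 k b s) M" "\<not> I x (ln3 k b s)" using oppI[of "pt2 k b" k "ln3 k b s"] q n assms by auto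
  show "pj x (ln3 k b s) = pt2 k b" by (rule pj_eq) (use n o q xP in auto)
qed

lemma ln3_U: "\<lbrakk>b \<in> B; s \<in> R\<rbrakk> \<Longrightarrow> ln3 U b s = n0 b s"
  by (simp add: ln3_def n0_def pt2_U)

lemma pl_o_ln3: "\<lbrakk>k \<in> K; b \<in> B; s \<in> R\<rbrakk> \<Longrightarrow> pl o1 (ln3 k b s) = s"
  by (rule pl_eq) (use ln3[of k b s] o1 RL[of s] in \<open>auto simp: mt_sym intro: mtI\<close>)

lemma ln3_inj: "\<lbrakk>k \<in> K; b \<in> B; s \<in> R; k' \<in> K; b' \<in> B; s' \<in> R; ln3 k b s = ln3 k' b' s'\<rbrakk> \<Longrightarrow> k = k' \<and> b = b' \<and> s = s'"
  using ln3(7)[of k b s] ln3(7)[of k' b' s'] pl_o_ln3[of k b s] pl_o_ln3[of k' b' s'] pt2_k[of k k' b b'] by auto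

lemma ln3_surj:
  assumes "N \<in> L" "\<not> mt N M"
  shows "\<exists>k\<in>K. \<exists>b\<in>B. \<exists>s\<in>R. N = ln3 k b s"
proof -
  have xN: "\<not> I x N" using assms xM xP by (auto intro: mtI)
  let ?q = "pj x N"
  have q: "?q \<in> P" "I ?q N" "cl x ?q" using pj[of x N] assms xP by auto
  obtain k where k: "k \<in> L" "I x k" "I ?q k" using q by (auto simp: col_def)
  have "k \<noteq> M" using k q assms by (auto intro: mtI)
  then have kK: "k \<in> K" using k by (simp add: K_def)
  have qx: "?q \<noteq> x" using q xN by auto
  obtain b where b: "b \<in> B" "pt2 k b = ?q" using pt2_surj[OF kK q(1) k(3) qx] by blast
  have oN: "\<not> I o1 N" using assms o1 by (auto intro: mtI)
  let ?s = "pl o1 N"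
  have s: "?s \<in> L" "I o1 ?s" "mt ?s N" using pl[of o1 N] oN o1 assms by auto
  then have sR: "?s \<in> R" using assms by (auto simp: R_def mt_sym)
  have "ln3 k b ?s = N" unfolding ln3_def b(2)
    by (rule pl_eq) (use q s assms ln3(9)[OF kK b(1) sR] b in \<open>auto simp: mt_sym\<close>)
  then have "N = ln3 k b ?s" by simp
  then show ?thesis using kK b(1) sR by blast
qed

lemma el_surj:
  assumes "a \<in> A" "W \<in> L" "I a W" "W \<noteq> M"
  shows "\<exists>l\<in>R. W = el a l"
proof -
  have pW: "\<not> I p0 W" using nAline[of p0 U a W] p0 assms by simp
  let ?N = "pl p0 W"
  have N: "?N \<in> L" "I p0 ?N" "mt ?N W" using pl[of p0 W] pW p0 assms by auto
  have xW: "\<not> I x W" using nxA assms by blast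
  have "?N \<noteq> U"
  proof
    assume "?N = U"
    then obtain t where t: "t \<in> P" "I t U" "I t W" using N by (auto simp: col_def)
    then show False using nAline[of t U a W] xW assms by auto
  qed
  then have o: "\<not> mt ?N M" using oppI[of p0 U ?N] N p0 by simp
  have oN: "\<not> I o1 ?N" using o o1 by (auto intro: mtI)
  let ?l = "pl o1 ?N"
  have l: "?l \<in> L" "I o1 ?l" "mt ?l ?N" using pl[of o1 ?N] oN o1 N by auto
  then have lR: "?l \<in> R" using o by (auto simp: R_def mt_sym)
  have "n0 p0 ?l = ?N" unfolding n0_def
    by (rule pl_eq) (use N l p0 n0(5)[OF base(3) lR] in \<open>auto simp: mt_sym\<close>)
  moreover have "pl a ?N = W"
    by (rule pl_eq) (use N assms o AP[OF assms(1)] in \<open>auto simp: mt_sym intro: mtI\<close>)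
  ultimately show ?thesis unfolding el_def using lR by metis
qed

lemma el_inj:
  assumes "a \<in> A" "l \<in> R" "a' \<in> A" "l' \<in> R" "el a l = el a' l'"
  shows "a = a' \<and> l = l'"
proof -
  note e = el[OF assms(1,2)] and e' = el[OF assms(3,4)]
  have a: "a = a'" using line_unique[of a a' M "el a l"] e e' AP[OF assms(1)] AP[OF assms(3)] MinL assms(5) by auto
  have "\<not> I p0 (el a l)" using nAline[of p0 U a "el a l"] p0 assms e by simp
  then have "n0 p0 l = n0 p0 l'"
    using pl_unique[of p0 "el a l" "n0 p0 l" "n0 p0 l'"] p0 e e' assms(5) n0[OF base(3) assms(2)] n0[OF base(3) assms(4)]
    by (simp add: mt_sym)
  moreover have "pl o1 (n0 p0 l) = l" if "l \<in> R" for l using pl_o_ln3[OF base(2,3) that] ln3_U[OF base(3) that] by simp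
  ultimately show ?thesis using a assms by metis
qed

lemma pt3_surj:
  assumes "y \<in> P" "\<not> cl x y"
  shows "\<exists>a\<in>A. \<exists>l\<in>R. \<exists>b\<in>B. y = pt3 a l b"
proof -
  have yM: "\<not> I y M" using assms xM MinL by (auto intro: clI)
  let ?W = "pl y M"
  have W: "?W \<in> L" "I y ?W" "mt ?W M" using pl[of y M] assms yM MinL by auto
  then obtain a where a: "a \<in> P" "I a ?W" "I a M" by (auto simp: col_def)
  have "a \<noteq> x" using a W assms by (auto intro: clI)
  then have aA: "a \<in> A" using a by (simp add: A_def)
  have "?W \<noteq> M" using W yM by auto
  then obtain l where l: "l \<in> R" "?W = el a l" using el_surj[OF aA W(1) a(2)] by blast
  let ?b = "pj y U"
  have b: "?b \<in> P" "I ?b U" "cl y ?b" using pj[of y U] assms U by auto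
  then have bB: "?b \<in> B" using assms by (auto simp: B_def cl_sym)
  have "pt3 a l ?b = y" unfolding pt3_def l(2)[symmetric]
    by (rule pj_eq) (use W b assms nAline[of ?b U a ?W] BP[OF bB] aA a in \<open>auto simp: cl_sym\<close>)
  then have "y = pt3 a l ?b" by simp
  then show ?thesis using aA l(1) bB by blast
qed

lemma pt3_inj: "\<lbrakk>a \<in> A; l \<in> R; b \<in> B; a' \<in> A; l' \<in> R; b' \<in> B; pt3 a l b = pt3 a' l' b'\<rbrakk> \<Longrightarrow> a = a' \<and> l = l' \<and> b = b'"
proof -
  assume h: "a \<in> A" "l \<in> R" "b \<in> B" "a' \<in> A" "l' \<in> R" "b' \<in> B" "pt3 a l b = pt3 a' l' b'"
  note t = pt3[OF h(1-3)] and t' = pt3[OF h(4-6)]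
  have a: "a = a'" "b = b'" using t(6,7) t'(6,7) h(7) by metis+
  have "a \<noteq> pt3 a l b" using t(9) AP[OF h(1)] by auto
  then have "el a l = el a' l'"
    using line_unique[of a "pt3 a l b" "el a l" "el a' l'"] el[OF h(1,2)] el[OF h(4,5)] t t' a h(7) AP[OF h(1)] by auto
  then show ?thesis using el_inj h a by blast
qed

text \<open>\<open>TT a k b\<close> is the last coordinate of the points with first coordinate
  \<open>a\<close> that are collinear with \<open>pt2 k b\<close>; regularity of \<open>x\<close>
  makes it independent of the middle coordinate. Dually, \<open>LT a k l\<close> is the last
  coordinate of the lines with first coordinate \<open>k\<close> that meet \<open>el a l\<close>,
  and regularity of \<open>M\<close> makes it independent of the point on \<open>k\<close>.\<close>

definition TT :: "'p \<Rightarrow> 'l \<Rightarrow> 'p \<Rightarrow> 'p" where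
  "TT a k b = pj (pj (pt2 k b) (el a r0)) U"
definition LT :: "'p \<Rightarrow> 'l \<Rightarrow> 'l \<Rightarrow> 'l" where
  "LT a k l = pl o1 (pl (pt2 k p0) (el a l))"

lemma TT:
  assumes "a \<in> A" "k \<in> K" "b \<in> B"
  shows "TT a k b \<in> B" "\<lbrakk>l \<in> R; b' \<in> B\<rbrakk> \<Longrightarrow> cl (pt3 a l b') (pt2 k b) \<longleftrightarrow> b' = TT a k b"
proof -
  note q = pt2[OF assms(2,3)]
  have nq: "\<not> I (pt2 k b) (el a l)" if "l \<in> R" for l
    using nAline[of "pt2 k b" k a "el a l"] q el[OF assms(1) that] assms by simp
  let ?y = "pj (pt2 k b) (el a r0)"
  have y: "?y \<in> P" "I ?y (el a r0)" "cl (pt2 k b) ?y" using pj[of "pt2 k b" "el a r0"] q el[OF assms(1) base(4)] by auto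
  have ya: "?y \<noteq> a" using nA[of "pt2 k b" k a] q y assms by auto
  have ca: "cl ?y a" using y el[OF assms(1) base(4)] by (auto intro: clI)
  have xa: "cl x a" using AP[OF assms(1)] xM MinL by (auto intro: clI)
  have yx: "\<not> cl x ?y"
  proof
    assume "cl x ?y"
    then have "I x (el a r0)" using no_tri[of a ?y x "el a r0"] xa ya y el[OF assms(1) base(4)] AP[OF assms(1)] xP by auto
    then show False using nxA[of a "el a r0"] el[OF assms(1) base(4)] assms by simp
  qed
  let ?b = "TT a k b"
  have b: "?b \<in> P" "I ?b U" "cl ?y ?b" unfolding TT_def using pj[of ?y U] y U by auto
  then show bB: "?b \<in> B" using yx by (auto simp: B_def cl_sym)
  assume l: "l \<in> R" and b': "b' \<in> B"
  note t = pt3[OF assms(1) l bB] and t' = pt3[OF assms(1) l b']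
  have ab: "a \<noteq> ?b" using nM[of ?b U] BP[OF bB] AP[OF assms(1)] by auto
  have c: "cl (pt3 a l ?b) (pt2 k b)"
    by (rule regD[OF rx yx ab]) (use t y b q ca xa AP[OF assms(1)] clx[OF base(2), of ?b] in \<open>auto simp: cl_sym\<close>)
  show "cl (pt3 a l b') (pt2 k b) \<longleftrightarrow> b' = ?b"
  proof
    assume "cl (pt3 a l b') (pt2 k b)"
    then have "pt3 a l b' = pt3 a l ?b"
      using pj_unique[of "pt2 k b" "el a l" "pt3 a l b'" "pt3 a l ?b"] nq[OF l] q(1) el(1)[OF assms(1) l] t(1,2) t'(1,2) c
      by (simp add: cl_sym)
    then show "b' = ?b" using t(6) t'(6) by metis
  qed (use c in simp)
qed

lemma TT_U: "\<lbrakk>a \<in> A; b \<in> B\<rbrakk> \<Longrightarrow> TT a U b = b"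
  using TT(2)[OF _ base(2), of a b r0 b] pt3(3)[of a r0 b] pt2_U[of b] by (simp add: cl_sym)

lemma TT_o: "\<lbrakk>k \<in> K; b \<in> B\<rbrakk> \<Longrightarrow> TT o1 k b = b"
  using TT(2)[OF base(1), of k b r0 b] pt2(4)[of k b r0] by simp

lemma XA_ex:
  assumes "k \<in> K" "c \<in> K" "k \<noteq> c" "b \<in> B" "d \<in> B"
  shows "\<exists>a\<in>A. TT a k b = TT a c d"
proof -
  note q = pt2[OF assms(1,4)] and q' = pt2[OF assms(2,5)]
  have nc: "\<not> cl (pt2 k b) (pt2 c d)"
  proof
    assume "cl (pt2 k b) (pt2 c d)"
    then have "I (pt2 c d) k" using no_tri[of x "pt2 k b" "pt2 c d" k] q q' KL[OF assms(1)] xP by (auto simp: cl_sym)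
    then show False using line_unique[of x "pt2 c d" k c] q' KL assms xP by auto
  qed
  obtain y where y: "y \<in> P" "y \<noteq> x" "cl (pt2 k b) y" "cl (pt2 c d) y" using two_traces[OF q(1) q'(1) nc] by metis
  have "\<not> cl x y" using trace_opp[of "pt2 k b" "pt2 c d" x y] q q' nc y xP by (auto simp: cl_sym)
  then obtain a l b' where "a \<in> A" "l \<in> R" "b' \<in> B" "y = pt3 a l b'" using pt3_surj y by blast
  then show ?thesis using TT(2) y assms by (metis cl_sym)
qed

lemma XA_un:
  assumes "k \<in> K" "c \<in> K" "k \<noteq> c" "b \<in> B" "d \<in> B" "a \<in> A" "a' \<in> A" "TT a k b = TT a c d" "TT a' k b = TT a' c d"
  shows "a = a'"
proof -
  note q = pt2[OF assms(1,4)] and q' = pt2[OF assms(2,5)]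
  note B1 = TT(1)[OF assms(6,1,4)] and B2 = TT(1)[OF assms(7,1,4)]
  let ?y = "pt3 a r0 (TT a k b)" and ?y' = "pt3 a' r0 (TT a' k b)"
  note t = pt3[OF assms(6) base(4) B1] and t' = pt3[OF assms(7) base(4) B2]
  have c: "cl ?y (pt2 k b)" "cl ?y (pt2 c d)" "cl ?y' (pt2 k b)" "cl ?y' (pt2 c d)"
    using TT(2)[OF assms(6,1,4) base(4) B1] TT(2)[OF assms(6,2,5) base(4) B1]
      TT(2)[OF assms(7,1,4) base(4) B2] TT(2)[OF assms(7,2,5) base(4) B2] assms by auto
  have ne: "pt2 k b \<noteq> pt2 c d" using pt2_k assms by blast
  have "cl ?y' a"
    by (rule regD[OF rx t(5) ne])
      (use c q q' t t' AP[OF assms(6)] xM MinL in \<open>auto simp: cl_sym intro: clI\<close>)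
  then show ?thesis using pj_eq[of ?y' M a] t' AP[OF assms(6)] MinL by auto
qed

lemma mt_ln3_el:
  assumes "k \<in> K" "g \<in> B" "g' \<in> B" "s \<in> R" "a \<in> A" "l \<in> R" "mt (ln3 k g s) (el a l)"
  shows "mt (ln3 k g' s) (el a l)"
proof (rule rlD[OF rM])
  note n = ln3[OF assms(1,2,4)] and n' = ln3[OF assms(1,3,4)]
  show "\<not> mt M (ln3 k g s)" using n by (simp add: mt_sym)
  show "k \<noteq> s" using n(9) pt2(2)[OF assms(1,2)] by auto
  show "mt M k" using KL[OF assms(1)] xM xP by (auto intro: mtI)
  show "mt (ln3 k g s) k" "mt (ln3 k g' s) k" using n n' pt2[OF assms(1,2)] pt2[OF assms(1,3)] by (auto intro: mtI)
  show "mt M s" using RL[OF assms(4)] o1 by (auto intro: mtI)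
  show "mt M (el a l)" using el[OF assms(5,6)] by (simp add: mt_sym)
qed (use ln3 el KL RL assms in auto)

lemma LT:
  assumes "a \<in> A" "k \<in> K" "l \<in> R"
  shows "LT a k l \<in> R" "\<lbrakk>g \<in> B; s \<in> R\<rbrakk> \<Longrightarrow> mt (ln3 k g s) (el a l) \<longleftrightarrow> s = LT a k l"
proof -
  note q = pt2[OF assms(2) base(3)] and e = el[OF assms(1,3)]
  have nq: "\<not> I (pt2 k p0) (el a l)"
    using nAline[of "pt2 k p0" k a "el a l"] q e assms by simp
  let ?N = "pl (pt2 k p0) (el a l)"
  have N: "?N \<in> L" "I (pt2 k p0) ?N" "mt ?N (el a l)" using pl[of "pt2 k p0" "el a l"] nq q e by auto
  have "?N \<noteq> k"
  proof
    assume "?N = k"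
    then obtain t where t: "t \<in> P" "I t k" "I t (el a l)" using N by (auto simp: col_def)
    have "t \<noteq> x" using nxA[of a "el a l"] e t assms by auto
    then show False using nAline[of t k a "el a l"] t e assms by simp
  qed
  then have o: "\<not> mt ?N M" using oppI[of "pt2 k p0" k ?N] q N assms by simp
  have oN: "\<not> I o1 ?N" using o o1 by (auto intro: mtI)
  have s: "LT a k l \<in> L" "I o1 (LT a k l)" "mt (LT a k l) ?N" using pl[of o1 ?N] oN o1 N unfolding LT_def by auto
  then show sR: "LT a k l \<in> R" using o by (auto simp: R_def mt_sym)
  have ln: "ln3 k p0 (LT a k l) = ?N" unfolding ln3_def
    by (rule pl_eq) (use N s q ln3(9)[OF assms(2) base(3) sR] in \<open>auto simp: mt_sym\<close>)
  assume g: "g \<in> B" and t: "s \<in> R"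
  show "mt (ln3 k g s) (el a l) \<longleftrightarrow> s = LT a k l"
  proof
    assume "mt (ln3 k g s) (el a l)"
    then have "mt (ln3 k p0 s) (el a l)" using mt_ln3_el[OF assms(2) g base(3) t assms(1,3)] by blast
    then have "?N = ln3 k p0 s"
      using pl_eq[of "pt2 k p0" "el a l" "ln3 k p0 s"] nq q e ln3[OF assms(2) base(3) t] by auto
    then show "s = LT a k l" unfolding LT_def using pl_o_ln3[OF assms(2) base(3) t] by simp
  next
    assume "s = LT a k l"
    then show "mt (ln3 k g s) (el a l)"
      using mt_ln3_el[OF assms(2) base(3) g t assms(1,3)] ln N by simp
  qed
qed

text \<open>Incidence splits into collinearity with a point on \<open>k\<close> and concurrency with
  a line through \<open>a\<close>. Conversely, if both hold, the line meets \<open>el a l\<close> in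
  the projection of \<open>pt2 k g\<close>, and that is the given point.\<close>

lemma inc33:
  assumes "a \<in> A" "l \<in> R" "b \<in> B" "k \<in> K" "g \<in> B" "s \<in> R"
  shows "I (pt3 a l b) (ln3 k g s) \<longleftrightarrow> b = TT a k g \<and> s = LT a k l"
proof
  note t = pt3[OF assms(1-3)] and n = ln3[OF assms(4-6)] and q = pt2[OF assms(4,5)] and e = el[OF assms(1,2)]
  {
    assume i: "I (pt3 a l b) (ln3 k g s)"
    have "cl (pt3 a l b) (pt2 k g)" using i n by (auto intro: clI)
    moreover have "mt (ln3 k g s) (el a l)" using i n t by (auto intro: mtI)
    ultimately show "b = TT a k g \<and> s = LT a k l"
      using TT(2)[OF assms(1,4,5,2,3)] LT(2)[OF assms(1,4,2,5,6)] by blast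
  }
  assume "b = TT a k g \<and> s = LT a k l"
  then have c: "cl (pt3 a l b) (pt2 k g)" and m: "mt (ln3 k g s) (el a l)"
    using TT(2)[OF assms(1,4,5,2,3)] LT(2)[OF assms(1,4,2,5,6)] by blast+
  obtain z where z: "z \<in> P" "I z (ln3 k g s)" "I z (el a l)" using m by (rule mtE)
  have "\<not> I (pt2 k g) (el a l)"
    using nAline[of "pt2 k g" k a "el a l"] q e assms by simp
  then have "z = pt3 a l b"
    using pj_unique[of "pt2 k g" "el a l" z "pt3 a l b"] z q t e n c by (auto simp: cl_sym intro: clI)
  then show "I (pt3 a l b) (ln3 k g s)" using z by simp
qed

lemma LT_o: "\<lbrakk>k \<in> K; l \<in> R\<rbrakk> \<Longrightarrow> LT o1 k l = l"
  using LT(2)[OF base(1), of k l p0 l] ln3(3)[of k p0 l] by (simp add: el_o)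

lemma LT_U: "\<lbrakk>a \<in> A; l \<in> R\<rbrakk> \<Longrightarrow> LT a U l = l"
  using LT(2)[OF _ base(2), of a l p0 l] el_meets[of a l p0] by (simp add: ln3_U)

lemma LT_inj:
  assumes "a \<in> A" "k \<in> K" "l \<in> R" "l' \<in> R" "LT a k l = LT a k l'"
  shows "l = l'"
proof -
  let ?s = "LT a k l"
  have s: "?s \<in> R" using LT(1)[OF assms(1-3)] .
  have m: "mt (ln3 k p0 ?s) (el a l)" "mt (ln3 k p0 ?s) (el a l')"
    using LT(2)[OF assms(1-3) base(3) s] LT(2)[OF assms(1,2,4) base(3) s] assms(5) by auto
  have "\<not> I a (ln3 k p0 ?s)" using ln3[OF assms(2) base(3) s] AP[OF assms(1)] by (auto intro: mtI)
  then have "el a l = el a l'"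
    using pl_unique[of a "ln3 k p0 ?s" "el a l" "el a l'"] m el[OF assms(1,3)] el[OF assms(1,4)]
      ln3[OF assms(2) base(3) s] AP[OF assms(1)] by (simp add: mt_sym)
  then show ?thesis using el_inj assms by blast
qed

lemma LT_surj:
  assumes "a \<in> A" "k \<in> K" "s \<in> R"
  shows "\<exists>l\<in>R. LT a k l = s"
proof -
  note n = ln3[OF assms(2) base(3) assms(3)]
  have na: "\<not> I a (ln3 k p0 s)" using n AP[OF assms(1)] by (auto intro: mtI)
  let ?W = "pl a (ln3 k p0 s)"
  have W: "?W \<in> L" "I a ?W" "mt ?W (ln3 k p0 s)" using pl[of a "ln3 k p0 s"] na n AP[OF assms(1)] by auto
  have "?W \<noteq> M" using W n by (auto simp: mt_sym)
  then obtain l where l: "l \<in> R" "?W = el a l" using el_surj[OF assms(1) W(1,2)] by blast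
  then show ?thesis using LT(2)[OF assms(1,2) l(1) base(3) assms(3)] W by (auto simp: mt_sym)
qed

lemma opp_el:
  assumes "a \<in> A" "a' \<in> A" "a \<noteq> a'" "l \<in> R" "l' \<in> R" "z \<in> P" "I z (el a l)" "\<not> I z M" "w \<in> P" "I w (el a' l')" "\<not> I w M"
    "N \<in> L" "I z N" "I w N"
  shows "\<not> mt N M" "z \<noteq> w"
proof -
  note e = el[OF assms(1,4)] and e' = el[OF assms(2,5)]
  have nza: "\<not> cl z a'"
    using pj_unique[of z M a a'] e assms AP[OF assms(1)] AP[OF assms(2)] MinL by (auto intro: clI)
  have nwa: "\<not> cl w a"
    using pj_unique[of w M a a'] e' assms AP[OF assms(1)] AP[OF assms(2)] MinL by (auto intro: clI)
  show "z \<noteq> w" using nza assms e' by (auto intro: clI)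
  show "\<not> mt N M"
  proof
    assume "mt N M"
    then obtain t where t: "t \<in> P" "I t N" "I t M" by (rule mtE)
    have "t = a" using pj_unique[of z M t a] t assms e AP[OF assms(1)] MinL by (auto intro: clI)
    then show False using nwa t assms by (auto intro: clI)
  qed
qed

lemma XB_ex:
  assumes "a \<in> A" "a' \<in> A" "a \<noteq> a'" "l \<in> R" "l' \<in> R"
  shows "\<exists>k\<in>K. LT a k l = LT a' k l'"
proof -
  note t = pt3[OF assms(1,4) base(3)] and e = el[OF assms(1,4)] and e' = el[OF assms(2,5)]
  let ?z = "pt3 a l p0" and ?w = "pj (pt3 a l p0) (el a' l')"
  have w: "?w \<in> P" "I ?w (el a' l')" "cl ?z ?w" using pj[of ?z "el a' l'"] t e' by auto
  have wM: "\<not> I ?w M"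
  proof
    assume "I ?w M"
    moreover have "?w = a" using calculation pj_unique[of ?z M ?w a] w t AP[OF assms(1)] MinL e by (auto simp: cl_sym)
    ultimately show False using line_unique[of a a' M "el a' l'"] w e' AP[OF assms(1)] AP[OF assms(2)] MinL assms by auto
  qed
  obtain N where N: "N \<in> L" "I ?z N" "I ?w N" using w by (auto simp: col_def)
  have "\<not> mt N M" using opp_el(1)[OF assms t(1,2,9) w(1,2) wM N] .
  then obtain k g s where k: "k \<in> K" "g \<in> B" "s \<in> R" "N = ln3 k g s" using ln3_surj[OF N(1)] by blast
  have "mt N (el a l)" "mt N (el a' l')" using N t w by (auto intro: mtI)
  then have "s = LT a k l" "s = LT a' k l'"
    using LT(2)[OF assms(1) k(1) assms(4) k(2,3)] LT(2)[OF assms(2) k(1) assms(5) k(2,3)] k by auto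
  then show ?thesis using k(1) by metis
qed

lemma XB_un:
  assumes "a \<in> A" "a' \<in> A" "a \<noteq> a'" "l \<in> R" "l' \<in> R" "k \<in> K" "LT a k l = LT a' k l'" "h \<in> K" "LT a h l = LT a' h l'"
  shows "k = h"
proof (rule ccontr)
  assume kh: "k \<noteq> h"
  let ?N = "ln3 k p0 (LT a k l)" and ?N' = "ln3 h p0 (LT a h l)"
  note s = LT(1)[OF assms(1,6,4)] and s' = LT(1)[OF assms(1,8,4)]
  note n = ln3[OF assms(6) base(3) s] and n' = ln3[OF assms(8) base(3) s'] and e = el[OF assms(1,4)] and e' = el[OF assms(2,5)]
  have 1: "mt ?N (el a l)" "mt ?N (el a' l')" using LT(2)[OF assms(1,6,4) base(3) s] LT(2)[OF assms(2,6,5) base(3) s] assms(7) by auto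
  have 2: "mt ?N' (el a l)" "mt ?N' (el a' l')" using LT(2)[OF assms(1,8,4) base(3) s'] LT(2)[OF assms(2,8,5) base(3) s'] assms(9) by auto
  have nn: "\<not> mt M ?N" using n by (simp add: mt_sym)
  have ee: "el a l \<noteq> el a' l'" using el_inj assms by blast
  have "mt ?N' k"
  proof (rule rlD[OF rM nn ee])
    show "mt M k" using KL[OF assms(6)] xM xP by (auto intro: mtI)
    show "mt ?N k" using n pt2[OF assms(6) base(3)] by (auto intro: mtI)
  qed (use 1 2 e e' n n' KL[OF assms(6)] in \<open>auto simp: mt_sym\<close>)
  then obtain t where t: "t \<in> P" "I t ?N'" "I t k" by (rule mtE)
  have "t = pt2 h p0" using pj_eq[of x ?N' t] n' t clx[OF assms(6)] xP by auto
  then show False using line_unique[of x t k h] t pt2[OF assms(8) base(3)] KL[OF assms(6)] KL[OF assms(8)] kh xP by auto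
qed

lemma point_on_ln3:
  assumes "k \<in> K" "g \<in> B" "s \<in> R" "c \<in> K" "g' \<in> B" "s' \<in> R" "pt2 k g \<noteq> pt2 c g'" "mt (ln3 k g s) (ln3 c g' s')"
  shows "\<exists>a\<in>A. \<exists>l\<in>R. \<exists>b\<in>B. b = TT a k g \<and> b = TT a c g' \<and> s = LT a k l \<and> s' = LT a c l"
proof -
  note n = ln3[OF assms(1-3)] and n' = ln3[OF assms(4-6)]
  obtain t where t: "t \<in> P" "I t (ln3 k g s)" "I t (ln3 c g' s')" using assms(8) by (rule mtE)
  have "\<not> cl x t"
  proof
    assume "cl x t"
    then have "pj x (ln3 k g s) = t" "pj x (ln3 c g' s') = t"
      using pj_eq[of x _ t] t n n' xP by auto
    then show False using n n' assms by metis
  qed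
  then obtain a l b where a: "a \<in> A" "l \<in> R" "b \<in> B" "t = pt3 a l b" using pt3_surj t by blast
  then show ?thesis using inc33[OF a(1-3) assms(1-3)] inc33[OF a(1-3) assms(4-6)] t by blast
qed

lemma n0_pt3: "\<lbrakk>a \<in> A; l \<in> R; b \<in> B; b' \<in> B; l' \<in> R\<rbrakk> \<Longrightarrow> I (pt3 a l b) (ln3 U b' l') \<longleftrightarrow> b = b' \<and> l = l'"
  using inc33[of a l b U b' l'] by (auto simp: TT_U LT_U)

lemma o_pt3: "\<lbrakk>k \<in> K; s \<in> R; g \<in> B\<rbrakk> \<Longrightarrow> I (pt3 o1 s g) (ln3 k g s)"
  by (rule ln3(4))

text \<open>The axis enters here: a symmetry about \<open>M\<close> carrying \<open>b\<close> to
  \<open>b'\<close> fixes every line meeting \<open>M\<close>, hence every line occurring in the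
  construction of \<open>TT\<close>, and so commutes with it.\<close>

lemma shift_ex:
  assumes "b \<in> B" "b' \<in> B"
  shows "\<exists>f. (\<forall>c\<in>B. f c \<in> B) \<and> f b = b' \<and> (\<forall>a\<in>A. \<forall>k\<in>K. \<forall>c\<in>B. TT a k (f c) = f (TT a k c))"
proof -
  have m: "mt U M" using U xM xP by (auto intro: mtI)
  obtain f g where fg: "colln f g" "\<forall>N\<in>L. mt N M \<longrightarrow> g N = N" "f b = b'"
    using axM assms nM[of b U] nM[of b' U] U m BP[of b] BP[of b'] unfolding axis_def by (metis base(2))
  have gW: "g W = W" if "W \<in> L" "I t W" "I t M" "t \<in> P" for W t using fg(2) that by (auto intro: mtI)
  have gU: "g U = U" and gr: "g r0 = r0" and gM: "g M = M"
    using gW[of U x] gW[of r0 o1] gW[of M x] U xM xP o1 r0 MinL by auto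
  have fx: "f x = x"
  proof -
    have "I (f x) U" "I (f x) M" using colln_I[OF fg(1) xP, of U] colln_I[OF fg(1) xP, of M] gU gM U xM MinL by auto
    then show ?thesis using line_unique[of "f x" x U M] colln_P[OF fg(1) xP] U xM xP MinL by auto
  qed
  have fB: "f c \<in> B" if "c \<in> B" for c
    using colln_I[OF fg(1), of c U] colln_inj[OF fg(1), of c x] colln_P[OF fg(1), of c] gU fx BP[OF that] U xP by (auto simp: B_def)
  have p: "pj (f q) W = f (pj q W)" if "q \<in> P" "W \<in> L" "g W = W" for q W
    using colln_pj[OF fg(1) that(1,2)] that(3) by simp
  have "TT a k (f c) = f (TT a k c)" if a: "a \<in> A" and k: "k \<in> K" and c: "c \<in> B" for a k c
  proof -
    note q = pt2[OF k c]
    have gk: "g k = k" using gW[of k x] KL[OF k] xM xP by auto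
    have ge: "g (el a r0) = el a r0" using gW[of "el a r0" a] el[OF a base(4)] AP[OF a] by auto
    have "pt2 k (f c) = f (pt2 k c)"
      unfolding pt2_def using p[of c r0] p[of "pj c r0" k] gr gk BP[OF c] r0 KL[OF k] pj(1)[of c r0] by simp
    then show ?thesis
      unfolding TT_def using p[of "pt2 k c" "el a r0"] p[of "pj (pt2 k c) (el a r0)" U] ge gU q el[OF a base(4)] U
        pj(1)[of "pt2 k c" "el a r0"] by simp
  qed
  then show ?thesis using fB fg(3) by blast
qed

end

section \<open>The group law on \<open>B\<close> from the symmetries about \<open>M\<close>\<close>

context axis_flag
begin

definition kk :: 'l where "kk = (SOME k. k \<in> K \<and> k \<noteq> U)"
definition ab :: "'p \<Rightarrow> 'p" where "ab b = (SOME a. a \<in> A \<and> TT a kk p0 = b)"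
text \<open>\<open>TT _ kk p0\<close> is a bijection from \<open>A\<close> to \<open>B\<close>, so
  exactly one of the maps \<open>TT a kk\<close> takes \<open>p0\<close> to \<open>b\<close>.
  Applying that map to \<open>c\<close> defines the sum.\<close>

definition bp :: "'p \<Rightarrow> 'p \<Rightarrow> 'p" (infixl "\<boxplus>" 65) where "b \<boxplus> c = TT (ab b) kk c"
definition mm :: "'p \<Rightarrow> 'l \<Rightarrow> 'p" where "mm a k = TT a k p0"

lemma K_ex: "\<exists>k\<in>K. k \<noteq> U"
  using line_other[OF xP, of M U] by (auto simp: K_def)

lemma kk: "kk \<in> K" "kk \<noteq> U"
proof -
  have "\<exists>k. k \<in> K \<and> k \<noteq> U" using K_ex by blast
  then have "kk \<in> K \<and> kk \<noteq> U" unfolding kk_def by (rule someI_ex)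
  then show "kk \<in> K" "kk \<noteq> U" by auto
qed

lemma TT_ex:
  assumes "k \<in> K" "k \<noteq> U" "b \<in> B" "d \<in> B"
  shows "\<exists>a\<in>A. TT a k b = d"
  using XA_ex[OF assms(1) base(2) assms(2-4)] TT_U assms(4) by auto

lemma TT_un:
  assumes "k \<in> K" "k \<noteq> U" "b \<in> B" "a \<in> A" "a' \<in> A" "TT a k b = TT a' k b"
  shows "a = a'"
proof (rule XA_un[OF assms(1) base(2) assms(2,3) TT(1)[OF assms(4,1,3)] assms(4,5)])
  show "TT a k b = TT a U (TT a k b)" "TT a' k b = TT a' U (TT a k b)"
    using TT_U[OF assms(4) TT(1)[OF assms(4,1,3)]] TT_U[OF assms(5) TT(1)[OF assms(4,1,3)]] assms(6) by (simp_all only:)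
qed

lemma ab:
  assumes "b \<in> B"
  shows "ab b \<in> A" "TT (ab b) kk p0 = b"
proof -
  have "\<exists>a. a \<in> A \<and> TT a kk p0 = b" using TT_ex[OF kk base(3) assms] by blast
  then have "ab b \<in> A \<and> TT (ab b) kk p0 = b" unfolding ab_def by (rule someI_ex)
  then show "ab b \<in> A" "TT (ab b) kk p0 = b" by auto
qed

text \<open>The maps \<open>TT a k\<close> commute with a transitive set of maps, so each is determined by its value at \<open>p0\<close>.\<close>

lemma TT_eq:
  assumes "a \<in> A" "a' \<in> A" "k \<in> K" "k' \<in> K" "TT a k p0 = TT a' k' p0" "c \<in> B"
  shows "TT a k c = TT a' k' c"
proof -
  obtain f where f: "f p0 = c" "\<forall>a\<in>A. \<forall>k\<in>K. \<forall>c\<in>B. TT a k (f c) = f (TT a k c)"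
    using shift_ex[OF base(3) assms(6)] by blast
  have "TT a k (f p0) = TT a' k' (f p0)" using f(2) assms base(3) by simp
  then show ?thesis using f(1) by simp
qed

lemma TT_comp:
  assumes "a \<in> A" "a' \<in> A" "a'' \<in> A" "k \<in> K" "k' \<in> K" "k'' \<in> K" "TT a k (TT a' k' p0) = TT a'' k'' p0" "c \<in> B"
  shows "TT a k (TT a' k' c) = TT a'' k'' c"
proof -
  obtain f where f: "f p0 = c" "\<forall>a\<in>A. \<forall>k\<in>K. \<forall>c\<in>B. TT a k (f c) = f (TT a k c)"
    using shift_ex[OF base(3) assms(8)] by blast
  have "TT a k (TT a' k' (f p0)) = TT a'' k'' (f p0)" using f(2) assms base(3) TT(1) by simp
  then show ?thesis using f(1) by simp
qed

lemma TT_bp: "\<lbrakk>a \<in> A; k \<in> K; c \<in> B\<rbrakk> \<Longrightarrow> TT a k c = mm a k \<boxplus> c"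
  unfolding bp_def mm_def using TT_eq[of a "ab (TT a k p0)" k kk c] ab[OF TT(1)[OF _ _ base(3)], of a k] kk by simp

lemma mm_B: "\<lbrakk>a \<in> A; k \<in> K\<rbrakk> \<Longrightarrow> mm a k \<in> B"
  unfolding mm_def by (rule TT(1)) auto

lemma bp_B: "\<lbrakk>b \<in> B; c \<in> B\<rbrakk> \<Longrightarrow> b \<boxplus> c \<in> B"
  unfolding bp_def using TT(1) ab kk by blast

lemma ab_p0: "ab p0 = o1"
  using TT_un[OF kk base(3) ab(1)[OF base(3)] base(1)] ab(2)[OF base(3)] TT_o[OF kk(1) base(3)] by simp

lemma bp_0l: "c \<in> B \<Longrightarrow> p0 \<boxplus> c = c"
  unfolding bp_def ab_p0 using TT_o kk by blast

lemma bp_0r: "b \<in> B \<Longrightarrow> b \<boxplus> p0 = b"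
  unfolding bp_def using ab by blast

lemma bp_assoc:
  assumes "b \<in> B" "c \<in> B" "d \<in> B"
  shows "b \<boxplus> c \<boxplus> d = b \<boxplus> (c \<boxplus> d)"
proof -
  have "TT (ab b) kk (TT (ab c) kk d) = TT (ab (b \<boxplus> c)) kk d"
    by (rule TT_comp) (use ab kk bp_B assms in \<open>auto simp: bp_def\<close>)
  then show ?thesis by (simp add: bp_def)
qed

lemma bp_linv: "b \<in> B \<Longrightarrow> \<exists>c\<in>B. c \<boxplus> b = p0"
proof -
  assume b: "b \<in> B"
  obtain a where a: "a \<in> A" "TT a kk b = p0" using TT_ex[OF kk b base(3)] by blast
  then have "mm a kk \<boxplus> b = p0" using TT_bp[OF a(1) kk(1) b] by simp
  then show ?thesis using mm_B[OF a(1) kk(1)] by blast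
qed

lemma bp_inv:
  assumes "b \<in> B"
  shows "\<exists>c\<in>B. c \<boxplus> b = p0 \<and> b \<boxplus> c = p0"
proof -
  obtain c where c: "c \<in> B" "c \<boxplus> b = p0" using bp_linv assms by blast
  obtain w where w: "w \<in> B" "w \<boxplus> c = p0" using bp_linv c by blast
  have "b \<boxplus> c = w \<boxplus> c \<boxplus> (b \<boxplus> c)" using w bp_0l bp_B assms c by simp
  also have "\<dots> = w \<boxplus> (c \<boxplus> b \<boxplus> c)" using w(1) c(1) assms by (simp add: bp_assoc bp_B)
  also have "\<dots> = p0" using c w by (simp add: bp_0l)
  finally show ?thesis using c by blast
qed

lemma bp_lcan: "\<lbrakk>b \<in> B; c \<in> B; d \<in> B; b \<boxplus> c = b \<boxplus> d\<rbrakk> \<Longrightarrow> c = d"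
  using bp_inv[of b] bp_assoc bp_0l by metis

lemma bp_rcan: "\<lbrakk>b \<in> B; c \<in> B; d \<in> B; c \<boxplus> b = d \<boxplus> b\<rbrakk> \<Longrightarrow> c = d"
  using bp_inv[of b] bp_assoc bp_0r by metis

lemma Jinc: "\<lbrakk>a \<in> A; l \<in> R; b \<in> B; k \<in> K; g \<in> B; s \<in> R\<rbrakk> \<Longrightarrow>
    I (pt3 a l b) (ln3 k g s) \<longleftrightarrow> b = mm a k \<boxplus> g \<and> s = LT a k l"
  using inc33 TT_bp by simp

lemma mm_o: "k \<in> K \<Longrightarrow> mm o1 k = p0" unfolding mm_def using TT_o by simp
lemma mm_U: "a \<in> A \<Longrightarrow> mm a U = p0" unfolding mm_def using TT_U by simp

lemma Xa_ex: "\<lbrakk>k \<in> K; c \<in> K; k \<noteq> c; d \<in> B\<rbrakk> \<Longrightarrow> \<exists>a\<in>A. mm a k = mm a c \<boxplus> d"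
  using XA_ex[of k c p0 d] TT_bp[of _ c d] unfolding mm_def[of _ k] by fastforce

lemma Xa_un: "\<lbrakk>k \<in> K; c \<in> K; k \<noteq> c; d \<in> B; a \<in> A; mm a k = mm a c \<boxplus> d; a' \<in> A; mm a' k = mm a' c \<boxplus> d\<rbrakk> \<Longrightarrow> a = a'"
  using XA_un[of k c p0 d a a'] TT_bp[of _ c d] unfolding mm_def[of _ k] by simp

section \<open>Geometric proofs of the coordinate axioms\<close>

lemma no_triangles:
  assumes k: "k1 \<in> K" "k2 \<in> K" "k3 \<in> K" "k1 \<noteq> k2" "k2 \<noteq> k3" "k1 \<noteq> k3" and a: "a1 \<in> A" "a2 \<in> A" "a3 \<in> A"
    and r: "r1 \<in> R" "r2 \<in> R" "r3 \<in> R" and g: "g1 \<in> B" "g2 \<in> B" "g3 \<in> B"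
    and e: "mm a1 k1 \<boxplus> g1 = mm a1 k2 \<boxplus> g2" "LT a1 k1 r1 = s1" "LT a1 k2 r1 = s2"
      "mm a2 k2 \<boxplus> g2 = mm a2 k3 \<boxplus> g3" "LT a2 k2 r2 = s2" "LT a2 k3 r2 = s3"
      "mm a3 k3 \<boxplus> g3 = mm a3 k1 \<boxplus> g1" "LT a3 k3 r3 = s3" "LT a3 k1 r3 = s1"
  shows "a1 = a2 \<and> a2 = a3"
proof -
  have s: "s1 \<in> R" "s2 \<in> R" "s3 \<in> R" using LT(1) a k r e by auto
  have b: "mm a1 k1 \<boxplus> g1 \<in> B" "mm a2 k2 \<boxplus> g2 \<in> B" "mm a3 k3 \<boxplus> g3 \<in> B" using bp_B mm_B a k g by auto
  let ?p = "pt3 a1 r1 (mm a1 k1 \<boxplus> g1)" and ?q = "pt3 a2 r2 (mm a2 k2 \<boxplus> g2)" and ?t = "pt3 a3 r3 (mm a3 k3 \<boxplus> g3)"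
  have P: "?p \<in> P" "?q \<in> P" "?t \<in> P" using pt3(1) a r b by auto
  have N: "ln3 k1 g1 s1 \<in> L" "ln3 k2 g2 s2 \<in> L" "ln3 k3 g3 s3 \<in> L" using ln3(1) k g s by auto
  have ne: "ln3 k1 g1 s1 \<noteq> ln3 k2 g2 s2" "ln3 k1 g1 s1 \<noteq> ln3 k3 g3 s3" "ln3 k2 g2 s2 \<noteq> ln3 k3 g3 s3"
    using ln3_inj k g s by blast+
  have i: "I ?p (ln3 k1 g1 s1)" "I ?p (ln3 k2 g2 s2)" "I ?q (ln3 k2 g2 s2)" "I ?q (ln3 k3 g3 s3)" "I ?t (ln3 k3 g3 s3)" "I ?t (ln3 k1 g1 s1)"
    using Jinc[OF a(1) r(1) b(1) k(1) g(1) s(1)] Jinc[OF a(1) r(1) b(1) k(2) g(2) s(2)]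
      Jinc[OF a(2) r(2) b(2) k(2) g(2) s(2)] Jinc[OF a(2) r(2) b(2) k(3) g(3) s(3)]
      Jinc[OF a(3) r(3) b(3) k(3) g(3) s(3)] Jinc[OF a(3) r(3) b(3) k(1) g(1) s(1)] e by simp_all
  have "?p = ?q" "?q = ?t" by (rule no_tri'[OF P N ne i])+
  then show ?thesis using pt3_inj a r b by blast
qed

lemma ln3_meet:
  assumes "k \<in> K" "g \<in> B" "s \<in> R" "c \<in> K" "g' \<in> B" "s' \<in> R" "a \<in> A" "l \<in> R"
    "mm a k \<boxplus> g = mm a c \<boxplus> g'" "s = LT a k l" "s' = LT a c l"
  shows "mt (ln3 k g s) (ln3 c g' s')"
proof -
  have b: "mm a k \<boxplus> g \<in> B" using bp_B mm_B assms by blast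
  show ?thesis
    by (rule mtI[of "pt3 a l (mm a k \<boxplus> g)"]) (use pt3(1) Jinc b assms in auto)
qed

lemma ln3_meetD:
  assumes "k \<in> K" "g \<in> B" "s \<in> R" "c \<in> K" "g' \<in> B" "s' \<in> R" "pt2 k g \<noteq> pt2 c g'" "mt (ln3 k g s) (ln3 c g' s')"
  shows "\<exists>a\<in>A. \<exists>l\<in>R. mm a k \<boxplus> g = mm a c \<boxplus> g' \<and> s = LT a k l \<and> s' = LT a c l"
  using point_on_ln3[OF assms] TT_bp assms by metis

lemma pt3_join:
  assumes a: "a \<in> A" "l \<in> R" "b \<in> B" and a': "a' \<in> A" "l' \<in> R" "b' \<in> B" and ne: "a \<noteq> a'" and c: "cl (pt3 a l b) (pt3 a' l' b')"
  shows "\<exists>h\<in>K. \<exists>g\<in>B. b = mm a h \<boxplus> g \<and> b' = mm a' h \<boxplus> g \<and> LT a h l = LT a' h l'"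
proof -
  note t = pt3[OF a] and t' = pt3[OF a']
  obtain N where N: "N \<in> L" "I (pt3 a l b) N" "I (pt3 a' l' b') N" using c by (rule clE)
  have "\<not> mt N M" by (rule opp_el(1)[OF a(1) a'(1) ne a(2) a'(2) t(1,2,9) t'(1,2,9) N])
  then obtain h g s where h: "h \<in> K" "g \<in> B" "s \<in> R" "N = ln3 h g s" using ln3_surj[OF N(1)] by blast
  then show ?thesis using Jinc[OF a h(1-3)] Jinc[OF a' h(1-3)] N by blast
qed

text \<open>Regularity of the line \<open>c\<close> through \<open>x\<close>, for the opposite line
  \<open>?Y\<close> with transversals \<open>k\<close>, \<open>?W'\<close>, \<open>?W''\<close>: the
  line \<open>?Z\<close> meets the first two and hence the third. The coordinates of that meeting
  point give the equation.\<close>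

lemma line_regularity:
  assumes k: "k \<in> K" "c \<in> K" "k \<noteq> c" and a: "a \<in> A" "a' \<in> A" "a'' \<in> A" and d: "d \<in> B" "d' \<in> B"
    and e: "mm a k = mm a c \<boxplus> d" "mm a' k = mm a' c \<boxplus> d'" "mm a'' k = mm a'' c \<boxplus> (d \<boxplus> d')"
    and r: "r1 \<in> R" "r2 \<in> R" "r3 \<in> R" "LT a k r2 = LT a' c r1" "LT a'' k r3 = LT a' k r1"
  shows "LT a'' c r3 = LT a c r2"
proof -
  let ?s = "LT a' k r1" and ?w' = "LT a' c r1" and ?w'' = "LT a'' c r3"
  have s: "?s \<in> R" "?w' \<in> R" "?w'' \<in> R" using LT(1) a k r by auto
  have dd: "d \<boxplus> d' \<in> B" using bp_B d by blast
  let ?Y = "ln3 k p0 ?s" and ?W' = "ln3 c d' ?w'" and ?W'' = "ln3 c (d \<boxplus> d') ?w''" and ?Z = "ln3 k d' ?w'"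
  note Y = ln3[OF k(1) base(3) s(1)] and W' = ln3[OF k(2) d(2) s(2)] and W'' = ln3[OF k(2) dd s(3)] and Z = ln3[OF k(1) d(2) s(2)]
  have cY: "\<not> mt c ?Y"
  proof
    assume "mt c ?Y"
    then obtain t where t: "t \<in> P" "I t c" "I t ?Y" by (rule mtE)
    have "pj x ?Y = t" using pj_eq[of x ?Y t] t Y clx[OF k(2)] xP by auto
    then have "I t k" using Y pt2[OF k(1) base(3)] by simp
    then have "t = x" using line_unique[of t x k c] t KL[OF k(1)] KL[OF k(2)] xP k by auto
    then show False using Y t by simp
  qed
  have kW: "k \<noteq> ?W'" using W' KL[OF k(1)] by auto
  have "mt ?Z ?W''"
  proof (rule rlD[OF regx[OF KL(1,2)[OF k(2)]] cY kW])
    show "mt c k" using KL[OF k(1)] KL[OF k(2)] xP by (auto intro: mtI)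
    show "mt ?Y k" "mt ?Z k" using Y Z pt2[OF k(1) base(3)] pt2[OF k(1) d(2)] by (auto intro: mtI)
    show "mt c ?W'" "mt c ?W''" using W' W'' pt2[OF k(2) d(2)] pt2[OF k(2) dd] by (auto intro: mtI)
    show "mt ?Y ?W'"
      by (rule ln3_meet[OF k(1) base(3) s(1) k(2) d(2) s(2) a(2) r(1)]) (use e mm_B[OF a(2) k(1)] bp_0r in auto)
    show "mt ?Z ?W'"
      by (rule ln3_meet[OF k(1) d(2) s(2) k(2) d(2) s(2) base(1) s(2)]) (use mm_o k LT_o s in auto)
    show "mt ?Y ?W''"
      by (rule ln3_meet[OF k(1) base(3) s(1) k(2) dd s(3) a(3) r(3)]) (use e mm_B[OF a(3) k(1)] bp_0r r in auto)
  qed (use Y W' W'' Z KL[OF k(1)] in auto)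
  then obtain f l where f: "f \<in> A" "l \<in> R" "mm f k \<boxplus> d' = mm f c \<boxplus> (d \<boxplus> d')" "?w' = LT f k l" "?w'' = LT f c l"
    using ln3_meetD[OF k(1) d(2) s(2) k(2) dd s(3)] pt2_k[OF k(1,2) d(2) dd] k(3) by blast
  have "mm f k \<boxplus> d' = mm f c \<boxplus> d \<boxplus> d'" using f(3) bp_assoc[OF mm_B[OF f(1) k(2)] d] by simp
  then have "mm f k = mm f c \<boxplus> d" by (rule bp_rcan[OF d(2) mm_B[OF f(1) k(1)] bp_B[OF mm_B[OF f(1) k(2)] d(1)]])
  then have fa: "f = a" using Xa_un[OF k d(1) f(1) _ a(1) e(1)] by blast
  then have "l = r2" using LT_inj[OF a(1) k(1) f(2) r(2)] f(4) r(4) by simp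
  then show ?thesis using f(5) fa by simp
qed

text \<open>Regularity of the point \<open>a'\<close> of \<open>M\<close>, for the opposite point
  \<open>?y\<close> whose trace with \<open>a'\<close> contains \<open>a\<close>, \<open>?w\<close>,
  \<open>?w''\<close>: the point \<open>?z\<close> is collinear with the first two and hence with
  \<open>?w''\<close>. The joining line has first coordinate \<open>h\<close>.\<close>

lemma point_regularity:
  assumes a: "a \<in> A" "a' \<in> A" "a \<noteq> a'" and k: "k \<in> K" "k'' \<in> K" and r: "r \<in> R" and g: "g \<in> B" "g'' \<in> B"
    and r13: "r1 \<in> R" "r3 \<in> R" and e: "mm a k \<boxplus> g = p0" "mm a k'' \<boxplus> g'' = p0" "LT a' k r1 = LT a k r" "LT a' k'' r3 = LT a k'' r"
  shows "\<exists>h\<in>K. \<exists>gh\<in>B. mm a h \<boxplus> gh = p0 \<and> mm a' k'' \<boxplus> g'' = (mm a' h \<boxplus> gh) \<boxplus> (mm a' k \<boxplus> g) \<and> LT a' h r3 = LT a h r1"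
proof -
  let ?e = "mm a' k \<boxplus> g" and ?e'' = "mm a' k'' \<boxplus> g''"
  have eB: "?e \<in> B" "?e'' \<in> B" using bp_B mm_B a k g by auto
  let ?y = "pt3 a r p0" and ?w = "pt3 a' r1 ?e" and ?w'' = "pt3 a' r3 ?e''" and ?z = "pt3 a r1 ?e"
  note y = pt3[OF a(1) r base(3)] and w = pt3[OF a(2) r13(1) eB(1)] and w'' = pt3[OF a(2) r13(2) eB(2)]
    and z = pt3[OF a(1) r13(1) eB(1)]
  have ya: "\<not> cl a' ?y"
    using pj_eq[of ?y M a'] y AP[OF a(1)] AP[OF a(2)] MinL a(3) by (auto simp: cl_sym)
  have join: "cl (pt3 a r p0) (pt3 a' q (mm a' h \<boxplus> i))"
    if "h \<in> K" "i \<in> B" "mm a h \<boxplus> i = p0" "q \<in> R" "LT a' h q = LT a h r" for h i q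
  proof -
    have s: "LT a h r \<in> R" and b: "mm a' h \<boxplus> i \<in> B" using LT(1) a r bp_B mm_B that by auto
    show ?thesis
      by (rule clI[of "ln3 h i (LT a h r)"])
        (use ln3(1) Jinc[OF a(1) r base(3) that(1,2) s] Jinc[OF a(2) that(4) b that(1,2) s] s that in auto)
  qed
  have aw: "a \<noteq> ?w" using w AP[OF a(1)] by auto
  have "cl ?z ?w''"
  proof (rule regD[OF regM ya aw])
    show "a' \<in> P" "I a' M" using AP[OF a(2)] by auto
    show "cl a' a" using AP[OF a(1)] AP[OF a(2)] MinL by (auto intro: clI)
    show "cl ?y ?w" by (rule join[OF k(1) g(1) e(1) r13(1) e(3)])
    show "cl ?y ?w''" by (rule join[OF k(2) g(2) e(2) r13(2) e(4)])
    show "cl ?z ?w"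
      by (rule clI[of "ln3 U ?e r1"])
        (use ln3(1)[OF base(2) eB(1) r13(1)] n0_pt3[OF a(1) r13(1) eB(1) eB(1) r13(1)] n0_pt3[OF a(2) r13(1) eB(1) eB(1) r13(1)] in auto)
  qed (use y w w'' z AP[OF a(1)] in \<open>auto simp: cl_sym\<close>)
  then obtain h q where h: "h \<in> K" "q \<in> B" "?e = mm a h \<boxplus> q" "?e'' = mm a' h \<boxplus> q" "LT a h r1 = LT a' h r3"
    using pt3_join[OF a(1) r13(1) eB(1) a(2) r13(2) eB(2) a(3)] by blast
  have mB: "mm a h \<in> B" "mm a' h \<in> B" using mm_B a h by auto
  obtain i where i: "i \<in> B" "mm a h \<boxplus> i = p0" using bp_inv[OF mB(1)] by blast
  have "mm a h \<boxplus> (i \<boxplus> ?e) = ?e" using bp_assoc[OF mB(1) i(1) eB(1)] i(2) bp_0l[OF eB(1)] by simp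
  then have "q = i \<boxplus> ?e" using bp_lcan[OF mB(1) h(2) bp_B[OF i(1) eB(1)]] h(3) by simp
  then have "?e'' = mm a' h \<boxplus> i \<boxplus> ?e" using h(4) bp_assoc[OF mB(2) i(1) eB(1)] by simp
  then show ?thesis using h i by metis
qed

lemma G_line:
  assumes "b \<in> B" "b \<noteq> p0" "r \<in> R" "r' \<in> R" "r \<noteq> r'"
  shows "pt3 o1 r' b \<in> P" "ln3 U p0 r \<in> L" "\<not> I (pt3 o1 r' b) (ln3 U p0 r)"
  using pt3(1)[OF base(1) assms(4,1)] ln3(1)[OF base(2,3) assms(3)] n0_pt3[OF base(1) assms(4,1) base(3) assms(3)] assms(2) by auto

text \<open>The point with coordinates \<open>o1\<close>, \<open>r'\<close>, \<open>b\<close> is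
  projected on the line with coordinates \<open>U\<close>, \<open>p0\<close>, \<open>r\<close>. The
  projecting line cannot meet \<open>M\<close>: it would be \<open>r'\<close>, and \<open>r\<close>
  is the line through \<open>o1\<close> that meets the target line.\<close>

lemma antiflag_ex:
  assumes "b \<in> B" "b \<noteq> p0" "r \<in> R" "r' \<in> R" "r \<noteq> r'"
  shows "\<exists>a\<in>A. \<exists>k\<in>K. mm a k \<boxplus> b = p0 \<and> LT a k r = r'"
proof -
  note g = G_line[OF assms]
  note y = pt3[OF base(1) assms(4,1)] and N = ln3[OF base(2,3) assms(3)]
  obtain t Z where t: "t \<in> P" "Z \<in> L" "I (pt3 o1 r' b) Z" "I t Z" "I t (ln3 U p0 r)" using proj_ex[OF g] by blast
  have "\<not> mt Z M"
  proof
    assume m: "mt Z M"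
    have "Z = r'"
      using pl_unique[of "pt3 o1 r' b" M Z "el o1 r'"] m t y el[OF base(1) assms(4)] el_o[OF assms(4)] MinL by auto
    moreover have "\<not> I o1 (ln3 U p0 r)" using N o1 by (auto intro: mtI)
    ultimately have "Z = r"
      using pl_unique[of o1 "ln3 U p0 r" Z r] t N o1 RL[OF assms(3)] RL[OF assms(4)] by (auto simp: mt_sym intro: mtI)
    then show False using \<open>Z = r'\<close> assms by simp
  qed
  then obtain k i s where k: "k \<in> K" "i \<in> B" "s \<in> R" "Z = ln3 k i s" using ln3_surj[OF t(2)] by blast
  have ks: "b = i" "s = r'" using Jinc[OF base(1) assms(4,1) k(1-3)] t(3) k mm_o[OF k(1)] bp_0l[OF k(2)] LT_o[OF k(1) assms(4)] by auto
  have ne: "pt2 k i \<noteq> pt2 U p0" using pt2_k[OF k(1) base(2) k(2) base(3)] ks assms by blast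
  have "mt (ln3 k i s) (ln3 U p0 r)" using t k by (auto intro: mtI)
  then obtain a l where a: "a \<in> A" "l \<in> R" "mm a k \<boxplus> i = mm a U \<boxplus> p0" "s = LT a k l" "r = LT a U l"
    using ln3_meetD[OF k(1-3) base(2,3) assms(3) ne] by blast
  then show ?thesis using k(1) ks mm_U LT_U bp_0l by auto
qed

lemma antiflag_un:
  assumes "b \<in> B" "b \<noteq> p0" "r \<in> R" "r' \<in> R" "r \<noteq> r'"
    and h: "a \<in> A" "k \<in> K" "mm a k \<boxplus> b = p0" "LT a k r = r'" "a' \<in> A" "k' \<in> K" "mm a' k' \<boxplus> b = p0" "LT a' k' r = r'"
  shows "a = a' \<and> k = k'"
proof -
  note g = G_line[OF assms(1-5)]
  have i: "I (pt3 c r p0) (ln3 h b r') \<and> I (pt3 o1 r' b) (ln3 h b r') \<and> I (pt3 c r p0) (ln3 U p0 r) \<and> pt3 c r p0 \<in> P \<and> ln3 h b r' \<in> L"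
    if "c \<in> A" "h \<in> K" "mm c h \<boxplus> b = p0" "LT c h r = r'" for c h
    using Jinc[OF that(1) assms(3) base(3) that(2) assms(1,4)] o_pt3[OF that(2) assms(4,1)]
      n0_pt3[OF that(1) assms(3) base(3,3) assms(3)] pt3(1)[OF that(1) assms(3) base(3)] ln3(1)[OF that(2) assms(1,4)] that by auto
  have "pt3 a r p0 = pt3 a' r p0" "ln3 k b r' = ln3 k' b r'"
    using proj_unique[OF g, of "pt3 a r p0" "ln3 k b r'" "pt3 a' r p0" "ln3 k' b r'"] i[OF h(1-4)] i[OF h(5-8)] by auto
  then show ?thesis using pt3_inj[OF h(1) assms(3) base(3) h(5) assms(3) base(3)] ln3_inj[OF h(2) assms(1,4) h(6) assms(1,4)] by blast
qed

text \<open>Regularity of \<open>p0\<close> for the opposite point \<open>?y\<close>, whose trace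
  with \<open>p0\<close> contains \<open>b\<close>, \<open>?w\<close> and
  \<open>?w'\<close>.\<close>

lemma base_point_regularity:
  assumes a: "a \<in> A" "a' \<in> A" "a \<noteq> a'" and k: "k \<in> K" "k' \<in> K" and l: "l \<in> R" "l' \<in> R" and b: "b \<in> B" "b \<noteq> p0"
    and e: "mm a k \<boxplus> b = p0" "mm a' k' \<boxplus> b = p0" "LT a k l = r0" "LT a' k' l' = r0"
  shows "\<exists>h\<in>K. \<exists>g\<in>B. b = mm a h \<boxplus> g \<and> p0 = mm a' h \<boxplus> g \<and> LT a h l = LT a' h l'"
proof -
  let ?y = "pt3 o1 r0 b" and ?w = "pt3 a l p0" and ?w' = "pt3 a' l' p0" and ?z = "pt3 a l b"
  note y = pt3[OF base(1,4) b(1)] and w = pt3[OF a(1) l(1) base(3)] and w' = pt3[OF a(2) l(2) base(3)] and z = pt3[OF a(1) l(1) b(1)]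
  have py: "\<not> cl p0 ?y"
    using pj_eq[of ?y U p0] y p0 U b(2) clI[of U x ?y] by (auto simp: cl_sym)
  have bw: "b \<noteq> ?w" using w(5) clx[OF base(2)] BP[OF b(1)] by auto
  have j: "cl ?y (pt3 c q p0)" if "c \<in> A" "q \<in> R" "h \<in> K" "mm c h \<boxplus> b = p0" "LT c h q = r0" for c q h
    by (rule clI[of "ln3 h b r0"])
      (use ln3(1)[OF that(3) b(1) base(4)] o_pt3[OF that(3) base(4) b(1)] Jinc[OF that(1,2) base(3) that(3) b(1) base(4)] that in auto)
  have "cl ?z ?w'"
  proof (rule regD[OF rp0 py bw])
    show "cl p0 b" using p0 BP[OF b(1)] U by (auto intro: clI)
    show "cl ?y b" "cl ?z b" using y z by (simp_all add: cl_sym)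
    show "cl p0 ?w" "cl p0 ?w'" using w w' by simp_all
    show "cl ?y ?w" "cl ?y ?w'" using j a l k e by blast+
    show "cl ?z ?w" using w z el[OF a(1) l(1)] by (auto intro: clI)
  qed (use y w w' z BP[OF b(1)] in auto)
  then show ?thesis by (rule pt3_join[OF a(1) l(1) b(1) a(2) l(2) base(3) a(3)])
qed

text \<open>Regularity of \<open>r0\<close> for the opposite line \<open>?Y\<close>, with common
  transversals \<open>l\<close>, \<open>?W\<close> and \<open>?W'\<close>.\<close>

lemma base_line_regularity:
  assumes a: "a \<in> A" "a' \<in> A" and k: "k \<in> K" "k' \<in> K" "k \<noteq> k'" and b: "b \<in> B" "b' \<in> B" and l: "l \<in> R" "l \<noteq> r0"
    and e: "mm a k \<boxplus> b = p0" "mm a' k' \<boxplus> b' = p0" "LT a k l = r0" "LT a' k' l = r0"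
  shows "\<exists>c\<in>A. \<exists>s\<in>R. mm c k \<boxplus> b = mm c k' \<boxplus> b' \<and> LT c k s = l \<and> LT c k' s = r0"
proof -
  let ?Y = "ln3 U p0 l" and ?W = "ln3 k b r0" and ?W' = "ln3 k' b' r0" and ?Z = "ln3 k b l"
  note Y = ln3[OF base(2,3) l(1)] and W = ln3[OF k(1) b(1) base(4)] and W' = ln3[OF k(2) b(2) base(4)] and Z = ln3[OF k(1) b(1) l(1)]
  have lW: "l \<noteq> ?W" using W RL[OF l(1)] o1 by (auto intro: mtI)
  have oY: "\<not> I o1 ?Y" using Y o1 by (auto intro: mtI)
  have rY: "\<not> mt r0 ?Y"
  proof
    assume "mt r0 ?Y"
    then have "r0 = l"
      using pl_unique[of o1 ?Y r0 l] oY Y o1 r0 RL[OF l(1)] by (auto simp: mt_sym)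
    then show False using l by simp
  qed
  have "mt ?Z ?W'"
  proof (rule rlD[OF rr0 rY lW])
    show "mt r0 l" using r0 RL[OF l(1)] o1 by (auto intro: mtI)
    show "mt ?Y l" "mt ?Z l" using Y Z by simp_all
    show "mt r0 ?W" "mt r0 ?W'" using W W' by (simp_all add: mt_sym)
    show "mt ?Y ?W"
      by (rule ln3_meet[OF base(2,3) l(1) k(1) b(1) base(4) a(1) l(1)]) (use mm_U[OF a(1)] bp_0l LT_U[OF a(1)] l e in auto)
    show "mt ?Y ?W'"
      by (rule ln3_meet[OF base(2,3) l(1) k(2) b(2) base(4) a(2) l(1)]) (use mm_U[OF a(2)] bp_0l LT_U[OF a(2)] l e in auto)
    show "mt ?Z ?W" using W Z pt2[OF k(1) b(1)] by (auto intro: mtI)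
  qed (use Y W W' Z RL[OF l(1)] in auto)
  then obtain c s where "c \<in> A" "s \<in> R" "mm c k \<boxplus> b = mm c k' \<boxplus> b'" "l = LT c k s" "r0 = LT c k' s"
    using ln3_meetD[OF k(1) b(1) l(1) k(2) b(2) base(4)] pt2_k[OF k(1,2) b] k(3) by blast
  then show ?thesis by metis
qed

sublocale ca: regular_coordinate_algebra A K B R o1 U p0 r0 "(\<boxplus>)" mm LT
proof unfold_locales
  show "\<exists>b\<in>B. b \<noteq> p0"
  proof -
    obtain b where "b \<in> P" "I b U" "b \<noteq> x" "b \<noteq> p0" using three_points[OF U(1)] by blast
    then show ?thesis by (auto simp: B_def)
  qed
qed (fact base bp_B bp_assoc bp_0l bp_0r bp_inv mm_B LT(1) mm_o mm_U LT_o LT_U LT_inj LT_surj Xa_ex Xa_un XB_ex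
    XB_un no_triangles line_regularity point_regularity K_ex antiflag_ex antiflag_un base_point_regularity base_line_regularity)+

section \<open>The coordinate geometry is isomorphic to the quadrangle\<close>

definition fp :: "('p, 'l, 'l, 'p) cpoint \<Rightarrow> 'p" where
  "fp c = (case c of CI \<Rightarrow> x | C1 a \<Rightarrow> a | C2 k b \<Rightarrow> pt2 k b | C3 a r b \<Rightarrow> pt3 a r b)"
definition fl :: "('p, 'l, 'l, 'p) cline \<Rightarrow> 'l" where
  "fl c = (case c of DI \<Rightarrow> M | D1 k \<Rightarrow> k | D2 a r \<Rightarrow> el a r | D3 k b r \<Rightarrow> ln3 k b r)"

lemma fp_simps[simp]: "fp CI = x" "fp (C1 a) = a" "fp (C2 k b) = pt2 k b" "fp (C3 a r b) = pt3 a r b"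
  and fl_simps[simp]: "fl DI = M" "fl (D1 k) = k" "fl (D2 a r) = el a r" "fl (D3 k b r) = ln3 k b r"
  by (auto simp: fp_def fl_def)

lemma pt3_ne: "\<lbrakk>a \<in> A; r \<in> R; b \<in> B\<rbrakk> \<Longrightarrow> pt3 a r b \<noteq> x \<and> pt3 a r b \<notin> A \<and> (\<forall>k\<in>K. \<forall>c\<in>B. pt3 a r b \<noteq> pt2 k c)"
  using pt3[of a r b] pt2(6) xM AP(2) by metis

lemma pt2_ne: "\<lbrakk>k \<in> K; b \<in> B\<rbrakk> \<Longrightarrow> pt2 k b \<noteq> x \<and> pt2 k b \<notin> A"
  using pt2[of k b] AP(2) by blast

lemma bij_fp: "bij_betw fp ca.cpoints P"
proof -
  have "fp ` ca.cpoints \<subseteq> P"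
    using pt2(1) pt3(1) AP(1) xP by (auto simp: ca.cpoints_def)
  moreover have "y \<in> fp ` ca.cpoints" if y: "y \<in> P" for y
  proof (cases "cl x y")
    case False
    then obtain a l b where a: "a \<in> A" "l \<in> R" "b \<in> B" "y = pt3 a l b" using pt3_surj[OF y] by blast
    then show ?thesis by (intro image_eqI[of _ _ "C3 a l b"]) (auto simp: ca.cpoints_def)
  next
    case True
    then obtain k where k: "k \<in> L" "I x k" "I y k" by (rule clE)
    consider "y = x" | "y \<noteq> x" "k = M" | "y \<noteq> x" "k \<noteq> M" by blast
    then show ?thesis
    proof cases
      case 1 then show ?thesis by (intro image_eqI[of _ _ CI]) (auto simp: ca.cpoints_def)
    next
      case 2
      then have "y \<in> A" using y k by (simp add: A_def)
      then show ?thesis by (intro image_eqI[of _ _ "C1 y"]) (auto simp: ca.cpoints_def)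
    next
      case 3
      then have kK: "k \<in> K" using k by (simp add: K_def)
      obtain b where b: "b \<in> B" "pt2 k b = y" using pt2_surj[OF kK y k(3)] 3 by blast
      then show ?thesis using kK by (intro image_eqI[of _ _ "C2 k b"]) (auto simp: ca.cpoints_def)
    qed
  qed
  moreover have "inj_on fp ca.cpoints"
  proof (rule inj_onI)
    fix c d assume c: "c \<in> ca.cpoints" and d: "d \<in> ca.cpoints" and e: "fp c = fp d"
    have ne: "pt3 a r b \<noteq> x" "x \<noteq> pt3 a r b" "pt3 a r b \<notin> A" if "a \<in> A" "r \<in> R" "b \<in> B" for a r b
      using pt3_ne[OF that] by auto
    have ne': "pt3 a r b \<noteq> pt2 k c" "pt2 k c \<noteq> pt3 a r b" if "a \<in> A" "r \<in> R" "b \<in> B" "k \<in> K" "c \<in> B" for a r b k c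
      using pt3_ne[OF that(1-3)] that(4,5) by metis+
    have ne2: "pt2 k b \<noteq> x" "x \<noteq> pt2 k b" "pt2 k b \<notin> A" if "k \<in> K" "b \<in> B" for k b
      using pt2_ne[OF that] by auto
    have xA: "x \<notin> A" by (simp add: A_def)
    have i3: "pt3 a r b = pt3 a' r' b' \<longleftrightarrow> a = a' \<and> r = r' \<and> b = b'"
      if "a \<in> A" "r \<in> R" "b \<in> B" "a' \<in> A" "r' \<in> R" "b' \<in> B" for a r b a' r' b'
      using pt3_inj[OF that] by blast
    have i2: "pt2 k b = pt2 k' b' \<longleftrightarrow> k = k' \<and> b = b'" if "k \<in> K" "b \<in> B" "k' \<in> K" "b' \<in> B" for k b k' b'
      using pt2_k[OF that(1,3,2,4)] by blast
    show "c = d"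
      using c d e by (cases c; cases d) (simp_all add: ca.cpoints_def ne ne' ne2 i2 i3, (use xA ne ne2 in metis)+)
  qed
  ultimately show ?thesis unfolding bij_betw_def by blast
qed

lemma el_ne: "\<lbrakk>a \<in> A; r \<in> R\<rbrakk> \<Longrightarrow> el a r \<noteq> M \<and> el a r \<notin> K"
  using el[of a r] nxA[of a "el a r"] KL(2) by blast

lemma ln3_ne: "\<lbrakk>k \<in> K; b \<in> B; s \<in> R\<rbrakk> \<Longrightarrow> ln3 k b s \<noteq> M \<and> ln3 k b s \<notin> K \<and> (\<forall>a\<in>A. \<forall>r\<in>R. ln3 k b s \<noteq> el a r)"
  using ln3(5,6)[of k b s] el(5) KL(2) xM by metis

lemma bij_fl: "bij_betw fl ca.clines L"
proof -
  have "fl ` ca.clines \<subseteq> L"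
    using ln3(1) el(1) KL(1) MinL by (auto simp: ca.clines_def)
  moreover have "N \<in> fl ` ca.clines" if N: "N \<in> L" for N
  proof (cases "mt N M")
    case False
    then obtain k b s where "k \<in> K" "b \<in> B" "s \<in> R" "N = ln3 k b s" using ln3_surj[OF N] by blast
    then show ?thesis by (intro image_eqI[of _ _ "D3 k b s"]) (auto simp: ca.clines_def)
  next
    case True
    then obtain t where t: "t \<in> P" "I t N" "I t M" by (rule mtE)
    consider "N = M" | "N \<noteq> M" "t = x" | "N \<noteq> M" "t \<noteq> x" by blast
    then show ?thesis
    proof cases
      case 1 then show ?thesis by (intro image_eqI[of _ _ DI]) (auto simp: ca.clines_def)
    next
      case 2
      then have "N \<in> K" using N t by (simp add: K_def)
      then show ?thesis by (intro image_eqI[of _ _ "D1 N"]) (auto simp: ca.clines_def)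
    next
      case 3
      then have tA: "t \<in> A" using t by (simp add: A_def)
      obtain l where l: "l \<in> R" "N = el t l" using el_surj[OF tA N t(2)] 3 by blast
      then show ?thesis using tA by (intro image_eqI[of _ _ "D2 t l"]) (auto simp: ca.clines_def)
    qed
  qed
  moreover have "inj_on fl ca.clines"
  proof (rule inj_onI)
    fix c d assume c: "c \<in> ca.clines" and d: "d \<in> ca.clines" and e: "fl c = fl d"
    have ne: "ln3 k b s \<noteq> M" "M \<noteq> ln3 k b s" "ln3 k b s \<notin> K" if "k \<in> K" "b \<in> B" "s \<in> R" for k b s
      using ln3_ne[OF that] by auto
    have ne': "ln3 k b s \<noteq> el a r" "el a r \<noteq> ln3 k b s" if "k \<in> K" "b \<in> B" "s \<in> R" "a \<in> A" "r \<in> R" for k b s a r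
      using ln3_ne[OF that(1-3)] that(4,5) by metis+
    have ne2: "el a r \<noteq> M" "M \<noteq> el a r" "el a r \<notin> K" if "a \<in> A" "r \<in> R" for a r
      using el_ne[OF that] by auto
    have MK: "M \<notin> K" by (simp add: K_def)
    have i3: "ln3 k b s = ln3 k' b' s' \<longleftrightarrow> k = k' \<and> b = b' \<and> s = s'"
      if "k \<in> K" "b \<in> B" "s \<in> R" "k' \<in> K" "b' \<in> B" "s' \<in> R" for k b s k' b' s'
      using ln3_inj[OF that] by blast
    have i2: "el a r = el a' r' \<longleftrightarrow> a = a' \<and> r = r'" if "a \<in> A" "r \<in> R" "a' \<in> A" "r' \<in> R" for a r a' r'
      using el_inj[OF that] by blast
    show "c = d"
      using c d e by (cases c; cases d) (simp_all add: ca.clines_def ne ne' ne2 i2 i3, (use MK ne ne2 in metis)+)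
  qed
  ultimately show ?thesis unfolding bij_betw_def by blast
qed

lemma inc_C1: "\<lbrakk>a \<in> A; a' \<in> A; r \<in> R\<rbrakk> \<Longrightarrow> I a (el a' r) \<longleftrightarrow> a' = a"
  using el[of a' r] line_unique[of a a' M "el a' r"] AP[of a] AP[of a'] MinL by auto

lemma inc_C2: "\<lbrakk>k \<in> K; b \<in> B; k' \<in> K\<rbrakk> \<Longrightarrow> I (pt2 k b) k' \<longleftrightarrow> k' = k"
  using pt2[of k b] line_unique[of x "pt2 k b" k k'] KL[of k] KL[of k'] xP by auto

lemma inc_C2_el: "\<lbrakk>k \<in> K; b \<in> B; a \<in> A; r \<in> R\<rbrakk> \<Longrightarrow> \<not> I (pt2 k b) (el a r)"
  using nAline[of "pt2 k b" k a "el a r"] pt2[of k b] el[of a r] by blast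

lemma inc_C2_D3:
  assumes "k \<in> K" "b \<in> B" "k' \<in> K" "g \<in> B" "s \<in> R"
  shows "I (pt2 k b) (ln3 k' g s) \<longleftrightarrow> k' = k \<and> g = b"
proof
  note n = ln3[OF assms(3-5)] and q = pt2[OF assms(1,2)]
  assume "I (pt2 k b) (ln3 k' g s)"
  then have "pj x (ln3 k' g s) = pt2 k b" using pj_eq[of x "ln3 k' g s" "pt2 k b"] n q xP by auto
  then show "k' = k \<and> g = b" using n(7) pt2_k[OF assms(3,1,4,2)] by auto
qed (use ln3(2)[OF assms(3-5)] in auto)

lemma inc_C3_D2:
  assumes "a \<in> A" "r \<in> R" "b \<in> B" "a' \<in> A" "r' \<in> R"
  shows "I (pt3 a r b) (el a' r') \<longleftrightarrow> a' = a \<and> r' = r"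
proof
  note t = pt3[OF assms(1-3)]
  assume "I (pt3 a r b) (el a' r')"
  then have "el a' r' = el a r"
    using pl_unique[of "pt3 a r b" M "el a' r'" "el a r"] t el[OF assms(1,2)] el[OF assms(4,5)] MinL by auto
  then show "a' = a \<and> r' = r" using el_inj[OF assms(4,5,1,2)] by blast
qed (use pt3(2)[OF assms(1-3)] in auto)

lemma inc_cpoint:
  assumes c: "c \<in> ca.cpoints" and d: "d \<in> ca.clines"
  shows "ca.cinc c d \<longleftrightarrow> I (fp c) (fl d)"
proof -
  have C3x: "\<not> I (pt3 a r b) k" if "a \<in> A" "r \<in> R" "b \<in> B" "k \<in> K" for a r b k
    using pt3(5)[OF that(1-3)] clx[OF that(4)] by blast
  have C1k: "\<not> I a k" if "a \<in> A" "k \<in> K" for a k using nM[OF AP(1,3)[OF that(1)] that(2)] AP(2)[OF that(1)] by blast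
  have D3A: "\<not> I a (ln3 k g s)" if "a \<in> P" "I a M" "k \<in> K" "g \<in> B" "s \<in> R" for a k g s
    using ln3(5)[OF that(3-5)] that by (auto intro: mtI)
  have xe: "\<not> I x (el a r)" if "a \<in> A" "r \<in> R" for a r
    using nxA[OF that(1) el(1,2)[OF that]] el_ne[OF that] by blast
  have pM: "\<not> I (pt2 k b) M" if "k \<in> K" "b \<in> B" for k b using pt2(5)[OF that] .
  have tM: "\<not> I (pt3 a r b) M" if "a \<in> A" "r \<in> R" "b \<in> B" for a r b using pt3(9)[OF that] .
  have xl: "\<not> I x (ln3 k b s)" if "k \<in> K" "b \<in> B" "s \<in> R" for k b s using ln3(6)[OF that] .
  show ?thesis
    using c d by (cases c; cases d)
      (simp_all add: ca.cpoints_def ca.clines_def ca.cinc.simps xM KL(2) AP(1,2) xe pM tM xl C3x C1k D3A inc_C1 inc_C2 inc_C2_el inc_C2_D3 inc_C3_D2 Jinc)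
qed

theorem mixed: "mixed_quadrangle P L I"
proof (rule ca.mixed_if_coordinates)
  show "isomorphic_geometries ca.cpoints ca.clines ca.cinc P L I"
    unfolding isomorphic_geometries_def using bij_fp bij_fl inc_cpoint by blast
qed

end

section \<open>Conjugates of axes\<close>

text \<open>In \<open>spanS\<close>, membership in a line span is unfolded: a line belongs to the
  span of \<open>M\<close> and \<open>N\<close> iff it meets all their common transversals.\<close>

locale regular_sets = gq P L I for P :: "'p set" and L :: "'l set" and I +
  fixes Ob :: "'p set" and S :: "'l set"
  assumes Ob_ne: "Ob \<noteq> {}" and SL: "S \<subseteq> L"
    and regO: "\<And>x. x \<in> Ob \<Longrightarrow> rp x" and regS: "\<And>M. M \<in> S \<Longrightarrow> rl M"
    and spanS: "\<And>M N. \<lbrakk>M \<in> S; N \<in> L; \<not> mt M N\<rbrakk> \<Longrightarrow> \<exists>N'\<in>S. N' \<noteq> M \<and> (\<forall>W\<in>L. mt M W \<longrightarrow> mt N W \<longrightarrow> mt N' W)"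
    and SO: "\<And>M. M \<in> S \<Longrightarrow> \<exists>x\<in>Ob. I x M"
    and OS: "\<And>x. x \<in> Ob \<Longrightarrow> \<exists>M\<in>S. I x M \<and> LD_at P L I x M"
begin

definition AA :: "'l \<Rightarrow> bool" where
  "AA M \<longleftrightarrow> (\<exists>f g N. colln f g \<and> N \<in> S \<and> axis N \<and> M = g N)"

lemma OS_axis: "x \<in> Ob \<Longrightarrow> \<exists>M\<in>S. I x M \<and> axis M"
proof -
  assume x: "x \<in> Ob"
  then obtain M where M: "M \<in> S" "I x M" "LD_at P L I x M" using OS by blast
  interpret LD_flag P L I x M by unfold_locales (use x M regO regS in auto)
  show ?thesis using M axis by blast
qed

lemma AA:
  assumes "AA M"
  shows "M \<in> L" "axis M" "rl M" "\<exists>x\<in>P. I x M \<and> rp x"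
proof -
  obtain f g N where c: "colln f g" "N \<in> S" "axis N" "M = g N" using assms by (auto simp: AA_def)
  then have N: "N \<in> L" using SL by blast
  obtain x where x: "x \<in> Ob" "I x N" using SO c by blast
  then have xP: "x \<in> P" using regO rpP by blast
  show "M \<in> L" using colln_L[OF c(1) N] c(4) by simp
  show "axis M" using colln_axis[OF c(1,3)] c(4) by simp
  show "rl M" using colln_rl[OF c(1) regS[OF c(2)]] c(4) by simp
  show "\<exists>x\<in>P. I x M \<and> rp x"
    using colln_P[OF c(1) xP] colln_I[OF c(1) xP N] x(2) colln_reg[OF c(1) regO[OF x(1)]] c(4) by blast
qed

lemma AA_ex: "\<exists>M. AA M"
proof -
  obtain x where "x \<in> Ob" using Ob_ne by blast
  then obtain M where M: "M \<in> S" "axis M" using OS_axis by blast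
  have "colln id id" by (simp add: colln_def)
  then have "AA (id M)" using M unfolding AA_def by blast
  then show ?thesis by blast
qed

text \<open>A line span containing \<open>M \<in> S\<close> contains a second line of \<open>S\<close>, which the symmetries about \<open>M\<close>
  move to any other line of the span.\<close>
lemma regular_opposite_axis:
  assumes M: "AA M" and N: "N \<in> L" "\<not> mt M N"
  shows "rl N" "\<exists>x\<in>P. I x N \<and> rp x \<and> (\<exists>R. AA R \<and> I x R)"
proof -
  obtain f g M0 where c: "colln f g" "M0 \<in> S" "axis M0" "M = g M0" using M by (auto simp: AA_def)
  have M0: "M0 \<in> L" using c SL by blast
  obtain N0 where N0: "N0 \<in> L" "N = g N0" using colln_surjL[OF c(1) N(1)] by blast
  have n: "\<not> mt M0 N0" using N N0 c colln_mt[OF c(1) M0 N0(1)] by simp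
  obtain N1 where N1: "N1 \<in> S" "N1 \<noteq> M0" "\<And>W. W \<in> L \<Longrightarrow> mt M0 W \<Longrightarrow> mt N0 W \<Longrightarrow> mt N1 W"
    using spanS[OF c(2) N0(1) n] by blast
  have N1L: "N1 \<in> L" using N1 SL by blast
  obtain U V where UV: "U \<in> L" "V \<in> L" "U \<noteq> V" "mt M0 U" "mt N0 U" "mt M0 V" "mt N0 V"
    using two_trans[OF M0 N0(1) n] by blast
  have opp: "\<not> mt U V" by (rule trace_opp_line[OF M0 N0(1) UV(1,2) n UV(3-7)])
  obtain n1 where n1: "n1 \<in> P" "I n1 N1" "I n1 U" using N1(3)[OF UV(1,4,5)] by (rule mtE)
  obtain n0 where n0: "n0 \<in> P" "I n0 N0" "I n0 U" using UV(5) by (rule mtE)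
  have nV: "\<not> I n1 V" "\<not> I n0 V" using opp mtI[of _ U V] n1 n0 by blast+
  have n1M: "\<not> I n1 M0"
  proof
    assume "I n1 M0"
    then have "M0 = N1"
      using pl_unique[OF n1(1) UV(2) nV(1) M0 _ UV(6) N1L n1(2) N1(3)[OF UV(2,6,7)]] by blast
    then show False using N1 by simp
  qed
  have n0M: "\<not> I n0 M0" using n n0 mtI by blast
  have UM: "U \<noteq> M0" using n UV(5) by (auto simp: mt_sym)
  obtain h k where h: "colln h k" "\<forall>W\<in>L. mt W M0 \<longrightarrow> k W = W" "h n1 = n0"
    using c(3) UV(1,4) n1 n0 UM n1M n0M unfolding axis_def by (metis mt_sym)
  have "k V = V" using h(2) UV by (auto simp: mt_sym)
  then have "mt (k N1) V" using colln_mt[OF h(1) N1L UV(2)] N1(3)[OF UV(2,6,7)] by simp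
  moreover have "I n0 (k N1)" using colln_I[OF h(1) n1(1) N1L] n1 h(3) by simp
  ultimately have kN: "k N1 = N0"
    using pl_unique[OF n0(1) UV(2) nV(2) colln_L[OF h(1) N1L] _ _ N0(1) n0(2) UV(7)] by blast
  have d: "colln (f \<circ> h) (g \<circ> k)" by (rule colln_comp[OF h(1) c(1)])
  have e: "(g \<circ> k) N1 = N" using kN N0 by simp
  show "rl N" using colln_rl[OF d regS[OF N1(1)]] e by simp
  obtain x where x: "x \<in> Ob" "I x N1" using SO N1 by blast
  obtain R where R: "R \<in> S" "I x R" "axis R" using OS_axis x by blast
  have xP: "x \<in> P" using regO x rpP by blast
  have "AA ((g \<circ> k) R)" unfolding AA_def using d R by blast
  moreover have "I ((f \<circ> h) x) ((g \<circ> k) R)" using colln_I[OF d xP] R SL by blast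
  moreover have "I ((f \<circ> h) x) N" using colln_I[OF d xP N1L] e x by simp
  ultimately show "\<exists>x\<in>P. I x N \<and> rp x \<and> (\<exists>R. AA R \<and> I x R)"
    using colln_P[OF d xP] colln_reg[OF d regO[OF x(1)]] by blast
qed

lemma axis_move:
  assumes "axis M" "U \<in> L" "p \<in> P" "q \<in> P" "U \<noteq> M" "mt U M" "I p U" "I q U" "\<not> I p M" "\<not> I q M" "rp p"
  shows "rp q"
proof -
  obtain f g where "colln f g" "f p = q" using assms(1-10) unfolding axis_def by blast
  then show ?thesis using colln_reg assms(11) by blast
qed

text \<open>Lines opposite \<open>M\<close> or \<open>N\<close> are settled by
  \<open>regular_opposite_axis\<close>. If \<open>W\<close> meets both, then for each
  \<open>V\<close> opposite \<open>W\<close> a common transversal through a point of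
  \<open>W\<close> off \<open>M\<close> is opposite \<open>M\<close>, hence regular, and regular
  transversals suffice.\<close>

lemma opp_lines_reg:
  assumes M: "AA M" and N: "AA N" and o: "\<not> mt M N" and W: "W \<in> L"
  shows "rl W"
proof -
  consider "\<not> mt M W" | "\<not> mt N W" | "mt M W" "mt N W" by blast
  then show ?thesis
  proof cases
    case 3
    obtain m where m: "m \<in> P" "I m M" "I m W" using 3(1) by (rule mtE)
    have WM: "W \<noteq> M" using 3 o by (auto simp: mt_sym)
    show ?thesis
    proof (rule reg_line_by_traces[OF W])
      fix V assume V: "V \<in> L" "\<not> mt W V"
      obtain w where w: "w \<in> P" "I w W" "w \<noteq> m" using three_points[OF W] by blast
      have wM: "\<not> I w M" using line_unique[of w m W M] w m W WM AA(1)[OF M] by blast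
      have wV: "\<not> I w V" using V w mtI by blast
      note T = pl[OF w(1) V(1) wV]
      have "\<not> mt M (pl w V)"
      proof
        assume "mt M (pl w V)"
        then have "pl w V = W"
          using pl_unique[OF w(1) AA(1)[OF M] wM T(1,2) _ W w(2)] 3 mt_sym by blast
        then show False using T V by simp
      qed
      then have "rl (pl w V)" using regular_opposite_axis(1)[OF M T(1)] by blast
      moreover have "mt W (pl w V)" using mtI[OF w(1,2) T(2)] .
      ultimately show "\<exists>W'\<in>L. rl W' \<and> mt W W' \<and> mt V W'" using T mt_sym by blast
    qed
  qed (use regular_opposite_axis(1) M N W in auto)
qed

text \<open>A line \<open>N'\<close> through \<open>x'\<close> opposite \<open>M\<close> carries a
  regular point \<open>x\<close> on an axis \<open>R\<close>. If \<open>x\<close> differs from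
  \<open>x'\<close> and \<open>R\<close> from \<open>N'\<close>, then \<open>x\<close> is moved
  along \<open>N'\<close> by a symmetry about \<open>N\<close>, which meets \<open>N'\<close> in
  \<open>x'\<close>, and from there to \<open>x'\<close> by one about \<open>R\<close>. If
  \<open>R\<close> is \<open>N'\<close>, its symmetries make all points of \<open>N\<close> other
  than \<open>x'\<close> regular, once one of them is, and then the traces of \<open>x'\<close>
  contain regular points.\<close>

lemma opp_points_reg:
  assumes M: "AA M" and N: "AA N" and o: "\<not> mt M N" and x': "x' \<in> P" "I x' N"
  shows "rp x'"
proof -
  have MinL: "M \<in> L" and NL: "N \<in> L" using AA(1) M N by auto
  have xM: "\<not> I x' M" using o x' mtI by blast
  obtain N' where N': "N' \<in> L" "I x' N'" "N' \<noteq> N" "N' \<noteq> pl x' M" using line_other[OF x'(1)] by blast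
  have "\<not> mt N' M" using pl_eq[OF x'(1) MinL xM N'(1,2)] N'(4) by blast
  then have "\<not> mt M N'" using mt_sym by blast
  then obtain x R where x: "x \<in> P" "I x N'" "rp x" and R: "AA R" "I x R" using regular_opposite_axis(2)[OF M N'(1)] by blast
  have mN: "mt N' N" using mtI[OF x'(1) N'(2) x'(2)] .
  have nN: "\<not> I t N" if "t \<in> P" "I t N'" "t \<noteq> x'" for t
    using line_unique[of t x' N' N] that N' x' NL by blast
  consider "x = x'" | "x \<noteq> x'" "R \<noteq> N'" | "R = N'" by blast
  then show ?thesis
  proof cases
    case 1 then show ?thesis using x by simp
  next
    case 2
    obtain t where t: "t \<in> P" "I t N'" "t \<noteq> x" "t \<noteq> x'" using three_points[OF N'(1)] by blast
    have nR: "\<not> I s R" if "s \<in> P" "I s N'" "s \<noteq> x" for s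
      using line_unique[of s x N' R] that N' x R 2 AA(1)[OF R(1)] by blast
    have "rp t"
      by (rule axis_move[OF AA(2)[OF N] N'(1) x(1) t(1) N'(3) mN x(2) t(2) nN[OF x(1,2) 2(1)] nN[OF t(1,2,4)] x(3)])
    then show ?thesis
      using axis_move[OF AA(2)[OF R(1)] N'(1) t(1) x'(1) _ mtI[OF x(1,2) R(2)] t(2) N'(2) nR[OF t(1,2,3)]
          nR[OF x'(1) N'(2)]] 2 by auto
  next
    case 3
    obtain r where r: "r \<in> P" "I r N" "rp r" using AA(4)[OF N] by blast
    have nN': "\<not> I s N'" if "s \<in> P" "I s N" "s \<noteq> x'" for s
      using line_unique[of s x' N' N] that N' x' NL by blast
    show ?thesis
    proof (cases "r = x'")
      case True then show ?thesis using r by simp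
    next
      case False
      have s: "rp s" if "s \<in> P" "I s N" "s \<noteq> x'" for s
        using axis_move[of N' N r s] AA(2)[OF R(1)] 3 NL r that nN' False N'(3) mN mt_sym by metis
      show ?thesis
      proof (rule reg_by_traces[OF x'(1)])
        fix y assume y: "y \<in> P" "\<not> cl x' y"
        note w = pj[OF y(1) NL]
        have "pj y N \<noteq> x'" using w(3) y(2) cl_sym by metis
        then show "\<exists>w\<in>P. rp w \<and> cl x' w \<and> cl y w" using s[OF w(1,2)] w clI[OF NL x'(2)] by blast
      qed
    qed
  qed
qed

theorem mixed: "mixed_quadrangle P L I"
proof (cases "\<exists>M N. AA M \<and> AA N \<and> \<not> mt M N")
  case True
  then obtain M N where M: "AA M" and N: "AA N" and o: "\<not> mt M N" by blast
  have o': "\<not> mt N M" using o mt_sym by blast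
  have MinL: "M \<in> L" and NL: "N \<in> L" using AA(1) M N by auto
  obtain x where x: "x \<in> P" "I x N" using three_points[OF NL] by blast
  obtain o1 where o1: "o1 \<in> P" "I o1 N" "o1 \<noteq> x" using three_points[OF NL] by blast
  obtain r0 where r0: "r0 \<in> L" "I o1 r0" "r0 \<noteq> N" using line_other[OF o1(1)] by blast
  have xM: "\<not> I x M" using o x mtI by blast
  \<comment> \<open>The line \<open>U\<close> is chosen to meet \<open>M\<close>, so that
    \<open>p0\<close> can be taken on \<open>M\<close>, where all points are regular.\<close>
  note U = pl[OF x(1) MinL xM]
  obtain p0 where p0: "p0 \<in> P" "I p0 (pl x M)" "I p0 M" using U(3) by (rule mtE)
  interpret axis_flag P L I x N "pl x M" o1 p0 r0
    by unfold_locales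
      (use x U p0 xM o1 r0 AA(2)[OF N] opp_lines_reg[OF M N o] opp_points_reg[OF M N o] opp_points_reg[OF N M o'] o' in auto)
  show ?thesis by (rule mixed)
next
  case False
  then have F: "mt M N" if "AA M" "AA N" for M N using that by blast
  obtain M0 where M0: "AA M0" using AA_ex by blast
  have M0L: "M0 \<in> L" using AA(1)[OF M0] .
  have oppN: "\<not> mt M N" if "M \<in> L" "W \<in> L" "N \<in> L" "y \<in> P" "I y W" "I y N" "W \<noteq> N" "\<not> I y M" "mt W M" for M W N y
    using pl_unique[of y M W N] that mt_sym by blast
  obtain p where p: "p \<in> P" "I p M0" using three_points[OF M0L] by blast
  obtain V where V: "V \<in> L" "I p V" "V \<noteq> M0" using line_other[OF p(1)] by blast
  obtain q where q: "q \<in> P" "I q V" "q \<noteq> p" using three_points[OF V(1)] by blast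
  obtain N where N: "N \<in> L" "I q N" "N \<noteq> V" using line_other[OF q(1)] by blast
  have qM: "\<not> I q M0" using line_unique[of q p V M0] p q V M0L by blast
  have NM: "\<not> mt M0 N" using oppN[OF M0L V(1) N(1) q(1,2) N(2) _ qM mtI[OF p(1) V(2) p(2)]] N(3) by blast
  obtain t R where R: "t \<in> P" "I t N" "AA R" "I t R" using regular_opposite_axis(2)[OF M0 N(1) NM] by blast
  have tM: "\<not> I t M0" using NM R mtI by blast
  then have RM: "R \<noteq> M0" using R by auto
  have RL: "R \<in> L" using AA(1)[OF R(3)] .
  obtain z where z: "z \<in> P" "I z M0" "I z R" using F[OF M0 R(3)] by (rule mtE)
  have thru: "I z T" if T: "AA T" for T
  proof (cases "T = M0 \<or> T = R")
    case False
    obtain a where a: "a \<in> P" "I a R" "I a T" using F[OF R(3) T] by (rule mtE)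
    obtain b where b: "b \<in> P" "I b T" "I b M0" using F[OF T M0] by (rule mtE)
    have "z = a" by (rule no_tri'(1)[of z a b M0 R T]) (use z a b False RM M0L RL AA(1)[OF T] in auto)
    then show ?thesis using a by simp
  qed (use z in auto)
  \<comment> \<open>A line \<open>N'\<close> through \<open>y\<close> opposite \<open>M\<close>
    carries a regular point \<open>s\<close> on some axis \<open>R'\<close>. Since all these axes
    pass through \<open>z\<close>, the point \<open>s\<close> is the projection of \<open>z\<close>
    on \<open>N'\<close>, which is \<open>y\<close>, and \<open>R'\<close> is
    \<open>W\<close>.\<close>
  have spread: "rp y \<and> AA W"
    if M: "AA M" and W: "W \<in> L" "I z W" "W \<noteq> M" and y: "y \<in> P" "I y W" "y \<noteq> z" for M W y
  proof -
    have MinL: "M \<in> L" using AA(1)[OF M] .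
    have yM: "\<not> I y M" using line_unique[of y z W M] y W z thru[OF M] MinL by blast
    obtain N' where N': "N' \<in> L" "I y N'" "N' \<noteq> W" using line_other[OF y(1)] by blast
    have "\<not> mt M N'" using oppN[OF MinL W(1) N'(1) y(1,2) N'(2) _ yM mtI[OF z(1) W(2) thru[OF M]]] N'(3) by blast
    then obtain s R' where s: "s \<in> P" "I s N'" "rp s" "AA R'" "I s R'" using regular_opposite_axis(2)[OF M N'(1)] by blast
    have zN: "\<not> I z N'" using line_unique[of z y W N'] z y W N' by blast
    have "s = y" "R' = W"
      using proj_unique[OF z(1) N'(1) zN s(1) AA(1)[OF s(4)] thru[OF s(4)] s(5) s(2) y(1) W(1,2) y(2) N'(2)] by blast+
    then show ?thesis using s by simp
  qed
  have all: "rp y \<and> AA W" if W: "W \<in> L" "I z W" and y: "y \<in> P" "I y W" "y \<noteq> z" for W y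
    using spread[OF M0 W _ y] spread[OF R(3) W _ y] RM by blast
  have linez: "rl W" if W: "W \<in> L" "I z W" for W
    using three_points[OF W(1), of z] all[OF W] AA(3) by blast
  have rz: "rp z"
  proof (rule reg_by_traces[OF z(1)])
    fix y assume y: "y \<in> P" "\<not> cl z y"
    note w = pj[OF y(1) M0L]
    have "pj y M0 \<noteq> z" using w(3) y(2) cl_sym by metis
    then show "\<exists>w\<in>P. rp w \<and> cl z w \<and> cl y w" using all[OF M0L z(2) w(1,2)] w clI[OF M0L z(2)] by blast
  qed
  obtain o1 where o1: "o1 \<in> P" "I o1 M0" "o1 \<noteq> z" using three_points[OF M0L] by blast
  obtain r0 where r0: "r0 \<in> L" "I o1 r0" "r0 \<noteq> M0" using line_other[OF o1(1)] by blast
  obtain p0 where p0: "p0 \<in> P" "I p0 R" "p0 \<noteq> z" using three_points[OF RL] by blast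
  have o1R: "\<not> I o1 R" using line_unique[of o1 z M0 R] o1 z M0L RL RM by blast
  have "\<not> mt R r0" using oppN[OF RL M0L r0(1) o1(1,2) r0(2) _ o1R mtI[OF z]] r0(3) by blast
  then have rr0: "rl r0" using regular_opposite_axis(1)[OF R(3) r0(1)] by blast
  interpret axis_flag P L I z M0 R o1 p0 r0
  proof unfold_locales
    show "rp a" if "a \<in> P" "I a M0" for a using that rz all[OF M0L z(2), of a] by blast
    show "rp p0" using all[OF RL z(3) p0] by blast
  qed (use z M0L RL RM p0 o1 r0 rr0 linez AA(2)[OF M0] in auto)
  show ?thesis by (rule mixed)
qed

end

lemma (in gq) mixed_if_conditions:
  assumes "Ob \<noteq> {}" "Ob \<subseteq> P" "S \<subseteq> L" "\<forall>x\<in>Ob. regular_point P L I x" "\<forall>M\<in>S. regular_line P L I M"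
    and sp: "\<forall>T \<in> line_spans P L I. (\<exists>M\<in>S. M \<in> T) \<longrightarrow> (\<exists>M\<in>S. \<exists>N\<in>S. M \<noteq> N \<and> M \<in> T \<and> N \<in> T)"
    and "\<forall>M\<in>S. \<exists>x\<in>Ob. I x M" "\<forall>x\<in>Ob. \<exists>M\<in>S. I x M \<and> LD_at P L I x M"
  shows "mixed_quadrangle P L I"
proof -
  interpret d: gq L P "conversep I" by (rule dual)
  have mem: "N' \<in> point_span L P (conversep I) M N \<longleftrightarrow> N' \<in> L \<and> (\<forall>W\<in>L. mt M W \<longrightarrow> mt N W \<longrightarrow> mt N' W)"
    if "M \<in> L" "N \<in> L" for M N N'
    unfolding point_span_def using d.perp_iff[OF d.perp_sub, of N' "{M, N}"] d.perp_iff[of "{M, N}"] that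
    by (auto simp: mt_sym)
  have "\<exists>N'\<in>S. N' \<noteq> M \<and> (\<forall>W\<in>L. mt M W \<longrightarrow> mt N W \<longrightarrow> mt N' W)" if M: "M \<in> S" "N \<in> L" "\<not> mt M N" for M N
  proof -
    have MinL: "M \<in> L" using M assms(3) by blast
    let ?T = "point_span L P (conversep I) M N"
    have "?T \<in> line_spans P L I" using M MinL d.opposite_iff unfolding line_spans_def by blast
    moreover have "M \<in> ?T" using mem[OF MinL M(2)] MinL by blast
    ultimately obtain M1 M2 where "M1 \<in> S" "M2 \<in> S" "M1 \<noteq> M2" "M1 \<in> ?T" "M2 \<in> ?T" using sp M(1) by blast
    then show ?thesis using mem[OF MinL M(2)] by metis
  qed
  then interpret regular_sets P L I Ob S
    by unfold_locales (use assms in \<open>auto simp: regular_point_iff regular_line_iff\<close>)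
  show ?thesis by (rule mixed)
qed

lemma (in gq) line_span_two:
  assumes "T \<in> line_spans P L I"
  shows "\<exists>M\<in>L. \<exists>N\<in>L. M \<noteq> N \<and> M \<in> T \<and> N \<in> T"
proof -
  interpret d: gq L P "conversep I" by (rule dual)
  obtain M N where T: "T = point_span L P (conversep I) M N" and o: "opposite L P (conversep I) M N"
    using assms by (auto simp: line_spans_def)
  have MN: "M \<in> L" "N \<in> L" "\<not> mt M N" using o d.opposite_iff by auto
  then have "M \<in> T" "N \<in> T"
    unfolding T point_span_def using d.perp_iff[OF d.perp_sub] d.perp_iff[of "{M, N}"] by (auto simp: mt_sym)
  then show ?thesis using MN mt_refl by metis
qed

section \<open>Regularity and (LD) in symplectic geometry\<close>

type_synonym 'a vec = "'a \<times> 'a \<times> 'a \<times> 'a"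

section \<open>Linear algebra of an alternating form in dimension 4\<close>

locale char2 = field K for K (structure) +
  assumes char2: "\<one> \<oplus> \<one> = \<zero>"
begin

lemma dbl: "x \<in> carrier K \<Longrightarrow> x \<oplus> x = \<zero>"
  using l_distr[of \<one> \<one> x] char2 by simp

lemma dbl': "\<lbrakk>x \<in> carrier K; y \<in> carrier K\<rbrakk> \<Longrightarrow> x \<oplus> (x \<oplus> y) = y"
  using a_assoc[of x x y] dbl by simp

lemma sum0_iff: "\<lbrakk>x \<in> carrier K; y \<in> carrier K\<rbrakk> \<Longrightarrow> x \<oplus> y = \<zero> \<longleftrightarrow> x = y"
  using dbl dbl'[of x y] by auto

lemmas nf = l_distr r_distr a_ac m_ac dbl dbl'

definition V4 :: "'a vec set" where
  "V4 = carrier K \<times> carrier K \<times> carrier K \<times> carrier K"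

fun bf :: "'a vec \<Rightarrow> 'a vec \<Rightarrow> 'a" where
  "bf (a0, a1, a2, a3) (b0, b1, b2, b3) = (a0 \<otimes> b1 \<oplus> a1 \<otimes> b0) \<oplus> (a2 \<otimes> b3 \<oplus> a3 \<otimes> b2)"

fun sm :: "'a \<Rightarrow> 'a vec \<Rightarrow> 'a vec" where
  "sm c (a0, a1, a2, a3) = (c \<otimes> a0, c \<otimes> a1, c \<otimes> a2, c \<otimes> a3)"

fun ad :: "'a vec \<Rightarrow> 'a vec \<Rightarrow> 'a vec" where
  "ad (a0, a1, a2, a3) (b0, b1, b2, b3) = (a0 \<oplus> b0, a1 \<oplus> b1, a2 \<oplus> b2, a3 \<oplus> b3)"

lemma V4E: "x \<in> V4 \<Longrightarrow> (\<And>a b c d. \<lbrakk>x = (a, b, c, d); a \<in> carrier K; b \<in> carrier K; c \<in> carrier K; d \<in> carrier K\<rbrakk> \<Longrightarrow> thesis) \<Longrightarrow> thesis"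
  by (auto simp: V4_def)

lemma bf_cl[simp]: "\<lbrakk>x \<in> V4; y \<in> V4\<rbrakk> \<Longrightarrow> bf x y \<in> carrier K"
  by (auto elim!: V4E)

lemma sm_cl[simp]: "\<lbrakk>c \<in> carrier K; y \<in> V4\<rbrakk> \<Longrightarrow> sm c y \<in> V4"
  by (auto simp: V4_def)

lemma ad_cl[simp]: "\<lbrakk>x \<in> V4; y \<in> V4\<rbrakk> \<Longrightarrow> ad x y \<in> V4"
  by (auto simp: V4_def)

lemma bf_sym: "\<lbrakk>x \<in> V4; y \<in> V4\<rbrakk> \<Longrightarrow> bf x y = bf y x"
  by (elim V4E) (simp add: nf)

lemma bf_ad: "\<lbrakk>x \<in> V4; y \<in> V4; z \<in> V4\<rbrakk> \<Longrightarrow> bf (ad x y) z = bf x z \<oplus> bf y z"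
  by (elim V4E) (simp add: nf)

lemma bf_sm: "\<lbrakk>c \<in> carrier K; x \<in> V4; y \<in> V4\<rbrakk> \<Longrightarrow> bf (sm c x) y = c \<otimes> bf x y"
  by (elim V4E) (simp add: nf)

text \<open>The 3 by 3 determinant; in characteristic 2 its signs disappear.\<close>

definition dt :: "'a \<Rightarrow> 'a \<Rightarrow> 'a \<Rightarrow> 'a \<Rightarrow> 'a \<Rightarrow> 'a \<Rightarrow> 'a \<Rightarrow> 'a \<Rightarrow> 'a \<Rightarrow> 'a" where
  "dt a1 a2 a3 b1 b2 b3 c1 c2 c3 = a1 \<otimes> (b2 \<otimes> c3 \<oplus> b3 \<otimes> c2) \<oplus> (a2 \<otimes> (b1 \<otimes> c3 \<oplus> b3 \<otimes> c1) \<oplus> a3 \<otimes> (b1 \<otimes> c2 \<oplus> b2 \<otimes> c1))"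

lemma dt_cl[simp]: "\<lbrakk>a1 \<in> carrier K; a2 \<in> carrier K; a3 \<in> carrier K; b1 \<in> carrier K; b2 \<in> carrier K; b3 \<in> carrier K;
    c1 \<in> carrier K; c2 \<in> carrier K; c3 \<in> carrier K\<rbrakk> \<Longrightarrow> dt a1 a2 a3 b1 b2 b3 c1 c2 c3 \<in> carrier K"
  by (simp add: dt_def)

text \<open>A combination of the first two triples that lies in the span of \<open>c\<close> and
  \<open>d\<close> has determinant zero with \<open>c\<close> and \<open>d\<close>.\<close>

lemma dt_relation:
  assumes [simp]: "a1 \<in> carrier K" "a2 \<in> carrier K" "a3 \<in> carrier K" "b1 \<in> carrier K" "b2 \<in> carrier K" "b3 \<in> carrier K"
    "c1 \<in> carrier K" "c2 \<in> carrier K" "c3 \<in> carrier K" "d1 \<in> carrier K" "d2 \<in> carrier K" "d3 \<in> carrier K"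
    "g0 \<in> carrier K" "g1 \<in> carrier K" "g2 \<in> carrier K" "g3 \<in> carrier K"
    and e: "g0 \<otimes> a1 \<oplus> g1 \<otimes> b1 = g2 \<otimes> c1 \<oplus> g3 \<otimes> d1" "g0 \<otimes> a2 \<oplus> g1 \<otimes> b2 = g2 \<otimes> c2 \<oplus> g3 \<otimes> d2"
      "g0 \<otimes> a3 \<oplus> g1 \<otimes> b3 = g2 \<otimes> c3 \<oplus> g3 \<otimes> d3"
  shows "g0 \<otimes> dt a1 a2 a3 c1 c2 c3 d1 d2 d3 = g1 \<otimes> dt b1 b2 b3 c1 c2 c3 d1 d2 d3"
proof -
  have "g0 \<otimes> dt a1 a2 a3 c1 c2 c3 d1 d2 d3 \<oplus> g1 \<otimes> dt b1 b2 b3 c1 c2 c3 d1 d2 d3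
      = dt (g0 \<otimes> a1 \<oplus> g1 \<otimes> b1) (g0 \<otimes> a2 \<oplus> g1 \<otimes> b2) (g0 \<otimes> a3 \<oplus> g1 \<otimes> b3) c1 c2 c3 d1 d2 d3"
    unfolding dt_def by (simp add: nf)
  also have "\<dots> = \<zero>" unfolding e dt_def by (simp add: nf)
  finally show ?thesis by (simp add: sum0_iff)
qed

text \<open>\<open>nv u v w\<close> represents the linear form \<open>z \<mapsto> Pf(u, v, w, z)\<close>, which vanishes at \<open>u, v, w\<close>. In four
  dimensions, it is therefore a multiple of every nonzero vector perpendicular to \<open>u, v, w\<close>.\<close>

definition nv :: "'a vec \<Rightarrow> 'a vec \<Rightarrow> 'a vec \<Rightarrow> 'a vec" where
  "nv u v w = ad (sm (bf u v) w) (ad (sm (bf u w) v) (sm (bf v w) u))"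

lemma nv_cl[simp]: "\<lbrakk>u \<in> V4; v \<in> V4; w \<in> V4\<rbrakk> \<Longrightarrow> nv u v w \<in> V4"
  by (simp add: nv_def)

lemma nv_coord:
  assumes [simp]: "u0 \<in> carrier K" "u1 \<in> carrier K" "u2 \<in> carrier K" "u3 \<in> carrier K"
    "v0 \<in> carrier K" "v1 \<in> carrier K" "v2 \<in> carrier K" "v3 \<in> carrier K"
    "w0 \<in> carrier K" "w1 \<in> carrier K" "w2 \<in> carrier K" "w3 \<in> carrier K"
  shows "nv (u0, u1, u2, u3) (v0, v1, v2, v3) (w0, w1, w2, w3) =
    (dt u0 v0 w0 u2 v2 w2 u3 v3 w3, dt u1 v1 w1 u2 v2 w2 u3 v3 w3, dt u0 v0 w0 u1 v1 w1 u2 v2 w2, dt u0 v0 w0 u1 v1 w1 u3 v3 w3)"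
  unfolding nv_def dt_def by (simp add: nf)

lemma dt_perm:
  assumes "a1 \<in> carrier K" "a2 \<in> carrier K" "a3 \<in> carrier K" "b1 \<in> carrier K" "b2 \<in> carrier K" "b3 \<in> carrier K"
    "c1 \<in> carrier K" "c2 \<in> carrier K" "c3 \<in> carrier K"
  shows "dt a1 a2 a3 b1 b2 b3 c1 c2 c3 = dt b1 b2 b3 a1 a2 a3 c1 c2 c3"
    "dt a1 a2 a3 b1 b2 b3 c1 c2 c3 = dt a1 a2 a3 c1 c2 c3 b1 b2 b3"
  unfolding dt_def using assms by (simp_all add: nf)

text \<open>Perpendicularity says that the four coordinate triples of \<open>u\<close>,
  \<open>v\<close>, \<open>w\<close> satisfy a linear relation with the coordinates of the
  perpendicular vector as coefficients. The 3 by 3 minors are then proportional to these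
  coefficients.\<close>

lemma nv_prop:
  assumes c: "u0 \<in> carrier K" "u1 \<in> carrier K" "u2 \<in> carrier K" "u3 \<in> carrier K"
    "v0 \<in> carrier K" "v1 \<in> carrier K" "v2 \<in> carrier K" "v3 \<in> carrier K"
    "w0 \<in> carrier K" "w1 \<in> carrier K" "w2 \<in> carrier K" "w3 \<in> carrier K"
    and g: "g0 \<in> carrier K" "g1 \<in> carrier K" "g2 \<in> carrier K" "g3 \<in> carrier K"
    and e: "g1 \<otimes> u0 \<oplus> g0 \<otimes> u1 \<oplus> (g3 \<otimes> u2 \<oplus> g2 \<otimes> u3) = \<zero>" "g1 \<otimes> v0 \<oplus> g0 \<otimes> v1 \<oplus> (g3 \<otimes> v2 \<oplus> g2 \<otimes> v3) = \<zero>"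
      "g1 \<otimes> w0 \<oplus> g0 \<otimes> w1 \<oplus> (g3 \<otimes> w2 \<oplus> g2 \<otimes> w3) = \<zero>"
  defines "n0 \<equiv> dt u0 v0 w0 u2 v2 w2 u3 v3 w3" and "n1 \<equiv> dt u1 v1 w1 u2 v2 w2 u3 v3 w3"
    and "n2 \<equiv> dt u0 v0 w0 u1 v1 w1 u2 v2 w2" and "n3 \<equiv> dt u0 v0 w0 u1 v1 w1 u3 v3 w3"
  shows "g1 \<otimes> n0 = g0 \<otimes> n1" "g2 \<otimes> n0 = g0 \<otimes> n2" "g3 \<otimes> n0 = g0 \<otimes> n3"
    "g2 \<otimes> n1 = g1 \<otimes> n2" "g3 \<otimes> n1 = g1 \<otimes> n3" "g3 \<otimes> n2 = g2 \<otimes> n3"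
proof -
  have sw: "p \<oplus> q = r \<oplus> s" "p \<oplus> r = q \<oplus> s" "p \<oplus> s = q \<oplus> r"
    if "p \<oplus> q \<oplus> (r \<oplus> s) = \<zero>" "p \<in> carrier K" "q \<in> carrier K" "r \<in> carrier K" "s \<in> carrier K" for p q r s
  proof -
    show 1: "p \<oplus> q = r \<oplus> s" using that sum0_iff[of "p \<oplus> q" "r \<oplus> s"] by simp
    have "p \<oplus> r = (p \<oplus> q) \<oplus> (q \<oplus> r)" "p \<oplus> s = (p \<oplus> q) \<oplus> (q \<oplus> s)" using that(2-) by (simp_all add: nf)
    then show "p \<oplus> r = q \<oplus> s" "p \<oplus> s = q \<oplus> r" unfolding 1 using that(2-) by (simp_all add: nf)
  qed
  note s = sw[OF e(1)] sw[OF e(2)] sw[OF e(3)]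
  have p: "dt a1 a2 a3 b1 b2 b3 c1 c2 c3 = dt b1 b2 b3 a1 a2 a3 c1 c2 c3"
    "dt a1 a2 a3 b1 b2 b3 c1 c2 c3 = dt c1 c2 c3 a1 a2 a3 b1 b2 b3"
    if t: "a1 \<in> carrier K" "a2 \<in> carrier K" "a3 \<in> carrier K" "b1 \<in> carrier K" "b2 \<in> carrier K" "b3 \<in> carrier K"
    "c1 \<in> carrier K" "c2 \<in> carrier K" "c3 \<in> carrier K" for a1 a2 a3 b1 b2 b3 c1 c2 c3
    using dt_perm(1)[OF t] trans[OF dt_perm(2)[OF t] dt_perm(1)[OF t(1-3,7-9,4-6)]] .
  show "g1 \<otimes> n0 = g0 \<otimes> n1" unfolding n0_def n1_def
    by (rule dt_relation[of u0 v0 w0 u1 v1 w1 u2 v2 w2 u3 v3 w3 g1 g0 g3 g2]) (use c g s in auto)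
  show "g3 \<otimes> n2 = g2 \<otimes> n3" unfolding n2_def n3_def
    using dt_relation[of u2 v2 w2 u3 v3 w3 u0 v0 w0 u1 v1 w1 g3 g2 g1 g0] c g s
      p(2)[of u0 v0 w0 u1 v1 w1 u2 v2 w2] p(2)[of u0 v0 w0 u1 v1 w1 u3 v3 w3] by simp
  show "g2 \<otimes> n0 = g0 \<otimes> n2"
    using dt_relation[of u3 v3 w3 u1 v1 w1 u0 v0 w0 u2 v2 w2 g2 g0 g1 g3] c g s a_comm
      p(2)[of u0 v0 w0 u2 v2 w2 u3 v3 w3] p(1)[of u0 v0 w0 u1 v1 w1 u2 v2 w2] unfolding n0_def n2_def by simp
  show "g3 \<otimes> n0 = g0 \<otimes> n3"
    using dt_relation[of u2 v2 w2 u1 v1 w1 u0 v0 w0 u3 v3 w3 g3 g0 g1 g2] c g s a_comm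
      p(1)[of u0 v0 w0 u2 v2 w2 u3 v3 w3] p(1)[of u0 v0 w0 u1 v1 w1 u3 v3 w3] unfolding n0_def n3_def by simp
  show "g2 \<otimes> n1 = g1 \<otimes> n2"
    using dt_relation[of u3 v3 w3 u0 v0 w0 u1 v1 w1 u2 v2 w2 g2 g1 g0 g3] c g s a_comm
      p(2)[of u1 v1 w1 u2 v2 w2 u3 v3 w3] unfolding n1_def n2_def by simp
  show "g3 \<otimes> n1 = g1 \<otimes> n3"
    using dt_relation[of u2 v2 w2 u0 v0 w0 u1 v1 w1 u3 v3 w3 g3 g1 g0 g2] c g s a_comm
      p(1)[of u1 v1 w1 u2 v2 w2 u3 v3 w3] unfolding n1_def n3_def by simp
qed

lemma frac:
  assumes c: "g \<in> carrier K" "g \<noteq> \<zero>" "a \<in> carrier K" "m \<in> carrier K" "h \<in> carrier K" and e: "h \<otimes> a = g \<otimes> m"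
  shows "m = (a \<otimes> inv g) \<otimes> h"
proof -
  have i: "inv g \<in> carrier K" "inv g \<otimes> g = \<one>" using c field_Units by auto
  have "(a \<otimes> inv g) \<otimes> h = inv g \<otimes> (h \<otimes> a)" using c i(1) by (simp add: m_ac)
  also have "\<dots> = (inv g \<otimes> g) \<otimes> m" unfolding e using c i(1) by (simp add: m_assoc)
  finally show ?thesis using i c by simp
qed

lemma frac_nz:
  assumes "g \<in> carrier K" "g \<noteq> \<zero>" "a \<in> carrier K"
  shows "a \<otimes> inv g \<in> carrier K" "a \<noteq> \<zero> \<Longrightarrow> a \<otimes> inv g \<noteq> \<zero>"
proof -
  have u: "inv g \<in> carrier K" "inv g \<noteq> \<zero>" using assms field_Units Units_inv_Units by auto
  then show "a \<otimes> inv g \<in> carrier K" using assms by simp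
  show "a \<otimes> inv g \<noteq> \<zero>" if "a \<noteq> \<zero>" using that u assms integral by blast
qed

text \<open>The computation common to the two pairs of sides assumed to meet on the vertical line in
  \<open>all_LD\<close>. The value \<open>q\<close> at the meeting point is eliminated between the
  relations for the two triangles.\<close>

lemma perspective_algebra:
  assumes c: "l \<in> carrier K" "l' \<in> carrier K" "s \<in> carrier K" "c \<in> carrier K" "q \<in> carrier K" "k \<in> carrier K" "k' \<in> carrier K"
    "z \<in> carrier K" "w \<in> carrier K" "w' \<in> carrier K"
    and nz: "l \<noteq> \<zero>" "l' \<noteq> \<zero>" "s \<noteq> \<zero>"
    and e: "c \<otimes> q = (s \<otimes> k) \<otimes> z"
      "(l \<otimes> (l' \<otimes> c)) \<otimes> q = (l \<otimes> (s \<otimes> k)) \<otimes> (l' \<otimes> w') \<oplus> (l' \<otimes> (s \<otimes> k')) \<otimes> (l \<otimes> w)"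
  shows "k' \<otimes> w = k \<otimes> (z \<oplus> w')"
proof -
  have "(l \<otimes> l' \<otimes> s) \<otimes> (k \<otimes> z) = (l \<otimes> (l' \<otimes> c)) \<otimes> q"
    using e(1) c by (simp add: m_assoc)
  also have "\<dots> = (l \<otimes> l' \<otimes> s) \<otimes> (k \<otimes> w' \<oplus> k' \<otimes> w)" unfolding e(2) using c by (simp add: r_distr m_ac)
  finally have 1: "k \<otimes> z = k \<otimes> w' \<oplus> k' \<otimes> w"
    using m_lcancel[of "l \<otimes> l' \<otimes> s" "k \<otimes> z" "k \<otimes> w' \<oplus> k' \<otimes> w"] nz c integral_iff by auto
  show ?thesis using c by (simp add: r_distr 1 nf)
qed

lemma prop_scalar:
  assumes "n \<in> V4" "x \<in> V4" "n = (n0, n1, n2, n3)" "x = (g0, g1, g2, g3)" "x \<noteq> (\<zero>, \<zero>, \<zero>, \<zero>)"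
    and e: "g1 \<otimes> n0 = g0 \<otimes> n1" "g2 \<otimes> n0 = g0 \<otimes> n2" "g3 \<otimes> n0 = g0 \<otimes> n3"
    "g2 \<otimes> n1 = g1 \<otimes> n2" "g3 \<otimes> n1 = g1 \<otimes> n3" "g3 \<otimes> n2 = g2 \<otimes> n3"
  shows "\<exists>c\<in>carrier K. n = sm c x"
proof -
  have c: "n0 \<in> carrier K" "n1 \<in> carrier K" "n2 \<in> carrier K" "n3 \<in> carrier K"
    "g0 \<in> carrier K" "g1 \<in> carrier K" "g2 \<in> carrier K" "g3 \<in> carrier K" using assms(1-4) by (auto simp: V4_def)
  note r = frac
  have w: "a \<otimes> inv g \<in> carrier K" if "g \<in> carrier K" "g \<noteq> \<zero>" "a \<in> carrier K" for a g
    using that field_Units by auto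
  consider "g0 \<noteq> \<zero>" | "g1 \<noteq> \<zero>" | "g2 \<noteq> \<zero>" | "g3 \<noteq> \<zero>" using assms(4,5) by auto
  then show ?thesis
  proof cases
    case 1 show ?thesis
      by (rule bexI[OF _ w[OF c(5) 1 c(1)]]) (use c e r[OF c(5) 1 c(1)] assms(3,4) in auto)
  next
    case 2 show ?thesis
      by (rule bexI[OF _ w[OF c(6) 2 c(2)]]) (use c e e(1)[symmetric] r[OF c(6) 2 c(2)] assms(3,4) in auto)
  next
    case 3 show ?thesis
      by (rule bexI[OF _ w[OF c(7) 3 c(3)]]) (use c e e[symmetric] r[OF c(7) 3 c(3)] assms(3,4) in auto)
  next
    case 4 show ?thesis
      by (rule bexI[OF _ w[OF c(8) 4 c(4)]]) (use c e e[symmetric] r[OF c(8) 4 c(4)] assms(3,4) in auto)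
  qed
qed

text \<open>The Pfaffian of the Gram matrix of four vectors.\<close>

definition Pf :: "'a vec \<Rightarrow> 'a vec \<Rightarrow> 'a vec \<Rightarrow> 'a vec \<Rightarrow> 'a" where
  "Pf u v w z = bf u v \<otimes> bf w z \<oplus> (bf u w \<otimes> bf v z \<oplus> bf v w \<otimes> bf u z)"

lemma Pf_perp:
  assumes V: "x \<in> V4" "u \<in> V4" "v \<in> V4" "w \<in> V4" "y \<in> V4"
    and ne: "bf x y \<noteq> \<zero>" and p: "bf x u = \<zero>" "bf x v = \<zero>" "bf x w = \<zero>"
  shows "\<exists>c\<in>carrier K. \<forall>z\<in>V4. Pf u v w z = c \<otimes> bf x z"
proof -
  obtain u0 u1 u2 u3 where u: "u = (u0, u1, u2, u3)" "u0 \<in> carrier K" "u1 \<in> carrier K" "u2 \<in> carrier K" "u3 \<in> carrier K"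
    using V(2) by (rule V4E)
  obtain v0 v1 v2 v3 where v: "v = (v0, v1, v2, v3)" "v0 \<in> carrier K" "v1 \<in> carrier K" "v2 \<in> carrier K" "v3 \<in> carrier K"
    using V(3) by (rule V4E)
  obtain w0 w1 w2 w3 where w: "w = (w0, w1, w2, w3)" "w0 \<in> carrier K" "w1 \<in> carrier K" "w2 \<in> carrier K" "w3 \<in> carrier K"
    using V(4) by (rule V4E)
  obtain g0 g1 g2 g3 where g: "x = (g0, g1, g2, g3)" "g0 \<in> carrier K" "g1 \<in> carrier K" "g2 \<in> carrier K" "g3 \<in> carrier K"
    using V(1) by (rule V4E)
  have nz: "x \<noteq> (\<zero>, \<zero>, \<zero>, \<zero>)" using ne V(5) by (auto elim!: V4E)
  have e: "g1 \<otimes> u0 \<oplus> g0 \<otimes> u1 \<oplus> (g3 \<otimes> u2 \<oplus> g2 \<otimes> u3) = \<zero>" "g1 \<otimes> v0 \<oplus> g0 \<otimes> v1 \<oplus> (g3 \<otimes> v2 \<oplus> g2 \<otimes> v3) = \<zero>"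
      "g1 \<otimes> w0 \<oplus> g0 \<otimes> w1 \<oplus> (g3 \<otimes> w2 \<oplus> g2 \<otimes> w3) = \<zero>"
    using p u v w g by (simp_all add: a_ac)
  have "\<exists>c\<in>carrier K. nv u v w = sm c x"
    by (rule prop_scalar[OF nv_cl[OF V(2-4)] V(1) _ g(1) nz])
      (use nv_coord[OF u(2-) v(2-) w(2-)] nv_prop[OF u(2-) v(2-) w(2-) g(2-) e] u v w in simp_all)
  then obtain c where c: "c \<in> carrier K" "nv u v w = sm c x" by blast
  have "Pf u v w z = c \<otimes> bf x z" if z: "z \<in> V4" for z
  proof -
    have "Pf u v w z = bf (nv u v w) z" unfolding nv_def Pf_def using V z by (simp add: bf_ad bf_sm)
    then show ?thesis using c V z by (simp add: bf_sm)
  qed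
  then show ?thesis using c by blast
qed

lemma Pf_all_perp:
  assumes V: "x \<in> V4" "p \<in> V4" "q \<in> V4" "t \<in> V4" "m \<in> V4" "y \<in> V4"
    and ne: "bf x y \<noteq> \<zero>" and p: "bf x p = \<zero>" "bf x q = \<zero>" "bf x t = \<zero>" "bf x m = \<zero>"
  shows "Pf p q t m = \<zero>"
  using Pf_perp[OF V(1-4,6) ne p(1-3)] V p by auto

text \<open>The scalar from \<open>Pf_perp\<close> is found by inserting \<open>y\<close>: there the
  Pfaffian vanishes but \<open>bf x y\<close> does not.\<close>

lemma Pf_coplanar:
  assumes V: "x \<in> V4" "y \<in> V4" "p \<in> V4" "q \<in> V4" "r \<in> V4" "z \<in> V4"
    and ne: "bf x y \<noteq> \<zero>" and p: "bf x p = \<zero>" "bf x q = \<zero>" "bf x r = \<zero>" "bf y p = \<zero>" "bf y q = \<zero>" "bf y r = \<zero>"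
  shows "Pf p q r z = \<zero>"
proof -
  obtain c where c: "c \<in> carrier K" "\<forall>z\<in>V4. Pf p q r z = c \<otimes> bf x z" using Pf_perp[OF V(1,3-5,2) ne p(1-3)] by blast
  have "bf p y = \<zero>" "bf q y = \<zero>" "bf r y = \<zero>" using p bf_sym V by metis+
  then have "Pf p q r y = \<zero>" unfolding Pf_def using V by simp
  then have "c \<otimes> bf x y = \<zero>" using c V by simp
  then have "c = \<zero>" using ne c V integral_iff by auto
  then show ?thesis using c V by simp
qed

end

section \<open>Quadrangles in which collinearity is perpendicularity\<close>

locale symplectic_quadrangle = gq P L I + char2 K for P :: "'p set" and L :: "'l set" and I and K :: "('a, 'm) ring_scheme" (structure) +
  fixes \<phi> :: "'p \<Rightarrow> 'a vec"
  assumes V[simp]: "p \<in> P \<Longrightarrow> \<phi> p \<in> V4"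
    and cl_bf: "\<lbrakk>p \<in> P; q \<in> P\<rbrakk> \<Longrightarrow> cl p q \<longleftrightarrow> bf (\<phi> p) (\<phi> q) = \<zero>"
begin

abbreviation bb :: "'p \<Rightarrow> 'p \<Rightarrow> 'a" where "bb p q \<equiv> bf (\<phi> p) (\<phi> q)"

lemma bb_sym: "\<lbrakk>p \<in> P; q \<in> P\<rbrakk> \<Longrightarrow> bb p q = bb q p"
  by (rule bf_sym) auto

text \<open>The points \<open>u\<close>, \<open>v\<close>, \<open>w\<close> are perpendicular to the
  opposite points \<open>x\<close> and \<open>y\<close>, so the Pfaffian of \<open>u\<close>,
  \<open>v\<close>, \<open>w\<close>, \<open>z\<close> vanishes. Its only surviving term is
  \<open>bb u v\<close> times \<open>bb w z\<close>, whose first factor is nonzero.\<close>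

lemma all_regular:
  assumes x: "x \<in> P"
  shows "rp x"
  unfolding reg_def
proof (intro conjI ballI impI x)
  fix y u v z w
  assume P: "y \<in> P" "u \<in> P" "v \<in> P" "z \<in> P" "w \<in> P"
    and a: "\<not> cl x y" "u \<noteq> v" "cl x u" "cl y u" "cl x v" "cl y v" "cl z u" "cl z v" "cl x w" "cl y w"
  have uv: "\<not> cl u v" using trace_opp[of x y u v] x P a by blast
  have b: "bb x y \<noteq> \<zero>" "bb u v \<noteq> \<zero>" "bb x u = \<zero>" "bb x v = \<zero>" "bb x w = \<zero>" "bb y u = \<zero>" "bb y v = \<zero>" "bb y w = \<zero>"
    "bb v z = \<zero>" "bb u z = \<zero>" using a uv x P cl_bf bb_sym by metis+
  have "Pf (\<phi> u) (\<phi> v) (\<phi> w) (\<phi> z) = \<zero>"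
    by (rule Pf_coplanar[of "\<phi> x" "\<phi> y"]) (use b x P in auto)
  then have "bb u v \<otimes> bb w z = \<zero>" unfolding Pf_def using b P by simp
  then have "bb w z = \<zero>" using b P integral_iff by auto
  then show "cl z w" using cl_bf P cl_sym by auto
qed

lemma par_cl:
  assumes x: "x \<in> P" and p: "p \<in> net_points P L I x" and q: "q \<in> net_points P L I x" and n: "net_parallel (net_blocks P L I x) p q"
  shows "cl p q"
proof (rule ccontr)
  assume o: "\<not> cl p q"
  have P: "p \<in> P" "cl x p" "q \<in> P" "cl x q" using p q perp_iff[of "{x}"] x by (auto simp: net_points_def cl_sym)
  obtain y where y: "y \<in> P" "y \<noteq> x" "cl p y" "cl q y" using two_traces[OF P(1,3) o] by metis
  have "\<not> cl x y" using trace_opp[of p q x y] P x y o by (auto simp: cl_sym)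
  moreover have "p \<in> perp P L I {x, y}" "q \<in> perp P L I {x, y}" using perp_iff[of "{x, y}"] P x y by (auto simp: cl_sym)
  ultimately show False using n x y unfolding net_parallel_def net_blocks_def opposite_iff by blast
qed

lemma vertical_cl:
  assumes x: "x \<in> P" and W: "W \<in> vertical_lines (net_points P L I x) (net_blocks P L I x)" and a: "a \<in> W" "b \<in> W"
  shows "cl a b"
proof -
  obtain p where p: "p \<in> net_points P L I x" "W = {q \<in> net_points P L I x. q = p \<or> net_parallel (net_blocks P L I x) p q}"
    using W by (auto simp: vertical_lines_def)
  have pP: "p \<in> P" "p \<noteq> x" "cl x p" using p perp_iff[of "{x}"] x by (auto simp: net_points_def cl_sym)
  have ab: "a \<in> net_points P L I x" "b \<in> net_points P L I x" using a p by auto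
  have P: "a \<in> P" "cl x a" "b \<in> P" "cl x b" using ab perp_iff[of "{x}"] x by (auto simp: net_points_def cl_sym)
  have c: "cl p a" "cl p b" using par_cl[OF x p(1)] ab a p(2) cl_refl[OF pP(1)] by auto
  obtain N where N: "N \<in> L" "I x N" "I p N" using pP(3) by (rule clE)
  have "I a N" "I b N" using no_tri[of x p a N] no_tri[of x p b N] N pP x P c by (auto simp: cl_sym)
  then show ?thesis using N clI by blast
qed

text \<open>Let the blocks \<open>A3\<close> and \<open>B3\<close> meet \<open>M\<close> in
  \<open>m\<close> and \<open>m'\<close>. Perspectivity makes the form of each \<open>b\<close>
  vertex on the perp of \<open>x\<close> a multiple of that of the corresponding \<open>a\<close>
  vertex. The two assumed meeting points then give two equations between the vertices; eliminating
  the third vertex shows that \<open>m'\<close> is perpendicular to the point \<open>y\<close>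
  defining \<open>A3\<close>, so \<open>m'\<close> and \<open>m\<close> are both the projection of
  \<open>y\<close> on \<open>M\<close>.\<close>

theorem all_LD:
  assumes x: "x \<in> P" and M: "M \<in> L" "I x M"
  shows "LD_at P L I x M"
  unfolding LD_at_def LD_def
proof (intro allI impI, elim conjE)
  let ?Q = "net_points P L I x" and ?B = "net_blocks P L I x" and ?V = "vertical_line_of P I x M"
  fix a1 a2 a3 A1 A2 A3 b1 b2 b3 B1 B2 B3
  assume tA: "triangle ?B a1 a2 a3 A1 A2 A3" and tB: "triangle ?B b1 b2 b3 B1 B2 B3"
    and per: "in_perspective ?Q ?B a1 a2 a3 b1 b2 b3" and m1: "meet_on ?V A1 B1" and m2: "meet_on ?V A2 B2"
  have blk: "\<exists>y\<in>P. \<not> cl x y \<and> (\<forall>t. t \<in> C \<longleftrightarrow> t \<in> P \<and> cl x t \<and> cl y t)" if C: "C \<in> ?B" for C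
  proof -
    obtain y where y: "C = perp P L I {x, y}" "y \<in> P" "\<not> cl x y" using C unfolding net_blocks_def opposite_iff by blast
    then show ?thesis using perp_iff[of "{x, y}"] x by (auto simp: cl_sym)
  qed
  have aA: "a1 \<in> A2" "a1 \<in> A3" "a2 \<in> A1" "a2 \<in> A3" "a3 \<in> A1" "a3 \<in> A2" and A: "A1 \<in> ?B" "A2 \<in> ?B" "A3 \<in> ?B"
    and da: "a1 \<noteq> a2" using tA unfolding triangle_def by auto
  have bB: "b1 \<in> B2" "b1 \<in> B3" "b2 \<in> B1" "b2 \<in> B3" "b3 \<in> B1" "b3 \<in> B2" and B: "B1 \<in> ?B" "B2 \<in> ?B" "B3 \<in> ?B"
    using tB unfolding triangle_def by auto
  have ab: "a1 \<noteq> b1" "a2 \<noteq> b2" "a3 \<noteq> b3" and c: "cl a1 b1" "cl a2 b2" "cl a3 b3"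
    using per vertical_cl[OF x] unfolding in_perspective_def by auto
  have inB: "t \<in> P" "cl x t" "t \<noteq> x" if "C \<in> ?B" "t \<in> C" for C t
    using blk[OF that(1)] that(2) by (auto simp: cl_sym)
  have in2: "\<not> cl s t" if "C \<in> ?B" "s \<in> C" "t \<in> C" "s \<noteq> t" for C s t
  proof -
    obtain y where y: "y \<in> P" "\<not> cl x y" "\<And>t. t \<in> C \<longleftrightarrow> t \<in> P \<and> cl x t \<and> cl y t" using blk[OF \<open>C \<in> ?B\<close>] by blast
    show ?thesis by (rule trace_opp[of x y]) (use x y that in auto)
  qed
  have inV: "I t M" "t \<noteq> x" if "t \<in> ?V" for t using that by (auto simp: vertical_line_of_def)
  have VI: "t \<in> ?V" if "t \<in> P" "I t M" "t \<noteq> x" for t using that by (auto simp: vertical_line_of_def)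
  obtain r1 where r1: "r1 \<in> ?V" "r1 \<in> A1" "r1 \<in> B1" using m1 unfolding meet_on_def by blast
  obtain r2 where r2: "r2 \<in> ?V" "r2 \<in> A2" "r2 \<in> B2" using m2 unfolding meet_on_def by blast
  obtain y where y: "y \<in> P" "\<not> cl x y" "\<And>t. t \<in> A3 \<longleftrightarrow> t \<in> P \<and> cl x t \<and> cl y t" using blk[OF A(3)] by blast
  obtain y' where y': "y' \<in> P" "\<not> cl x y'" "\<And>t. t \<in> B3 \<longleftrightarrow> t \<in> P \<and> cl x t \<and> cl y' t" using blk[OF B(3)] by blast
  define m where "m = pj y M"
  define m' where "m' = pj y' M"
  have m: "m \<in> P" "I m M" "cl y m" "cl x m" using pj[OF y(1) M(1)] clI[OF M] by (auto simp: m_def)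
  have m': "m' \<in> P" "I m' M" "cl y' m'" "cl x m'" using pj[OF y'(1) M(1)] clI[OF M] by (auto simp: m'_def)
  have mA: "m \<in> A3" using m y by blast
  have mB: "m' \<in> B3" using m' y' by blast
  have mx: "m \<noteq> x" "m' \<noteq> x" using m m' y y' by (auto simp: cl_sym)
  \<comment> \<open>no vertex lies on \<open>V\<close>, since blocks meet \<open>V\<close> only once\<close>
  have off: "\<not> I a M" if C: "C \<in> ?B" "D \<in> ?B" and r: "r \<in> ?V" "r \<in> C" "r \<in> D" and a: "a \<in> C" "b \<in> D" "cl a b" "a \<noteq> b" for C D r a b
  proof
    assume "I a M"
    have rM: "I r M" "r \<noteq> x" using inV r by auto
    have "cl a r" using clI[OF M(1) \<open>I a M\<close> rM(1)] .
    then have e: "a = r" using in2[OF C(1) a(1) r(2)] by blast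
    then have "\<not> cl r b" using in2[OF C(2) r(3) a(2)] a(4) by blast
    then show False using e a(3) by simp
  qed
  have aP: "a1 \<in> P" "a2 \<in> P" "a3 \<in> P" "cl x a1" "cl x a2" "cl x a3" "a1 \<noteq> x" "a2 \<noteq> x" "a3 \<noteq> x"
    using inB A aA by blast+
  have bP: "b1 \<in> P" "b2 \<in> P" "b3 \<in> P" "cl x b1" "cl x b2" "cl x b3" "b1 \<noteq> x" "b2 \<noteq> x" "b3 \<noteq> x"
    using inB B bB by blast+
  have rP: "r1 \<in> P" "r2 \<in> P" "cl x r1" "cl x r2" using inB A r1 r2 by blast+
  have aM: "\<not> I a1 M" "\<not> I a2 M" "\<not> I a3 M"
    using off[OF A(2) B(2) r2 aA(1) bB(1) c(1) ab(1)]
      off[OF A(1) B(1) r1 aA(3) bB(3) c(2) ab(2)] off[OF A(1) B(1) r1 aA(5) bB(5) c(3) ab(3)] by blast+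
  have bM: "\<not> I b1 M" "\<not> I b2 M" "\<not> I b3 M"
    using off[OF B(2) A(2) r2(1,3,2) bB(1) aA(1)] off[OF B(1) A(1) r1(1,3,2) bB(3) aA(3)] off[OF B(1) A(1) r1(1,3,2) bB(5) aA(5)]
      c ab by (auto simp: cl_sym)
  have nV: "bb a t \<noteq> \<zero>" if "a \<in> P" "cl x a" "\<not> I a M" "t \<in> P" "I t M" "t \<noteq> x" for a t
  proof
    assume "bb a t = \<zero>"
    then have "cl a t" using cl_bf that by blast
    then show False using no_tri[of t x a M] that x M by (auto simp: cl_sym)
  qed
  have xo: "bb x y \<noteq> \<zero>" using cl_bf x y by blast
  \<comment> \<open>the form induced on \<open>x\<^sup>\<bottom>/x\<close> is two-dimensional\<close>
  have fA: "bb p q \<otimes> bb t m \<oplus> (bb p t \<otimes> bb q m \<oplus> bb q t \<otimes> bb p m) = \<zero>"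
    if "p \<in> P" "q \<in> P" "t \<in> P" "cl x p" "cl x q" "cl x t" for p q t
    using Pf_all_perp[of "\<phi> x" "\<phi> p" "\<phi> q" "\<phi> t" "\<phi> m" "\<phi> y"] xo that x y m cl_bf unfolding Pf_def by auto
  have fB: "bb p q \<otimes> bb r y \<oplus> (bb p r \<otimes> bb q y \<oplus> bb q r \<otimes> bb p y) = \<zero>" if C: "C \<in> ?B" "p \<in> C" "q \<in> C" "r \<in> C" for C p q r
  proof -
    obtain w where w: "w \<in> P" "\<not> cl x w" "\<And>t. t \<in> C \<longleftrightarrow> t \<in> P \<and> cl x t \<and> cl w t" using blk[OF C(1)] by blast
    show ?thesis
      using Pf_coplanar[of "\<phi> x" "\<phi> w" "\<phi> p" "\<phi> q" "\<phi> r" "\<phi> y"] w C x y cl_bf unfolding Pf_def by auto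
  qed
  \<comment> \<open>\<open>\<xi>\<close> vanishes on the points of \<open>M\<close>, and
    \<open>\<zeta>\<close> on the block \<open>A3\<close>; in these coordinates the claim becomes
    \<open>\<zeta> m' = \<zero>\<close>.\<close>
  define \<xi> where "\<xi> p = bb p m" for p
  define \<zeta> where "\<zeta> p = bb p y" for p
  have cK[simp]: "\<xi> p \<in> carrier K" "\<zeta> p \<in> carrier K" if "p \<in> P" for p using that m y by (auto simp: \<xi>_def \<zeta>_def)
  have bbK: "bb p q \<in> carrier K" if "p \<in> P" "q \<in> P" for p q using that by simp
  have prp: "bb p t \<otimes> \<xi> q = bb q t \<otimes> \<xi> p"
    if "p \<in> P" "q \<in> P" "t \<in> P" "cl x p" "cl x q" "cl x t" "bb p q = \<zero>" for p q t
    using fA[OF that(1-6)] that m by (simp add: \<xi>_def sum0_iff)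
  have propV: "bb p r \<otimes> \<xi> q = bb q r \<otimes> \<xi> p" if "p \<in> P" "q \<in> P" "r \<in> P" "I r M" "cl x p" "cl x q" for p q r
  proof -
    have "bb r m = \<zero>" using that m cl_bf clI[OF M(1)] by blast
    then show ?thesis using fA[OF that(1-3,5,6)] that m x clI[OF M] by (simp add: \<xi>_def sum0_iff)
  qed
  have xinz: "\<xi> p \<noteq> \<zero>" if "p \<in> P" "cl x p" "\<not> I p M" for p unfolding \<xi>_def by (rule nV[OF that m(1,2) mx(1)])
  \<comment> \<open>Modulo the vector of \<open>x\<close>, two points on one line through
    \<open>x\<close> agree up to a factor; the factor is read off at \<open>m\<close>.\<close>
  have lam: "\<exists>l\<in>carrier K. l \<noteq> \<zero> \<and> (\<forall>t\<in>P. cl x t \<longrightarrow> bb b t = l \<otimes> bb a t)"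
    if h: "a \<in> P" "cl x a" "\<not> I a M" "b \<in> P" "cl x b" "\<not> I b M" "cl a b" for a b
  proof -
    have ab: "bb a b = \<zero>" using cl_bf h by blast
    note n = frac_nz[OF cK(1)[OF h(1)] xinz[OF h(1-3)] cK(1)[OF h(4)]]
    have "bb b t = (\<xi> b \<otimes> inv \<xi> a) \<otimes> bb a t" if t: "t \<in> P" "cl x t" for t
      by (rule frac[OF cK(1)[OF h(1)] xinz[OF h(1-3)] cK(1)[OF h(4)] bbK[OF h(4) t(1)] bbK[OF h(1) t(1)]])
        (use prp[OF h(1,4) t(1) h(2,5) t(2) ab] m_comm[OF cK(1)[OF h(1)] bbK[OF h(4) t(1)]] in simp)
    then show ?thesis using n(1) n(2)[OF xinz[OF h(4-6)]] by blast
  qed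
  \<comment> \<open>All points of \<open>M\<close> other than \<open>x\<close> induce proportional
    forms on the perp of \<open>x\<close>; the factor relative to \<open>m\<close> is read off at
    \<open>a1\<close>.\<close>
  have rho: "\<exists>s\<in>carrier K. s \<noteq> \<zero> \<and> (\<forall>p\<in>P. cl x p \<longrightarrow> bb p r = s \<otimes> \<xi> p)" if r: "r \<in> P" "I r M" "r \<noteq> x" for r
  proof -
    note g = cK(1)[OF aP(1)] xinz[OF aP(1,4) aM(1)]
    note n = frac_nz[OF g bbK[OF aP(1) r(1)]]
    have "bb p r = (bb a1 r \<otimes> inv \<xi> a1) \<otimes> \<xi> p" if p: "p \<in> P" "cl x p" for p
      by (rule frac[OF g bbK[OF aP(1) r(1)] bbK[OF p(1) r(1)] cK(1)[OF p(1)]])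
        (use propV[OF p(1) aP(1) r(1,2) p(2) aP(4)] m_comm[OF cK(1)[OF p(1)] bbK[OF aP(1) r(1)]] m_comm[OF cK(1)[OF aP(1)] bbK[OF p(1) r(1)]] in simp)
    then show ?thesis using n(1) n(2)[OF nV[OF aP(1,4) aM(1) r]] by blast
  qed
  obtain l1 where l1: "l1 \<in> carrier K" "l1 \<noteq> \<zero>" "\<And>t. t \<in> P \<Longrightarrow> cl x t \<Longrightarrow> bb b1 t = l1 \<otimes> bb a1 t"
    using lam[OF aP(1,4) aM(1) bP(1,4) bM(1) c(1)] by blast
  obtain l2 where l2: "l2 \<in> carrier K" "l2 \<noteq> \<zero>" "\<And>t. t \<in> P \<Longrightarrow> cl x t \<Longrightarrow> bb b2 t = l2 \<otimes> bb a2 t"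
    using lam[OF aP(2,5) aM(2) bP(2,5) bM(2) c(2)] by blast
  obtain l3 where l3: "l3 \<in> carrier K" "l3 \<noteq> \<zero>" "\<And>t. t \<in> P \<Longrightarrow> cl x t \<Longrightarrow> bb b3 t = l3 \<otimes> bb a3 t"
    using lam[OF aP(3,6) aM(3) bP(3,6) bM(3) c(3)] by blast
  have rM: "I r1 M" "r1 \<noteq> x" "I r2 M" "r2 \<noteq> x" using inV r1 r2 by blast+
  obtain s1 where s1: "s1 \<in> carrier K" "s1 \<noteq> \<zero>" "\<And>p. p \<in> P \<Longrightarrow> cl x p \<Longrightarrow> bb p r1 = s1 \<otimes> \<xi> p"
    using rho[OF rP(1) rM(1,2)] by blast
  obtain s2 where s2: "s2 \<in> carrier K" "s2 \<noteq> \<zero>" "\<And>p. p \<in> P \<Longrightarrow> cl x p \<Longrightarrow> bb p r2 = s2 \<otimes> \<xi> p"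
    using rho[OF rP(2) rM(3,4)] by blast
  obtain s3 where s3: "s3 \<in> carrier K" "s3 \<noteq> \<zero>" "\<And>p. p \<in> P \<Longrightarrow> cl x p \<Longrightarrow> bb p m' = s3 \<otimes> \<xi> p"
    using rho[OF m'(1,2) mx(2)] by blast
  have quot: "\<exists>w\<in>carrier K. z = l \<otimes> w" if "l \<in> carrier K" "l \<noteq> \<zero>" "z \<in> carrier K" for l z
    using frac[OF that(1,2) one_closed that(3,3)] that frac_nz(1)[OF that(1,2) one_closed] m_assoc field_Units
    by (intro bexI[of _ "inv l \<otimes> z"]) (auto simp: m_assoc[symmetric])
  obtain w1 where w1: "w1 \<in> carrier K" "\<zeta> b1 = l1 \<otimes> w1" using quot[OF l1(1,2) cK(2)[OF bP(1)]] by blast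
  obtain w2 where w2: "w2 \<in> carrier K" "\<zeta> b2 = l2 \<otimes> w2" using quot[OF l2(1,2) cK(2)[OF bP(2)]] by blast
  obtain w3 where w3: "w3 \<in> carrier K" "\<zeta> b3 = l3 \<otimes> w3" using quot[OF l3(1,2) cK(2)[OF bP(3)]] by blast
  have z0: "\<zeta> a1 = \<zero>" "\<zeta> a2 = \<zero>" using y aA aP cl_bf cl_sym unfolding \<zeta>_def by metis+
  have bb2: "bb b1 b2 = l1 \<otimes> (l2 \<otimes> bb a1 a2)" "bb b1 b3 = l1 \<otimes> (l3 \<otimes> bb a1 a3)" "bb b2 b3 = l2 \<otimes> (l3 \<otimes> bb a2 a3)"
    using l1(3) l2(3) l3(3) bb_sym aP bP by metis+
  have r': "bb b1 r2 = l1 \<otimes> (s2 \<otimes> \<xi> a1)" "bb b3 r2 = l3 \<otimes> (s2 \<otimes> \<xi> a3)" "bb b2 r1 = l2 \<otimes> (s1 \<otimes> \<xi> a2)" "bb b3 r1 = l3 \<otimes> (s1 \<otimes> \<xi> a3)"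
    "bb b1 m' = l1 \<otimes> (s3 \<otimes> \<xi> a1)" "bb b2 m' = l2 \<otimes> (s3 \<otimes> \<xi> a2)"
    using l1(3) l2(3) l3(3) s1(3) s2(3) s3(3) aP rP m' by simp_all
  note zed = \<zeta>_def[symmetric]
  have "\<xi> a3 \<otimes> w2 = \<xi> a2 \<otimes> (\<zeta> a3 \<oplus> w3)"
  proof (rule perspective_algebra[OF l2(1) l3(1) s1(1) bbK[OF aP(2,3)] cK(2)[OF rP(1)] cK(1)[OF aP(2)] cK(1)[OF aP(3)] cK(2)[OF aP(3)] w2(1) w3(1) l2(2) l3(2) s1(2)])
    show "bb a2 a3 \<otimes> \<zeta> r1 = (s1 \<otimes> \<xi> a2) \<otimes> \<zeta> a3"
      using fB[OF A(1) aA(3,5) r1(2)] s1 aP z0 rP bbK by (simp add: zed sum0_iff)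
    show "(l2 \<otimes> (l3 \<otimes> bb a2 a3)) \<otimes> \<zeta> r1 = (l2 \<otimes> (s1 \<otimes> \<xi> a2)) \<otimes> (l3 \<otimes> w3) \<oplus> (l3 \<otimes> (s1 \<otimes> \<xi> a3)) \<otimes> (l2 \<otimes> w2)"
      using fB[OF B(1) bB(3,5) r1(3)] bb2 r' w2 w3 l2 l3 s1 aP rP bbK by (simp add: zed sum0_iff)
  qed
  moreover have "\<xi> a3 \<otimes> w1 = \<xi> a1 \<otimes> (\<zeta> a3 \<oplus> w3)"
  proof (rule perspective_algebra[OF l1(1) l3(1) s2(1) bbK[OF aP(1,3)] cK(2)[OF rP(2)] cK(1)[OF aP(1)] cK(1)[OF aP(3)] cK(2)[OF aP(3)] w1(1) w3(1) l1(2) l3(2) s2(2)])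
    show "bb a1 a3 \<otimes> \<zeta> r2 = (s2 \<otimes> \<xi> a1) \<otimes> \<zeta> a3"
      using fB[OF A(2) aA(1,6) r2(2)] s2 aP z0 rP bbK by (simp add: zed sum0_iff)
    show "(l1 \<otimes> (l3 \<otimes> bb a1 a3)) \<otimes> \<zeta> r2 = (l1 \<otimes> (s2 \<otimes> \<xi> a1)) \<otimes> (l3 \<otimes> w3) \<oplus> (l3 \<otimes> (s2 \<otimes> \<xi> a3)) \<otimes> (l1 \<otimes> w1)"
      using fB[OF B(2) bB(1,6) r2(3)] bb2 r' w1 w3 l1 l3 s2 aP rP bbK by (simp add: zed sum0_iff)
  qed
  ultimately have "\<xi> a3 \<otimes> (\<xi> a1 \<otimes> w2) = \<xi> a3 \<otimes> (\<xi> a2 \<otimes> w1)"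
    using m_lcomm[of "\<xi> a3" "\<xi> a1" w2] m_lcomm[of "\<xi> a3" "\<xi> a2" w1] m_lcomm[of "\<xi> a1" "\<xi> a2" "\<zeta> a3 \<oplus> w3"] aP w1 w2 w3 by simp
  then have key: "\<xi> a1 \<otimes> w2 = \<xi> a2 \<otimes> w1"
    using m_lcancel[of "\<xi> a3" "\<xi> a1 \<otimes> w2" "\<xi> a2 \<otimes> w1"] xinz[OF aP(3,6) aM(3)] aP w1 w2 by simp
  have "bb b1 b2 \<otimes> \<zeta> m' = bb b1 m' \<otimes> \<zeta> b2 \<oplus> bb b2 m' \<otimes> \<zeta> b1"
    using fB[OF B(3) bB(2,4) mB] bP m' bbK by (simp add: zed sum0_iff)
  also have "\<dots> = (l1 \<otimes> l2 \<otimes> s3) \<otimes> (\<xi> a1 \<otimes> w2) \<oplus> (l1 \<otimes> l2 \<otimes> s3) \<otimes> (\<xi> a2 \<otimes> w1)"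
    unfolding r' w1(2) w2(2) using l1 l2 s3 w1 w2 aP by (simp add: m_ac)
  also have "\<dots> = \<zero>" unfolding key using l1 l2 s3 w1 aP by (simp add: dbl)
  finally have "bb b1 b2 \<otimes> \<zeta> m' = \<zero>" .
  moreover have "b1 \<noteq> b2" using tB unfolding triangle_def by auto
  then have "bb b1 b2 \<noteq> \<zero>" using in2[OF B(3) bB(2,4)] cl_bf bP by blast
  ultimately have "bb m' y = \<zero>" using integral_iff[of "bb b1 b2" "\<zeta> m'"] bbK[OF bP(1,2)] bbK[OF m'(1) y(1)] unfolding \<zeta>_def by simp
  then have "cl y m'" using cl_bf[OF m'(1) y(1)] by (simp add: cl_sym)
  moreover have "\<not> I y M" using y clI[OF M] by blast
  ultimately have mm: "m' = m" using pj_unique[OF y(1) M(1) _ m'(1,2) _ m(1-3)] by blast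
  have "A3 \<inter> B3 = {m}"
  proof (intro equalityI subsetI)
    fix t assume t: "t \<in> A3 \<inter> B3"
    show "t \<in> {m}"
    proof (rule ccontr)
      assume "t \<notin> {m}"
      then have "m \<noteq> t" by auto
      have "cl y' a1"
        by (rule regD[OF all_regular[OF x] y(2) \<open>m \<noteq> t\<close>]) (use t mA mB mm y y' aA in auto)
      then have "a1 \<in> B3" using y' aP by blast
      then show False using in2[OF B(3) _ bB(2) ab(1)] c(1) by blast
    qed
  qed (use mA mB mm in auto)
  then show "meet_on ?V A3 B3" unfolding meet_on_def using VI[OF m(1,2) mx(1)] by blast
qed

end

section \<open>Vector representations of a mixed quadrangle\<close>

locale mixed_field = char2 K for K :: "('a, 'm) ring_scheme" (structure) +
  fixes K' LL LL' :: "'a set"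
  assumes D: "mixed_data K K' LL LL'"
begin

lemma incl: "squares K \<subseteq> K'" "K' \<subseteq> LL" "squares K \<subseteq> LL'" "LL' \<subseteq> K'"
  and subs: "subfield K' K" "subalgebra K' LL K" "subalgebra (squares K) LL' K"
  using D by (auto simp: mixed_data_def)

lemma LLc[simp]: "a \<in> LL \<Longrightarrow> a \<in> carrier K"
  using subs(2) by (auto simp: subalgebra_def subgroup_def)

lemma LL'_LL: "k \<in> LL' \<Longrightarrow> k \<in> LL" using incl by blast
lemma LL'c[simp]: "k \<in> LL' \<Longrightarrow> k \<in> carrier K" using LL'_LL LLc by blast

lemma LL_add: "\<lbrakk>a \<in> LL; b \<in> LL\<rbrakk> \<Longrightarrow> a \<oplus> b \<in> LL"
  using subgroup.m_closed[of LL "add_monoid K"] subs(2) by (auto simp: subalgebra_def)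

lemma LL'_add: "\<lbrakk>a \<in> LL'; b \<in> LL'\<rbrakk> \<Longrightarrow> a \<oplus> b \<in> LL'"
  using subgroup.m_closed[of LL' "add_monoid K"] subs(3) by (auto simp: subalgebra_def)

lemma LL_smult: "\<lbrakk>k \<in> K'; a \<in> LL\<rbrakk> \<Longrightarrow> a \<otimes> k \<in> LL"
proof -
  assume k: "k \<in> K'" and a: "a \<in> LL"
  have "k \<otimes> a \<in> LL" using subs(2) k a by (auto simp: subalgebra_def subalgebra_axioms_def)
  then show ?thesis using k a incl m_comm[of k a] by auto
qed

lemma LL'_smult: "\<lbrakk>c \<in> carrier K; k \<in> LL'\<rbrakk> \<Longrightarrow> c \<otimes> c \<otimes> k \<in> LL'"
  using subs(3) by (auto simp: subalgebra_def subalgebra_axioms_def squares_def)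

lemma K'_inv: "\<lbrakk>k \<in> K'; k \<noteq> \<zero>\<rbrakk> \<Longrightarrow> inv k \<in> K'"
  using subfield_m_inv(1)[OF subs(1)] by blast

text \<open>Two points of the quadrangle are collinear iff their vectors are perpendicular, and dually for lines; the
  vector of a line consists of its Pluecker coordinates as a totally isotropic line, without the two that coincide.\<close>

fun pv :: "'a mq_point \<Rightarrow> 'a vec" where
  "pv Pt_inf = (\<one>, \<zero>, \<zero>, \<zero>)"
| "pv (Pt1 a) = (a, \<zero>, \<zero>, \<one>)"
| "pv (Pt2 k b) = (b, \<zero>, \<one>, k)"
| "pv (Pt3 a l a') = (l \<oplus> a \<otimes> a', \<one>, a, a')"

fun lv :: "'a mq_line \<Rightarrow> 'a vec" where
  "lv Ln_inf = (\<one>, \<zero>, \<zero>, \<zero>)"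
| "lv (Ln1 k) = (k, \<zero>, \<zero>, \<one>)"
| "lv (Ln2 a l) = (l, \<zero>, \<one>, a \<otimes> a)"
| "lv (Ln3 k b k') = (b \<otimes> b \<oplus> k \<otimes> k', \<one>, k, k')"

abbreviation "PP \<equiv> mq_points LL LL'"
abbreviation "QQ \<equiv> mq_lines LL LL'"
abbreviation "J \<equiv> mq_inc K"

lemma pv: "p \<in> PP \<Longrightarrow> pv p \<in> V4"
  by (auto simp: mq_points_def V4_def)

lemma lv: "p \<in> QQ \<Longrightarrow> lv p \<in> V4"
  by (auto simp: mq_lines_def V4_def)

lemma inPP[simp]: "Pt_inf \<in> PP" "Pt1 a \<in> PP \<longleftrightarrow> a \<in> LL" "Pt2 k b \<in> PP \<longleftrightarrow> k \<in> LL' \<and> b \<in> LL"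
    "Pt3 a l a' \<in> PP \<longleftrightarrow> a \<in> LL \<and> l \<in> LL' \<and> a' \<in> LL"
  and inQQ[simp]: "Ln_inf \<in> QQ" "Ln1 k \<in> QQ \<longleftrightarrow> k \<in> LL'" "Ln2 a l \<in> QQ \<longleftrightarrow> a \<in> LL \<and> l \<in> LL'"
    "Ln3 k b k' \<in> QQ \<longleftrightarrow> k \<in> LL' \<and> b \<in> LL \<and> k' \<in> LL'"
  by (auto simp: mq_points_def mq_lines_def)

lemma ex_QQ: "(\<exists>M\<in>QQ. R M) \<longleftrightarrow> R Ln_inf \<or> (\<exists>k\<in>LL'. R (Ln1 k)) \<or> (\<exists>a\<in>LL. \<exists>l\<in>LL'. R (Ln2 a l)) \<or>
    (\<exists>k\<in>LL'. \<exists>b\<in>LL. \<exists>k'\<in>LL'. R (Ln3 k b k'))"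
  by (auto simp: mq_lines_def)

lemma ex_PP: "(\<exists>M\<in>PP. R M) \<longleftrightarrow> R Pt_inf \<or> (\<exists>a\<in>LL. R (Pt1 a)) \<or> (\<exists>k\<in>LL'. \<exists>b\<in>LL. R (Pt2 k b)) \<or>
    (\<exists>a\<in>LL. \<exists>l\<in>LL'. \<exists>a'\<in>LL. R (Pt3 a l a'))"
  by (auto simp: mq_points_def)

section \<open>Collinearity and concurrency as perpendicularity\<close>

lemma sum_cong4: "\<lbrakk>a \<in> carrier K; b \<in> carrier K; c \<in> carrier K; d \<in> carrier K\<rbrakk> \<Longrightarrow> a \<oplus> b = c \<oplus> d \<longleftrightarrow> a \<oplus> c = b \<oplus> d"
  using sum0_iff[of "a \<oplus> b" "c \<oplus> d"] sum0_iff[of "a \<oplus> c" "b \<oplus> d"] by (simp add: a_ac)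

lemma div_ex:
  assumes "g \<in> carrier K" "g \<noteq> \<zero>" "m \<in> carrier K"
  shows "m = (m \<otimes> inv g) \<otimes> g" "m \<otimes> inv g \<in> carrier K" "inv g \<in> carrier K"
  using assms field_Units by (auto simp: m_assoc)

text \<open>For \<open>a\<close> and \<open>c\<close> different, the slope of the joining line has
  to be \<open>k = (a' + c') / (a + c)\<close>. It lies in \<open>LL'\<close> because the equation
  turns it into \<open>(l + m) / (a + c)^2\<close>, a multiple of an element of \<open>LL'\<close>
  by a square.\<close>

lemma col_33:
  assumes p: "a \<in> LL" "l \<in> LL'" "a' \<in> LL" and q: "c \<in> LL" "m \<in> LL'" "c' \<in> LL"
  shows "col QQ J (Pt3 a l a') (Pt3 c m c') \<longleftrightarrow> l \<oplus> m = (a \<oplus> c) \<otimes> (a' \<oplus> c')"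
proof
  assume "col QQ J (Pt3 a l a') (Pt3 c m c')"
  then consider "a = c" "l = m" | k b where "k \<in> LL'" "b \<in> LL" "a' = a \<otimes> k \<oplus> b" "c' = c \<otimes> k \<oplus> b"
      "(a \<otimes> a) \<otimes> k \<oplus> l = (c \<otimes> c) \<otimes> k \<oplus> m"
    by (auto simp: col_def ex_QQ)
  then show "l \<oplus> m = (a \<oplus> c) \<otimes> (a' \<oplus> c')"
  proof cases
    case 2
    have "l \<oplus> m = (a \<otimes> a) \<otimes> k \<oplus> (c \<otimes> c) \<otimes> k"
      using 2 p q sum_cong4[of "(a \<otimes> a) \<otimes> k" l "(c \<otimes> c) \<otimes> k" m] by simp
    also have "\<dots> = (a \<oplus> c) \<otimes> (a' \<oplus> c')" using 2(1,2) p q unfolding 2(3,4) by (simp add: nf)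
    finally show ?thesis .
  qed (use p q in \<open>simp add: dbl\<close>)
next
  assume e: "l \<oplus> m = (a \<oplus> c) \<otimes> (a' \<oplus> c')"
  show "col QQ J (Pt3 a l a') (Pt3 c m c')"
  proof (cases "a = c")
    case True
    then have "l = m" using e p q sum0_iff[of l m] by (simp add: dbl)
    then show ?thesis using True p unfolding col_def ex_QQ by auto
  next
    case False
    let ?g = "a \<oplus> c"
    have g: "?g \<in> carrier K" "?g \<noteq> \<zero>" using p q False sum0_iff by auto
    define k where "k = (a' \<oplus> c') \<otimes> inv ?g"
    note d = div_ex[OF g]
    have k: "k \<in> carrier K" "a' \<oplus> c' = k \<otimes> ?g" using d[of "a' \<oplus> c'"] p q by (simp_all add: k_def)
    have ig: "inv ?g \<in> carrier K" "inv ?g \<otimes> ?g = \<one>" using g field_Units by auto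
    have "inv ?g \<otimes> inv ?g \<otimes> (l \<oplus> m) = (inv ?g \<otimes> ?g) \<otimes> (inv ?g \<otimes> ?g) \<otimes> k"
      unfolding e k(2) using g ig(1) k(1) by (simp only: m_ac m_closed)
    also have "\<dots> = k" unfolding ig(2) using k(1) by simp
    finally have kL: "k \<in> LL'" using LL'_smult[OF ig(1) LL'_add[OF p(2) q(2)]] by simp
    define b where "b = a \<otimes> k \<oplus> a'"
    have bL: "b \<in> LL" unfolding b_def by (rule LL_add[OF LL_smult[OF subsetD[OF incl(4) kL] p(1)] p(3)])
    define k' where "k' = (a \<otimes> a) \<otimes> k \<oplus> l"
    have kL': "k' \<in> LL'" unfolding k'_def by (rule LL'_add[OF LL'_smult[OF LLc[OF p(1)] kL] p(2)])
    have c: "a \<in> carrier K" "c \<in> carrier K" "a' \<in> carrier K" "c' \<in> carrier K" "l \<in> carrier K" "m \<in> carrier K" using p q by auto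
    have 1: "a' = a \<otimes> k \<oplus> b" using c k(1) unfolding b_def by (simp add: nf)
    have "c' = a' \<oplus> (a' \<oplus> c')" using c by (simp add: nf)
    also have "\<dots> = c \<otimes> k \<oplus> b" unfolding k(2) b_def using c k(1) by (simp add: nf)
    finally have 2: "c' = c \<otimes> k \<oplus> b" .
    have "m = l \<oplus> (l \<oplus> m)" using c by (simp add: nf)
    also have "\<dots> = l \<oplus> (a \<oplus> c) \<otimes> (k \<otimes> (a \<oplus> c))" unfolding e k(2) ..
    also have "\<dots> = (c \<otimes> c) \<otimes> k \<oplus> k'" unfolding k'_def using c k(1) by (simp add: nf)
    finally have "(c \<otimes> c) \<otimes> k \<oplus> m = k'" using c k(1) kL' by (simp add: nf)
    then have "J (Pt3 a l a') (Ln3 k b k')" "J (Pt3 c m c') (Ln3 k b k')" using 1 2 k'_def by auto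
    then show ?thesis using kL bL kL' unfolding col_def by (metis inQQ(4))
  qed
qed

lemma sq_inj: "\<lbrakk>a \<in> carrier K; b \<in> carrier K\<rbrakk> \<Longrightarrow> a \<otimes> a = b \<otimes> b \<longleftrightarrow> a = b"
proof
  assume c: "a \<in> carrier K" "b \<in> carrier K" and e: "a \<otimes> a = b \<otimes> b"
  have "(a \<oplus> b) \<otimes> (a \<oplus> b) = a \<otimes> a \<oplus> b \<otimes> b" using c by (simp add: nf)
  then have "(a \<oplus> b) \<otimes> (a \<oplus> b) = \<zero>" using e c by (simp add: dbl)
  then show "a = b" using c integral sum0_iff by auto
qed simp

text \<open>For \<open>k\<close> and \<open>h\<close> different, the first coordinate of the meeting
  point has to be \<open>(b + c) / (k + h)\<close>. It lies in \<open>LL\<close> because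
  \<open>k + h\<close> lies in the subfield \<open>K'\<close>.\<close>

lemma mt_33:
  assumes p: "k \<in> LL'" "b \<in> LL" "k' \<in> LL'" and q: "h \<in> LL'" "c \<in> LL" "h' \<in> LL'"
  shows "col PP (conversep J) (Ln3 k b k') (Ln3 h c h') \<longleftrightarrow> (b \<oplus> c) \<otimes> (b \<oplus> c) = (k \<oplus> h) \<otimes> (k' \<oplus> h')"
proof
  have c: "k \<in> carrier K" "b \<in> carrier K" "k' \<in> carrier K" "h \<in> carrier K" "c \<in> carrier K" "h' \<in> carrier K" using p q by auto
  assume "col PP (conversep J) (Ln3 k b k') (Ln3 h c h')"
  then consider "k = h" "b = c" | a l where "a \<in> LL" "l \<in> LL'" "a \<otimes> k \<oplus> b = a \<otimes> h \<oplus> c"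
      "k' = (a \<otimes> a) \<otimes> k \<oplus> l" "h' = (a \<otimes> a) \<otimes> h \<oplus> l"
    by (auto simp: col_def ex_PP)
  then show "(b \<oplus> c) \<otimes> (b \<oplus> c) = (k \<oplus> h) \<otimes> (k' \<oplus> h')"
  proof cases
    case 2
    have "b \<oplus> c = a \<otimes> k \<oplus> a \<otimes> h" using 2 c sum_cong4[of "a \<otimes> k" b "a \<otimes> h" c] by simp
    then have "b \<oplus> c = a \<otimes> (k \<oplus> h)" using 2(1) c by (simp add: r_distr)
    moreover have "k' \<oplus> h' = (a \<otimes> a) \<otimes> (k \<oplus> h)" unfolding 2(4,5) using 2(1,2) c by (simp add: nf)
    ultimately show ?thesis using 2(1) c by (simp add: m_ac)
  qed (use c in \<open>simp add: dbl\<close>)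
next
  have c: "k \<in> carrier K" "b \<in> carrier K" "k' \<in> carrier K" "h \<in> carrier K" "c \<in> carrier K" "h' \<in> carrier K" using p q by auto
  assume e: "(b \<oplus> c) \<otimes> (b \<oplus> c) = (k \<oplus> h) \<otimes> (k' \<oplus> h')"
  show "col PP (conversep J) (Ln3 k b k') (Ln3 h c h')"
  proof (cases "k = h")
    case True
    then have "b \<oplus> c = \<zero>" using e c integral[of "b \<oplus> c" "b \<oplus> c"] by (simp add: dbl)
    then have "b = c" using sum0_iff c by simp
    then show ?thesis using True p unfolding col_def ex_PP by auto
  next
    case False
    let ?g = "k \<oplus> h"
    have g: "?g \<in> carrier K" "?g \<noteq> \<zero>" using c False sum0_iff by auto
    have gK: "?g \<in> K'" using LL'_add[OF p(1) q(1)] incl by blast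
    define a where "a = (b \<oplus> c) \<otimes> inv ?g"
    have a: "a \<in> carrier K" "b \<oplus> c = a \<otimes> ?g" using div_ex[OF g, of "b \<oplus> c"] c by (simp_all add: a_def)
    have aL: "a \<in> LL" unfolding a_def by (rule LL_smult[OF K'_inv[OF gK g(2)] LL_add[OF p(2) q(2)]])
    define l where "l = (a \<otimes> a) \<otimes> k \<oplus> k'"
    have lL: "l \<in> LL'" unfolding l_def by (rule LL'_add[OF LL'_smult[OF a(1) p(1)] p(3)])
    define a' where "a' = a \<otimes> k \<oplus> b"
    have aL': "a' \<in> LL" unfolding a'_def by (rule LL_add[OF LL_smult[OF subsetD[OF incl(4) p(1)] aL] p(2)])
    have "?g \<otimes> (a \<otimes> a \<otimes> ?g) = ?g \<otimes> (k' \<oplus> h')" unfolding e[symmetric] a(2) using a(1) g(1) by (simp add: m_ac)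
    then have kh: "a \<otimes> a \<otimes> ?g = k' \<oplus> h'" using m_lcancel[OF g(2,1), of "a \<otimes> a \<otimes> ?g" "k' \<oplus> h'"] a(1) g(1) c by simp
    have 1: "k' = (a \<otimes> a) \<otimes> k \<oplus> l" using c a(1) unfolding l_def by (simp add: nf)
    have "h' = k' \<oplus> (k' \<oplus> h')" using c by (simp add: nf)
    also have "\<dots> = (a \<otimes> a) \<otimes> h \<oplus> l" unfolding kh[symmetric] l_def using c a(1) by (simp add: nf)
    finally have 2: "h' = (a \<otimes> a) \<otimes> h \<oplus> l" .
    have "c = b \<oplus> (b \<oplus> c)" using c by (simp add: nf)
    also have "\<dots> = a \<otimes> h \<oplus> a'" unfolding a(2) a'_def using c a(1) by (simp add: nf)
    finally have "a \<otimes> h \<oplus> c = a'" using c a(1) aL' by (simp add: nf)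
    then have "J (Pt3 a l a') (Ln3 k b k')" "J (Pt3 a l a') (Ln3 h c h')" using 1 2 a'_def by auto
    then show ?thesis using aL lL aL' unfolding col_def by (metis inPP(4) conversep_iff)
  qed
qed

lemma col_23:
  assumes "k \<in> LL'" "b \<in> LL" "a \<in> LL" "l \<in> LL'" "a' \<in> LL"
  shows "(\<exists>M\<in>QQ. J (Pt2 k b) M \<and> J (Pt3 a l a') M) \<longleftrightarrow> a' = a \<otimes> k \<oplus> b"
  unfolding ex_QQ using assms LL'_add LL'_smult by auto

lemma mt_23:
  assumes "a \<in> LL" "l \<in> LL'" "k \<in> LL'" "b \<in> LL" "k' \<in> LL'"
  shows "(\<exists>M\<in>PP. J M (Ln2 a l) \<and> J M (Ln3 k b k')) \<longleftrightarrow> k' = a \<otimes> a \<otimes> k \<oplus> l"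
  unfolding ex_PP using assms LL_add LL_smult incl by auto

lemma col_bf:
  assumes p: "p \<in> PP" and q: "q \<in> PP"
  shows "col QQ J p q \<longleftrightarrow> bf (pv p) (pv q) = \<zero>"
proof -
  have s: "(\<exists>M\<in>QQ. J p M \<and> J q M) \<longleftrightarrow> (\<exists>M\<in>QQ. J q M \<and> J p M)" for p q by auto
  have c33: "(\<exists>M\<in>QQ. J (Pt3 a l a') M \<and> J (Pt3 c m c') M) \<longleftrightarrow> bf (pv (Pt3 a l a')) (pv (Pt3 c m c')) = \<zero>"
    if h: "a \<in> LL" "l \<in> LL'" "a' \<in> LL" "c \<in> LL" "m \<in> LL'" "c' \<in> LL" for a l a' c m c'
  proof -
    have "bf (pv (Pt3 a l a')) (pv (Pt3 c m c')) = (l \<oplus> m) \<oplus> (a \<oplus> c) \<otimes> (a' \<oplus> c')" using h by (simp add: nf)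
    then show ?thesis using col_33[OF h] sum0_iff h unfolding col_def by simp
  qed
  have c23: "(\<exists>M\<in>QQ. J (Pt2 k b) M \<and> J (Pt3 a l a') M) \<longleftrightarrow> bf (pv (Pt2 k b)) (pv (Pt3 a l a')) = \<zero>"
    if h: "k \<in> LL'" "b \<in> LL" "a \<in> LL" "l \<in> LL'" "a' \<in> LL" for k b a l a'
  proof -
    have "bf (pv (Pt2 k b)) (pv (Pt3 a l a')) = (a \<otimes> k \<oplus> b) \<oplus> a'" using h by (simp add: nf)
    then show ?thesis using col_23[OF h] sum0_iff[of "a \<otimes> k \<oplus> b" a'] h by auto
  qed
  have rest: "(\<exists>M\<in>QQ. J p M \<and> J q M) \<longleftrightarrow> bf (pv p) (pv q) = \<zero>"
    if "p \<in> PP" "q \<in> PP" "(case p of Pt_inf \<Rightarrow> True | Pt1 a \<Rightarrow> (case q of Pt_inf \<Rightarrow> False | _ \<Rightarrow> True)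
        | Pt2 k b \<Rightarrow> (case q of Pt2 k' b' \<Rightarrow> True | _ \<Rightarrow> False) | Pt3 a l a' \<Rightarrow> False)" for p q
    using that
    by (cases p; cases q) (auto simp: ex_QQ sum0_iff nf intro: incl)
  show ?thesis
    unfolding col_def
    using p q rest[OF p q] rest[OF q p] c33 c23 s[of p q] bf_sym[OF pv[OF p] pv[OF q]]
    by (cases p; cases q) (simp_all del: bf.simps pv.simps)
qed

lemma mt_bf:
  assumes p: "p \<in> QQ" and q: "q \<in> QQ"
  shows "col PP (conversep J) p q \<longleftrightarrow> bf (lv p) (lv q) = \<zero>"
proof -
  have s: "(\<exists>M\<in>PP. J M p \<and> J M q) \<longleftrightarrow> (\<exists>M\<in>PP. J M q \<and> J M p)" for p q by auto
  have c33: "(\<exists>M\<in>PP. J M (Ln3 k b k') \<and> J M (Ln3 h c h')) \<longleftrightarrow> bf (lv (Ln3 k b k')) (lv (Ln3 h c h')) = \<zero>"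
    if t: "k \<in> LL'" "b \<in> LL" "k' \<in> LL'" "h \<in> LL'" "c \<in> LL" "h' \<in> LL'" for k b k' h c h'
  proof -
    have "bf (lv (Ln3 k b k')) (lv (Ln3 h c h')) = (b \<oplus> c) \<otimes> (b \<oplus> c) \<oplus> (k \<oplus> h) \<otimes> (k' \<oplus> h')" using t by (simp add: nf)
    then show ?thesis using mt_33[OF t] sum0_iff t unfolding col_def by simp
  qed
  have c23: "(\<exists>M\<in>PP. J M (Ln2 a l) \<and> J M (Ln3 k b k')) \<longleftrightarrow> bf (lv (Ln2 a l)) (lv (Ln3 k b k')) = \<zero>"
    if h: "a \<in> LL" "l \<in> LL'" "k \<in> LL'" "b \<in> LL" "k' \<in> LL'" for a l k b k'
  proof -
    have "bf (lv (Ln2 a l)) (lv (Ln3 k b k')) = (a \<otimes> a \<otimes> k \<oplus> l) \<oplus> k'" using h by (simp add: nf)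
    then show ?thesis using mt_23[OF h] sum0_iff[of "a \<otimes> a \<otimes> k \<oplus> l" k'] h by auto
  qed
  have rest: "(\<exists>M\<in>PP. J M p \<and> J M q) \<longleftrightarrow> bf (lv p) (lv q) = \<zero>"
    if "p \<in> QQ" "q \<in> QQ" "(case p of Ln_inf \<Rightarrow> True | Ln1 a \<Rightarrow> (case q of Ln_inf \<Rightarrow> False | _ \<Rightarrow> True)
        | Ln2 k b \<Rightarrow> (case q of Ln2 k' b' \<Rightarrow> True | _ \<Rightarrow> False) | Ln3 a l a' \<Rightarrow> False)" for p q
    using that
    by (cases p; cases q) (auto simp: ex_PP sum0_iff sq_inj nf intro: incl)
  show ?thesis
    unfolding col_def conversep_iff
    using p q rest[OF p q] rest[OF q p] c33 c23 s[of p q] bf_sym[OF lv[OF p] lv[OF q]]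
    by (cases p; cases q) (simp_all del: bf.simps lv.simps)
qed

end

lemma col_iso:
  assumes f: "bij_betw f P' P" and g: "bij_betw g L' L" and fg: "\<And>x M. x \<in> P' \<Longrightarrow> M \<in> L' \<Longrightarrow> J x M \<longleftrightarrow> I (f x) (g M)"
    and p: "p \<in> P" "q \<in> P"
  shows "col L I p q \<longleftrightarrow> col L' J (inv_into P' f p) (inv_into P' f q)"
proof -
  let ?f = "inv_into P' f"
  have i: "?f p \<in> P'" "?f q \<in> P'" "f (?f p) = p" "f (?f q) = q"
    using p f by (auto simp: bij_betw_inv_into_right bij_betw_def inv_into_into)
  have "L = g ` L'" using g by (simp add: bij_betw_def)
  then have "col L I p q \<longleftrightarrow> (\<exists>M\<in>L'. I p (g M) \<and> I q (g M))" by (simp add: col_def)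
  also have "\<dots> \<longleftrightarrow> (\<exists>M\<in>L'. J (?f p) M \<and> J (?f q) M)" using fg[OF i(1)] fg[OF i(2)] i by auto
  finally show ?thesis by (simp add: col_def)
qed

text \<open>Points and lines carry separate representations over the same field, so regularity of
  lines is regularity of points in the dual geometry.\<close>

lemma (in gq) mixed_imp_regular_LD:
  assumes "mixed_quadrangle P L I"
  shows "x \<in> P \<Longrightarrow> rp x" "M \<in> L \<Longrightarrow> rl M" "\<lbrakk>x \<in> P; M \<in> L; I x M\<rbrakk> \<Longrightarrow> LD_at P L I x M"
proof -
  obtain K :: "'p ring" and K' LL LL' where D: "mixed_data K K' LL LL'"
    and iso: "isomorphic_geometries (mq_points LL LL') (mq_lines LL LL') (mq_inc K) P L I"
    using assms unfolding mixed_quadrangle_def by blast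
  obtain f g where f: "bij_betw f (mq_points LL LL') P" and g: "bij_betw g (mq_lines LL LL') L"
    and fg: "\<And>x M. x \<in> mq_points LL LL' \<Longrightarrow> M \<in> mq_lines LL LL' \<Longrightarrow> mq_inc K x M \<longleftrightarrow> I (f x) (g M)"
    using iso by (auto simp: isomorphic_geometries_def)
  have "field K" and "\<one>\<^bsub>K\<^esub> \<oplus>\<^bsub>K\<^esub> \<one>\<^bsub>K\<^esub> = \<zero>\<^bsub>K\<^esub>" using D by (auto simp: mixed_data_def)
  then have c: "char2 K" by (intro char2.intro char2_axioms.intro)
  interpret m: mixed_field K K' LL LL' by (intro mixed_field.intro c mixed_field_axioms.intro D)
  have fP: "inv_into m.PP f p \<in> m.PP" if "p \<in> P" for p
    using that f by (auto simp: bij_betw_def inv_into_into)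
  have gL: "inv_into m.QQ g N \<in> m.QQ" if "N \<in> L" for N
    using that g by (auto simp: bij_betw_def inv_into_into)
  interpret s: symplectic_quadrangle P L I K "\<lambda>p. m.pv (inv_into m.PP f p)"
  proof
    fix p q assume p: "p \<in> P" "q \<in> P"
    show "cl p q \<longleftrightarrow> m.bf (m.pv (inv_into m.PP f p)) (m.pv (inv_into m.PP f q)) = \<zero>\<^bsub>K\<^esub>"
      using col_iso[where J = "mq_inc K" and I = I, OF f g fg p] m.col_bf fP p by simp
  qed (simp add: m.pv fP)
  interpret dl: gq L P "conversep I" by (rule dual)
  interpret t: symplectic_quadrangle L P "conversep I" K "\<lambda>N. m.lv (inv_into m.QQ g N)"
  proof
    fix p q assume p: "p \<in> L" "q \<in> L"
    show "mt p q \<longleftrightarrow> m.bf (m.lv (inv_into m.QQ g p)) (m.lv (inv_into m.QQ g q)) = \<zero>\<^bsub>K\<^esub>"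
      using col_iso[where J = "conversep (mq_inc K)" and I = "conversep I", OF g f _ p] fg m.mt_bf gL p by simp
  qed (simp add: m.lv gL)
  show "x \<in> P \<Longrightarrow> rp x" by (rule s.all_regular)
  show "M \<in> L \<Longrightarrow> rl M" by (rule t.all_regular)
  show "\<lbrakk>x \<in> P; M \<in> L; I x M\<rbrakk> \<Longrightarrow> LD_at P L I x M" by (rule s.all_LD)
qed

section \<open>The characterization\<close>

theorem theorem4:
  fixes \<P> :: "'p set" and \<L> :: "'l set" and I :: "'p \<Rightarrow> 'l \<Rightarrow> bool"
  assumes "generalized_quadrangle \<P> \<L> I"
  shows
    "(mixed_quadrangle \<P> \<L> I \<longleftrightarrow>
       (\<exists>\<O> \<S>. \<O> \<noteq> {} \<and> \<O> \<subseteq> \<P> \<and> \<S> \<subseteq> \<L> \<and>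
          (\<forall>x\<in>\<O>. regular_point \<P> \<L> I x) \<and> (\<forall>M\<in>\<S>. regular_line \<P> \<L> I M) \<and>
          (\<forall>T \<in> line_spans \<P> \<L> I. (\<exists>M\<in>\<S>. M \<in> T) \<longrightarrow>
             (\<exists>M\<in>\<S>. \<exists>N\<in>\<S>. M \<noteq> N \<and> M \<in> T \<and> N \<in> T)) \<and>
          (\<forall>M\<in>\<S>. \<exists>x\<in>\<O>. I x M) \<and>
          (\<forall>x\<in>\<O>. \<exists>M\<in>\<S>. I x M \<and> LD_at \<P> \<L> I x M)))
     \<and>
     ((\<forall>x\<in>\<P>. regular_point \<P> \<L> I x) \<and> (\<forall>M\<in>\<L>. regular_line \<P> \<L> I M) \<and>
      (\<forall>x\<in>\<P>. \<exists>M\<in>\<L>. I x M \<and> LD_at \<P> \<L> I x M)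
        \<longrightarrow> mixed_quadrangle \<P> \<L> I)"
proof (intro conjI iffI)
  interpret gq \<P> \<L> I by unfold_locales (rule assms)
  have LDx: "\<exists>M\<in>\<L>. I x M \<and> LD_at \<P> \<L> I x M" if "mixed_quadrangle \<P> \<L> I" "x \<in> \<P>" for x
    using line_through[OF that(2)] mixed_imp_regular_LD(3)[OF that] by blast
  have span: "\<forall>T \<in> line_spans \<P> \<L> I. (\<exists>M\<in>\<L>. M \<in> T) \<longrightarrow> (\<exists>M\<in>\<L>. \<exists>N\<in>\<L>. M \<noteq> N \<and> M \<in> T \<and> N \<in> T)"
    using line_span_two by blast
  have point: "\<forall>M\<in>\<L>. \<exists>x\<in>\<P>. I x M" using three_points by blast
  have ne: "\<P> \<noteq> {}" using assms by (simp add: generalized_quadrangle_def)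
  show "\<exists>\<O> \<S>. \<O> \<noteq> {} \<and> \<O> \<subseteq> \<P> \<and> \<S> \<subseteq> \<L> \<and>
          (\<forall>x\<in>\<O>. regular_point \<P> \<L> I x) \<and> (\<forall>M\<in>\<S>. regular_line \<P> \<L> I M) \<and>
          (\<forall>T \<in> line_spans \<P> \<L> I. (\<exists>M\<in>\<S>. M \<in> T) \<longrightarrow>
             (\<exists>M\<in>\<S>. \<exists>N\<in>\<S>. M \<noteq> N \<and> M \<in> T \<and> N \<in> T)) \<and>
          (\<forall>M\<in>\<S>. \<exists>x\<in>\<O>. I x M) \<and>
          (\<forall>x\<in>\<O>. \<exists>M\<in>\<S>. I x M \<and> LD_at \<P> \<L> I x M)"
    if m: "mixed_quadrangle \<P> \<L> I"
    by (intro exI[of _ \<P>] exI[of _ \<L>] conjI)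
      (use ne span point LDx[OF m] mixed_imp_regular_LD[OF m] regular_point_iff regular_line_iff in auto)
  show "mixed_quadrangle \<P> \<L> I"
    if "\<exists>\<O> \<S>. \<O> \<noteq> {} \<and> \<O> \<subseteq> \<P> \<and> \<S> \<subseteq> \<L> \<and>
          (\<forall>x\<in>\<O>. regular_point \<P> \<L> I x) \<and> (\<forall>M\<in>\<S>. regular_line \<P> \<L> I M) \<and>
          (\<forall>T \<in> line_spans \<P> \<L> I. (\<exists>M\<in>\<S>. M \<in> T) \<longrightarrow>
             (\<exists>M\<in>\<S>. \<exists>N\<in>\<S>. M \<noteq> N \<and> M \<in> T \<and> N \<in> T)) \<and>
          (\<forall>M\<in>\<S>. \<exists>x\<in>\<O>. I x M) \<and>
          (\<forall>x\<in>\<O>. \<exists>M\<in>\<S>. I x M \<and> LD_at \<P> \<L> I x M)"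
    using that mixed_if_conditions by (elim exE conjE) presburger
  show "(\<forall>x\<in>\<P>. regular_point \<P> \<L> I x) \<and> (\<forall>M\<in>\<L>. regular_line \<P> \<L> I M) \<and>
      (\<forall>x\<in>\<P>. \<exists>M\<in>\<L>. I x M \<and> LD_at \<P> \<L> I x M)
        \<longrightarrow> mixed_quadrangle \<P> \<L> I"
    using mixed_if_conditions[OF ne subset_refl subset_refl _ _ span point] by blast
qed

end
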